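(* Let $\Delta_1,\Delta_2\subset(\mathbb{R}^n)^*$ be strict parallel Delzant polytopes with a common strict parallel hyperplane $F$ parallel to the $t_1^*,\dots,t_{n-1}^*$ plane, such that $\Delta_1$ lies above $F$, $\Delta_2$ lies below $F$, and $\Delta_1\cap F=\Delta_2\cap F=:\Delta_F$. Let ${}_{\mathrm{cut}}X_{\Delta_1}$ be the lower cutting of $X_{\Delta_1}$ along $F$ and ${}^{\mathrm{cut}}X_{\Delta_2}$ the upper cutting of $X_{\Delta_2}$ along $F$. Then: (i) the orientation preserved gluing ${}_{\mathrm{cut}}X_{\Delta_1}\cup{}^{\mathrm{cut}}X_{\Delta_2}$ carries a toric manifold structure, i.e. a symplectic form together with an effective Hamiltonian $\mathbb{T}^n$-action; (ii) the orientation reversed gluing ${}_{\mathrm{cut}}X_{\Delta_1}\cup\overline{{}^{\mathrm{cut}}X_{\Delta_2}}$, regarded as a $b$-manifold whose singular hypersurface is the cut locus $X_{\Delta_F}\times\mathbb{S}^1$, carries a $b$-toric manifold structure, i.e. a $b$-symplectic form together with a toric (effective Hamiltonian) $\mathbb{T}^n$-action.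
   Context: **Delzant and strict parallel polytopes.** $(\mathbb{R}^n)^*=(\mathrm{Lie}\,\mathbb{T}^n)^*$ has coordinates $t_1^*,\dots,t_n^*$, lattice $\mathbb{Z}^n$ and the standard Euclidean inner product. A Delzant polytope is an $n$-dimensional convex polytope such that at each vertex $v$ there is a lattice basis $u_1,\dots,u_n$ for which the edges at $v$ are of the form $v+tu_i$, $t\ge 0$. $X_\Delta$ is the compact connected $2n$-dimensional symplectic toric manifold with moment polytope $\Delta$, and $\mu_\Delta$ is its moment map (convention $d\mu^X=-\iota_{X^\#}\omega$). A hyperplane $F$ meeting $\Delta$ is a parallel hyperplane if every edge of $\Delta$ which meets $F$ (and is not contained in $F$) meets $F$ orthogonally. It is strict parallel if moreover $F\cap\Delta=F\cap\partial\Delta$. $\Delta$ is strict parallel if it has a strict parallel hyperplane. In that case $\Delta_F=F\cap\Delta$ is an $(n-1)$-dimensional Delzant polytope, with toric manifold $(X_{\Delta_F},\omega_{\Delta_F})$. **Local model and cutting.** Normalize so that $F=\{t_n^*=0\}$. Split $\mathbb{T}^n=\mathbb{T}^{n-1}\times\mathbb{S}^1$ (first $n-1$ coordinates, last coordinate). For small $\epsilon>0$ fix $\mathbb{T}^n$-equivariant symplectomorphisms from a neighborhood of $\mu_{\Delta_1}^{-1}(\Delta_F)$ in $X_{\Delta_1}$ and from a neighborhood of $\mu_{\Delta_2}^{-1}(\Delta_F)$ in $X_{\Delta_2}$ to $X_{\Delta_F}\times(\text{polar cap})$. Here the polar cap is that of a round sphere with form $dh\wedge d\theta$: in the first case the cap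 around the south pole with height $h\in[0,\epsilon)$, in the second the cap around the north pole with height $h\in(-\epsilon,0]$, the pole being at $h=0$ in both. $\mathbb{T}^{n-1}$ acts by the toric action on $X_{\Delta_F}$ and $\mathbb{S}^1$ by rotation in $\theta$. Put ${}_{\mathrm{cut}}X_{\Delta_1}=X_{\Delta_1}\setminus(X_{\Delta_F}\times\{\text{pole}\})$ and ${}^{\mathrm{cut}}X_{\Delta_2}=X_{\Delta_2}\setminus(X_{\Delta_F}\times\{\text{pole}\})$. Their ends are $X_{\Delta_F}\times\mathbb{S}^1\times(0,\epsilon)$ and $X_{\Delta_F}\times\mathbb{S}^1\times(-\epsilon,0)$ respectively, with coordinates $(x,\theta,h)$. **Gluing.** Both gluings are, as sets, ${}_{\mathrm{cut}}X_{\Delta_1}\sqcup (X_{\Delta_F}\times\mathbb{S}^1)\sqcup{}^{\mathrm{cut}}X_{\Delta_2}$; the middle piece is the cut locus. The smooth structure agrees with the given ones on the two open pieces and makes the union of the two ends with the cut locus diffeomorphic to $X_{\Delta_F}\times\mathbb{S}^1\times(-\epsilon,\epsilon)$, the cut locus being $h=0$. The end of ${}_{\mathrm{cut}}X_{\Delta_1}$ is always included by $(x,\theta,h)\mapsto(x,\theta,h)$. The end of ${}^{\mathrm{cut}}X_{\Delta_2}$ is included by $(x,\theta,h)\mapsto(x,\theta,h)$ in the orientation preserved gluing, and by $(x,\theta,h)\mapsto(x,-\theta,h)$ in the orientation reversed gluing (so the two cylinders are joined with opposite symplectic orientations). **$b$-geometry.** A $b$-manifold $(M,Z)$ is an oriented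 smooth manifold $M$ with a closed smooth hypersurface $Z$. ${}^bTM$ is the vector bundle whose sections are the vector fields tangent to $Z$ along $Z$, and ${}^bT^*M$ is its dual. $b$-forms are sections of $\Lambda^k({}^bT^*M)$; locally they are $\alpha\wedge\frac{df}{f}+\beta$ with $\alpha,\beta$ smooth forms and $f$ a defining function of $Z$, and $d(\alpha\wedge\frac{df}{f}+\beta)=d\alpha\wedge\frac{df}{f}+d\beta$. A $b$-symplectic form is a closed $b$-form $\omega$ of degree 2 with $\omega^n$ nowhere zero as a section of $\Lambda^{2n}({}^bT^*M)$. A $b$-function is a function locally of the form $c\log|y|+f$, with $c\in\mathbb{R}$, $f$ smooth and $y$ a defining function of $Z$. A $\mathbb{T}^n$-action on $(M,Z,\omega)$ is Hamiltonian if for all $X,Y\in\mathfrak{t}$ the $b$-one-form $\iota_{X^\#}\omega$ is the differential of a $b$-function and $\omega(X^\#,Y^\#)=0$. It is toric if it is also effective and $\dim M=2n$. *)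

theory Defs
  imports "HOL-Analysis.Analysis"
begin

section \<open>Smooth maps between linear spaces\<close>

text \<open>
  Everything is modelled on a linear subspace \<open>E\<close> of a Euclidean space rather than on the whole
  space, so that dimension \<open>0\<close> is covered. Only directions in \<open>E\<close> are ever used, and
  \<open>S\<close> is always relatively open in \<open>E\<close>.
\<close>

definition dderiv :: "('a::real_normed_vector \<Rightarrow> 'b::real_normed_vector) \<Rightarrow> 'a \<Rightarrow> 'a \<Rightarrow> 'b" where
  "dderiv f x u = vector_derivative (\<lambda>t::real. f (x + t *\<^sub>R u)) (at 0)"

primrec Ck_on :: "nat \<Rightarrow> 'a::real_normed_vector set \<Rightarrow> 'a set \<Rightarrow> ('a \<Rightarrow> 'b::real_normed_vector) \<Rightarrow> bool"
where
  "Ck_on 0 E S f \<longleftrightarrow> continuous_on S f"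
| "Ck_on (Suc k) E S f \<longleftrightarrow> f differentiable_on S \<and> (\<forall>u\<in>E. Ck_on k E S (\<lambda>x. dderiv f x u))"

definition smooth_on :: "'a::real_normed_vector set \<Rightarrow> 'a set \<Rightarrow> ('a \<Rightarrow> 'b::real_normed_vector) \<Rightarrow> bool" where
  "smooth_on E S f \<longleftrightarrow> (\<forall>k. Ck_on k E S f)"


section \<open>Smooth manifolds\<close>

type_synonym ('a, 'e) chart = "'a set \<times> ('a \<Rightarrow> 'e)"

record ('a, 'e) mfd =
  Model :: "'e set"
  Atlas :: "('a, 'e) chart set"

definition points :: "('a, 'e) mfd \<Rightarrow> 'a set" where
  "points M = \<Union>(fst ` Atlas M)"

definition mtopology :: "('a, 'e::euclidean_space) mfd \<Rightarrow> 'a topology" where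
  "mtopology M = topology (\<lambda>S. S \<subseteq> points M \<and>
     (\<forall>(U, \<phi>)\<in>Atlas M. openin (top_of_set (Model M)) (\<phi> ` (S \<inter> U))))"

definition charts_compatible ::
  "'e::euclidean_space set \<Rightarrow> ('a, 'e) chart \<Rightarrow> ('a, 'e) chart \<Rightarrow> bool" where
  "charts_compatible E c d \<longleftrightarrow>
     openin (top_of_set E) (snd c ` (fst c \<inter> fst d)) \<and>
     smooth_on E (snd c ` (fst c \<inter> fst d)) (snd d \<circ> inv_into (fst c) (snd c))"

definition smooth_manifold :: "('a, 'e::euclidean_space) mfd \<Rightarrow> bool" where
  "smooth_manifold M \<longleftrightarrow> subspace (Model M) \<and>
     (\<forall>(U, \<phi>)\<in>Atlas M. inj_on \<phi> U \<and> openin (top_of_set (Model M)) (\<phi> ` U)) \<and>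
     (\<forall>c\<in>Atlas M. \<forall>d\<in>Atlas M. charts_compatible (Model M) c d) \<and>
     Hausdorff_space (mtopology M) \<and> second_countable (mtopology M)"

lemma openin_mtopology:
  assumes "\<And>U \<phi>. (U, \<phi>) \<in> Atlas M \<Longrightarrow> inj_on \<phi> U"
  shows "openin (mtopology M) S \<longleftrightarrow> S \<subseteq> points M \<and>
           (\<forall>(U, \<phi>)\<in>Atlas M. openin (top_of_set (Model M)) (\<phi> ` (S \<inter> U)))"
proof -
  let ?P = "\<lambda>S. S \<subseteq> points M \<and>
     (\<forall>(U, \<phi>)\<in>Atlas M. openin (top_of_set (Model M)) (\<phi> ` (S \<inter> U)))"
  have "?P (S \<inter> T)" if "?P S" "?P T" for S T
  proof -
    have "\<phi> ` (S \<inter> T \<inter> U) = \<phi> ` (S \<inter> U) \<inter> \<phi> ` (T \<inter> U)" if "(U, \<phi>) \<in> Atlas M" for U \<phi>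
      using assms[OF that] by (auto simp: inj_on_def)
    then show ?thesis using that by (fastforce intro: openin_Int)
  qed
  moreover have "?P (\<Union>K)" if "\<forall>S\<in>K. ?P S" for K
  proof -
    have "\<phi> ` (\<Union>K \<inter> U) = (\<Union>S\<in>K. \<phi> ` (S \<inter> U))" for U and \<phi> :: "'a \<Rightarrow> 'b"
      by auto
    then show ?thesis using that by (fastforce intro!: openin_Union)
  qed
  ultimately have "istopology ?P"
    unfolding istopology_def by blast
  then show ?thesis
    by (simp add: mtopology_def topology_inverse')
qed

text \<open>Charts of the maximal atlas.\<close>

definition is_chart :: "('a, 'e::euclidean_space) mfd \<Rightarrow> ('a, 'e) chart \<Rightarrow> bool" where
  "is_chart M c \<longleftrightarrow> fst c \<subseteq> points M \<and> inj_on (snd c) (fst c) \<and>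
     openin (top_of_set (Model M)) (snd c ` fst c) \<and>
     (\<forall>d\<in>Atlas M. charts_compatible (Model M) c d \<and> charts_compatible (Model M) d c)"

text \<open>The condition below on preimages of chart domains gives continuity.\<close>

definition smooth_map_on ::
  "('a, 'e::euclidean_space) mfd \<Rightarrow> 'a set \<Rightarrow> ('b, 'f::euclidean_space) mfd \<Rightarrow> ('a \<Rightarrow> 'b) \<Rightarrow> bool" where
  "smooth_map_on M W N f \<longleftrightarrow> openin (mtopology M) W \<and> f ` W \<subseteq> points N \<and>
     (\<forall>(U, \<phi>)\<in>Atlas M. \<forall>(V, \<psi>)\<in>Atlas N.
        openin (top_of_set (Model M)) (\<phi> ` (U \<inter> W \<inter> f -` V)) \<and>
        smooth_on (Model M) (\<phi> ` (U \<inter> W \<inter> f -` V)) (\<psi> \<circ> f \<circ> inv_into U \<phi>))"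

abbreviation smooth_map ::
  "('a, 'e::euclidean_space) mfd \<Rightarrow> ('b, 'f::euclidean_space) mfd \<Rightarrow> ('a \<Rightarrow> 'b) \<Rightarrow> bool" where
  "smooth_map M N f \<equiv> smooth_map_on M (points M) N f"

definition flat :: "'e::euclidean_space set \<Rightarrow> ('e, 'e) mfd" where
  "flat E = \<lparr>Model = E, Atlas = {(E, \<lambda>x. x)}\<rparr>"

definition prod_mfd ::
  "('a, 'e::euclidean_space) mfd \<Rightarrow> ('b, 'f::euclidean_space) mfd \<Rightarrow> ('a \<times> 'b, 'e \<times> 'f) mfd" where
  "prod_mfd M N = \<lparr>Model = Model M \<times> Model N,
     Atlas = {(fst c \<times> fst d, map_prod (snd c) (snd d)) | c d. c \<in> Atlas M \<and> d \<in> Atlas N}\<rparr>"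


section \<open>Tangent vectors and differential forms\<close>

text \<open>
  Each tangent space \<open>T\<^sub>pM\<close> is identified with the model space through one fixed chart at
  \<open>p\<close>, the chart \<open>chart_at M p\<close>. A \<open>k\<close>-form is then a function of \<open>p\<close> and of \<open>k\<close> vectors of the model
  space. \<open>tmap\<close> is the tangent map in these identifications, and \<open>chart_vector M c x u\<close> is
  the tangent vector, at the point with coordinates \<open>x\<close> in the chart \<open>c\<close>, whose components in
  \<open>c\<close> are \<open>u\<close>.
\<close>

definition chart_at :: "('a, 'e) mfd \<Rightarrow> 'a \<Rightarrow> ('a, 'e) chart" where
  "chart_at M p = (SOME c. c \<in> Atlas M \<and> p \<in> fst c)"

definition chart_inv :: "('a, 'e) chart \<Rightarrow> 'e \<Rightarrow> 'a" where
  "chart_inv c = inv_into (fst c) (snd c)"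

definition tmap ::
  "('a, 'e::euclidean_space) mfd \<Rightarrow> ('b, 'f::euclidean_space) mfd \<Rightarrow> ('a \<Rightarrow> 'b) \<Rightarrow> 'a \<Rightarrow> 'e \<Rightarrow> 'f" where
  "tmap M N f p u =
     dderiv (snd (chart_at N (f p)) \<circ> f \<circ> chart_inv (chart_at M p)) (snd (chart_at M p) p) u"

definition chart_vector ::
  "('a, 'e::euclidean_space) mfd \<Rightarrow> ('a, 'e) chart \<Rightarrow> 'e \<Rightarrow> 'e \<Rightarrow> 'e" where
  "chart_vector M c x u = dderiv (snd (chart_at M (chart_inv c x)) \<circ> chart_inv c) x u"

type_synonym ('a, 'e) form2 = "'a \<Rightarrow> 'e \<Rightarrow> 'e \<Rightarrow> real"

definition local_form ::
  "('a, 'e::euclidean_space) mfd \<Rightarrow> ('a, 'e) chart \<Rightarrow> ('a, 'e) form2 \<Rightarrow> 'e \<Rightarrow> 'e \<Rightarrow> 'e \<Rightarrow> real" where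
  "local_form M c \<omega> x u v = \<omega> (chart_inv c x) (chart_vector M c x u) (chart_vector M c x v)"

definition alternating_bilinear :: "'e::real_vector set \<Rightarrow> ('e \<Rightarrow> 'e \<Rightarrow> real) \<Rightarrow> bool" where
  "alternating_bilinear E B \<longleftrightarrow> (\<forall>u\<in>E. B u u = 0) \<and>
     (\<forall>u\<in>E. \<forall>v\<in>E. \<forall>w\<in>E. \<forall>a. B (a *\<^sub>R u + v) w = a * B u w + B v w \<and>
                             B w (a *\<^sub>R u + v) = a * B w u + B w v)"

definition smooth_form2_on :: "('a, 'e::euclidean_space) mfd \<Rightarrow> 'a set \<Rightarrow> ('a, 'e) form2 \<Rightarrow> bool" where
  "smooth_form2_on M W \<omega> \<longleftrightarrow> (\<forall>p\<in>W. alternating_bilinear (Model M) (\<omega> p)) \<and>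
     (\<forall>c\<in>Atlas M. \<forall>u\<in>Model M. \<forall>v\<in>Model M.
        smooth_on (Model M) (snd c ` (fst c \<inter> W)) (\<lambda>x. local_form M c \<omega> x u v))"

definition closed_form2_on :: "('a, 'e::euclidean_space) mfd \<Rightarrow> 'a set \<Rightarrow> ('a, 'e) form2 \<Rightarrow> bool" where
  "closed_form2_on M W \<omega> \<longleftrightarrow>
     (\<forall>c\<in>Atlas M. \<forall>x\<in>snd c ` (fst c \<inter> W). \<forall>u\<in>Model M. \<forall>v\<in>Model M. \<forall>w\<in>Model M.
        dderiv (\<lambda>y. local_form M c \<omega> y v w) x u +
        dderiv (\<lambda>y. local_form M c \<omega> y w u) x v +
        dderiv (\<lambda>y. local_form M c \<omega> y u v) x w = 0)"

definition symplectic_form :: "('a, 'e::euclidean_space) mfd \<Rightarrow> ('a, 'e) form2 \<Rightarrow> bool" where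
  "symplectic_form M \<omega> \<longleftrightarrow>
     smooth_form2_on M (points M) \<omega> \<and> closed_form2_on M (points M) \<omega> \<and>
     (\<forall>p\<in>points M. \<forall>u\<in>Model M. u \<noteq> 0 \<longrightarrow> (\<exists>v\<in>Model M. \<omega> p u v \<noteq> 0))"

definition pullback2 ::
  "('a, 'e::euclidean_space) mfd \<Rightarrow> ('b, 'f::euclidean_space) mfd \<Rightarrow> ('a \<Rightarrow> 'b) \<Rightarrow> ('b, 'f) form2 \<Rightarrow> ('a, 'e) form2" where
  "pullback2 M N f \<omega> p u v = \<omega> (f p) (tmap M N f p u) (tmap M N f p v)"

definition prod_form ::
  "('a, 'e::euclidean_space) mfd \<Rightarrow> ('a, 'e) form2 \<Rightarrow> ('b, 'f::euclidean_space) mfd \<Rightarrow> ('b, 'f) form2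
   \<Rightarrow> ('a \<times> 'b, 'e \<times> 'f) form2" where
  "prod_form M \<omega> N \<tau> p u v =
     pullback2 (prod_mfd M N) M fst \<omega> p u v + pullback2 (prod_mfd M N) N snd \<tau> p u v"

text \<open>The \<open>n\<close>-fold wedge power \<open>B \<and> \<dots> \<and> B\<close> evaluated on \<open>v 0, \<dots>, v (2n - 1)\<close>.\<close>

definition wedge_power :: "nat \<Rightarrow> ('e \<Rightarrow> 'e \<Rightarrow> real) \<Rightarrow> (nat \<Rightarrow> 'e) \<Rightarrow> real" where
  "wedge_power n B v =
     (\<Sum>\<sigma> | \<sigma> permutes {..<2 * n}.
        of_int (sign \<sigma>) * (\<Prod>i<n. B (v (\<sigma> (2 * i))) (v (\<sigma> (2 * i + 1))))) / 2 ^ n"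

definition half_dim :: "('a, 'e::euclidean_space) mfd \<Rightarrow> nat" where
  "half_dim M = dim (Model M) div 2"

text \<open>An orientation is given by a nowhere vanishing smooth form of top degree.\<close>

definition alternating_multilinear ::
  "'e::real_vector set \<Rightarrow> nat \<Rightarrow> ((nat \<Rightarrow> 'e) \<Rightarrow> real) \<Rightarrow> bool" where
  "alternating_multilinear E d A \<longleftrightarrow>
     (\<forall>v. (\<forall>i. v i \<in> E) \<longrightarrow>
        (\<forall>i<d. \<forall>a. \<forall>u\<in>E. \<forall>w\<in>E. A (v(i := a *\<^sub>R u + w)) = a * A (v(i := u)) + A (v(i := w))) \<and>
        (\<forall>i<d. \<forall>j<d. i \<noteq> j \<and> v i = v j \<longrightarrow> A v = 0) \<and>
        (\<forall>w. (\<forall>i. w i \<in> E) \<and> (\<forall>i<d. w i = v i) \<longrightarrow> A w = A v))"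

definition orientation_form ::
  "('a, 'e::euclidean_space) mfd \<Rightarrow> ('a \<Rightarrow> (nat \<Rightarrow> 'e) \<Rightarrow> real) \<Rightarrow> bool" where
  "orientation_form M \<Omega> \<longleftrightarrow>
     (\<forall>p\<in>points M. alternating_multilinear (Model M) (dim (Model M)) (\<Omega> p) \<and>
        (\<exists>v. (\<forall>i. v i \<in> Model M) \<and> \<Omega> p v \<noteq> 0)) \<and>
     (\<forall>c\<in>Atlas M. \<forall>v. (\<forall>i. v i \<in> Model M) \<longrightarrow>
        smooth_on (Model M) (snd c ` fst c) (\<lambda>x. \<Omega> (chart_inv c x) (\<lambda>i. chart_vector M c x (v i))))"

text \<open>
  The local diffeomorphism \<open>f\<close>, defined on an open subset \<open>W\<close> of the symplectic manifold \<open>(M, \<omega>)\<close>,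
  carries the symplectic orientation \<open>\<omega>\<^sup>n\<close> to \<open>s\<close> times the orientation \<open>\<Omega>\<close>, where \<open>s\<close> is \<open>1\<close> or \<open>-1\<close>.
\<close>

definition matches_orientation ::
  "real \<Rightarrow> ('a, 'e::euclidean_space) mfd \<Rightarrow> ('a, 'e) form2 \<Rightarrow> 'a set \<Rightarrow>
   ('b, 'f::euclidean_space) mfd \<Rightarrow> ('b \<Rightarrow> (nat \<Rightarrow> 'f) \<Rightarrow> real) \<Rightarrow> ('a \<Rightarrow> 'b) \<Rightarrow> bool" where
  "matches_orientation s M \<omega> W N \<Omega> f \<longleftrightarrow>
     (\<forall>p\<in>W. \<exists>k>0. \<forall>v. (\<forall>i. v i \<in> Model M) \<longrightarrow>
        \<Omega> (f p) (\<lambda>i. tmap M N f p (v i)) = s * k * wedge_power (half_dim M) (\<omega> p) v)"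


section \<open>Torus actions and toric manifolds\<close>

text \<open>
  For a set \<open>J\<close> of coordinates, \<open>torus J\<close> is the coordinate subtorus of the standard torus,
  with Lie algebra \<open>torus_lie J\<close>; so \<open>torus UNIV\<close> is the full torus and \<open>torus (- {l})\<close> omits the
  coordinate \<open>l\<close>. The circle is \<open>\<real> / 2\<pi>\<int>\<close>. The dual of the Lie algebra is identified with the
  Lie algebra by the standard inner product.
\<close>

definition torus :: "'n set \<Rightarrow> (complex ^ 'n) set" where
  "torus J = {z. \<forall>i. cmod (z $ i) = 1 \<and> (i \<notin> J \<longrightarrow> z $ i = 1)}"

definition torus_lie :: "'n set \<Rightarrow> (real ^ 'n) set" where
  "torus_lie J = {X. \<forall>i. i \<notin> J \<longrightarrow> X $ i = 0}"

definition torus_exp :: "real ^ 'n \<Rightarrow> complex ^ 'n" where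
  "torus_exp X = (\<chi> i. cis (X $ i))"

text \<open>
  As \<open>torus_exp\<close> is a covering, smoothness of the action map can be tested after composition with it.
\<close>

definition torus_action ::
  "'n::finite set \<Rightarrow> ('a, 'e::euclidean_space) mfd \<Rightarrow> (complex ^ 'n \<Rightarrow> 'a \<Rightarrow> 'a) \<Rightarrow> bool" where
  "torus_action J M act \<longleftrightarrow>
     (\<forall>z\<in>torus J. \<forall>p\<in>points M. act z p \<in> points M) \<and>
     (\<forall>p\<in>points M. act 1 p = p) \<and>
     (\<forall>z\<in>torus J. \<forall>w\<in>torus J. \<forall>p\<in>points M. act (z * w) p = act z (act w p)) \<and>
     smooth_map (prod_mfd (flat (torus_lie J)) M) M (\<lambda>(X, p). act (torus_exp X) p)"

definition effective_action ::
  "'n::finite set \<Rightarrow> ('a, 'e) mfd \<Rightarrow> (complex ^ 'n \<Rightarrow> 'a \<Rightarrow> 'a) \<Rightarrow> bool" where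
  "effective_action J M act \<longleftrightarrow> (\<forall>z\<in>torus J. (\<forall>p\<in>points M. act z p = p) \<longrightarrow> z = 1)"

definition fundamental_field ::
  "('a, 'e::euclidean_space) mfd \<Rightarrow> (complex ^ 'n \<Rightarrow> 'a \<Rightarrow> 'a) \<Rightarrow> real ^ 'n::finite \<Rightarrow> 'a \<Rightarrow> 'e" where
  "fundamental_field M act X p =
     vector_derivative (\<lambda>t::real. snd (chart_at M p) (act (torus_exp (t *\<^sub>R X)) p)) (at 0)"

definition moment_map ::
  "'n::finite set \<Rightarrow> ('a, 'e::euclidean_space) mfd \<Rightarrow> ('a, 'e) form2 \<Rightarrow> (complex ^ 'n \<Rightarrow> 'a \<Rightarrow> 'a) \<Rightarrow>
   ('a \<Rightarrow> real ^ 'n) \<Rightarrow> bool" where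
  "moment_map J M \<omega> act \<mu> \<longleftrightarrow>
     smooth_map M (flat (torus_lie J)) \<mu> \<and>
     (\<forall>z\<in>torus J. \<forall>p\<in>points M. \<mu> (act z p) = \<mu> p) \<and>
     (\<forall>X\<in>torus_lie J. \<forall>p\<in>points M. \<forall>u\<in>Model M.
        tmap M (flat UNIV) (\<lambda>q. \<mu> q \<bullet> X) p u = - \<omega> p (fundamental_field M act X p) u)"

text \<open>Symplectic toric structures without compactness, with given moment map.\<close>

definition toric_structure ::
  "'n::finite set \<Rightarrow> ('a, 'e::euclidean_space) mfd \<Rightarrow> ('a, 'e) form2 \<Rightarrow> (complex ^ 'n \<Rightarrow> 'a \<Rightarrow> 'a) \<Rightarrow>
   ('a \<Rightarrow> real ^ 'n) \<Rightarrow> bool" where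
  "toric_structure J M \<omega> act \<mu> \<longleftrightarrow>
     smooth_manifold M \<and> dim (Model M) = 2 * card J \<and> symplectic_form M \<omega> \<and>
     torus_action J M act \<and> effective_action J M act \<and> moment_map J M \<omega> act \<mu>"

definition toric_manifold_of ::
  "'n::finite set \<Rightarrow> (real ^ 'n) set \<Rightarrow> ('a, 'e::euclidean_space) mfd \<Rightarrow> ('a, 'e) form2 \<Rightarrow>
   (complex ^ 'n \<Rightarrow> 'a \<Rightarrow> 'a) \<Rightarrow> ('a \<Rightarrow> real ^ 'n) \<Rightarrow> bool" where
  "toric_manifold_of J \<Delta> M \<omega> act \<mu> \<longleftrightarrow>
     toric_structure J M \<omega> act \<mu> \<and> compact_space (mtopology M) \<and> connected_space (mtopology M) \<and>
     \<mu> ` points M = \<Delta>"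


section \<open>Delzant and strict parallel polytopes\<close>

definition integral_vec :: "real ^ 'n \<Rightarrow> bool" where
  "integral_vec w \<longleftrightarrow> (\<forall>i. w $ i \<in> \<int>)"

definition lattice_basis :: "('n::finite \<Rightarrow> real ^ 'n) \<Rightarrow> bool" where
  "lattice_basis u \<longleftrightarrow> (\<forall>i. integral_vec (u i)) \<and>
     (\<forall>w. integral_vec w \<longrightarrow> (\<exists>!k :: 'n \<Rightarrow> int. w = (\<Sum>i\<in>UNIV. of_int (k i) *\<^sub>R u i)))"

definition delzant :: "(real ^ 'n::finite) set \<Rightarrow> bool" where
  "delzant \<Delta> \<longleftrightarrow> polytope \<Delta> \<and> aff_dim \<Delta> = int CARD('n) \<and>
     (\<forall>v. v extreme_point_of \<Delta> \<longrightarrow>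
        (\<exists>u :: 'n \<Rightarrow> real ^ 'n. lattice_basis u \<and>
           {e. e edge_of \<Delta> \<and> v \<in> e} = range (\<lambda>i. \<Delta> \<inter> {v + t *\<^sub>R u i | t. 0 \<le> t})))"

definition hyperplane :: "(real ^ 'n::finite) set \<Rightarrow> bool" where
  "hyperplane F \<longleftrightarrow> (\<exists>a b. a \<noteq> 0 \<and> F = {x. a \<bullet> x = b})"

definition parallel_hyperplane :: "(real ^ 'n::finite) set \<Rightarrow> (real ^ 'n) set \<Rightarrow> bool" where
  "parallel_hyperplane F \<Delta> \<longleftrightarrow> hyperplane F \<and> F \<inter> \<Delta> \<noteq> {} \<and>
     (\<forall>e. e edge_of \<Delta> \<and> e \<inter> F \<noteq> {} \<and> \<not> e \<subseteq> F \<longrightarrow>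
        (\<forall>x\<in>e. \<forall>y\<in>e. \<forall>p\<in>F. \<forall>q\<in>F. (x - y) \<bullet> (p - q) = 0))"

definition strict_parallel_hyperplane :: "(real ^ 'n::finite) set \<Rightarrow> (real ^ 'n) set \<Rightarrow> bool" where
  "strict_parallel_hyperplane F \<Delta> \<longleftrightarrow> parallel_hyperplane F \<Delta> \<and> F \<inter> \<Delta> = F \<inter> frontier \<Delta>"

text \<open>Forgetting the coordinate \<open>l\<close>, as a map to the vectors with vanishing \<open>l\<close>-th component.\<close>

definition drop_coord :: "'n::finite \<Rightarrow> real ^ 'n \<Rightarrow> real ^ 'n" where
  "drop_coord l t = (\<chi> i. if i = l then 0 else t $ i)"


section \<open>Polar caps and local models\<close>

text \<open>
  The round sphere of radius \<open>1\<close> touching the plane of height \<open>0\<close> at a pole, from above for \<open>s = 1\<close>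
  (south pole) and from below for \<open>s = -1\<close> (north pole); its points are written \<open>(z, h)\<close> with \<open>h\<close>
  the height and \<open>\<theta>\<close> the argument of \<open>z\<close>. For \<open>0 < \<epsilon> \<le> 1\<close> the cap of height \<open>\<epsilon>\<close> is a graph
  over a disc in the \<open>z\<close>-plane. In the coordinate \<open>z\<close> the form \<open>dh \<and> d\<theta>\<close> becomes \<open>cap_form\<close>, by the
  two lemmas below.
\<close>

definition cap :: "real \<Rightarrow> real \<Rightarrow> (complex \<times> real, complex) mfd" where
  "cap s \<epsilon> = \<lparr>Model = UNIV,
     Atlas = {({(z, h). (cmod z)\<^sup>2 + (h - s)\<^sup>2 = 1 \<and> \<bar>h\<bar> < \<epsilon>}, fst)}\<rparr>"

definition cap_form :: "real \<Rightarrow> (complex \<times> real, complex) form2" where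
  "cap_form s p u v = s * (Re u * Im v - Im u * Re v) / sqrt (1 - (cmod (fst p))\<^sup>2)"

lemma cap_height:
  assumes "s \<in> {1, -1}" "0 < \<epsilon>" "\<epsilon> \<le> 1" "(z, h) \<in> points (cap s \<epsilon>)"
  shows "h = s * (1 - sqrt (1 - (cmod z)\<^sup>2))"
proof -
  have eq: "1 - (cmod z)\<^sup>2 = (h - s)\<^sup>2" and h: "\<bar>h\<bar> < 1"
    using assms by (auto simp: cap_def points_def)
  have "s = 1 \<or> s = -1" using assms by simp
  then show ?thesis
    using h unfolding eq real_sqrt_abs by auto
qed

lemma cap_form_eq_dh_dtheta:
  fixes s h :: real and z u v :: complex
  assumes "z \<noteq> 0" "cmod z < 1"
  defines "height \<equiv> \<lambda>w. s * (1 - sqrt (1 - (cmod w)\<^sup>2))"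
  defines "dh \<equiv> \<lambda>u. s * (z \<bullet> u) / sqrt (1 - (cmod z)\<^sup>2)"
    \<comment> \<open>the differential at \<open>z\<close> of the argument, i.e. of the imaginary part of a logarithm\<close>
    and "dtheta \<equiv> \<lambda>u. Im (u / z)"
  shows "(height has_derivative dh) (at z)"
    and "cap_form s (z, h) u v = dh u * dtheta v - dh v * dtheta u"
proof -
  have pos: "0 < 1 - (cmod z)\<^sup>2"
    using assms(2) by (simp add: abs_square_less_1)
  have "((\<lambda>w. s * (1 - sqrt (1 - w \<bullet> w))) has_derivative dh) (at z)"
    unfolding dh_def using pos
    by (auto intro!: derivative_eq_intros simp: power2_norm_eq_inner field_simps inner_commute)
  then show "(height has_derivative dh) (at z)"
    by (simp add: height_def power2_norm_eq_inner)
  have r: "(Re z)\<^sup>2 + (Im z)\<^sup>2 \<noteq> 0"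
    using assms(1) by (simp add: complex_eq_iff)
  have "(z \<bullet> u) * Im (v / z) - (z \<bullet> v) * Im (u / z)
      = (Re u * Im v - Im u * Re v) * ((Re z)\<^sup>2 + (Im z)\<^sup>2) / ((Re z)\<^sup>2 + (Im z)\<^sup>2)"
    by (simp add: Im_divide inner_complex_def diff_divide_distrib[symmetric]
        power2_eq_square algebra_simps)
  also have "\<dots> = Re u * Im v - Im u * Re v"
    using r by simp
  finally have *: "Re u * Im v - Im u * Re v = (z \<bullet> u) * Im (v / z) - (z \<bullet> v) * Im (u / z)" ..
  show "cap_form s (z, h) u v = dh u * dtheta v - dh v * dtheta u"
    unfolding cap_form_def dh_def dtheta_def fst_conv *
    by (simp add: diff_divide_distrib right_diff_distrib mult.assoc)
qed

text \<open>
  A \<open>torus UNIV\<close>-equivariant symplectomorphism \<open>\<Phi>\<close> of an open set \<open>W\<close> of \<open>X\<close> onto the product of \<open>XF\<close>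
  with a polar cap. The coordinates other than \<open>l\<close> act on \<open>XF\<close> and the coordinate \<open>l\<close> rotates the cap.
\<close>

definition local_model ::
  "'n::finite \<Rightarrow> real \<Rightarrow> real \<Rightarrow>
   ('f, complex ^ 'n) mfd \<Rightarrow> ('f, complex ^ 'n) form2 \<Rightarrow> (complex ^ 'n \<Rightarrow> 'f \<Rightarrow> 'f) \<Rightarrow>
   ('a, complex ^ 'n) mfd \<Rightarrow> ('a, complex ^ 'n) form2 \<Rightarrow> (complex ^ 'n \<Rightarrow> 'a \<Rightarrow> 'a) \<Rightarrow>
   'a set \<Rightarrow> ('a \<Rightarrow> 'f \<times> complex \<times> real) \<Rightarrow> bool" where
  "local_model l s \<epsilon> XF \<omega>F actF X \<omega> act W \<Phi> \<longleftrightarrow>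
     (let P = prod_mfd XF (cap s \<epsilon>) in
       bij_betw \<Phi> W (points P) \<and>
       smooth_map_on X W P \<Phi> \<and> smooth_map P X (inv_into W \<Phi>) \<and>
       (\<forall>p\<in>W. \<forall>u\<in>Model X. \<forall>v\<in>Model X.
          pullback2 X P \<Phi> (prod_form XF \<omega>F (cap s \<epsilon>) (cap_form s)) p u v = \<omega> p u v) \<and>
       (\<forall>z\<in>torus UNIV. \<forall>p\<in>W. act z p \<in> W \<and>
          \<Phi> (act z p) = (case \<Phi> p of (x, w, h) \<Rightarrow>
             (actF (\<chi> i. if i = l then 1 else z $ i) x, z $ l * w, h))))"


section \<open>Cutting and gluing\<close>

definition cut_points :: "('a, 'e) mfd \<Rightarrow> 'a set \<Rightarrow> ('a \<Rightarrow> 'f \<times> complex \<times> real) \<Rightarrow> 'a set" where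
  "cut_points X W \<Phi> = points X - {p \<in> W. snd (\<Phi> p) = (0, 0)}"

text \<open>\<open>Above\<close>: the lower cutting of the first manifold. \<open>Below\<close>: the upper cutting of the second.\<close>

datatype ('a, 'f, 'b) glued = Above (of_Above: 'a) | Locus 'f complex | Below (of_Below: 'b)

definition cut_locus :: "('f, 'e) mfd \<Rightarrow> ('a, 'f, 'b) glued set" where
  "cut_locus XF = {Locus x z | x z. x \<in> points XF \<and> cmod z = 1}"

text \<open>The cylinder of all \<open>(z, h)\<close> with \<open>z\<close> on the unit circle, with coordinates \<open>\<theta> + \<i>h\<close>.\<close>

definition cylinder :: "real \<Rightarrow> (complex \<times> real, complex) mfd" where
  "cylinder \<epsilon> = \<lparr>Model = UNIV,
     Atlas = {({(z, h). cmod z = 1 \<and> z \<noteq> - a \<and> \<bar>h\<bar> < \<epsilon>}, \<lambda>(z, h). Complex (Arg (z / a)) h) | a.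
                cmod a = 1}\<rparr>"

definition cap_point :: "complex \<Rightarrow> real \<Rightarrow> complex \<times> real" where
  "cap_point z h = (complex_of_real (sqrt (2 * \<bar>h\<bar> - h\<^sup>2)) * z, h)"

text \<open>
  The identification of the product of \<open>XF\<close> with the cylinder with a neighbourhood of the cut locus.
  The map \<open>\<rho>\<close> of the circle is the identity for the orientation preserved gluing and complex
  conjugation, i.e. \<open>\<theta> \<mapsto> -\<theta>\<close>, for the orientation reversed gluing.
\<close>

definition neck ::
  "(complex \<Rightarrow> complex) \<Rightarrow> 'a set \<Rightarrow> ('a \<Rightarrow> 'f \<times> complex \<times> real) \<Rightarrow> 'b set \<Rightarrow> ('b \<Rightarrow> 'f \<times> complex \<times> real) \<Rightarrow>
   'f \<times> complex \<times> real \<Rightarrow> ('a, 'f, 'b) glued" where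
  "neck \<rho> W1 \<Phi>1 W2 \<Phi>2 = (\<lambda>(x, z, h).
     if h = 0 then Locus x z
     else if 0 < h then Above (inv_into W1 \<Phi>1 (x, cap_point z h))
     else Below (inv_into W2 \<Phi>2 (x, cap_point (\<rho> z) h)))"

definition join :: "'n::finite \<Rightarrow> (complex ^ 'n) \<times> complex \<Rightarrow> complex ^ 'n" where
  "join l = (\<lambda>(v, w). v + axis l w)"

definition gluing ::
  "'n::finite \<Rightarrow> real \<Rightarrow> (complex \<Rightarrow> complex) \<Rightarrow> ('f, complex ^ 'n) mfd \<Rightarrow>
   ('a, complex ^ 'n) mfd \<Rightarrow> 'a set \<Rightarrow> ('a \<Rightarrow> 'f \<times> complex \<times> real) \<Rightarrow>
   ('b, complex ^ 'n) mfd \<Rightarrow> 'b set \<Rightarrow> ('b \<Rightarrow> 'f \<times> complex \<times> real) \<Rightarrow>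
   (('a, 'f, 'b) glued, complex ^ 'n) mfd" where
  "gluing l \<epsilon> \<rho> XF X1 W1 \<Phi>1 X2 W2 \<Phi>2 =
     (let P = prod_mfd XF (cylinder \<epsilon>); g = neck \<rho> W1 \<Phi>1 W2 \<Phi>2 in
      \<lparr>Model = UNIV,
       Atlas =
         {(Above ` (U \<inter> cut_points X1 W1 \<Phi>1), \<phi> \<circ> of_Above) | U \<phi>. (U, \<phi>) \<in> Atlas X1} \<union>
         {(Below ` (U \<inter> cut_points X2 W2 \<Phi>2), \<phi> \<circ> of_Below) | U \<phi>. (U, \<phi>) \<in> Atlas X2} \<union>
         {(g ` V, join l \<circ> \<psi> \<circ> inv_into (points P) g) | V \<psi>. (V, \<psi>) \<in> Atlas P}\<rparr>)"


section \<open>\<open>b\<close>-geometry\<close>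

definition defining_function ::
  "('a, 'e::euclidean_space) mfd \<Rightarrow> 'a set \<Rightarrow> 'a set \<Rightarrow> ('a \<Rightarrow> real) \<Rightarrow> bool" where
  "defining_function M Z W y \<longleftrightarrow> smooth_map_on M W (flat UNIV) y \<and>
     Z \<inter> W = {q \<in> W. y q = 0} \<and>
     (\<forall>q\<in>Z \<inter> W. \<exists>u\<in>Model M. tmap M (flat UNIV) y q u \<noteq> 0)"

definition closed_hypersurface :: "('a, 'e::euclidean_space) mfd \<Rightarrow> 'a set \<Rightarrow> bool" where
  "closed_hypersurface M Z \<longleftrightarrow> closedin (mtopology M) Z \<and>
     (\<forall>p\<in>Z. \<exists>W y. p \<in> W \<and> defining_function M Z W y)"

definition b_manifold ::
  "('a, 'e::euclidean_space) mfd \<Rightarrow> ('a \<Rightarrow> (nat \<Rightarrow> 'e) \<Rightarrow> real) \<Rightarrow> 'a set \<Rightarrow> bool" where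
  "b_manifold M \<Omega> Z \<longleftrightarrow> smooth_manifold M \<and> orientation_form M \<Omega> \<and> closed_hypersurface M Z"

text \<open>
  An adapted chart has a coordinate \<open>y = x \<bullet> e\<close>, with \<open>e\<close> a unit vector, that defines \<open>Z\<close>. There the
  \<open>b\<close>-tangent bundle is trivialized by the frame consisting of \<open>y \<partial>/\<partial>y\<close> and of the constant fields
  orthogonal to \<open>e\<close>. The vector \<open>u\<close> of components with respect to this frame represents the ordinary
  tangent vector \<open>b_frame e x u\<close> at \<open>x\<close>.
\<close>

definition adapted_chart ::
  "('a, 'e::euclidean_space) mfd \<Rightarrow> 'a set \<Rightarrow> ('a, 'e) chart \<Rightarrow> 'e \<Rightarrow> bool" where
  "adapted_chart M Z c e \<longleftrightarrow> is_chart M c \<and> e \<in> Model M \<and> norm e = 1 \<and>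
     snd c ` (fst c \<inter> Z) = {x \<in> snd c ` fst c. x \<bullet> e = 0}"

definition b_frame :: "'e::euclidean_space \<Rightarrow> 'e \<Rightarrow> 'e \<Rightarrow> 'e" where
  "b_frame e x u = (u - (u \<bullet> e) *\<^sub>R e) + ((x \<bullet> e) * (u \<bullet> e)) *\<^sub>R e"

text \<open>
  A section of the bundle of alternating 2-forms on the \<open>b\<close>-tangent bundle is determined by its
  restriction to the dense set \<open>points M - Z\<close>, where it is an ordinary 2-form; so a \<open>b\<close>-form is
  recorded by this restriction, and the values of \<open>\<omega>\<close> on \<open>Z\<close> are irrelevant. In an adapted chart its
  coefficients in the above frame are a smooth family \<open>B\<close> of bilinear forms on the whole chart domain,
  including \<open>Z\<close>; at a point of \<open>Z\<close>, the form \<open>B x\<close> is the value of the section there.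
\<close>

definition b_coefficients ::
  "('a, 'e::euclidean_space) mfd \<Rightarrow> 'a set \<Rightarrow> ('a, 'e) form2 \<Rightarrow> ('a, 'e) chart \<Rightarrow> 'e \<Rightarrow>
   ('e \<Rightarrow> 'e \<Rightarrow> 'e \<Rightarrow> real) \<Rightarrow> bool" where
  "b_coefficients M Z \<omega> c e B \<longleftrightarrow> adapted_chart M Z c e \<and>
     (\<forall>x\<in>snd c ` fst c. alternating_bilinear (Model M) (B x)) \<and>
     (\<forall>u\<in>Model M. \<forall>v\<in>Model M. smooth_on (Model M) (snd c ` fst c) (\<lambda>x. B x u v)) \<and>
     (\<forall>x\<in>snd c ` (fst c - Z). \<forall>u\<in>Model M. \<forall>v\<in>Model M.
        B x u v = local_form M c \<omega> x (b_frame e x u) (b_frame e x v))"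

definition b_form2 :: "('a, 'e::euclidean_space) mfd \<Rightarrow> 'a set \<Rightarrow> ('a, 'e) form2 \<Rightarrow> bool" where
  "b_form2 M Z \<omega> \<longleftrightarrow> smooth_form2_on M (points M - Z) \<omega> \<and>
     (\<forall>p\<in>Z. \<exists>c e B. p \<in> fst c \<and> b_coefficients M Z \<omega> c e B)"

text \<open>
  Since \<open>d (\<alpha> \<and> df/f + \<beta>) = d\<alpha> \<and> df/f + d\<beta>\<close> is the ordinary exterior derivative off \<open>Z\<close>, closedness of a
  \<open>b\<close>-form can be tested on the dense set \<open>points M - Z\<close>. The non-vanishing of the top power as a
  section is required at all points; on \<open>Z\<close> it is expressed in the \<open>b\<close>-frame.
\<close>

definition b_symplectic_form :: "('a, 'e::euclidean_space) mfd \<Rightarrow> 'a set \<Rightarrow> ('a, 'e) form2 \<Rightarrow> bool" where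
  "b_symplectic_form M Z \<omega> \<longleftrightarrow> even (dim (Model M)) \<and> b_form2 M Z \<omega> \<and>
     closed_form2_on M (points M - Z) \<omega> \<and>
     (\<forall>p\<in>points M - Z. \<exists>v. (\<forall>i. v i \<in> Model M) \<and> wedge_power (half_dim M) (\<omega> p) v \<noteq> 0) \<and>
     (\<forall>p\<in>Z. \<exists>c e B. p \<in> fst c \<and> b_coefficients M Z \<omega> c e B \<and>
        (\<exists>v. (\<forall>i. v i \<in> Model M) \<and> wedge_power (half_dim M) (B (snd c p)) v \<noteq> 0))"

text \<open>The values of a \<open>b\<close>-function on \<open>Z\<close> are irrelevant.\<close>

definition b_function :: "('a, 'e::euclidean_space) mfd \<Rightarrow> 'a set \<Rightarrow> ('a \<Rightarrow> real) \<Rightarrow> bool" where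
  "b_function M Z f \<longleftrightarrow> smooth_map_on M (points M - Z) (flat UNIV) f \<and>
     (\<forall>p\<in>Z. \<exists>W c y g. p \<in> W \<and> defining_function M Z W y \<and> smooth_map_on M W (flat UNIV) g \<and>
        (\<forall>q\<in>W - Z. f q = c * ln \<bar>y q\<bar> + g q))"

text \<open>
  The action preserves \<open>Z\<close>, so that the fundamental fields are sections of the \<open>b\<close>-tangent bundle; the
  identities between sections below are again tested on the dense set \<open>points M - Z\<close>.
\<close>

definition b_hamiltonian ::
  "('a, 'e::euclidean_space) mfd \<Rightarrow> 'a set \<Rightarrow> ('a, 'e) form2 \<Rightarrow> (complex ^ 'n \<Rightarrow> 'a \<Rightarrow> 'a) \<Rightarrow> bool" where
  "b_hamiltonian M Z \<omega> act \<longleftrightarrow>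
     (\<forall>z\<in>torus (UNIV :: 'n::finite set). \<forall>p\<in>Z. act z p \<in> Z) \<and>
     (\<forall>X. \<exists>f. b_function M Z f \<and> (\<forall>p\<in>points M - Z. \<forall>u\<in>Model M.
        \<omega> p (fundamental_field M act X p) u = tmap M (flat UNIV) f p u)) \<and>
     (\<forall>X Y. \<forall>p\<in>points M - Z. \<omega> p (fundamental_field M act X p) (fundamental_field M act Y p) = 0)"

definition b_toric_structure ::
  "('a, 'e::euclidean_space) mfd \<Rightarrow> ('a \<Rightarrow> (nat \<Rightarrow> 'e) \<Rightarrow> real) \<Rightarrow> 'a set \<Rightarrow> ('a, 'e) form2 \<Rightarrow>
   (complex ^ 'n::finite \<Rightarrow> 'a \<Rightarrow> 'a) \<Rightarrow> bool" where
  "b_toric_structure M \<Omega> Z \<omega> act \<longleftrightarrow>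
     b_manifold M \<Omega> Z \<and> dim (Model M) = 2 * CARD('n) \<and> b_symplectic_form M Z \<omega> \<and>
     torus_action UNIV M act \<and> effective_action UNIV M act \<and> b_hamiltonian M Z \<omega> act"

end

(*
The glued manifold is covered by the two cut manifolds and by the neck, the product of the toric
manifold of the facet with a cylinder. On the two cut manifolds one keeps the given symplectic
forms, and on the neck one takes omega_F + gamma(h) dh /\ dtheta. In the local models the two given
forms are omega_F + dh /\ dtheta, up to the sign of the second term when theta is reflected in the
second model. For the orientation preserved gluing gamma = 1 fits both sides. For the orientation
reversed gluing gamma has to change from -1 to 1 without zeros, which is possible through a pole:
gamma = G' with G(h) = ln |h| near h = 0 and G(h) = |h| further out. In both cases the last component of
the moment map is G(h) near the cut locus. Invariance of the given moment maps and connectedness of the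
facet manifold show that they agree with it up to constants. The b-form so obtained is non-degenerate
because h gamma(h) extends to a positive function; it induces opposite orientations on the two
sides, so the orientation is defined by the top power of the form with gamma = 1 on the first side and by its
negative on the second.
*)

theory Submission imports Defs begin


section \<open>Calculus on relatively open subsets of linear subspaces\<close>

text \<open>Reflecting theta has a second effect: under the neck identification, rotation by
  \<open>z $ l\<close> on \<open>X2\<close> becomes rotation by the conjugate. The second action is
  therefore precomposed with the automorphism \<open>twist\<close> conjugating the l-th circle, and
  the second moment map is composed with its differential \<open>flip\<close>; this turns the height
  h into -h, which is where |h| in G comes from. Gluing along open ends may destroy the Hausdorff
  property. It survives because the part |h| \<le> b of a local model is the image of a compact
  product and so is closed in the Hausdorff space \<open>X1\<close> or \<open>X2\<close>; points
  outside the neck thus stay away from the cut locus. Tangent spaces are identified with the model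
  through arbitrarily chosen charts, and a product of chosen charts need not be the chosen chart of
  the product. Geometric facts are therefore drawn from functoriality of \<open>tmap\<close> and of
  pullback instead of from components. Top powers are permutation sums in which terms might cancel.
  They are controlled by Darboux bases, in which no term is negative, and by a linear map that
  stretches one direction.\<close>

abbreviation rel_open :: "'a::euclidean_space set => 'a set => bool" where
  "rel_open E S \<equiv> subspace E \<and> openin (top_of_set E) S"

lemma rel_open_subset: "rel_open E S ==> S \<subseteq> E" using openin_imp_subset by blast

lemma rel_open_Int: "rel_open E S ==> rel_open E T ==> rel_open E (S \<inter> T)" by (simp add: openin_Int)

lemma line_in_rel_open:
  assumes "rel_open E S" "x \<in> S" "u \<in> E"
  obtains d where "d > 0" "\<And>t. \<bar>t\<bar> < d ==> x + t *\<^sub>R u \<in> S"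
proof -
  obtain e where e: "e > 0" "ball x e \<inter> E \<subseteq> S" using assms by (metis openin_contains_ball)
  have xE: "x \<in> E" using assms rel_open_subset by blast
  show ?thesis
  \<comment> \<open>The summand 1 covers \<open>u = 0\<close>, where division by the norm alone
    would give radius \<open>0\<close>.\<close>
  proof (rule that[of "e / (norm u + 1)"])
    show "e / (norm u + 1) > 0" using e by (simp add: add_nonneg_pos)
    fix t :: real assume t: "\<bar>t\<bar> < e / (norm u + 1)"
    have "norm (t *\<^sub>R u) \<le> \<bar>t\<bar> * (norm u + 1)" by (simp add: algebra_simps)
    also have "\<dots> < e" using t by (simp add: pos_less_divide_eq add_nonneg_pos)
    finally have "x + t *\<^sub>R u \<in> ball x e" by (simp add: dist_norm)
    moreover have "x + t *\<^sub>R u \<in> E" using assms xE by (simp add: subspace_add subspace_scale)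
    ultimately show "x + t *\<^sub>R u \<in> S" using e by blast
  qed
qed

lemma has_vector_derivative_line:
  assumes "rel_open E S" "x \<in> S" "u \<in> E" "(f has_derivative D) (at x within S)"
  shows "((\<lambda>t. f (x + t *\<^sub>R u)) has_vector_derivative D u) (at 0)"
proof -
  obtain d where d: "d > 0" "\<And>t. \<bar>t\<bar> < d ==> x + t *\<^sub>R u \<in> S" using line_in_rel_open[OF assms(1-3)] by blast
  have 1: "((\<lambda>t. x + t *\<^sub>R u) has_derivative (\<lambda>t. t *\<^sub>R u)) (at 0 within ball 0 d)" by (auto intro!: derivative_eq_intros)
  have 2: "(f has_derivative D) (at (x + 0 *\<^sub>R u) within (\<lambda>t. x + t *\<^sub>R u) ` ball 0 d)"
    by (rule has_derivative_subset[of _ _ _ S]) (use assms(4) d in auto)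
  from has_derivative_in_compose[OF 1 2] d
  have "((\<lambda>t. f (x + t *\<^sub>R u)) has_derivative (\<lambda>t. D (t *\<^sub>R u))) (at 0)" by (simp add: at_within_open[of 0 "ball 0 d"])
  moreover have "D (t *\<^sub>R u) = t *\<^sub>R D u" for t using assms(4) has_derivative_bounded_linear linear_simps(5) by blast
  ultimately show ?thesis by (simp add: has_vector_derivative_def)
qed

text \<open>A Frechet derivative within \<open>S\<close> is determined only on directions in
  \<open>E\<close>; there it is computed along a short two-sided segment, which relative openness
  supplies. The one-variable derivative in \<open>dderiv\<close> thus serves even when
  \<open>E\<close> is a proper subspace.\<close>

lemma dderiv_eq:
  assumes "rel_open E S" "x \<in> S" "u \<in> E" "(f has_derivative D) (at x within S)"
  shows "dderiv f x u = D u"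
  unfolding dderiv_def by (rule vector_derivative_at[OF has_vector_derivative_line[OF assms]])

lemma differentiable_onE_dderiv:
  assumes "rel_open E S" "f differentiable_on S" "x \<in> S"
  obtains D where "(f has_derivative D) (at x within S)" "bounded_linear D"
    "\<And>u. u \<in> E ==> dderiv f x u = D u"
proof -
  obtain D where D: "(f has_derivative D) (at x within S)" using assms by (auto simp: differentiable_on_def differentiable_def)
  then show ?thesis using dderiv_eq[OF assms(1,3)] has_derivative_bounded_linear that by blast
qed

lemma dderiv_cong:
  assumes "rel_open E S" "x \<in> S" "u \<in> E" "\<And>y. y \<in> S ==> f y = g y"
  shows "dderiv f x u = dderiv g x u"
proof -
  obtain d where d: "d > 0" "\<And>t. \<bar>t\<bar> < d ==> x + t *\<^sub>R u \<in> S" using line_in_rel_open[OF assms(1-3)] by blast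
  have "\<forall>\<^sub>F t in nhds 0. f (x + t *\<^sub>R u) = g (x + t *\<^sub>R u)" unfolding eventually_nhds_metric
    by (rule exI[of _ d]) (use d assms(4) in \<open>auto simp: dist_norm\<close>)
  then show ?thesis unfolding dderiv_def by (intro vector_derivative_cong_eq) (auto elim: eventually_mono)
qed

text \<open>Let \<open>b\<close> be the part of the derivative orthogonal to \<open>F\<close>. The
  inner product of \<open>f\<close> with \<open>b\<close> is constantly zero on \<open>S\<close>, so
  its derivative, which is the squared norm of \<open>b\<close>, vanishes.\<close>

lemma dderiv_mem_subspace:
  fixes f :: "'a::euclidean_space => 'b::euclidean_space"
  assumes "rel_open E S" "f differentiable_on S" "x \<in> S" "u \<in> E" "subspace F" "f ` S \<subseteq> F"
  shows "dderiv f x u \<in> F"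
proof -
  obtain D where D: "(f has_derivative D) (at x within S)" using assms by (auto simp: differentiable_on_def differentiable_def)
  have Du: "dderiv f x u = D u" by (rule dderiv_eq[OF assms(1,3,4) D])
  obtain a b where ab: "a \<in> span F" "\<And>w. w \<in> span F ==> orthogonal b w" "D u = a + b"
    using orthogonal_subspace_decomp_exists[of F "D u"] by metis
  have bF: "w \<bullet> b = 0" if "w \<in> F" for w using ab(2)[of w] that by (simp add: orthogonal_def inner_commute span_base)
  have "((\<lambda>x. f x \<bullet> b) has_derivative (\<lambda>h. D h \<bullet> b)) (at x within S)" by (intro derivative_intros D)
  from dderiv_eq[OF assms(1,3,4) this]
  have "dderiv (\<lambda>x. f x \<bullet> b) x u = D u \<bullet> b" .
  moreover have "dderiv (\<lambda>x. f x \<bullet> b) x u = dderiv (\<lambda>x. 0) x u" using assms bF by (intro dderiv_cong[OF assms(1,3,4)]) auto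
  ultimately have "D u \<bullet> b = 0" by (simp add: dderiv_def)
  moreover have "a \<bullet> b = 0" using bF ab(1) assms(5) by (simp add: span_eq_iff[THEN iffD2])
  ultimately have "b = 0" using ab(3) by (simp add: inner_add_left)
  then show ?thesis using ab Du assms(5) by (simp add: span_eq_iff[THEN iffD2])
qed

text \<open>Lets a derivative within one relatively open set be read within another, which makes
  differentiability a local property.\<close>

lemma at_within_rel_open:
  assumes "x \<in> S" "x \<in> T" "rel_open E S" "rel_open E T"
  shows "at x within S = at x within T"
proof -
  obtain U V where UV: "open U" "S = E \<inter> U" "open V" "T = E \<inter> V" using assms by (meson openin_open)
  show ?thesis by (rule at_within_nhd[of _ "U \<inter> V"]) (use UV assms in auto)
qed

lemma Ck_on_subset: "Ck_on k E S f ==> T \<subseteq> S ==> Ck_on k E T f"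
  by (induction k arbitrary: f) (auto intro: continuous_on_subset differentiable_on_subset)

lemma Ck_on_cong:
  assumes "rel_open E S" "Ck_on k E S f" "\<And>x. x \<in> S ==> g x = f x"
  shows "Ck_on k E S g"
  using assms(2,3)
proof (induction k arbitrary: f g)
  case 0
  then show ?case by (simp cong: continuous_on_cong)
next
  case (Suc k)
  have "g differentiable_on S" unfolding differentiable_on_def
  proof
    fix x assume x: "x \<in> S"
    obtain D where D: "(f has_derivative D) (at x within S)" using Suc.prems x by (auto simp: differentiable_on_def differentiable_def)
    show "g differentiable (at x within S)" using has_derivative_transform[OF x Suc.prems(2) D] by (auto simp: differentiable_def)
  qed
  moreover have "Ck_on k E S (\<lambda>x. dderiv g x u)" if "u \<in> E" for u
  proof (rule Suc.IH[of "\<lambda>x. dderiv f x u"])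
    show "Ck_on k E S (\<lambda>x. dderiv f x u)" using Suc.prems(1) that by simp
    show "dderiv g x u = dderiv f x u" if "x \<in> S" for x by (rule dderiv_cong[OF assms(1) that \<open>u \<in> E\<close> Suc.prems(2)])
  qed
  ultimately show ?case by simp
qed

lemma Ck_on_SucD: "Ck_on (Suc k) E S f ==> Ck_on k E S f" by (induction k arbitrary: f) (auto simp: differentiable_imp_continuous_on)

lemma Ck_on_local:
  assumes S: "rel_open E S"
    and "\<And>x. x \<in> S ==> \<exists>T. rel_open E T \<and> x \<in> T \<and> Ck_on k E T f"
  shows "Ck_on k E S f"
  using assms(2)
proof (induction k arbitrary: f)
  case 0
  show ?case unfolding Ck_on.simps continuous_on_eq_continuous_within
  proof
    fix x assume x: "x \<in> S"
    then obtain T where T: "rel_open E T" "x \<in> T" "continuous_on T f" using 0 by auto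
    then show "continuous (at x within S) f" using at_within_rel_open[OF x T(2) S T(1)] by (simp add: continuous_on_eq_continuous_within)
  qed
next
  case (Suc k)
  have "f differentiable (at x within S)" if x: "x \<in> S" for x
  proof -
    obtain T where T: "rel_open E T" "x \<in> T" "Ck_on (Suc k) E T f" using Suc.prems x by blast
    then show ?thesis using at_within_rel_open[OF x T(2) S T(1)] by (simp add: differentiable_on_def)
  qed
  moreover have "Ck_on k E S (\<lambda>x. dderiv f x u)" if "u \<in> E" for u using Suc.prems that by (intro Suc.IH) fastforce
  ultimately show ?case by (simp add: differentiable_on_def)
qed

lemma Ck_on_const: "subspace E ==> Ck_on k E S (\<lambda>x. c)" by (induction k arbitrary: c) (auto simp: dderiv_def)

lemma Ck_on_bounded_linear_id:
  assumes "rel_open E S" "bounded_linear f"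
  shows "Ck_on k E S f"
proof (cases k)
  case 0
  then show ?thesis using assms by (simp add: bounded_linear.linear linear_continuous_on)
next
  case (Suc j)
  have "dderiv f x u = f u" if "x \<in> S" "u \<in> E" for x u using dderiv_eq[OF assms(1) that bounded_linear_imp_has_derivative[OF assms(2)]] .
  then have "Ck_on j E S (\<lambda>x. dderiv f x u)" if "u \<in> E" for u
    using assms that by (intro Ck_on_cong[OF assms(1) Ck_on_const[of E _ _ "f u"]]) auto
  then show ?thesis using Suc assms by (simp add: bounded_linear_imp_differentiable_on)
qed

lemma Ck_on_add:
  assumes "rel_open E S" "Ck_on k E S f" "Ck_on k E S g"
  shows "Ck_on k E S (\<lambda>x. f x + g x)"
  using assms(2,3)
proof (induction k arbitrary: f g)
  case 0
  then show ?case by (auto intro: continuous_on_add)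
next
  case (Suc k)
  have *: "dderiv (\<lambda>x. f x + g x) x u = dderiv f x u + dderiv g x u" if x: "x \<in> S" and u: "u \<in> E" for x u
  proof -
    obtain D D' where D: "(f has_derivative D) (at x within S)" "(g has_derivative D') (at x within S)"
      using Suc.prems x unfolding differentiable_on_def differentiable_def Ck_on.simps by metis
    show ?thesis using dderiv_eq[OF assms(1) x u has_derivative_add[OF D]] dderiv_eq[OF assms(1) x u D(1)]
        dderiv_eq[OF assms(1) x u D(2)] by simp
  qed
  have "Ck_on k E S (\<lambda>x. dderiv (\<lambda>x. f x + g x) x u)" if "u \<in> E" for u
  proof (rule Ck_on_cong[OF assms(1)])
    show "Ck_on k E S (\<lambda>x. dderiv f x u + dderiv g x u)" by (rule Suc.IH) (use Suc.prems that in auto)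
  qed (use that * in auto)
  then show ?case using Suc.prems by (simp add: differentiable_on_add)
qed

text \<open>Scalar multiples, products and inner products are all instances. In the induction step
  the product rule pairs a derivative with an undifferentiated factor, so the latter is first
  weakened from class \<open>Suc k\<close> to class \<open>k\<close>.\<close>

lemma Ck_on_bilinear:
  assumes "rel_open E S" "bounded_bilinear p" "Ck_on k E S f" "Ck_on k E S g"
  shows "Ck_on k E S (\<lambda>x. p (f x) (g x))"
  using assms(3,4)
proof (induction k arbitrary: f g)
  case 0
  then show ?case using assms(2) by (auto intro: bounded_bilinear.continuous_on)
next
  case (Suc k)
  have d: "(\<lambda>x. p (f x) (g x)) differentiable (at x within S) \<and>
      (\<forall>u\<in>E. dderiv (\<lambda>x. p (f x) (g x)) x u = p (f x) (dderiv g x u) + p (dderiv f x u) (g x))"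
    if x: "x \<in> S" for x
  proof -
    obtain D D' where D: "(f has_derivative D) (at x within S)" "(g has_derivative D') (at x within S)"
      using Suc.prems x unfolding differentiable_on_def differentiable_def Ck_on.simps by metis
    note FD = bounded_bilinear.FDERIV[OF assms(2) D]
    show ?thesis using dderiv_eq[OF assms(1) x _ FD] dderiv_eq[OF assms(1) x _ D(1)]
        dderiv_eq[OF assms(1) x _ D(2)] FD by (auto simp: differentiable_def)
  qed
  have "Ck_on k E S (\<lambda>x. dderiv (\<lambda>x. p (f x) (g x)) x u)" if u: "u \<in> E" for u
  proof (rule Ck_on_cong[OF assms(1)])
    show "Ck_on k E S (\<lambda>x. p (f x) (dderiv g x u) + p (dderiv f x u) (g x))"
    proof (rule Ck_on_add[OF assms(1)])
      show "Ck_on k E S (\<lambda>x. p (f x) (dderiv g x u))" using Suc.prems u by (intro Suc.IH Ck_on_SucD[of k E S f]) simp_all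
      show "Ck_on k E S (\<lambda>x. p (dderiv f x u) (g x))" using Suc.prems u by (intro Suc.IH Ck_on_SucD[of k E S g]) simp_all
    qed
  qed (use d u in auto)
  then show ?case using d by (auto simp: differentiable_on_def)
qed

lemma Ck_on_sum:
  assumes "rel_open E S" "\<And>i. i \<in> I ==> Ck_on k E S (f i)"
  shows "Ck_on k E S (\<lambda>x. \<Sum>i\<in>I. f i x)"
  using assms(2) by (induction I rule: infinite_finite_induct) (auto simp: assms(1) Ck_on_const Ck_on_add)

lemma subspace_orthonormal_basis:
  fixes E :: "'a::euclidean_space set"
  assumes "subspace E"
  obtains B where "finite B" "B \<subseteq> E" "\<And>x. x \<in> E ==> (\<Sum>b\<in>B. (x \<bullet> b) *\<^sub>R b) = x"
proof -
  obtain B where "B \<subseteq> E" "pairwise orthogonal B" "\<And>x. x \<in> B ==> norm x = 1"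
    "independent B" "card B = dim E" "span B = E"
    using orthonormal_basis_subspace[OF assms] by metis
  then show ?thesis using orthonormal_basis_expand[of B] independent_imp_finite[of B] that by blast
qed

lemma dderiv_linear:
  assumes "rel_open E S" "f differentiable_on S" "x \<in> S" "\<And>i. i \<in> I ==> u i \<in> E"
  shows "dderiv f x (\<Sum>i\<in>I. a i *\<^sub>R u i) = (\<Sum>i\<in>I. a i *\<^sub>R dderiv f x (u i))"
proof -
  obtain D where D: "bounded_linear D" "\<And>u. u \<in> E ==> dderiv f x u = D u" using differentiable_onE_dderiv[OF assms(1-3)] by metis
  have "(\<Sum>i\<in>I. a i *\<^sub>R u i) \<in> E" using assms by (simp add: subspace_sum subspace_scale)
  then show ?thesis using D assms(4) by (simp add: bounded_linear.linear linear_sum linear_scale)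
qed

lemma dderiv_compose:
  assumes S: "rel_open E S" "f differentiable_on S" "x \<in> S" "u \<in> E"
    and T: "rel_open F T" "g differentiable_on T" "f ` S \<subseteq> T"
  shows "dderiv (\<lambda>x. g (f x)) x u = dderiv g (f x) (dderiv f x u)"
    and "(\<lambda>x. g (f x)) differentiable_on S"
proof -
  obtain D where D: "(f has_derivative D) (at x within S)" "\<And>u. u \<in> E ==> dderiv f x u = D u"
    using differentiable_onE_dderiv[OF S(1-3)] by metis
  have fx: "f x \<in> T" using S T by blast
  obtain D' where D': "(g has_derivative D') (at (f x) within T)" "\<And>u. u \<in> F ==> dderiv g (f x) u = D' u"
    using differentiable_onE_dderiv[OF T(1,2) fx] by metis
  have "(g has_derivative D') (at (f x) within f ` S)" using D' T(3) has_derivative_subset by blast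
  from dderiv_eq[OF S(1,3,4) has_derivative_in_compose[OF D(1) this]]
  have "dderiv (\<lambda>x. g (f x)) x u = D' (D u)" .
  moreover have "dderiv f x u \<in> F" using dderiv_mem_subspace[OF S _, of F] T rel_open_subset[of F T] by auto
  ultimately show "dderiv (\<lambda>x. g (f x)) x u = dderiv g (f x) (dderiv f x u)" using D D' S by auto
  show "(\<lambda>x. g (f x)) differentiable_on S" by (rule differentiable_on_compose[OF S(2) differentiable_on_subset[OF T(2,3)]])
qed

text \<open>The chain rule differentiates \<open>g\<close> in the direction
  \<open>dderiv f x u\<close>, which moves with \<open>x\<close>, while the induction hypothesis
  concerns fixed directions. Expanding that direction in an orthonormal basis of \<open>F\<close>
  leaves a finite sum of products with fixed directions.\<close>

lemma Ck_on_compose: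
  fixes g :: "'b::euclidean_space => 'c::real_normed_vector"
  assumes S: "rel_open E S" and T: "rel_open F T" "f ` S \<subseteq> T"
    and "Ck_on k E S f" "Ck_on k F T g"
  shows "Ck_on k E S (\<lambda>x. g (f x))"
  using assms(4,5)
proof (induction k arbitrary: g)
  case 0
  then show ?case using T(2) by (auto intro: continuous_on_compose2)
next
  case (Suc k)
  obtain B where B: "finite B" "B \<subseteq> F" "\<And>x. x \<in> F ==> (\<Sum>b\<in>B. (x \<bullet> b) *\<^sub>R b) = x"
    using subspace_orthonormal_basis T(1) by metis
  have df: "f differentiable_on S" and dg: "g differentiable_on T" using Suc.prems by auto
  have "dderiv (\<lambda>x. g (f x)) x u = (\<Sum>b\<in>B. (dderiv f x u \<bullet> b) *\<^sub>R dderiv g (f x) b)"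
    if x: "x \<in> S" and u: "u \<in> E" for x u
  proof -
    have "dderiv f x u \<in> F" using dderiv_mem_subspace[OF S df x u, of F] T rel_open_subset[of F T] by auto
    then have "dderiv g (f x) (dderiv f x u) = dderiv g (f x) (\<Sum>b\<in>B. (dderiv f x u \<bullet> b) *\<^sub>R b)" using B by simp
    also have "\<dots> = (\<Sum>b\<in>B. (dderiv f x u \<bullet> b) *\<^sub>R dderiv g (f x) b)"
      using x T(2) B by (intro dderiv_linear[OF T(1) dg]) auto
    finally show ?thesis using dderiv_compose(1)[OF S df x u T(1) dg T(2)] by simp
  qed
  moreover have "Ck_on k E S (\<lambda>x. \<Sum>b\<in>B. (dderiv f x u \<bullet> b) *\<^sub>R dderiv g (f x) b)" if "u \<in> E" for u
  proof (intro Ck_on_sum[OF S] Ck_on_bilinear[OF S bounded_bilinear_scaleR] Suc.IH)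
    fix b assume b: "b \<in> B"
    show "Ck_on k E S (\<lambda>x. dderiv f x u \<bullet> b)"
      using Suc.prems that S by (intro Ck_on_bilinear[OF S bounded_bilinear_inner] Ck_on_const) auto
    show "Ck_on k E S f" using Suc.prems Ck_on_SucD by blast
    show "Ck_on k F T (\<lambda>y. dderiv g y b)" using Suc.prems b B by auto
  qed
  ultimately have "Ck_on k E S (\<lambda>x. dderiv (\<lambda>x. g (f x)) x u)" if "u \<in> E" for u
    using that Ck_on_cong[OF S] by (metis (no_types, lifting))
  moreover have "(\<lambda>x. g (f x)) differentiable_on S" by (rule differentiable_on_compose[OF df differentiable_on_subset[OF dg T(2)]])
  ultimately show ?case by simp
qed


section \<open>Rules for smooth maps between linear spaces\<close>

lemma smooth_on_subset: "smooth_on E S f ==> T \<subseteq> S ==> smooth_on E T f" unfolding smooth_on_def using Ck_on_subset by blast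

lemma smooth_on_cong:
  assumes "rel_open E S" "smooth_on E S f" "\<And>x. x \<in> S ==> g x = f x"
  shows "smooth_on E S g"
  unfolding smooth_on_def
proof
  fix k show "Ck_on k E S g"
    by (rule Ck_on_cong[OF assms(1), where f = f]) (use assms(2,3) in \<open>auto simp: smooth_on_def\<close>)
qed

lemma smooth_on_local:
  assumes "rel_open E S" "\<And>x. x \<in> S ==> \<exists>T. rel_open E T \<and> x \<in> T \<and> smooth_on E T f"
  shows "smooth_on E S f"
  unfolding smooth_on_def
proof
  fix k show "Ck_on k E S f"
    by (rule Ck_on_local[OF assms(1)]) (use assms(2) in \<open>auto simp: smooth_on_def\<close>)
qed

lemma smooth_on_const: "subspace E ==> smooth_on E S (\<lambda>x. c)" by (simp add: smooth_on_def Ck_on_const)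

lemma smooth_on_linear: "rel_open E S ==> bounded_linear f ==> smooth_on E S f" by (simp add: smooth_on_def Ck_on_bounded_linear_id)

lemma smooth_on_add:
  "rel_open E S ==> smooth_on E S f ==> smooth_on E S g ==> smooth_on E S (\<lambda>x. f x + g x)"
  by (simp add: smooth_on_def Ck_on_add)

lemma smooth_on_bilinear:
  "rel_open E S ==> bounded_bilinear p ==> smooth_on E S f ==> smooth_on E S g ==>
    smooth_on E S (\<lambda>x. p (f x) (g x))"
  by (simp add: smooth_on_def Ck_on_bilinear)

lemmas smooth_on_scaleR = smooth_on_bilinear[OF _ bounded_bilinear_scaleR]
lemmas smooth_on_mult = smooth_on_bilinear[OF _ bounded_bilinear_mult]

lemma smooth_on_sum:
  "rel_open E S ==> (\<And>i. i \<in> I ==> smooth_on E S (f i)) ==> smooth_on E S (\<lambda>x. \<Sum>i\<in>I. f i x)"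
  by (simp add: smooth_on_def Ck_on_sum)

lemma smooth_on_prod:
  fixes f :: "'i => 'a::euclidean_space => 'b::{real_normed_algebra,comm_ring_1}"
  assumes "rel_open E S" "\<And>i. i \<in> I ==> smooth_on E S (f i)"
  shows "smooth_on E S (\<lambda>x. \<Prod>i\<in>I. f i x)"
  using assms(2) by (induction I rule: infinite_finite_induct)
    (auto simp: assms(1) smooth_on_const intro!: smooth_on_mult)

lemma smooth_on_compose:
  fixes g :: "'b::euclidean_space => 'c::real_normed_vector"
  assumes "rel_open E S" "rel_open F T" "f ` S \<subseteq> T" "smooth_on E S f" "smooth_on F T g"
  shows "smooth_on E S (\<lambda>x. g (f x))"
  using Ck_on_compose[OF assms(1-3)] assms(4,5) unfolding smooth_on_def by blast

lemma smooth_on_compose_linear: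
  fixes f :: "'a::euclidean_space => 'b::euclidean_space"
  assumes "rel_open E S" "smooth_on E S f" "bounded_linear g"
  shows "smooth_on E S (\<lambda>x. g (f x))"
  by (rule smooth_on_compose[OF assms(1) _ _ assms(2) smooth_on_linear[of UNIV UNIV]]) (use assms in auto)

lemma smooth_on_diff:
  fixes f g :: "'a::euclidean_space => 'b::euclidean_space"
  assumes "rel_open E S" "smooth_on E S f" "smooth_on E S g"
  shows "smooth_on E S (\<lambda>x. f x - g x)"
  using smooth_on_add[OF assms(1,2) smooth_on_compose_linear[OF assms(1,3), of uminus]] by (simp add: bounded_linear_minus bounded_linear_ident)

lemma smooth_on_Pair:
  fixes f :: "'a::euclidean_space => 'b::euclidean_space" and g :: "'a => 'c::euclidean_space"
  assumes "rel_open E S" "smooth_on E S f" "smooth_on E S g"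
  shows "smooth_on E S (\<lambda>x. (f x, g x))"
proof -
  have "bounded_linear (\<lambda>y::'b. (y, 0::'c))" "bounded_linear (\<lambda>y::'c. (0::'b, y))"
    by (auto intro!: bounded_linear_Pair bounded_linear_ident bounded_linear_zero)
  from smooth_on_add[OF assms(1) smooth_on_compose_linear[OF assms(1,2) this(1)]
      smooth_on_compose_linear[OF assms(1,3) this(2)]]
  show ?thesis by simp
qed

lemma smooth_on_dderiv: "smooth_on E S f ==> u \<in> E ==> smooth_on E S (\<lambda>x. dderiv f x u)"
  unfolding smooth_on_def using Ck_on.simps(2) by blast

lemma smooth_on_differentiable: "smooth_on E S f ==> f differentiable_on S" unfolding smooth_on_def using Ck_on.simps(2) by blast

lemma smooth_on_continuous: "smooth_on E S f ==> continuous_on S f" unfolding smooth_on_def using Ck_on.simps(1) by blast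

lemma smooth_onI:
  assumes "f differentiable_on S" "\<And>u. u \<in> E ==> smooth_on E S (\<lambda>x. dderiv f x u)"
  shows "smooth_on E S f"
  unfolding smooth_on_def
proof
  fix k
  show "Ck_on k E S f"
  proof (cases k)
    case 0
    then show ?thesis using assms(1) by (simp add: differentiable_imp_continuous_on)
  next
    case (Suc j)
    then show ?thesis using assms by (simp add: smooth_on_def)
  qed
qed

text \<open>A class closed under directional derivatives, up to equality on \<open>S\<close>, can be
  differentiated any number of times. This is the route to smoothness of \<open>exp\<close>,
  \<open>inverse\<close> and \<open>flat_exp\<close>, whose derivatives stay in an explicit
  family.\<close>

lemma smooth_on_coinduct:
  assumes "rel_open E S" "C f"
    and "\<And>f. C f ==> f differentiable_on S"
    and "\<And>f u. C f ==> u \<in> E ==> \<exists>g. C g \<and> (\<forall>x\<in>S. dderiv f x u = g x)"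
  shows "smooth_on E S f"
  unfolding smooth_on_def
proof
  fix k show "Ck_on k E S f"
    using assms(2)
  proof (induction k arbitrary: f)
    case 0
    then show ?case using assms(3) by (simp add: differentiable_imp_continuous_on)
  next
    case (Suc k)
    have "Ck_on k E S (\<lambda>x. dderiv f x u)" if u: "u \<in> E" for u
    proof -
      obtain g where "C g" "\<And>x. x \<in> S ==> dderiv f x u = g x" using assms(4)[OF Suc.prems u] by blast
      then show ?thesis by (intro Ck_on_cong[OF assms(1), where f = g and g = "\<lambda>x. dderiv f x u"] Suc.IH)
    qed
    then show ?case using assms(3)[OF Suc.prems] by simp
  qed
qed

lemma dderiv_bounded_linear:
  assumes "rel_open E S" "f differentiable_on S" "x \<in> S" "u \<in> E" "bounded_linear L"
  shows "dderiv (\<lambda>x. L (f x)) x u = L (dderiv f x u)"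
proof -
  obtain D where D: "(f has_derivative D) (at x within S)" "\<And>u. u \<in> E ==> dderiv f x u = D u"
    using differentiable_onE_dderiv[OF assms(1-3)] by metis
  show ?thesis using dderiv_eq[OF assms(1,3,4) bounded_linear.has_derivative[OF assms(5) D(1)]] D(2) assms(4) by simp
qed

section \<open>Symmetry of second derivatives\<close>

lemma DERIV_line:
  fixes h :: "'a::euclidean_space => real"
  assumes "rel_open E S" "h differentiable_on S" "y + t *\<^sub>R u \<in> S" "u \<in> E"
  shows "((\<lambda>t. h (y + t *\<^sub>R u)) has_real_derivative dderiv h (y + t *\<^sub>R u) u) (at t)"
proof -
  obtain D where D: "(h has_derivative D) (at (y + t *\<^sub>R u) within S)" "bounded_linear D"
      "\<And>w. w \<in> E ==> dderiv h (y + t *\<^sub>R u) w = D w"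
    by (rule differentiable_onE_dderiv[OF assms(1-3)]) blast
  have "((\<lambda>s. h (y + (s + t) *\<^sub>R u)) has_real_derivative D u) (at 0)" using has_vector_derivative_line[OF assms(1,3,4) D(1)]
    by (simp add: has_real_derivative_iff_has_vector_derivative algebra_simps)
  then show ?thesis using D(3) assms(4) DERIV_shift[of "\<lambda>t. h (y + t *\<^sub>R u)" "D u" 0 t] by simp
qed

text \<open>Two mean value theorems: one along \<open>u\<close>, applied to the increment of
  \<open>h\<close> in direction \<open>v\<close>, then one along \<open>v\<close>, applied to the
  derivative in direction \<open>u\<close>. The second difference on the left is symmetric in
  \<open>u\<close> and \<open>v\<close>, which is what the sequel exploits.\<close>

lemma mixed_difference:
  fixes h :: "'a::euclidean_space => real"
  assumes S: "rel_open E S" and h: "smooth_on E S h" and u: "u \<in> E" and v: "v \<in> E" and s: "s > 0"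
    and sub: "\<And>a b. 0 \<le> a ==> a \<le> s ==> 0 \<le> b ==> b \<le> s ==> x + a *\<^sub>R u + b *\<^sub>R v \<in> S"
  shows "\<exists>a b. 0 < a \<and> a < s \<and> 0 < b \<and> b < s \<and>
     h (x + s *\<^sub>R u + s *\<^sub>R v) - h (x + s *\<^sub>R u) - h (x + s *\<^sub>R v) + h x
       = s * s * dderiv (\<lambda>y. dderiv h y u) (x + a *\<^sub>R u + b *\<^sub>R v) v"
proof -
  let ?hu = "\<lambda>y. dderiv h y u"
  have hd: "h differentiable_on S" and hud: "?hu differentiable_on S" using smooth_on_differentiable h smooth_on_dderiv[OF h u] by blast+
  have "\<exists>a>0. a < s \<and> (h ((x + s *\<^sub>R v) + s *\<^sub>R u) - h (x + s *\<^sub>R u)) - (h ((x + s *\<^sub>R v) + 0 *\<^sub>R u) - h (x + 0 *\<^sub>R u))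
     = (s - 0) * (?hu ((x + s *\<^sub>R v) + a *\<^sub>R u) - ?hu (x + a *\<^sub>R u))"
  proof (rule MVT2[OF s])
    fix t assume t: "0 \<le> t" "t \<le> s"
    have "(x + s *\<^sub>R v) + t *\<^sub>R u \<in> S" "x + t *\<^sub>R u \<in> S" using sub[of t s] sub[of t 0] t s by (simp_all add: algebra_simps)
    then show "((\<lambda>t. h ((x + s *\<^sub>R v) + t *\<^sub>R u) - h (x + t *\<^sub>R u)) has_real_derivative
        ?hu ((x + s *\<^sub>R v) + t *\<^sub>R u) - ?hu (x + t *\<^sub>R u)) (at t)"
      by (intro DERIV_diff DERIV_line[OF S hd] u)
  qed
  then obtain a where a: "0 < a" "a < s" and eq1:
    "(h ((x + s *\<^sub>R v) + s *\<^sub>R u) - h (x + s *\<^sub>R u)) - (h ((x + s *\<^sub>R v) + 0 *\<^sub>R u) - h (x + 0 *\<^sub>R u))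
     = (s - 0) * (?hu ((x + s *\<^sub>R v) + a *\<^sub>R u) - ?hu (x + a *\<^sub>R u))" by blast
  have "\<exists>b>0. b < s \<and> ?hu ((x + a *\<^sub>R u) + s *\<^sub>R v) - ?hu ((x + a *\<^sub>R u) + 0 *\<^sub>R v)
     = (s - 0) * dderiv ?hu ((x + a *\<^sub>R u) + b *\<^sub>R v) v"
  proof (rule MVT2[OF s])
    fix t assume t: "0 \<le> t" "t \<le> s"
    then have "(x + a *\<^sub>R u) + t *\<^sub>R v \<in> S" using sub[of a t] a by simp
    then show "((\<lambda>t. ?hu ((x + a *\<^sub>R u) + t *\<^sub>R v)) has_real_derivative
        dderiv ?hu ((x + a *\<^sub>R u) + t *\<^sub>R v) v) (at t)"
      by (intro DERIV_line[OF S hud] v)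
  qed
  then obtain b where b: "0 < b" "b < s" and eq2:
    "?hu ((x + a *\<^sub>R u) + s *\<^sub>R v) - ?hu ((x + a *\<^sub>R u) + 0 *\<^sub>R v)
     = (s - 0) * dderiv ?hu ((x + a *\<^sub>R u) + b *\<^sub>R v) v" by blast
  have e: "x + s *\<^sub>R u + s *\<^sub>R v = (x + s *\<^sub>R v) + s *\<^sub>R u" "(x + s *\<^sub>R v) + a *\<^sub>R u = (x + a *\<^sub>R u) + s *\<^sub>R v"
    by (simp_all add: algebra_simps)
  have "h (x + s *\<^sub>R u + s *\<^sub>R v) - h (x + s *\<^sub>R u) - h (x + s *\<^sub>R v) + h x =
    s * (?hu ((x + s *\<^sub>R v) + a *\<^sub>R u) - ?hu (x + a *\<^sub>R u))"
    using eq1 unfolding e(1) by simp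
  also have "\<dots> = s * s * dderiv ?hu ((x + a *\<^sub>R u) + b *\<^sub>R v) v" using eq2 unfolding e(2) by simp
  finally show ?thesis using a b by blast
qed

text \<open>The second difference over a parallelogram of size \<open>s\<close> equals
  \<open>s * s\<close> times either mixed derivative at some nearby point. If the two mixed
  derivatives differed at \<open>x\<close>, continuity would keep them apart on a small
  parallelogram.\<close>

lemma dderiv_commute_real:
  fixes h :: "'a::euclidean_space => real"
  assumes S: "rel_open E S" and h: "smooth_on E S h" and u: "u \<in> E" and v: "v \<in> E" and x: "x \<in> S"
  shows "dderiv (\<lambda>y. dderiv h y u) x v = dderiv (\<lambda>y. dderiv h y v) x u" (is "?A x = ?B x")
proof (rule ccontr)
  assume ne: "?A x \<noteq> ?B x"
  define e where "e = dist (?A x) (?B x) / 2"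
  have e: "e > 0" using ne by (simp add: e_def)
  have cA: "continuous_on S ?A" and cB: "continuous_on S ?B" by (intro smooth_on_continuous[of E] smooth_on_dderiv h u v)+
  obtain d1 where d1: "d1 > 0" "\<And>y. y \<in> S ==> dist y x < d1 ==> dist (?A y) (?A x) < e"
    using continuous_on_iff[THEN iffD1, rule_format, OF cA x e] by blast
  obtain d2 where d2: "d2 > 0" "\<And>y. y \<in> S ==> dist y x < d2 ==> dist (?B y) (?B x) < e"
    using continuous_on_iff[THEN iffD1, rule_format, OF cB x e] by blast
  obtain d3 where d3: "d3 > 0" "ball x d3 \<inter> E \<subseteq> S" using S x by (metis openin_contains_ball)
  define d where "d = min d1 (min d2 d3)"
  \<comment> \<open>With this size all points \<open>x + a u + b v\<close> with \<open>a\<close> and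
    \<open>b\<close> between \<open>0\<close> and \<open>s\<close> lie within distance
    \<open>d\<close> of \<open>x\<close>.\<close>
  define s where "s = d / (norm u + norm v + 1)"
  have d: "d > 0" using d1 d2 d3 by (simp add: d_def)
  have n: "norm u + norm v + 1 > 0" by (simp add: add_nonneg_pos)
  have s: "s > 0" using d n by (simp add: s_def)
  have xE: "x \<in> E" using S x rel_open_subset by blast
  have near: "dist (x + a *\<^sub>R u + b *\<^sub>R v) x < d" if "0 \<le> a" "a \<le> s" "0 \<le> b" "b \<le> s" for a b
  proof -
    have "dist (x + a *\<^sub>R u + b *\<^sub>R v) x \<le> a * norm u + b * norm v"
      using norm_triangle_ineq[of "a *\<^sub>R u" "b *\<^sub>R v"] that by (simp add: dist_norm add.assoc)
    also have "\<dots> \<le> s * norm u + s * norm v" using that by (intro add_mono mult_right_mono) auto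
    also have "\<dots> < s * (norm u + norm v + 1)" using s by (simp add: algebra_simps)
    also have "\<dots> = d" using n by (simp add: s_def)
    finally show ?thesis .
  qed
  have sub: "x + a *\<^sub>R u + b *\<^sub>R v \<in> S" if "0 \<le> a" "a \<le> s" "0 \<le> b" "b \<le> s" for a b
  proof -
    have "x + a *\<^sub>R u + b *\<^sub>R v \<in> E" using S xE u v by (simp add: subspace_add subspace_scale)
    then show ?thesis using near[OF that] d3(2) by (auto simp: d_def dist_commute)
  qed
  obtain a b where ab: "0 < a" "a < s" "0 < b" "b < s"
    "h (x + s *\<^sub>R u + s *\<^sub>R v) - h (x + s *\<^sub>R u) - h (x + s *\<^sub>R v) + h x
       = s * s * ?A (x + a *\<^sub>R u + b *\<^sub>R v)"
    using mixed_difference[OF S h u v s sub] by blast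
  have sub': "x + a *\<^sub>R v + b *\<^sub>R u \<in> S" if "0 \<le> a" "a \<le> s" "0 \<le> b" "b \<le> s" for a b
    using sub[OF that(3,4,1,2)] by (simp add: algebra_simps)
  obtain a' b' where ab': "0 < a'" "a' < s" "0 < b'" "b' < s"
    "h (x + s *\<^sub>R v + s *\<^sub>R u) - h (x + s *\<^sub>R v) - h (x + s *\<^sub>R u) + h x
       = s * s * ?B (x + a' *\<^sub>R v + b' *\<^sub>R u)"
    using mixed_difference[OF S h v u s sub'] by blast
  have sw: "x + s *\<^sub>R v + s *\<^sub>R u = x + s *\<^sub>R u + s *\<^sub>R v" "x + a' *\<^sub>R v + b' *\<^sub>R u = x + b' *\<^sub>R u + a' *\<^sub>R v"
    by (simp_all add: algebra_simps)
  have "s * s * ?A (x + a *\<^sub>R u + b *\<^sub>R v) = s * s * ?B (x + b' *\<^sub>R u + a' *\<^sub>R v)" using ab(5) ab'(5) unfolding sw by linarith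
  then have eq: "?A (x + a *\<^sub>R u + b *\<^sub>R v) = ?B (x + b' *\<^sub>R u + a' *\<^sub>R v)" using s by simp
  have "dist (?A (x + a *\<^sub>R u + b *\<^sub>R v)) (?A x) < e" using ab near[of a b] sub[of a b] by (intro d1) (auto simp: d_def)
  moreover have "dist (?B (x + b' *\<^sub>R u + a' *\<^sub>R v)) (?B x) < e" using ab' near[of b' a'] sub[of b' a'] by (intro d2) (auto simp: d_def)
  ultimately have "dist (?A x) (?B x) < 2 * e" using eq dist_triangle_half_r by (smt (verit) dist_commute dist_triangle2)
  then show False by (simp add: e_def)
qed

lemma dderiv_commute:
  fixes h :: "'a::euclidean_space => 'b::euclidean_space"
  assumes S: "rel_open E S" and h: "smooth_on E S h" and u: "u \<in> E" and v: "v \<in> E" and x: "x \<in> S"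
  shows "dderiv (\<lambda>y. dderiv h y u) x v = dderiv (\<lambda>y. dderiv h y v) x u"
proof (rule euclidean_eqI)
  fix b :: 'b assume "b \<in> Basis"
  have bl: "bounded_linear (\<lambda>y. y \<bullet> b)" by (rule bounded_linear_inner_left)
  have hb: "smooth_on E S (\<lambda>y. h y \<bullet> b)" by (rule smooth_on_compose_linear[OF S h bl])
  have *: "dderiv (\<lambda>y. dderiv h y w) x z \<bullet> b = dderiv (\<lambda>y. dderiv (\<lambda>y. h y \<bullet> b) y w) x z"
    if "w \<in> E" "z \<in> E" for w z
  proof -
    have "dderiv (\<lambda>y. dderiv h y w) x z \<bullet> b = dderiv (\<lambda>y. dderiv h y w \<bullet> b) x z"
      using dderiv_bounded_linear[OF S smooth_on_differentiable[OF smooth_on_dderiv[OF h that(1)]] x that(2) bl] by simp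
    also have "\<dots> = dderiv (\<lambda>y. dderiv (\<lambda>y. h y \<bullet> b) y w) x z" by (rule dderiv_cong[OF S x that(2)])
        (simp add: dderiv_bounded_linear[OF S smooth_on_differentiable[OF h] _ that(1) bl])
    finally show ?thesis .
  qed
  show "dderiv (\<lambda>y. dderiv h y u) x v \<bullet> b = dderiv (\<lambda>y. dderiv h y v) x u \<bullet> b"
    using *[OF u v] *[OF v u] dderiv_commute_real[OF S hb u v x] by simp
qed


text \<open>The exterior derivative of a two-form evaluated on constant vector fields; their
  brackets vanish, so only the cyclic sum remains.\<close>

abbreviation ext_d where
  "ext_d \<beta> x u v w \<equiv> dderiv (\<lambda>y. \<beta> y v w) x u + dderiv (\<lambda>y. \<beta> y w u) x v + dderiv (\<lambda>y. \<beta> y u v) x w"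
abbreviation closed_at where
  "closed_at E T \<beta> x \<equiv> (\<forall>u\<in>E. \<forall>v\<in>E. smooth_on E T (\<lambda>y. \<beta> y u v)) \<and>
     (\<forall>u\<in>E. \<forall>v\<in>E. \<forall>w\<in>E. ext_d \<beta> x u v w = 0)"

section \<open>Alternating bilinear forms on linear subspaces\<close>

lemma alternating_bilinear_left:
  assumes "alternating_bilinear E B" "subspace E" "u \<in> E" "v \<in> E" "w \<in> E"
  shows "B (u + v) w = B u w + B v w" "B (a *\<^sub>R u) w = a * B u w" "B 0 w = 0"
    "B u v = - B v u"
proof -
  have lin: "B (a *\<^sub>R u + v) w = a * B u w + B v w" "B w (a *\<^sub>R u + v) = a * B w u + B w v"
    if "u \<in> E" "v \<in> E" "w \<in> E" for u v w a
    using assms(1) that unfolding alternating_bilinear_def by blast+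
  have alt: "B u u = 0" if "u \<in> E" for u using assms(1) that unfolding alternating_bilinear_def by blast
  have 0: "0 \<in> E" using assms(2) by (rule subspace_0)
  show z: "B 0 w = 0" using lin(1)[OF 0 0 assms(5), of 1] by simp
  show "B (u + v) w = B u w + B v w" using lin(1)[OF assms(3-5), of 1] by simp
  show "B (a *\<^sub>R u) w = a * B u w" using lin(1)[OF assms(3) 0 assms(5), of a] z by simp
  have uv: "u + v \<in> E" using assms by (simp add: subspace_add)
  have "B (u + v) (u + v) = B u u + B u v + (B v u + B v v)"
    using lin(1)[OF assms(3,4) uv, of 1] lin(2)[OF assms(3,4,3), of 1] lin(2)[OF assms(3,4,4), of 1] by simp
  then show "B u v = - B v u" using alt assms uv by simp
qed

lemma alternating_bilinear_right:
  assumes "alternating_bilinear E B" "subspace E" "u \<in> E" "v \<in> E" "w \<in> E"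
  shows "B w (u + v) = B w u + B w v" "B w (a *\<^sub>R u) = a * B w u" "B w 0 = 0"
proof -
  note l = alternating_bilinear_left[OF assms(1,2)]
  have "u + v \<in> E" "a *\<^sub>R u \<in> E" "0 \<in> E" using assms by (simp_all add: subspace_add subspace_scale subspace_0)
  then show "B w (u + v) = B w u + B w v" "B w (a *\<^sub>R u) = a * B w u" "B w 0 = 0"
    using l(1)[OF assms(3,4,5)] l(2)[OF assms(3,4,5), of a] l(3)[OF assms(3,4,5)]
      l(4)[OF _ assms(5,5)] l(4)[OF assms(3,5,5)] l(4)[OF assms(4,5,5)] by auto
qed

lemma alternating_bilinear_sum_left:
  assumes B: "alternating_bilinear E B" and E: "subspace E" and "w \<in> E" "\<And>i. i \<in> I ==> u i \<in> E"
  shows "B (\<Sum>i\<in>I. c i *\<^sub>R u i) w = (\<Sum>i\<in>I. c i * B (u i) w)"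
  using assms(4)
proof (induction I rule: infinite_finite_induct)
  case (insert i I)
  have "(\<Sum>i\<in>I. c i *\<^sub>R u i) \<in> E" "c i *\<^sub>R u i \<in> E" "u i \<in> E"
    using insert E by (auto intro!: subspace_sum subspace_scale)
  then show ?case using insert alternating_bilinear_left(1,2)[OF B E _ _ assms(3)] by simp
qed (use alternating_bilinear_left(3)[OF B E assms(3,3,3)] in auto)

lemma alternating_bilinear_sum_right:
  assumes B: "alternating_bilinear E B" and E: "subspace E" and "w \<in> E" "\<And>i. i \<in> I ==> u i \<in> E"
  shows "B w (\<Sum>i\<in>I. c i *\<^sub>R u i) = (\<Sum>i\<in>I. c i * B w (u i))"
proof -
  have "(\<Sum>i\<in>I. c i *\<^sub>R u i) \<in> E" using assms by (auto intro!: subspace_sum subspace_scale)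
  then have "B w (\<Sum>i\<in>I. c i *\<^sub>R u i) = - B (\<Sum>i\<in>I. c i *\<^sub>R u i) w"
    by (intro alternating_bilinear_left(4)[OF B E assms(3) _ assms(3)])
  also have "B (\<Sum>i\<in>I. c i *\<^sub>R u i) w = (\<Sum>i\<in>I. c i * B (u i) w)" by (rule alternating_bilinear_sum_left[OF B E assms(3,4)])
  also have "- (\<Sum>i\<in>I. c i * B (u i) w) = (\<Sum>i\<in>I. c i * B w (u i))" unfolding sum_negf[symmetric]
    by (rule sum.cong) (use alternating_bilinear_left(4)[OF B E assms(3) _ assms(3)] assms(4) in auto)
  finally show ?thesis .
qed

lemma alternating_bilinear_pullback:
  assumes "alternating_bilinear F B" "subspace F" "\<And>u. u \<in> E ==> L u \<in> F"
    "\<And>a u v. u \<in> E ==> v \<in> E ==> L (a *\<^sub>R u + v) = a *\<^sub>R L u + L v"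
  shows "alternating_bilinear E (\<lambda>u v. B (L u) (L v))"
  using assms unfolding alternating_bilinear_def by simp

lemma alternating_bilinear_plus:
  assumes "alternating_bilinear E A" "alternating_bilinear E B"
  shows "alternating_bilinear E (\<lambda>u v. A u v + B u v)"
  using assms unfolding alternating_bilinear_def by (simp add: algebra_simps)

lemma dderiv_mult:
  fixes f g :: "'a::euclidean_space => real"
  assumes "rel_open E S" "f differentiable_on S" "g differentiable_on S" "x \<in> S" "u \<in> E"
  shows "dderiv (\<lambda>x. f x * g x) x u = f x * dderiv g x u + dderiv f x u * g x"
proof -
  obtain D where D: "(f has_derivative D) (at x within S)" "bounded_linear D" "\<And>w. w \<in> E ==> dderiv f x w = D w"
    by (rule differentiable_onE_dderiv[OF assms(1,2,4)]) blast
  obtain D' where D': "(g has_derivative D') (at x within S)" "bounded_linear D'" "\<And>w. w \<in> E ==> dderiv g x w = D' w"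
    by (rule differentiable_onE_dderiv[OF assms(1,3,4)]) blast
  show ?thesis using dderiv_eq[OF assms(1,4,5) has_derivative_mult[OF D(1) D'(1)]] D(3) D'(3) assms(5) by simp
qed

lemma dderiv_const [simp]: "dderiv (\<lambda>x. c) x u = 0" by (simp add: dderiv_def)

lemma dderiv_sum:
  assumes S: "rel_open E S" and "\<And>i. i \<in> I ==> f i differentiable_on S" and x: "x \<in> S" "u \<in> E"
  shows "dderiv (\<lambda>x. \<Sum>i\<in>I. f i x) x u = (\<Sum>i\<in>I. dderiv (f i) x u)"
proof -
  have "\<forall>i\<in>I. \<exists>D. (f i has_derivative D) (at x within S)"
    using assms(2) x(1) unfolding differentiable_on_def differentiable_def by blast
  then obtain D where D: "\<And>i. i \<in> I ==> (f i has_derivative D i) (at x within S)" by metis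
  show ?thesis using dderiv_eq[OF S x has_derivative_sum[OF D]] dderiv_eq[OF S x D] by simp
qed

section \<open>Pullback of two-forms between linear spaces\<close>

context
  fixes E S :: "'a::euclidean_space set" and F T :: "'b::euclidean_space set"
    and \<phi> :: "'a => 'b" and \<beta> :: "'b => 'b => 'b => real"
  assumes S: "rel_open E S" and T: "rel_open F T"
    and \<phi>: "smooth_on E S \<phi>" "\<phi> ` S \<subseteq> T"
    and ab: "\<And>y. y \<in> T ==> alternating_bilinear F (\<beta> y)"
    and sm: "\<And>u v. u \<in> F ==> v \<in> F ==> smooth_on F T (\<lambda>y. \<beta> y u v)"
begin

lemma form_expand:
  assumes "finite I" "I \<subseteq> F" "\<And>x. x \<in> F ==> (\<Sum>b\<in>I. (x \<bullet> b) *\<^sub>R b) = x" "y \<in> T" "p \<in> F" "q \<in> F"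
  shows "\<beta> y p q = (\<Sum>i\<in>I. \<Sum>j\<in>I. (p \<bullet> i) * ((q \<bullet> j) * \<beta> y i j))"
proof -
  have F: "subspace F" using T by simp
  have "\<beta> y p q = \<beta> y (\<Sum>i\<in>I. (p \<bullet> i) *\<^sub>R i) (\<Sum>j\<in>I. (q \<bullet> j) *\<^sub>R j)" using assms by simp
  also have "\<dots> = (\<Sum>i\<in>I. (p \<bullet> i) * \<beta> y i (\<Sum>j\<in>I. (q \<bullet> j) *\<^sub>R j))"
    using assms F by (intro alternating_bilinear_sum_left[OF ab]) (auto simp del: assms(3) intro!: subspace_sum subspace_scale)
  also have "\<dots> = (\<Sum>i\<in>I. (p \<bullet> i) * (\<Sum>j\<in>I. (q \<bullet> j) * \<beta> y i j))"
    using assms(2) by (intro sum.cong refl arg_cong2[where f = "(*)"] alternating_bilinear_sum_right[OF ab[OF assms(4)] F]) auto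
  finally show ?thesis by (simp add: sum_distrib_left)
qed

text \<open>\<open>Ck_on_bilinear\<close> does not apply directly, since \<open>\<beta>\<close>
  varies with the point and is bilinear only on \<open>F\<close>. Expansion in an orthonormal basis
  of \<open>F\<close> turns the expression into products of scalar functions; the Leibniz rule is
  then collected back into values of \<open>\<beta>\<close>.\<close>

lemma form_apply:
  assumes a: "smooth_on E S a" "a ` S \<subseteq> F" and b: "smooth_on E S b" "b ` S \<subseteq> F"
  shows smooth_form_apply: "smooth_on E S (\<lambda>x. \<beta> (\<phi> x) (a x) (b x))"
    and dderiv_form_apply: "x \<in> S ==> u \<in> E ==>
      dderiv (\<lambda>x. \<beta> (\<phi> x) (a x) (b x)) x u =
      dderiv (\<lambda>y. \<beta> y (a x) (b x)) (\<phi> x) (dderiv \<phi> x u) +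
      \<beta> (\<phi> x) (dderiv a x u) (b x) + \<beta> (\<phi> x) (a x) (dderiv b x u)"
proof -
  obtain I where I: "finite I" "I \<subseteq> F" "\<And>x. x \<in> F ==> (\<Sum>b\<in>I. (x \<bullet> b) *\<^sub>R b) = x"
    using subspace_orthonormal_basis T by metis
  have eq: "\<beta> (\<phi> x) (a x) (b x) = (\<Sum>i\<in>I. \<Sum>j\<in>I. (a x \<bullet> i) * ((b x \<bullet> j) * \<beta> (\<phi> x) i j))"
    if "x \<in> S" for x
    using that a b \<phi> by (intro form_expand[OF I]) auto
  have sc: "smooth_on E S (\<lambda>x. \<beta> (\<phi> x) i j)" if "i \<in> I" "j \<in> I" for i j
    by (rule smooth_on_compose[OF S T \<phi>(2,1) sm]) (use that I in auto)
  have sa: "smooth_on E S (\<lambda>x. a x \<bullet> i)" "smooth_on E S (\<lambda>x. b x \<bullet> i)" for i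
    by (rule smooth_on_compose_linear[OF S a(1) bounded_linear_inner_left]
        smooth_on_compose_linear[OF S b(1) bounded_linear_inner_left])+
  have sbc: "smooth_on E S (\<lambda>x. (b x \<bullet> j) * \<beta> (\<phi> x) i j)" if "i \<in> I" "j \<in> I" for i j
    by (rule smooth_on_mult[OF S sa(2) sc[OF that]])
  have sabc: "smooth_on E S (\<lambda>x. (a x \<bullet> i) * ((b x \<bullet> j) * \<beta> (\<phi> x) i j))" if "i \<in> I" "j \<in> I" for i j
    by (rule smooth_on_mult[OF S sa(1) sbc[OF that]])
  have ssum: "smooth_on E S (\<lambda>x. \<Sum>j\<in>I. (a x \<bullet> i) * ((b x \<bullet> j) * \<beta> (\<phi> x) i j))" if "i \<in> I" for i
    by (rule smooth_on_sum[OF S sabc[OF that]])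
  show "smooth_on E S (\<lambda>x. \<beta> (\<phi> x) (a x) (b x))" by (rule smooth_on_cong[OF S smooth_on_sum[OF S ssum] eq])
  assume x: "x \<in> S" and u: "u \<in> E"
  note df = smooth_on_differentiable
  have \<phi>x: "\<phi> x \<in> T" "a x \<in> F" "b x \<in> F" using x \<phi> a b by auto
  have du: "dderiv \<phi> x u \<in> F" "dderiv a x u \<in> F" "dderiv b x u \<in> F"
    using dderiv_mem_subspace[OF S df[OF \<phi>(1)] x u, of F] dderiv_mem_subspace[OF S df[OF a(1)] x u _ a(2)]
      dderiv_mem_subspace[OF S df[OF b(1)] x u _ b(2)] \<phi>(2) T rel_open_subset[OF T] by auto
  have dc: "dderiv (\<lambda>x. \<beta> (\<phi> x) i j) x u = dderiv (\<lambda>y. \<beta> y i j) (\<phi> x) (dderiv \<phi> x u)"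
    if "i \<in> I" "j \<in> I" for i j
    by (rule dderiv_compose(1)[OF S df[OF \<phi>(1)] x u T df[OF sm] \<phi>(2)]) (use that I in auto)
  have da: "dderiv (\<lambda>x. a x \<bullet> i) x u = dderiv a x u \<bullet> i" "dderiv (\<lambda>x. b x \<bullet> i) x u = dderiv b x u \<bullet> i" for i
    by (rule dderiv_bounded_linear[OF S df[OF a(1)] x u bounded_linear_inner_left]
        dderiv_bounded_linear[OF S df[OF b(1)] x u bounded_linear_inner_left])+
  have "dderiv (\<lambda>x. \<beta> (\<phi> x) (a x) (b x)) x u
      = dderiv (\<lambda>x. \<Sum>i\<in>I. \<Sum>j\<in>I. (a x \<bullet> i) * ((b x \<bullet> j) * \<beta> (\<phi> x) i j)) x u"
    by (rule dderiv_cong[OF S x u eq])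
  also have "\<dots> = (\<Sum>i\<in>I. \<Sum>j\<in>I. dderiv (\<lambda>x. (a x \<bullet> i) * ((b x \<bullet> j) * \<beta> (\<phi> x) i j)) x u)"
    by (subst dderiv_sum[OF S _ x u]) (auto intro!: sum.cong dderiv_sum[OF S _ x u] df ssum sabc)
  also have "\<dots> = (\<Sum>i\<in>I. \<Sum>j\<in>I. (a x \<bullet> i) * ((b x \<bullet> j) * dderiv (\<lambda>y. \<beta> y i j) (\<phi> x) (dderiv \<phi> x u)
       + (dderiv b x u \<bullet> j) * \<beta> (\<phi> x) i j) + (dderiv a x u \<bullet> i) * ((b x \<bullet> j) * \<beta> (\<phi> x) i j))"
    by (intro sum.cong refl)
      (simp add: dderiv_mult[OF S df[OF sa(1)] df[OF sbc] x u] dderiv_mult[OF S df[OF sa(2)] df[OF sc] x u] dc da)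
  also have "\<dots> = (\<Sum>i\<in>I. \<Sum>j\<in>I. (a x \<bullet> i) * ((b x \<bullet> j) * dderiv (\<lambda>y. \<beta> y i j) (\<phi> x) (dderiv \<phi> x u)))
      + (\<Sum>i\<in>I. \<Sum>j\<in>I. (dderiv a x u \<bullet> i) * ((b x \<bullet> j) * \<beta> (\<phi> x) i j))
      + (\<Sum>i\<in>I. \<Sum>j\<in>I. (a x \<bullet> i) * ((dderiv b x u \<bullet> j) * \<beta> (\<phi> x) i j))"
    by (simp add: sum.distrib distrib_left algebra_simps)
  also have "(\<Sum>i\<in>I. \<Sum>j\<in>I. (dderiv a x u \<bullet> i) * ((b x \<bullet> j) * \<beta> (\<phi> x) i j)) = \<beta> (\<phi> x) (dderiv a x u) (b x)"
    by (rule form_expand[OF I \<phi>x(1) du(2) \<phi>x(3), symmetric])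
  also have "(\<Sum>i\<in>I. \<Sum>j\<in>I. (a x \<bullet> i) * ((dderiv b x u \<bullet> j) * \<beta> (\<phi> x) i j)) = \<beta> (\<phi> x) (a x) (dderiv b x u)"
    by (rule form_expand[OF I \<phi>x(1,2) du(3), symmetric])
  also have "(\<Sum>i\<in>I. \<Sum>j\<in>I. (a x \<bullet> i) * ((b x \<bullet> j) * dderiv (\<lambda>y. \<beta> y i j) (\<phi> x) (dderiv \<phi> x u)))
      = dderiv (\<lambda>y. \<beta> y (a x) (b x)) (\<phi> x) (dderiv \<phi> x u)"
  proof -
    have s: "smooth_on F T (\<lambda>y. \<beta> y i j)" if "i \<in> I" "j \<in> I" for i j using sm that I by auto
    have s1: "smooth_on F T (\<lambda>y. (b x \<bullet> j) * \<beta> y i j)" if "i \<in> I" "j \<in> I" for i j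
      using T by (intro smooth_on_mult[OF T smooth_on_const s] that) auto
    have s2: "smooth_on F T (\<lambda>y. (a x \<bullet> i) * ((b x \<bullet> j) * \<beta> y i j))" if "i \<in> I" "j \<in> I" for i j
      using T by (intro smooth_on_mult[OF T smooth_on_const s1] that) auto
    have s3: "smooth_on F T (\<lambda>y. \<Sum>j\<in>I. (a x \<bullet> i) * ((b x \<bullet> j) * \<beta> y i j))" if "i \<in> I" for i
      by (rule smooth_on_sum[OF T s2[OF that]])
    have c: "(\<lambda>y. c) differentiable_on T" for c :: real by simp
    have "dderiv (\<lambda>y. \<beta> y (a x) (b x)) (\<phi> x) (dderiv \<phi> x u)
      = dderiv (\<lambda>y. \<Sum>i\<in>I. \<Sum>j\<in>I. (a x \<bullet> i) * ((b x \<bullet> j) * \<beta> y i j)) (\<phi> x) (dderiv \<phi> x u)"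
      by (rule dderiv_cong[OF T \<phi>x(1) du(1)]) (rule form_expand[OF I _ \<phi>x(2,3)])
    also have "\<dots> = (\<Sum>i\<in>I. \<Sum>j\<in>I. dderiv (\<lambda>y. (a x \<bullet> i) * ((b x \<bullet> j) * \<beta> y i j)) (\<phi> x) (dderiv \<phi> x u))"
      by (subst dderiv_sum[OF T _ \<phi>x(1) du(1)]) (auto intro!: sum.cong dderiv_sum[OF T _ \<phi>x(1) du(1)] df s3 s2)
    finally show ?thesis by (simp add: dderiv_mult[OF T c df[OF s1] \<phi>x(1) du(1)] dderiv_mult[OF T c df[OF s] \<phi>x(1) du(1)])
  qed
  finally show "dderiv (\<lambda>x. \<beta> (\<phi> x) (a x) (b x)) x u =
      dderiv (\<lambda>y. \<beta> y (a x) (b x)) (\<phi> x) (dderiv \<phi> x u) +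
      \<beta> (\<phi> x) (dderiv a x u) (b x) + \<beta> (\<phi> x) (a x) (dderiv b x u)" .
qed

lemma dderiv_image_subspace: "v \<in> E ==> (\<lambda>x. dderiv \<phi> x v) ` S \<subseteq> F"
  using dderiv_mem_subspace[OF S smooth_on_differentiable[OF \<phi>(1)], of _ v F] T \<phi>(2) rel_open_subset[OF T] by auto

lemma smooth_pullback_linear:
  assumes "v \<in> E" "w \<in> E"
  shows "smooth_on E S (\<lambda>x. \<beta> (\<phi> x) (dderiv \<phi> x v) (dderiv \<phi> x w))"
  by (rule smooth_form_apply[OF smooth_on_dderiv[OF \<phi>(1) assms(1)] dderiv_image_subspace[OF assms(1)]
    smooth_on_dderiv[OF \<phi>(1) assms(2)] dderiv_image_subspace[OF assms(2)]])

text \<open>By the Leibniz rule the terms that differentiate \<open>\<beta>\<close> add up to its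
  exterior derivative on the image vectors. The six terms with second derivatives of
  \<open>\<phi>\<close> cancel in pairs, by symmetry of second derivatives and skew symmetry of
  \<open>\<beta>\<close>.\<close>

lemma closed_pullback_linear:
  assumes cl: "\<And>y u v w. y \<in> T ==> u \<in> F ==> v \<in> F ==> w \<in> F ==>
      ext_d \<beta> y u v w = 0"
    and x: "x \<in> S" and u: "u \<in> E" and v: "v \<in> E" and w: "w \<in> E"
  defines "\<alpha> \<equiv> \<lambda>v w x. \<beta> (\<phi> x) (dderiv \<phi> x v) (dderiv \<phi> x w)"
  shows "dderiv (\<alpha> v w) x u + dderiv (\<alpha> w u) x v + dderiv (\<alpha> u v) x w = 0"
proof -
  let ?d = "\<lambda>v x. dderiv \<phi> x v"
  have F: "subspace F" and \<phi>x: "\<phi> x \<in> T" using T \<phi> x by auto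
  have s: "smooth_on E S (?d v)" "?d v ` S \<subseteq> F" if "v \<in> E" for v
    using smooth_on_dderiv[OF \<phi>(1) that] dderiv_image_subspace[OF that] by blast+
  have D: "dderiv (\<alpha> v w) x u = dderiv (\<lambda>y. \<beta> y (?d v x) (?d w x)) (\<phi> x) (?d u x)
      + \<beta> (\<phi> x) (dderiv (?d v) x u) (?d w x) + \<beta> (\<phi> x) (?d v x) (dderiv (?d w) x u)"
    if "u \<in> E" "v \<in> E" "w \<in> E" for u v w
    unfolding \<alpha>_def by (rule dderiv_form_apply[OF s[OF that(2)] s[OF that(3)] x that(1)])
  have c: "dderiv (?d v) x u = dderiv (?d u) x v" if "u \<in> E" "v \<in> E" for u v by (rule dderiv_commute[OF S \<phi>(1) that(2,1) x])
  have m: "?d v x \<in> F" "dderiv (?d v) x u \<in> F" if "u \<in> E" "v \<in> E" for u v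
    using s(2)[OF that(2)] x dderiv_mem_subspace[OF S smooth_on_differentiable[OF s(1)[OF that(2)]] x that(1) F s(2)[OF that(2)]] by auto
  have as: "\<beta> (\<phi> x) p q = - \<beta> (\<phi> x) q p" if "p \<in> F" "q \<in> F" for p q
    using alternating_bilinear_left(4)[OF ab[OF \<phi>x] F that that(1)] .
  show ?thesis unfolding D[OF u v w] D[OF v w u] D[OF w u v] using cl[OF \<phi>x m(1)[OF u u] m(1)[OF v v] m(1)[OF w w]]
      as[OF m(2)[OF u v] m(1)[OF u w]] as[OF m(2)[OF u w] m(1)[OF u v]] as[OF m(2)[OF v w] m(1)[OF u u]]
    unfolding c[OF v u] c[OF w u] c[OF w v] by simp
qed

end


section \<open>Smooth maps between manifolds\<close>

abbreviation open_in where "open_in M \<equiv> openin (mtopology M)"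
abbreviation img where "img c \<equiv> snd c ` fst c"
abbreviation img_on where "img_on c W \<equiv> snd c ` (fst c \<inter> W)"

text \<open>The separation and countability axioms are split off because the calculus of smooth maps
  is applied to the glued space before these axioms are proved for it, and indeed in order to prove
  them.\<close>

definition premanifold :: "('a, 'e::euclidean_space) mfd => bool" where
  "premanifold M \<longleftrightarrow> subspace (Model M) \<and>
     (\<forall>(U, \<phi>)\<in>Atlas M. inj_on \<phi> U \<and> openin (top_of_set (Model M)) (\<phi> ` U)) \<and>
     (\<forall>c\<in>Atlas M. \<forall>d\<in>Atlas M. charts_compatible (Model M) c d)"

lemma smooth_manifold_iff:
  "smooth_manifold M \<longleftrightarrow>
    premanifold M \<and> Hausdorff_space (mtopology M) \<and> second_countable (mtopology M)"
  by (auto simp: smooth_manifold_def premanifold_def)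

lemma mfd_subspace: "premanifold M ==> subspace (Model M)" by (simp add: premanifold_def)

lemma mfd_chart:
  assumes "premanifold M" "c \<in> Atlas M"
  shows "inj_on (snd c) (fst c)" "rel_open (Model M) (img c)"
  using assms by (auto simp: premanifold_def)

lemma chart_inv_left: "premanifold M ==> c \<in> Atlas M ==> p \<in> fst c ==> chart_inv c (snd c p) = p" by (simp add: chart_inv_def mfd_chart(1))

lemma chart_inv_right:
  "x \<in> img c ==> snd c (chart_inv c x) = x" "x \<in> img c ==> chart_inv c x \<in> fst c"
  by (simp_all add: chart_inv_def f_inv_into_f inv_into_into)

lemma chart_in_points: "c \<in> Atlas M ==> p \<in> fst c ==> p \<in> points M" by (auto simp: points_def)

lemma chart_transition:
  assumes "premanifold M" "c \<in> Atlas M" "d \<in> Atlas M"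
  shows "rel_open (Model M) (snd c ` (fst c \<inter> fst d))"
    "smooth_on (Model M) (snd c ` (fst c \<inter> fst d)) (\<lambda>x. snd d (chart_inv c x))"
  using assms unfolding premanifold_def charts_compatible_def chart_inv_def o_def by auto

lemma rel_open_preimage:
  assumes "rel_open E A" "continuous_on A f" "f ` A \<subseteq> F" "rel_open F T"
  shows "rel_open E (A \<inter> f -` T)"
proof -
  have "openin (top_of_set A) (A \<inter> f -` T)" using assms by (intro continuous_openin_preimage[of A f F]) auto
  then show ?thesis using assms(1) openin_trans by blast
qed

lemma mfd_openin:
  assumes "premanifold M"
  shows "open_in M S \<longleftrightarrow> S \<subseteq> points M \<and>
     (\<forall>c\<in>Atlas M. openin (top_of_set (Model M)) (snd c ` (S \<inter> fst c)))"
proof -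
  have "open_in M S \<longleftrightarrow> S \<subseteq> points M \<and>
           (\<forall>(U, \<phi>)\<in>Atlas M. openin (top_of_set (Model M)) (\<phi> ` (S \<inter> U)))"
    by (rule openin_mtopology) (use assms in \<open>auto simp: premanifold_def\<close>)
  then show ?thesis by (simp add: case_prod_unfold)
qed

lemma rel_open_chart_image:
  assumes "premanifold M" "open_in M W" "c \<in> Atlas M"
  shows "rel_open (Model M) (img_on c W)"
  using assms mfd_openin[OF assms(1), of W] by (auto simp: Int_commute mfd_subspace)

lemma openin_points: "premanifold M ==> open_in M (points M)" unfolding mfd_openin
proof (intro conjI ballI subset_refl)
  fix c assume "premanifold M" "c \<in> Atlas M"
  moreover have "points M \<inter> fst c = fst c" using \<open>c \<in> Atlas M\<close> by (auto simp: points_def)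
  ultimately show "openin (top_of_set (Model M)) (snd c ` (points M \<inter> fst c))" using mfd_chart(2)[of M c] by simp
qed

lemma topspace_mtopology: "premanifold M ==> topspace (mtopology M) = points M"
  using openin_subset[OF openin_points] mfd_openin[of M "topspace (mtopology M)"] by auto

lemma openin_chart_inv_image:
  assumes M: "premanifold M" and c: "c \<in> Atlas M" and T: "rel_open (Model M) T" "T \<subseteq> img c"
  shows "open_in M (chart_inv c ` T)"
  unfolding mfd_openin[OF M]
proof (intro conjI ballI)
  show "chart_inv c ` T \<subseteq> points M" by (auto intro!: chart_in_points[OF c] chart_inv_right(2) simp: subsetD[OF T(2)])
  fix d assume d: "d \<in> Atlas M"
  let ?A = "snd d ` (fst d \<inter> fst c)" and ?f = "\<lambda>x. snd c (chart_inv d x)"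
  note tr = chart_transition[OF M d c]
  have "?f ` ?A \<subseteq> Model M" using rel_open_subset[OF mfd_chart(2)[OF M c]] chart_inv_left[OF M d] by auto
  from rel_open_preimage[OF tr(1) smooth_on_continuous[OF tr(2)] this T(1)]
  have "rel_open (Model M) (?A \<inter> ?f -` T)" .
  moreover have "snd d ` (chart_inv c ` T \<inter> fst d) = ?A \<inter> ?f -` T"
  proof (intro equalityI subsetI)
    fix y assume "y \<in> snd d ` (chart_inv c ` T \<inter> fst d)"
    then obtain x where x: "x \<in> T" "chart_inv c x \<in> fst d" "y = snd d (chart_inv c x)" by auto
    then show "y \<in> ?A \<inter> ?f -` T" using T(2) chart_inv_right[of x c] chart_inv_left[OF M d] by auto
  next
    fix y assume "y \<in> ?A \<inter> ?f -` T"
    then obtain p where p: "p \<in> fst d" "p \<in> fst c" "y = snd d p" "snd c p \<in> T" using chart_inv_left[OF M d] by auto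
    then show "y \<in> snd d ` (chart_inv c ` T \<inter> fst d)" using chart_inv_left[OF M c p(2)] by (metis IntI image_eqI)
  qed
  ultimately show "openin (top_of_set (Model M)) (snd d ` (chart_inv c ` T \<inter> fst d))" by simp
qed

lemma openin_chart_domain: "premanifold M ==> c \<in> Atlas M ==> open_in M (fst c)"
proof -
  assume M: "premanifold M" and c: "c \<in> Atlas M"
  have "chart_inv c ` (img c) = fst c" using chart_inv_left[OF M c] by (auto simp: image_image)
  then show ?thesis using openin_chart_inv_image[OF M c mfd_chart(2)[OF M c]] by simp
qed

text \<open>One suitable pair of charts is demanded; \<open>smooth_at_charts\<close> shows that
  every pair then works. Continuity at the point is built in through the open set \<open>T\<close>,
  and the pointwise form handles maps that are smooth only on a part of \<open>M\<close>.\<close>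

definition smooth_at ::
  "('a, 'e::euclidean_space) mfd => ('b, 'f::euclidean_space) mfd => ('a => 'b) => 'a => bool" where
  "smooth_at M N f p \<longleftrightarrow> (\<exists>c\<in>Atlas M. \<exists>d\<in>Atlas N. \<exists>T. p \<in> fst c \<and> rel_open (Model M) T \<and> snd c p \<in> T \<and>
     T \<subseteq> img c \<and> (\<forall>x\<in>T. f (chart_inv c x) \<in> fst d) \<and>
     smooth_on (Model M) T (\<lambda>x. snd d (f (chart_inv c x))))"

abbreviation smooth_vec where "smooth_vec M \<equiv> smooth_at M (flat UNIV)"
abbreviation dmap where "dmap M \<equiv> tmap M (flat UNIV)"

lemma smooth_at_in_chart:
  assumes "smooth_at M N f p" "premanifold M"
  obtains d where "d \<in> Atlas N" "f p \<in> fst d"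
  using assms unfolding smooth_at_def by (metis chart_inv_left)

lemma smooth_at_points: "smooth_at M N f p ==> premanifold M ==> p \<in> points M \<and> f p \<in> points N"
  by (metis smooth_at_def chart_in_points smooth_at_in_chart)

text \<open>The known coordinate expression is composed with two transition maps. The domain shrinks
  twice: to \<open>T1\<close>, where the source transition lands in the known domain, and to
  \<open>T2\<close>, where the values lie in the overlap of the target charts.\<close>

lemma smooth_at_charts:
  assumes M: "premanifold M" and N: "premanifold N" and f: "smooth_at M N f p"
    and c: "c \<in> Atlas M" "p \<in> fst c" and d: "d \<in> Atlas N" "f p \<in> fst d"
  obtains T where "rel_open (Model M) T" "snd c p \<in> T" "T \<subseteq> img c"
    "\<And>x. x \<in> T ==> f (chart_inv c x) \<in> fst d" "smooth_on (Model M) T (\<lambda>x. snd d (f (chart_inv c x)))"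
proof -
  obtain c0 d0 T0 where 0: "c0 \<in> Atlas M" "d0 \<in> Atlas N" "p \<in> fst c0" "rel_open (Model M) T0"
    "snd c0 p \<in> T0" "T0 \<subseteq> img c0" "\<And>x. x \<in> T0 ==> f (chart_inv c0 x) \<in> fst d0"
    "smooth_on (Model M) T0 (\<lambda>x. snd d0 (f (chart_inv c0 x)))"
    using f unfolding smooth_at_def by blast
  let ?A = "snd c ` (fst c \<inter> fst c0)" and ?\<tau> = "\<lambda>x. snd c0 (chart_inv c x)"
  note tr = chart_transition[OF M c(1) 0(1)]
  have \<tau>E: "?\<tau> ` ?A \<subseteq> Model M" using rel_open_subset[OF mfd_chart(2)[OF M 0(1)]] chart_inv_left[OF M c(1)] by auto
  define T1 where "T1 = ?A \<inter> ?\<tau> -` T0"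
  have T1: "rel_open (Model M) T1" unfolding T1_def by (rule rel_open_preimage[OF tr(1) smooth_on_continuous[OF tr(2)] \<tau>E 0(4)])
  have T1e: "chart_inv c0 (?\<tau> x) = chart_inv c x" "chart_inv c x \<in> fst c \<inter> fst c0" "?\<tau> x \<in> T0" if "x \<in> T1" for x
    using that chart_inv_left[OF M c(1)] chart_inv_left[OF M 0(1)] by (auto simp: T1_def)
  let ?g = "\<lambda>x. snd d0 (f (chart_inv c x))"
  have \<tau>s: "smooth_on (Model M) T1 ?\<tau>" by (rule smooth_on_subset[OF tr(2)]) (auto simp: T1_def)
  have "smooth_on (Model M) T1 (\<lambda>x. snd d0 (f (chart_inv c0 (?\<tau> x))))"
    by (rule smooth_on_compose[OF T1 0(4) _ \<tau>s 0(8)]) (use T1e in auto)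
  then have gs: "smooth_on (Model M) T1 ?g" by (rule smooth_on_cong[OF T1]) (simp add: T1e)
  have fd0: "f (chart_inv c x) \<in> fst d0" if "x \<in> T1" for x using 0(7)[OF T1e(3)[OF that]] T1e(1)[OF that] by simp
  let ?B = "snd d0 ` (fst d0 \<inter> fst d)"
  note tr' = chart_transition[OF N 0(2) d(1)]
  define T2 where "T2 = T1 \<inter> ?g -` ?B"
  have "?g ` T1 \<subseteq> Model N" using rel_open_subset[OF mfd_chart(2)[OF N 0(2)]] fd0 by auto
  then have T2: "rel_open (Model M) T2" unfolding T2_def by (rule rel_open_preimage[OF T1 smooth_on_continuous[OF gs] _ tr'(1)])
  have fd: "f (chart_inv c x) \<in> fst d" if x: "x \<in> T2" for x
  proof -
    obtain q where "q \<in> fst d0 \<inter> fst d" "?g x = snd d0 q" using x by (auto simp: T2_def)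
    then have "f (chart_inv c x) = q" using mfd_chart(1)[OF N 0(2)] fd0[of x] x unfolding T2_def by (auto dest: inj_onD)
    then show ?thesis using \<open>q \<in> fst d0 \<inter> fst d\<close> by simp
  qed
  have gs2: "smooth_on (Model M) T2 ?g" by (rule smooth_on_subset[OF gs]) (auto simp: T2_def)
  have "smooth_on (Model M) T2 (\<lambda>x. snd d (chart_inv d0 (?g x)))" by (rule smooth_on_compose[OF T2 tr'(1) _ gs2 tr'(2)]) (auto simp: T2_def)
  then have s: "smooth_on (Model M) T2 (\<lambda>x. snd d (f (chart_inv c x)))"
    by (rule smooth_on_cong[OF T2]) (auto simp: T2_def fd0 chart_inv_left[OF N 0(2)])
  have p1: "snd c p \<in> T1" using c 0 chart_inv_left[OF M c] by (auto simp: T1_def)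
  then have "f p \<in> fst d0" using fd0[of "snd c p"] chart_inv_left[OF M c] by simp
  then have "snd c p \<in> T2" using p1 d chart_inv_left[OF M c] by (auto simp: T2_def)
  moreover have "T2 \<subseteq> img c" by (auto simp: T2_def T1_def)
  ultimately show ?thesis using that T2 fd s by blast
qed

lemma smooth_atI:
  assumes "c \<in> Atlas M" "d \<in> Atlas N" "p \<in> fst c" "rel_open (Model M) T" "snd c p \<in> T"
    "T \<subseteq> img c" "\<And>x. x \<in> T ==> f (chart_inv c x) \<in> fst d"
    "smooth_on (Model M) T (\<lambda>x. snd d (f (chart_inv c x)))"
  shows "smooth_at M N f p"
  using assms unfolding smooth_at_def by blast

lemma smooth_at_cong:
  assumes M: "premanifold M" and f: "smooth_at M N f p" and S: "open_in M S" "p \<in> S"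
    and eq: "\<And>q. q \<in> S ==> g q = f q"
  shows "smooth_at M N g p"
proof -
  obtain c d T where 0: "c \<in> Atlas M" "d \<in> Atlas N" "p \<in> fst c" "rel_open (Model M) T"
    "snd c p \<in> T" "T \<subseteq> img c" "\<And>x. x \<in> T ==> f (chart_inv c x) \<in> fst d"
    "smooth_on (Model M) T (\<lambda>x. snd d (f (chart_inv c x)))"
    using f unfolding smooth_at_def by blast
  let ?T = "T \<inter> img_on c S"
  have T: "rel_open (Model M) ?T" by (rule rel_open_Int[OF 0(4) rel_open_chart_image[OF M S(1) 0(1)]])
  have e: "g (chart_inv c x) = f (chart_inv c x)" if "x \<in> ?T" for x using that eq chart_inv_left[OF M 0(1)] by auto
  show ?thesis
  proof (rule smooth_atI[OF 0(1-3) T])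
    show "smooth_on (Model M) ?T (\<lambda>x. snd d (g (chart_inv c x)))" by (rule smooth_on_cong[OF T smooth_on_subset[OF 0(8)]]) (use e in auto)
  qed (use 0 S e in auto)
qed

lemma smooth_at_compose:
  assumes M: "premanifold M" and N: "premanifold N" and K: "premanifold K"
    and f: "smooth_at M N f p" and g: "smooth_at N K g (f p)"
  shows "smooth_at M K (\<lambda>q. g (f q)) p"
proof -
  obtain c d T where 0: "c \<in> Atlas M" "d \<in> Atlas N" "p \<in> fst c" "rel_open (Model M) T"
    "snd c p \<in> T" "T \<subseteq> img c" "\<And>x. x \<in> T ==> f (chart_inv c x) \<in> fst d"
    "smooth_on (Model M) T (\<lambda>x. snd d (f (chart_inv c x)))"
    using f unfolding smooth_at_def by blast
  have fp: "f p \<in> fst d" using 0 chart_inv_left[OF M] by metis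
  obtain e where e: "e \<in> Atlas K" "g (f p) \<in> fst e" using smooth_at_in_chart[OF g N] by blast
  obtain T' where T': "rel_open (Model N) T'" "snd d (f p) \<in> T'" "T' \<subseteq> img d"
    "\<And>x. x \<in> T' ==> g (chart_inv d x) \<in> fst e" "smooth_on (Model N) T' (\<lambda>x. snd e (g (chart_inv d x)))"
    using smooth_at_charts[OF N K g 0(2) fp e] by blast
  let ?F = "\<lambda>x. snd d (f (chart_inv c x))"
  let ?T = "T \<inter> ?F -` T'"
  have "?F ` T \<subseteq> Model N" using 0(7) rel_open_subset[OF mfd_chart(2)[OF N 0(2)]] by auto
  from rel_open_preimage[OF 0(4) smooth_on_continuous[OF 0(8)] this T'(1)]
  have T: "rel_open (Model M) ?T" .
  have eq: "chart_inv d (?F x) = f (chart_inv c x)" if "x \<in> T" for x using chart_inv_left[OF N 0(2) 0(7)[OF that]] .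
  show ?thesis
  proof (rule smooth_atI[OF 0(1) e(1) 0(3) T])
    show "snd c p \<in> ?T" using 0(3,5) T'(2) chart_inv_left[OF M 0(1)] by simp
    show "?T \<subseteq> img c" using 0(6) by auto
    show "g (f (chart_inv c x)) \<in> fst e" if "x \<in> ?T" for x using T'(4)[of "?F x"] eq[of x] that by simp
    have "smooth_on (Model M) ?T (\<lambda>x. snd e (g (chart_inv d (?F x))))"
      by (rule smooth_on_compose[OF T T'(1) _ smooth_on_subset[OF 0(8)] T'(5)]) auto
    then show "smooth_on (Model M) ?T (\<lambda>x. snd e (g (f (chart_inv c x))))" by (rule smooth_on_cong[OF T]) (simp add: eq)
  qed
qed

text \<open>Translates between the pointwise notion and the definition by all pairs of atlas charts.
  The latter enters through the hypotheses, the transition maps of the gluing and the final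
  structures.\<close>

lemma smooth_map_on_iff:
  assumes M: "premanifold M" and N: "premanifold N"
  shows "smooth_map_on M W N f \<longleftrightarrow> open_in M W \<and> (\<forall>p\<in>W. smooth_at M N f p)"
proof (intro iffI conjI ballI)
  assume s: "smooth_map_on M W N f"
  then show W: "open_in M W" by (simp add: smooth_map_on_def)
  fix p assume p: "p \<in> W"
  then have "p \<in> points M" "f p \<in> points N" using s W openin_subset topspace_mtopology[OF M] by (auto simp: smooth_map_on_def)
  then obtain c d where c: "c \<in> Atlas M" "p \<in> fst c" and d: "d \<in> Atlas N" "f p \<in> fst d" by (auto simp: points_def)
  let ?T = "snd c ` (fst c \<inter> W \<inter> f -` fst d)"
  have T: "openin (top_of_set (Model M)) ?T" "smooth_on (Model M) ?T (snd d \<circ> f \<circ> inv_into (fst c) (snd c))"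
    using s c d unfolding smooth_map_on_def by (auto simp: case_prod_unfold)
  show "smooth_at M N f p" by (rule smooth_atI[OF c(1) d(1) c(2), of ?T])
      (use T c d p mfd_subspace[OF M] chart_inv_left[OF M c(1)] in \<open>auto simp: o_def chart_inv_def\<close>)
next
  assume a: "open_in M W \<and> (\<forall>p\<in>W. smooth_at M N f p)"
  show "smooth_map_on M W N f" unfolding smooth_map_on_def case_prod_unfold
  proof (intro conjI ballI)
    show W: "open_in M W" using a by simp
    show "f ` W \<subseteq> points N" using a smooth_at_points[OF _ M] by blast
    fix c d assume c: "c \<in> Atlas M" and d: "d \<in> Atlas N"
    let ?S = "snd c ` (fst c \<inter> W \<inter> f -` fst d)"
    have *: "\<exists>T. rel_open (Model M) T \<and> x \<in> T \<and> T \<subseteq> ?S \<and>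
        smooth_on (Model M) T (snd d \<circ> f \<circ> inv_into (fst c) (snd c))" if x: "x \<in> ?S" for x
    proof -
      obtain p where p: "p \<in> fst c" "p \<in> W" "f p \<in> fst d" "x = snd c p" using x by auto
      have fs: "smooth_at M N f p" using a p(2) by blast
      obtain T where T: "rel_open (Model M) T" "snd c p \<in> T" "T \<subseteq> img c"
        "\<And>x. x \<in> T ==> f (chart_inv c x) \<in> fst d" "smooth_on (Model M) T (\<lambda>x. snd d (f (chart_inv c x)))"
        using smooth_at_charts[OF M N fs c p(1) d p(3)] by blast
      let ?T = "T \<inter> img_on c W"
      have "?T \<subseteq> ?S"
      proof
        fix y assume y: "y \<in> ?T"
        then obtain q where q: "q \<in> fst c" "q \<in> W" "y = snd c q" by auto
        then have "f q \<in> fst d" using T(4)[of y] y chart_inv_left[OF M c] by simp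
        then show "y \<in> ?S" using q by auto
      qed
      moreover have "rel_open (Model M) ?T" by (rule rel_open_Int[OF T(1) rel_open_chart_image[OF M W c]])
      moreover have "smooth_on (Model M) ?T (snd d \<circ> f \<circ> inv_into (fst c) (snd c))"
        using smooth_on_subset[OF T(5), of ?T] by (simp add: o_def chart_inv_def)
      ultimately show ?thesis using T(2) p by blast
    qed
    then show 1: "openin (top_of_set (Model M)) ?S" by (subst openin_subopen) blast
    show "smooth_on (Model M) ?S (snd d \<circ> f \<circ> inv_into (fst c) (snd c))" by (rule smooth_on_local) (use 1 mfd_subspace[OF M] * in blast)+
  qed
qed

lemma smooth_at_openin_preimage:
  assumes M: "premanifold M" and N: "premanifold N" and W: "open_in M W"
    and f: "\<And>p. p \<in> W ==> smooth_at M N f p" and V: "open_in N V"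
  shows "open_in M (W \<inter> f -` V)"
proof (subst openin_subopen, intro ballI)
  fix p assume p: "p \<in> W \<inter> f -` V"
  obtain c d T where 0: "c \<in> Atlas M" "d \<in> Atlas N" "p \<in> fst c" "rel_open (Model M) T"
    "snd c p \<in> T" "T \<subseteq> img c" "\<And>x. x \<in> T ==> f (chart_inv c x) \<in> fst d"
    "smooth_on (Model M) T (\<lambda>x. snd d (f (chart_inv c x)))"
    using f p unfolding smooth_at_def by blast
  let ?F = "\<lambda>x. snd d (f (chart_inv c x))" and ?V = "img_on d V"
  define T' where "T' = (T \<inter> ?F -` ?V) \<inter> img_on c W"
  have "?F ` T \<subseteq> Model N" using 0(7) rel_open_subset[OF mfd_chart(2)[OF N 0(2)]] by auto
  from rel_open_preimage[OF 0(4) smooth_on_continuous[OF 0(8)] this rel_open_chart_image[OF N V 0(2)]]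
  have T': "rel_open (Model M) T'" unfolding T'_def by (rule rel_open_Int[OF _ rel_open_chart_image[OF M W 0(1)]])
  have fp: "f p \<in> fst d" using 0(7)[OF 0(5)] chart_inv_left[OF M 0(1,3)] by simp
  have "chart_inv c x \<in> W \<inter> f -` V" if x: "x \<in> T'" for x
  proof -
    obtain q where "q \<in> fst d \<inter> V" "snd d (f (chart_inv c x)) = snd d q" using x by (auto simp: T'_def)
    moreover have "f (chart_inv c x) \<in> fst d" using 0(7) x by (auto simp: T'_def)
    ultimately have "f (chart_inv c x) \<in> V" using inj_onD[OF mfd_chart(1)[OF N 0(2)]] by blast
    moreover have "chart_inv c x \<in> W" using x chart_inv_left[OF M 0(1)] by (auto simp: T'_def)
    ultimately show ?thesis by simp
  qed
  moreover have "p \<in> chart_inv c ` T'" using p 0(3,5) fp chart_inv_left[OF M 0(1,3)] by (intro image_eqI[of _ _ "snd c p"]) (auto simp: T'_def)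
  moreover have "open_in M (chart_inv c ` T')" using T' 0(6) by (intro openin_chart_inv_image[OF M 0(1)]) (auto simp: T'_def)
  ultimately show "\<exists>T. open_in M T \<and> p \<in> T \<and> T \<subseteq> W \<inter> f -` V" by blast
qed

subsection \<open>Products and linear spaces\<close>

lemma smooth_at_id: "premanifold M ==> p \<in> points M ==> smooth_at M M (\<lambda>q. q) p"
proof -
  assume M: "premanifold M" and "p \<in> points M"
  then obtain c where c: "c \<in> Atlas M" "p \<in> fst c" by (auto simp: points_def)
  have T: "rel_open (Model M) (img c)" by (rule mfd_chart(2)[OF M c(1)])
  show ?thesis
  proof (rule smooth_atI[OF c(1) c(1) c(2) T])
    show "smooth_on (Model M) (img c) (\<lambda>x. snd c (chart_inv c x))"
      by (rule smooth_on_cong[OF T smooth_on_linear[OF T bounded_linear_ident]]) (simp add: chart_inv_right)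
  qed (use c chart_inv_left[OF M c(1)] in auto)
qed

lemma smooth_at_const: "premanifold M ==> p \<in> points M ==> r \<in> points N ==> smooth_at M N (\<lambda>q. r) p"
proof -
  assume M: "premanifold M" and "p \<in> points M" "r \<in> points N"
  then obtain c d where c: "c \<in> Atlas M" "p \<in> fst c" "d \<in> Atlas N" "r \<in> fst d" by (auto simp: points_def)
  show ?thesis by (rule smooth_atI[OF c(1,3,2) mfd_chart(2)[OF M c(1)]])
      (use c M in \<open>auto intro: smooth_on_const mfd_subspace\<close>)
qed

lemma flat_simps [simp]: "Model (flat E) = E" "Atlas (flat E) = {(E, \<lambda>x. x)}" "points (flat E) = E" by (simp_all add: flat_def points_def)

lemma chart_inv_flat: "x \<in> E ==> chart_inv (E, \<lambda>x. x) x = x" by (metis chart_inv_def fst_conv snd_conv f_inv_into_f image_ident)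

lemma mfd_flat: "subspace E ==> premanifold (flat E)"
proof -
  assume E: "subspace E"
  have "smooth_on E E (inv_into E (\<lambda>x. x))" by (rule smooth_on_cong[of E E "\<lambda>x. x"])
      (use E smooth_on_linear[of E E "\<lambda>x. x"] chart_inv_flat[of _ E] in \<open>auto simp: chart_inv_def bounded_linear_ident\<close>)
  then show ?thesis using E by (simp add: premanifold_def charts_compatible_def o_def)
qed

lemma mfd_vec [simp]: "premanifold (flat UNIV)" by (simp add: mfd_flat)

lemma smooth_at_flat:
  assumes "rel_open E T" "x \<in> T" "smooth_on E T f" "f ` T \<subseteq> F"
  shows "smooth_at (flat E) (flat F) f x"
proof -
  have TE: "T \<subseteq> E" using assms rel_open_subset by blast
  have e: "chart_inv (E, \<lambda>x. x) y = y" if "y \<in> T" for y by (rule chart_inv_flat) (use that TE in blast)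
  show ?thesis by (rule smooth_atI[of "(E, \<lambda>x. x)" _ "(F, \<lambda>x. x)" _ _ T])
      (use assms TE e in \<open>auto intro!: smooth_on_cong[OF assms(1,3)]\<close>)
qed

lemma smooth_at_flatD:
  assumes M: "premanifold M" and F: "subspace F" and f: "smooth_at M (flat F) f p" and c: "c \<in> Atlas M" "p \<in> fst c"
  obtains T where "rel_open (Model M) T" "snd c p \<in> T" "T \<subseteq> img c"
    "\<And>x. x \<in> T ==> f (chart_inv c x) \<in> F" "smooth_on (Model M) T (\<lambda>x. f (chart_inv c x))"
proof -
  have "f p \<in> F" using smooth_at_points[OF f M] by simp
  then show ?thesis using smooth_at_charts[OF M mfd_flat[OF F] f c, of "(F, \<lambda>x. x)"] that by auto
qed

lemma smooth_at_flatI: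
  assumes "c \<in> Atlas M" "p \<in> fst c" "rel_open (Model M) T" "snd c p \<in> T" "T \<subseteq> img c"
    "\<And>x. x \<in> T ==> f (chart_inv c x) \<in> F" "smooth_on (Model M) T (\<lambda>x. f (chart_inv c x))"
  shows "smooth_at M (flat F) f p"
  by (rule smooth_atI[of c _ "(F, \<lambda>x. x)" _ _ T]) (use assms in auto)

lemma smooth_at_chart:
  assumes M: "premanifold M" and c: "c \<in> Atlas M" "p \<in> fst c"
  shows "smooth_at M (flat (Model M)) (snd c) p"
proof -
  have T: "rel_open (Model M) (img c)" by (rule mfd_chart(2)[OF M c(1)])
  show ?thesis by (rule smooth_at_flatI[OF c T])
      (use c rel_open_subset[OF T] chart_inv_right[of _ c] in
       \<open>auto intro!: smooth_on_cong[OF T smooth_on_linear[OF T bounded_linear_ident]]\<close>)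
qed

lemma smooth_at_chart_inv:
  assumes M: "premanifold M" and c: "c \<in> Atlas M" and x: "x \<in> img c"
  shows "smooth_at (flat (Model M)) M (chart_inv c) x"
proof -
  have T: "rel_open (Model M) (img c)" by (rule mfd_chart(2)[OF M c])
  have e: "chart_inv (Model M, \<lambda>x. x) y = y" if "y \<in> img c" for y by (rule chart_inv_flat) (use that rel_open_subset[OF T] in blast)
  show ?thesis
  proof (rule smooth_atI[of "(Model M, \<lambda>x. x)" _ c _ _ "img c"])
    show "smooth_on (Model (flat (Model M))) (img c) (\<lambda>x. snd c (chart_inv c (chart_inv (Model M, \<lambda>x. x) x)))" unfolding flat_simps
      by (rule smooth_on_cong[OF T smooth_on_linear[OF T bounded_linear_ident]]) (simp add: chart_inv_right e)
  qed (use c x T e rel_open_subset[OF T] chart_inv_right[of _ c] in auto)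
qed

lemma smooth_at_bilinear:
  assumes M: "premanifold M" and "bounded_bilinear h" "smooth_vec M f p" "smooth_vec M g p"
  shows "smooth_vec M (\<lambda>q. h (f q) (g q)) p"
proof -
  obtain c where c: "c \<in> Atlas M" "p \<in> fst c" using smooth_at_points[OF assms(3) M] by (auto simp: points_def)
  obtain T where T: "rel_open (Model M) T" "snd c p \<in> T" "T \<subseteq> img c" "smooth_on (Model M) T (\<lambda>x. f (chart_inv c x))"
    by (rule smooth_at_flatD[OF M subspace_UNIV assms(3) c]) blast
  obtain T' where T': "rel_open (Model M) T'" "snd c p \<in> T'" "smooth_on (Model M) T' (\<lambda>x. g (chart_inv c x))"
    by (rule smooth_at_flatD[OF M subspace_UNIV assms(4) c]) blast
  note TT = rel_open_Int[OF T(1) T'(1)]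
  show ?thesis by (rule smooth_at_flatI[OF c TT])
      (use T T' in \<open>auto intro!: smooth_on_bilinear[OF TT assms(2) smooth_on_subset[OF T(4)] smooth_on_subset[OF T'(3)]]\<close>)
qed

definition prod_chart :: "('a, 'e) chart => ('b, 'f) chart => ('a \<times> 'b, 'e \<times> 'f) chart" where
  "prod_chart c d = (fst c \<times> fst d, map_prod (snd c) (snd d))"

lemma Atlas_prod_mfd: "Atlas (prod_mfd M N) = {prod_chart c d | c d. c \<in> Atlas M \<and> d \<in> Atlas N}"
  by (simp add: prod_mfd_def prod_chart_def)

lemma prod_chart_Atlas: "c \<in> Atlas M ==> d \<in> Atlas N ==> prod_chart c d \<in> Atlas (prod_mfd M N)" unfolding Atlas_prod_mfd by blast

lemma prod_mfd_simps [simp]: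
  "Model (prod_mfd M N) = Model M \<times> Model N"
  "points (prod_mfd M N) = points M \<times> points N"
proof -
  show "points (prod_mfd M N) = points M \<times> points N"
  proof (intro equalityI subsetI)
    fix p assume "p \<in> points M \<times> points N"
    then obtain c d where cd: "c \<in> Atlas M" "d \<in> Atlas N" "p \<in> fst c \<times> fst d" by (auto simp: points_def)
    then have "p \<in> fst (prod_chart c d)" by (simp add: prod_chart_def)
    then show "p \<in> points (prod_mfd M N)" by (rule chart_in_points[OF prod_chart_Atlas[OF cd(1,2)]])
  qed (auto simp: points_def prod_mfd_def)
qed (simp add: prod_mfd_def)

lemma prod_chart_simps [simp]:
  "fst (prod_chart c d) = fst c \<times> fst d" "snd (prod_chart c d) (p, q) = (snd c p, snd d q)"
  "snd (prod_chart c d) ` (A \<times> B) = snd c ` A \<times> snd d ` B"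
  by (auto simp: prod_chart_def map_prod_def)

lemma chart_inv_prod_chart:
  assumes "inj_on (snd c) (fst c)" "inj_on (snd d) (fst d)" "x \<in> img c" "y \<in> img d"
  shows "chart_inv (prod_chart c d) (x, y) = (chart_inv c x, chart_inv d y)"
proof -
  have "inj_on (snd (prod_chart c d)) (fst (prod_chart c d))" using assms(1,2) by (auto simp: inj_on_def)
  moreover have "(chart_inv c x, chart_inv d y) \<in> fst (prod_chart c d)"
    using chart_inv_right(2)[OF assms(3)] chart_inv_right(2)[OF assms(4)] by simp
  moreover have "snd (prod_chart c d) (chart_inv c x, chart_inv d y) = (x, y)"
    using chart_inv_right(1)[of x c] chart_inv_right(1)[of y d] assms by simp
  ultimately show ?thesis unfolding chart_inv_def by (metis inv_into_f_f)
qed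

lemma rel_open_Times: "rel_open E S ==> rel_open F T ==> rel_open (E \<times> F) (S \<times> T)" by (simp add: subspace_Times openin_Times)

lemma mfd_prod:
  assumes M: "premanifold M" and N: "premanifold N"
  shows "premanifold (prod_mfd M N)"
  unfolding premanifold_def
proof (intro conjI ballI)
  show "subspace (Model (prod_mfd M N))" using M N by (simp add: subspace_Times mfd_subspace)
  fix c assume "c \<in> Atlas (prod_mfd M N)"
  then obtain c1 c2 where c: "c1 \<in> Atlas M" "c2 \<in> Atlas N" "c = prod_chart c1 c2" by (auto simp: Atlas_prod_mfd)
  note i = mfd_chart[OF M c(1)] mfd_chart[OF N c(2)]
  show "case c of (U, \<phi>) => inj_on \<phi> U \<and> openin (top_of_set (Model (prod_mfd M N))) (\<phi> ` U)"
    using rel_open_Times[OF i(2,4)] i(1,3) by (auto simp: case_prod_unfold c inj_on_def)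
  fix d assume "d \<in> Atlas (prod_mfd M N)"
  then obtain d1 d2 where d: "d1 \<in> Atlas M" "d2 \<in> Atlas N" "d = prod_chart d1 d2" by (auto simp: Atlas_prod_mfd)
  note t1 = chart_transition[OF M c(1) d(1)] and t2 = chart_transition[OF N c(2) d(2)]
  let ?A = "snd c1 ` (fst c1 \<inter> fst d1)" and ?B = "snd c2 ` (fst c2 \<inter> fst d2)"
  note AB = rel_open_Times[OF t1(1) t2(1)]
  have im: "snd c ` (fst c \<inter> fst d) = ?A \<times> ?B" unfolding c(3) d(3) prod_chart_simps by (simp add: Times_Int_Times)
  have "smooth_on (Model M \<times> Model N) (?A \<times> ?B) (\<lambda>z. (snd d1 (chart_inv c1 (fst z)), snd d2 (chart_inv c2 (snd z))))"
    by (intro smooth_on_Pair[OF AB] smooth_on_compose[OF AB t1(1) _ smooth_on_linear[OF AB bounded_linear_fst] t1(2)]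
        smooth_on_compose[OF AB t2(1) _ smooth_on_linear[OF AB bounded_linear_snd] t2(2)]) auto
  then have "smooth_on (Model M \<times> Model N) (?A \<times> ?B) (snd d \<circ> inv_into (fst c) (snd c))"
  proof (rule smooth_on_cong[OF AB])
    fix z assume "z \<in> ?A \<times> ?B"
    then have "chart_inv c z = (chart_inv c1 (fst z), chart_inv c2 (snd z))" using chart_inv_prod_chart[OF i(1,3), of "fst z" "snd z"] c(3) by auto
    then show "(snd d \<circ> inv_into (fst c) (snd c)) z = (snd d1 (chart_inv c1 (fst z)), snd d2 (chart_inv c2 (snd z)))"
      by (simp add: d(3) chart_inv_def)
  qed
  then show "charts_compatible (Model (prod_mfd M N)) c d" unfolding charts_compatible_def im prod_mfd_simps using AB by blast
qed

lemma smooth_at_Pair: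
  assumes M: "premanifold M" and N: "premanifold N" and K: "premanifold K"
    and f: "smooth_at M N f p" and g: "smooth_at M K g p"
  shows "smooth_at M (prod_mfd N K) (\<lambda>q. (f q, g q)) p"
proof -
  obtain c d T where 0: "c \<in> Atlas M" "d \<in> Atlas N" "p \<in> fst c" "rel_open (Model M) T"
    "snd c p \<in> T" "T \<subseteq> img c" "\<And>x. x \<in> T ==> f (chart_inv c x) \<in> fst d"
    "smooth_on (Model M) T (\<lambda>x. snd d (f (chart_inv c x)))"
    using f unfolding smooth_at_def by blast
  obtain e where e: "e \<in> Atlas K" "g p \<in> fst e" using smooth_at_in_chart[OF g M] by blast
  obtain T' where T': "rel_open (Model M) T'" "snd c p \<in> T'" "T' \<subseteq> img c"
    "\<And>x. x \<in> T' ==> g (chart_inv c x) \<in> fst e" "smooth_on (Model M) T' (\<lambda>x. snd e (g (chart_inv c x)))"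
    using smooth_at_charts[OF M K g 0(1,3) e] by blast
  note TT = rel_open_Int[OF 0(4) T'(1)]
  show ?thesis
  proof (rule smooth_atI[of c _ "prod_chart d e" _ _ "T \<inter> T'"])
    show "smooth_on (Model M) (T \<inter> T') (\<lambda>x. snd (prod_chart d e) (f (chart_inv c x), g (chart_inv c x)))" unfolding prod_chart_simps
      by (rule smooth_on_Pair[OF TT smooth_on_subset[OF 0(8)] smooth_on_subset[OF T'(5)]]) auto
  qed (use 0 e T' TT in \<open>auto intro!: prod_chart_Atlas\<close>)
qed

lemma smooth_at_fst_snd:
  assumes M: "premanifold M" and N: "premanifold N" and p: "p \<in> points M \<times> points N"
  shows "smooth_at (prod_mfd M N) M fst p" "smooth_at (prod_mfd M N) N snd p"
proof -
  obtain c d where c: "c \<in> Atlas M" "fst p \<in> fst c" and d: "d \<in> Atlas N" "snd p \<in> fst d" using p by (auto simp: points_def)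
  have a: "prod_chart c d \<in> Atlas (prod_mfd M N)" "p \<in> fst (prod_chart c d)" using c d by (auto intro!: prod_chart_Atlas simp: mem_Times_iff)
  note i = mfd_chart[OF M c(1)] mfd_chart[OF N d(1)]
  note T = rel_open_Times[OF i(2,4)]
  have ci: "chart_inv (prod_chart c d) x = (chart_inv c (fst x), chart_inv d (snd x))"
    if "x \<in> img c \<times> img d" for x
    using chart_inv_prod_chart[OF i(1,3), of "fst x" "snd x"] that by auto
  have r: "chart_inv c (fst x) \<in> fst c" "snd c (chart_inv c (fst x)) = fst x"
      "chart_inv d (snd x) \<in> fst d" "snd d (chart_inv d (snd x)) = snd x"
    if "x \<in> img c \<times> img d" for x
    using chart_inv_right[of "fst x" c] chart_inv_right[of "snd x" d] that by auto
  have sp: "snd (prod_chart c d) p \<in> img c \<times> img d" using c d by (cases p) auto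
  show "smooth_at (prod_mfd M N) M fst p"
  proof (rule smooth_atI[OF a(1) c(1) a(2), of "img c \<times> img d"])
    show "smooth_on (Model (prod_mfd M N)) (img c \<times> img d)
        (\<lambda>x. snd c (fst (chart_inv (prod_chart c d) x)))"
      unfolding prod_mfd_simps by (rule smooth_on_cong[OF T smooth_on_linear[OF T bounded_linear_fst]]) (simp add: ci r)
  qed (use T sp ci r in auto)
  show "smooth_at (prod_mfd M N) N snd p"
  proof (rule smooth_atI[OF a(1) d(1) a(2), of "img c \<times> img d"])
    show "smooth_on (Model (prod_mfd M N)) (img c \<times> img d)
        (\<lambda>x. snd d (snd (chart_inv (prod_chart c d) x)))"
      unfolding prod_mfd_simps by (rule smooth_on_cong[OF T smooth_on_linear[OF T bounded_linear_snd]]) (simp add: ci r)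
  qed (use T sp ci r in auto)
qed


section \<open>Tangent maps and pullback of forms\<close>

lemma dderiv_add:
  assumes "rel_open E S" "f differentiable_on S" "g differentiable_on S" "x \<in> S" "u \<in> E"
  shows "dderiv (\<lambda>x. f x + g x) x u = dderiv f x u + dderiv g x u"
proof -
  obtain D where D: "(f has_derivative D) (at x within S)" "bounded_linear D" "\<And>w. w \<in> E ==> dderiv f x w = D w"
    by (rule differentiable_onE_dderiv[OF assms(1,2,4)]) blast
  obtain D' where D': "(g has_derivative D') (at x within S)" "bounded_linear D'" "\<And>w. w \<in> E ==> dderiv g x w = D' w"
    by (rule differentiable_onE_dderiv[OF assms(1,3,4)]) blast
  show ?thesis using dderiv_eq[OF assms(1,4,5) has_derivative_add[OF D(1) D'(1)]] D(3) D'(3) assms(5) by simp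
qed

lemma chart_at:
  assumes "p \<in> points M"
  shows "chart_at M p \<in> Atlas M" "p \<in> fst (chart_at M p)"
proof -
  have "\<exists>c. c \<in> Atlas M \<and> p \<in> fst c" using assms by (auto simp: points_def)
  from someI_ex[OF this] show "chart_at M p \<in> Atlas M" "p \<in> fst (chart_at M p)" by (simp_all add: chart_at_def)
qed

lemma chart_at_flat: "p \<in> E ==> chart_at (flat E) p = (E, \<lambda>x. x)" using chart_at(1)[of p "flat E"] by simp

lemma tmap_eq: "tmap M N f p u =
    dderiv (\<lambda>x. snd (chart_at N (f p)) (f (chart_inv (chart_at M p) x))) (snd (chart_at M p) p) u"
  by (simp add: tmap_def o_def)

lemma smooth_at_chart_at:
  assumes M: "premanifold M" and N: "premanifold N" and f: "smooth_at M N f p"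
  obtains T where "rel_open (Model M) T" "snd (chart_at M p) p \<in> T" "T \<subseteq> snd (chart_at M p) ` fst (chart_at M p)"
    "\<And>x. x \<in> T ==> f (chart_inv (chart_at M p) x) \<in> fst (chart_at N (f p))"
    "smooth_on (Model M) T (\<lambda>x. snd (chart_at N (f p)) (f (chart_inv (chart_at M p) x)))"
proof -
  have p: "p \<in> points M" "f p \<in> points N" using smooth_at_points[OF f M] by auto
  show ?thesis by (rule smooth_at_charts[OF M N f chart_at[OF p(1)] chart_at[OF p(2)]]) (rule that)
qed

lemma tmap_cong:
  assumes M: "premanifold M" and S: "open_in M S" "p \<in> S" and eq: "\<And>q. q \<in> S ==> g q = f q"
    and u: "u \<in> Model M"
  shows "tmap M N g p u = tmap M N f p u"
proof -
  have p: "p \<in> points M" using S mfd_openin[OF M] by blast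
  let ?c = "chart_at M p"
  let ?T = "img_on ?c S"
  have T: "rel_open (Model M) ?T" by (rule rel_open_chart_image[OF M S(1) chart_at(1)[OF p]])
  have "snd ?c p \<in> ?T" using chart_at[OF p] S by blast
  moreover have "g (chart_inv ?c x) = f (chart_inv ?c x)" if "x \<in> ?T" for x using that eq chart_inv_left[OF M chart_at(1)[OF p]] by auto
  ultimately show ?thesis unfolding tmap_eq eq[OF S(2)] by (intro dderiv_cong[OF T _ u]) auto
qed

lemma tmap_mem:
  assumes M: "premanifold M" and N: "premanifold N" and f: "smooth_at M N f p" and u: "u \<in> Model M"
  shows "tmap M N f p u \<in> Model N"
proof -
  obtain T where T: "rel_open (Model M) T" "snd (chart_at M p) p \<in> T" "T \<subseteq> snd (chart_at M p) ` fst (chart_at M p)"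
    "\<And>x. x \<in> T ==> f (chart_inv (chart_at M p) x) \<in> fst (chart_at N (f p))"
    "smooth_on (Model M) T (\<lambda>x. snd (chart_at N (f p)) (f (chart_inv (chart_at M p) x)))"
    by (rule smooth_at_chart_at[OF M N f]) (rule that)
  have "f p \<in> points N" using smooth_at_points[OF f M] by auto
  then have "(\<lambda>x. snd (chart_at N (f p)) (f (chart_inv (chart_at M p) x))) ` T \<subseteq> Model N"
    using T(4) rel_open_subset[OF mfd_chart(2)[OF N chart_at(1)]] by blast
  then show ?thesis unfolding tmap_eq using dderiv_mem_subspace[OF T(1) smooth_on_differentiable[OF T(5)] T(2) u mfd_subspace[OF N]] by blast
qed

lemma tmap_linear:
  assumes M: "premanifold M" and N: "premanifold N" and f: "smooth_at M N f p"
    and u: "u \<in> Model M" and v: "v \<in> Model M"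
  shows "tmap M N f p (a *\<^sub>R u + v) = a *\<^sub>R tmap M N f p u + tmap M N f p v"
proof -
  obtain T where T: "rel_open (Model M) T" "snd (chart_at M p) p \<in> T"
    "smooth_on (Model M) T (\<lambda>x. snd (chart_at N (f p)) (f (chart_inv (chart_at M p) x)))"
    by (rule smooth_at_chart_at[OF M N f]) blast
  obtain D where D: "bounded_linear D"
    "\<And>u. u \<in> Model M ==> tmap M N f p u = D u"
    unfolding tmap_eq by (rule differentiable_onE_dderiv[OF T(1) smooth_on_differentiable[OF T(3)] T(2)]) blast
  have "a *\<^sub>R u + v \<in> Model M" using u v mfd_subspace[OF M] by (simp add: subspace_add subspace_scale)
  then show ?thesis using D u v by (simp add: linear_simps)
qed

lemma tmap_0:
  assumes "premanifold M" "premanifold N" "smooth_at M N f p"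
  shows "tmap M N f p 0 = 0"
  using tmap_linear[OF assms, of 0 0 1] mfd_subspace[OF assms(1)] by (simp add: subspace_0)

text \<open>Both factors use the same chosen chart at \<open>f p\<close>, so that chart and its
  inverse cancel and the linear chain rule applies without a transition map.\<close>

lemma tmap_compose:
  assumes M: "premanifold M" and N: "premanifold N" and K: "premanifold K"
    and f: "smooth_at M N f p" and g: "smooth_at N K g (f p)" and u: "u \<in> Model M"
  shows "tmap M K (\<lambda>q. g (f q)) p u = tmap N K g (f p) (tmap M N f p u)"
proof -
  let ?c = "chart_at M p" and ?d = "chart_at N (f p)" and ?e = "chart_at K (g (f p))"
  let ?F = "\<lambda>x. snd ?d (f (chart_inv ?c x))" and ?G = "\<lambda>x. snd ?e (g (chart_inv ?d x))"
  obtain T where T: "rel_open (Model M) T" "snd ?c p \<in> T" "T \<subseteq> img ?c"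
    "\<And>x. x \<in> T ==> f (chart_inv ?c x) \<in> fst ?d" "smooth_on (Model M) T ?F"
    by (rule smooth_at_chart_at[OF M N f]) (rule that)
  obtain T' where T': "rel_open (Model N) T'" "snd ?d (f p) \<in> T'" "smooth_on (Model N) T' ?G" by (rule smooth_at_chart_at[OF N K g]) blast
  have p: "p \<in> points M" "f p \<in> points N" using smooth_at_points[OF f M] by auto
  have "?F ` T \<subseteq> Model N" using T(4) rel_open_subset[OF mfd_chart(2)[OF N chart_at(1)[OF p(2)]]] by auto
  from rel_open_preimage[OF T(1) smooth_on_continuous[OF T(5)] this T'(1)]
  have TT: "rel_open (Model M) (T \<inter> ?F -` T')" .
  have cp: "chart_inv ?c (snd ?c p) = p" by (rule chart_inv_left[OF M chart_at[OF p(1)]])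
  have x: "snd ?c p \<in> T \<inter> ?F -` T'" using T(2) T'(2) cp by simp
  have Fs: "?F differentiable_on (T \<inter> ?F -` T')" using smooth_on_differentiable[OF T(5)] differentiable_on_subset by blast
  have "tmap M K (\<lambda>q. g (f q)) p u = dderiv (\<lambda>x. ?G (?F x)) (snd ?c p) u" unfolding tmap_eq
    by (rule dderiv_cong[OF TT x u]) (simp add: chart_inv_left[OF N chart_at(1)[OF p(2)]] T(4))
  also have "\<dots> = dderiv ?G (?F (snd ?c p)) (dderiv ?F (snd ?c p) u)"
    by (rule dderiv_compose(1)[OF TT Fs x u T'(1) smooth_on_differentiable[OF T'(3)]]) auto
  finally show ?thesis by (simp add: tmap_eq cp)
qed

lemma tmap_id:
  assumes M: "premanifold M" and p: "p \<in> points M" and u: "u \<in> Model M"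
  shows "tmap M M (\<lambda>q. q) p u = u"
proof -
  let ?c = "chart_at M p"
  have T: "rel_open (Model M) (img ?c)" by (rule mfd_chart(2)[OF M chart_at(1)[OF p]])
  have x: "snd ?c p \<in> img ?c" using chart_at(2)[OF p] by blast
  have "dderiv (\<lambda>x. snd ?c (chart_inv ?c x)) (snd ?c p) u = dderiv (\<lambda>x. x) (snd ?c p) u"
    by (rule dderiv_cong[OF T x u]) (simp add: chart_inv_right)
  also have "\<dots> = u" by (rule dderiv_eq[OF T x u has_derivative_ident])
  finally show ?thesis by (simp add: tmap_eq)
qed

lemma tmap_const: "tmap M N (\<lambda>q. r) p u = 0" by (simp add: tmap_eq)

lemma tmap_left_inverse:
  assumes M: "premanifold M" and N: "premanifold N" and f: "smooth_at M N f p" and g: "smooth_at N M g (f p)"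
    and S: "open_in M S" "p \<in> S" "\<And>q. q \<in> S ==> g (f q) = q" and u: "u \<in> Model M"
  shows "tmap N M g (f p) (tmap M N f p u) = u"
proof -
  have p: "p \<in> points M" using smooth_at_points[OF f M] by simp
  have "tmap N M g (f p) (tmap M N f p u) = tmap M M (\<lambda>q. g (f q)) p u" by (rule tmap_compose[OF M N M f g u, symmetric])
  also have "\<dots> = tmap M M (\<lambda>q. q) p u" by (rule tmap_cong[OF M S(1,2,3) u])
  also have "\<dots> = u" by (rule tmap_id[OF M p u])
  finally show ?thesis .
qed

lemma tmap_flat:
  assumes "subspace E" "x \<in> E" "u \<in> E" "f x \<in> F"
  shows "tmap (flat E) (flat F) f x u = dderiv f x u"
proof -
  have E: "rel_open E E" using assms(1) by simp
  show ?thesis unfolding tmap_eq chart_at_flat[OF assms(2)] chart_at_flat[OF assms(4)] snd_conv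
    by (rule dderiv_cong[OF E assms(2,3)]) (simp add: chart_inv_flat)
qed

text \<open>The chosen chart of a flat space is the identity, so enlarging the target from
  \<open>F\<close> to the whole space changes nothing.\<close>

lemma tmap_into_flat: "f p \<in> F ==> tmap M (flat F) f p u = dmap M f p u" by (simp add: tmap_eq chart_at_flat)

lemma smooth_at_into_flat_UNIV:
  assumes M: "premanifold M" and F: "subspace F" and f: "smooth_at M (flat F) f p"
  shows "smooth_vec M f p"
proof -
  obtain c where c: "c \<in> Atlas M" "p \<in> fst c" using smooth_at_points[OF f M] by (auto simp: points_def)
  obtain T where T: "rel_open (Model M) T" "snd c p \<in> T" "T \<subseteq> img c"
    "smooth_on (Model M) T (\<lambda>x. f (chart_inv c x))"
    by (rule smooth_at_flatD[OF M F f c]) blast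
  show ?thesis by (rule smooth_at_flatI[OF c T(1-3) _ T(4)]) auto
qed

lemma smooth_at_compose_flat:
  assumes M: "premanifold M" and f: "smooth_vec M f p" and T: "open T" "f p \<in> T" "smooth_on UNIV T g"
  shows "smooth_vec M (\<lambda>q. g (f q)) p"
  by (rule smooth_at_compose[OF M _ _ f]) (use T in \<open>auto intro!: smooth_at_flat[of UNIV T]\<close>)

lemma tmap_compose_flat:
  assumes M: "premanifold M" and f: "smooth_vec M f p" and T: "open T" "f p \<in> T" "smooth_on UNIV T g"
    and g: "(g has_derivative g') (at (f p))" and u: "u \<in> Model M"
  shows "dmap M (\<lambda>q. g (f q)) p u = g' (dmap M f p u)"
proof -
  have "smooth_vec (flat UNIV) g (f p)" using T by (intro smooth_at_flat[of UNIV T]) auto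
  from tmap_compose[OF M _ _ f this u]
  have "dmap M (\<lambda>q. g (f q)) p u = dderiv g (f p) (dmap M f p u)" by (simp add: tmap_flat)
  also have "\<dots> = g' (dmap M f p u)" by (rule dderiv_eq[of UNIV UNIV]) (use g in auto)
  finally show ?thesis .
qed

lemma smooth_at_linear_flat:
  assumes M: "premanifold M" and f: "smooth_vec M f p" and L: "bounded_linear L"
  shows "smooth_vec M (\<lambda>q. L (f q)) p"
    "u \<in> Model M ==> dmap M (\<lambda>q. L (f q)) p u = L (dmap M f p u)"
  by (rule smooth_at_compose_flat[OF M f, of UNIV] tmap_compose_flat[OF M f, of UNIV];
      simp add: smooth_on_linear[OF _ L] bounded_linear_imp_has_derivative[OF L])+

lemma smooth_at_Pair_flat:
  assumes M: "premanifold M" and f: "smooth_vec M f p" and g: "smooth_vec M g p"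
  shows "smooth_vec M (\<lambda>q. (f q, g q)) p"
    "u \<in> Model M ==> dmap M (\<lambda>q. (f q, g q)) p u = (dmap M f p u, dmap M g p u)"
proof -
  let ?c = "chart_at M p"
  have p: "p \<in> points M" using smooth_at_points[OF f M] by simp
  obtain T where T: "rel_open (Model M) T" "snd ?c p \<in> T" "T \<subseteq> img ?c" "smooth_on (Model M) T (\<lambda>x. f (chart_inv ?c x))"
    by (rule smooth_at_flatD[OF M subspace_UNIV f chart_at[OF p]]) blast
  obtain T' where T': "rel_open (Model M) T'" "snd ?c p \<in> T'" "smooth_on (Model M) T' (\<lambda>x. g (chart_inv ?c x))"
    by (rule smooth_at_flatD[OF M subspace_UNIV g chart_at[OF p]]) blast
  note TT = rel_open_Int[OF T(1) T'(1)]
  have s: "smooth_on (Model M) (T \<inter> T') (\<lambda>x. f (chart_inv ?c x))" "smooth_on (Model M) (T \<inter> T') (\<lambda>x. g (chart_inv ?c x))"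
    by (rule smooth_on_subset[OF T(4)] smooth_on_subset[OF T'(3)]; blast)+
  note sP = smooth_on_Pair[OF TT s]
  have x: "snd ?c p \<in> T \<inter> T'" using T(2) T'(2) by simp
  show "smooth_vec M (\<lambda>q. (f q, g q)) p" by (rule smooth_at_flatI[OF chart_at[OF p] TT x _ _ sP]) (use T in auto)
  assume u: "u \<in> Model M"
  have "fst (dderiv (\<lambda>x. (f (chart_inv ?c x), g (chart_inv ?c x))) (snd ?c p) u) = dderiv (\<lambda>x. f (chart_inv ?c x)) (snd ?c p) u"
    using dderiv_bounded_linear[OF TT smooth_on_differentiable[OF sP] x u bounded_linear_fst] by simp
  moreover have "snd (dderiv (\<lambda>x. (f (chart_inv ?c x), g (chart_inv ?c x))) (snd ?c p) u) = dderiv (\<lambda>x. g (chart_inv ?c x)) (snd ?c p) u"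
    using dderiv_bounded_linear[OF TT smooth_on_differentiable[OF sP] x u bounded_linear_snd] by simp
  ultimately show "dmap M (\<lambda>q. (f q, g q)) p u = (dmap M f p u, dmap M g p u)" by (simp add: tmap_eq chart_at_flat prod_eq_iff)
qed

lemma smooth_at_add_flat:
  assumes M: "premanifold M" and f: "smooth_vec M f p" and g: "smooth_vec M g p"
  shows "smooth_vec M (\<lambda>q. f q + g q) p"
    "u \<in> Model M ==> dmap M (\<lambda>q. f q + g q) p u = dmap M f p u + dmap M g p u"
proof -
  have L: "bounded_linear (\<lambda>z::'c \<times> 'c. fst z + snd z)" by (intro bounded_linear_add bounded_linear_fst bounded_linear_snd)
  note P = smooth_at_Pair_flat[OF M f g]
  show "smooth_vec M (\<lambda>q. f q + g q) p" using smooth_at_linear_flat(1)[OF M P(1) L] by simp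
  show "u \<in> Model M ==> dmap M (\<lambda>q. f q + g q) p u = dmap M f p u + dmap M g p u" using smooth_at_linear_flat(2)[OF M P(1) L] P(2) by simp
qed

text \<open>Reads components in a chart as a tangent map. Local forms thereby become pullbacks under
  inverse charts, and changes of coordinates follow from functoriality.\<close>

lemma chart_vector_eq_tmap:
  assumes M: "premanifold M" and c: "c \<in> Atlas M" and x: "x \<in> img c" and u: "u \<in> Model M"
  shows "chart_vector M c x u = tmap (flat (Model M)) M (chart_inv c) x u"
proof -
  have T: "rel_open (Model M) (img c)" by (rule mfd_chart(2)[OF M c])
  have xE: "x \<in> Model M" using x rel_open_subset[OF T] by blast
  show ?thesis unfolding chart_vector_def tmap_eq chart_at_flat[OF xE] snd_conv o_def
    by (rule dderiv_cong[OF T x u]) (use rel_open_subset[OF T] chart_inv_flat[of _ "Model M"] in auto)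
qed

lemma chart_vector_mem:
  assumes M: "premanifold M" and c: "c \<in> Atlas M" and x: "x \<in> img c" and u: "u \<in> Model M"
  shows "chart_vector M c x u \<in> Model M"
  unfolding chart_vector_eq_tmap[OF assms] by (rule tmap_mem[OF mfd_flat[OF mfd_subspace[OF M]] M smooth_at_chart_inv[OF M c x]]) (simp add: u)

lemma local_form_eq_pullback2:
  assumes "premanifold M" "c \<in> Atlas M" "x \<in> img c" "u \<in> Model M" "v \<in> Model M"
  shows "local_form M c \<omega> x u v = pullback2 (flat (Model M)) M (chart_inv c) \<omega> x u v"
  by (simp add: local_form_def pullback2_def chart_vector_eq_tmap[OF assms(1-3)] assms(4,5))

lemma alternating_bilinear_pullback2:
  assumes M: "premanifold M" and N: "premanifold N" and f: "smooth_at M N f p" and "alternating_bilinear (Model N) (\<omega> (f p))"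
  shows "alternating_bilinear (Model M) (pullback2 M N f \<omega> p)"
  unfolding pullback2_def by (rule alternating_bilinear_pullback[OF assms(4) mfd_subspace[OF N] tmap_mem[OF M N f] tmap_linear[OF M N f]])

lemma pullback2_compose:
  assumes "premanifold M" "premanifold N" "premanifold K" "smooth_at M N f p" "smooth_at N K g (f p)"
    "u \<in> Model M" "v \<in> Model M"
  shows "pullback2 M K (\<lambda>q. g (f q)) \<omega> p u v = pullback2 M N f (pullback2 N K g \<omega>) p u v"
  by (simp add: pullback2_def tmap_compose[OF assms(1-5)] assms(6,7))

lemma pullback2_cong:
  assumes "premanifold M" "open_in M S" "p \<in> S" "\<And>q. q \<in> S ==> g q = f q" "u \<in> Model M" "v \<in> Model M"
  shows "pullback2 M N g \<omega> p u v = pullback2 M N f \<omega> p u v"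
  by (simp add: pullback2_def tmap_cong[OF assms(1-4)] assms)

text \<open>Both sides are pullbacks of \<open>\<omega>\<close> under the same map from the model
  space into \<open>N\<close>, factored in two ways. This reduces pullback of forms on manifolds to
  \<open>smooth_pullback_linear\<close> and \<open>closed_pullback_linear\<close>.\<close>

lemma local_form_pullback2:
  assumes M: "premanifold M" and N: "premanifold N" and c: "c \<in> Atlas M" and d: "d \<in> Atlas N"
    and x: "x \<in> img c" and f: "smooth_at M N f (chart_inv c x)" and fd: "f (chart_inv c x) \<in> fst d"
    and u: "u \<in> Model M" and v: "v \<in> Model M"
  defines "F \<equiv> \<lambda>x. snd d (f (chart_inv c x))"
  shows "local_form M c (pullback2 M N f \<omega>) x u v = local_form N d \<omega> (F x) (dderiv F x u) (dderiv F x v)"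
proof -
  let ?E = "Model M" and ?E' = "Model N"
  have E: "subspace ?E" and E': "subspace ?E'" using mfd_subspace M N by blast+
  have fE: "premanifold (flat ?E)" "premanifold (flat ?E')" using mfd_flat E E' by blast+
  have T0: "rel_open ?E (img c)" by (rule mfd_chart(2)[OF M c])
  have xE: "x \<in> ?E" using rel_open_subset[OF T0] x by blast
  note ci = smooth_at_chart_inv[OF M c x]
  have p: "chart_inv c x \<in> fst c" "snd c (chart_inv c x) = x" using chart_inv_right[OF x] by auto
  obtain T where T: "rel_open ?E T" "x \<in> T" "T \<subseteq> img c"
    "\<And>y. y \<in> T ==> f (chart_inv c y) \<in> fst d" "smooth_on ?E T F"
    using smooth_at_charts[OF M N f c p(1) d fd] unfolding F_def p(2) by blast
  have FE: "F y \<in> img d" if "y \<in> T" for y using T(4)[OF that] by (auto simp: F_def)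
  then have F: "smooth_at (flat ?E) (flat ?E') F x" using rel_open_subset[OF mfd_chart(2)[OF N d]] by (intro smooth_at_flat[OF T(1,2,5)]) auto
  have To: "open_in (flat ?E) T" using T(1) rel_open_subset[OF T(1)] by (simp add: mfd_openin[OF fE(1)] Int_absorb2)
  have Fx: "F x \<in> img d" "F x \<in> ?E'" using FE[OF T(2)] rel_open_subset[OF mfd_chart(2)[OF N d]] by auto
  note di = smooth_at_chart_inv[OF N d Fx(1)]
  have dF: "dderiv F x w = tmap (flat ?E) (flat ?E') F x w" "tmap (flat ?E) (flat ?E') F x w \<in> ?E'" if "w \<in> ?E" for w
    using tmap_flat[OF E xE that, of F ?E'] Fx(2) tmap_mem[OF fE F, of w] that by auto
  have "local_form M c (pullback2 M N f \<omega>) x u v = pullback2 (flat ?E) N (\<lambda>y. f (chart_inv c y)) \<omega> x u v"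
    unfolding local_form_eq_pullback2[OF M c x u v] using pullback2_compose[OF fE(1) M N ci f, of u v \<omega>] u v by simp
  also have "\<dots> = pullback2 (flat ?E) N (\<lambda>y. chart_inv d (F y)) \<omega> x u v"
    by (rule pullback2_cong[OF fE(1) To T(2)]) (use u v T(4) in \<open>auto simp: F_def chart_inv_left[OF N d]\<close>)
  also have "\<dots> = pullback2 (flat ?E) (flat ?E') F (pullback2 (flat ?E') N (chart_inv d) \<omega>) x u v"
    by (rule pullback2_compose[OF fE(1,2) N F di]) (use u v in auto)
  also have "\<dots> = local_form N d \<omega> (F x) (dderiv F x u) (dderiv F x v)"
    unfolding dF(1)[OF u] dF(1)[OF v] local_form_eq_pullback2[OF N d Fx(1) dF(2)[OF u] dF(2)[OF v]] by (simp add: pullback2_def)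
  finally show ?thesis .
qed

lemma alternating_local_form:
  assumes M: "premanifold M" and c: "c \<in> Atlas M" and x: "x \<in> img c"
    and "alternating_bilinear (Model M) (\<omega> (chart_inv c x))"
  shows "alternating_bilinear (Model M) (local_form M c \<omega> x)"
proof -
  have "alternating_bilinear (Model (flat (Model M))) (pullback2 (flat (Model M)) M (chart_inv c) \<omega> x)"
    by (rule alternating_bilinear_pullback2[OF mfd_flat[OF mfd_subspace[OF M]] M smooth_at_chart_inv[OF M c x]])
      (rule assms(4))
  then show ?thesis using mfd_subspace[OF M] by (simp add: alternating_bilinear_def local_form_eq_pullback2[OF M c x] subspace_add subspace_scale)
qed

section \<open>Closed smooth two-forms: locality, pullback and sums\<close>

abbreviation closed_smooth_form ::
  "('a, 'e::euclidean_space) mfd => 'a set => ('a, 'e) form2 => bool" where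
  "closed_smooth_form M W \<omega> \<equiv> smooth_form2_on M W \<omega> \<and> closed_form2_on M W \<omega>"

lemma closed_smooth_formI:
  assumes M: "premanifold M" and W: "open_in M W"
    and ab: "\<And>p. p \<in> W ==> alternating_bilinear (Model M) (\<omega> p)"
    and loc: "\<And>c x. c \<in> Atlas M ==> x \<in> img_on c W ==>
      \<exists>T. rel_open (Model M) T \<and> x \<in> T \<and> closed_at (Model M) T (local_form M c \<omega>) x"
  shows "closed_smooth_form M W \<omega>"
  unfolding smooth_form2_on_def closed_form2_on_def
proof (intro conjI ballI)
  fix c u v assume c: "c \<in> Atlas M" and uv: "u \<in> Model M" "v \<in> Model M"
  show "smooth_on (Model M) (img_on c W) (\<lambda>x. local_form M c \<omega> x u v)"
  proof (rule smooth_on_local[OF rel_open_chart_image[OF M W c]])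
    fix x assume "x \<in> img_on c W"
    from loc[OF c this] show "\<exists>T. rel_open (Model M) T \<and> x \<in> T \<and> smooth_on (Model M) T (\<lambda>x. local_form M c \<omega> x u v)"
      using uv by (elim exE) (rule exI, blast)
  qed
next
  fix c x u v w assume c: "c \<in> Atlas M" "x \<in> img_on c W" and uv: "u \<in> Model M" "v \<in> Model M" "w \<in> Model M"
  from loc[OF c] show "ext_d (local_form M c \<omega>) x u v w = 0" using uv by (elim exE) blast
qed (use ab in blast)

lemma closed_smooth_form_pullback:
  assumes M: "premanifold M" and N: "premanifold N" and W: "open_in M W" and V: "open_in N V"
    and f: "\<And>p. p \<in> W ==> smooth_at M N f p" "f ` W \<subseteq> V" and \<omega>: "closed_smooth_form N V \<omega>"
  shows "closed_smooth_form M W (pullback2 M N f \<omega>)"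
proof (rule closed_smooth_formI[OF M W])
  show "alternating_bilinear (Model M) (pullback2 M N f \<omega> p)" if "p \<in> W" for p
    using that f \<omega> by (intro alternating_bilinear_pullback2[OF M N]) (auto simp: smooth_form2_on_def)
  fix c x assume c: "c \<in> Atlas M" and x: "x \<in> img_on c W"
  then obtain p where p: "p \<in> fst c" "p \<in> W" "x = snd c p" by auto
  have cp: "chart_inv c x = p" using chart_inv_left[OF M c p(1)] p(3) by simp
  have "f p \<in> points N" using smooth_at_points[OF f(1)[OF p(2)] M] by simp
  then obtain d where d: "d \<in> Atlas N" "f p \<in> fst d" by (auto simp: points_def)
  let ?E = "Model M" and ?F = "\<lambda>x. snd d (f (chart_inv c x))"
  obtain T0 where T0: "rel_open ?E T0" "snd c p \<in> T0" "T0 \<subseteq> img c"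
    "\<And>y. y \<in> T0 ==> f (chart_inv c y) \<in> fst d" "smooth_on ?E T0 ?F"
    by (rule smooth_at_charts[OF M N f(1)[OF p(2)] c p(1) d]) (rule that)
  define T where "T = T0 \<inter> img_on c W"
  have T: "rel_open ?E T" unfolding T_def by (rule rel_open_Int[OF T0(1) rel_open_chart_image[OF M W c]])
  have xT: "x \<in> T" using T0 p by (auto simp: T_def)
  have Fs: "smooth_on ?E T ?F" by (rule smooth_on_subset[OF T0(5)]) (simp add: T_def)
  have TW: "chart_inv c y \<in> W" "f (chart_inv c y) \<in> fst d" "y \<in> img c" if "y \<in> T" for y
    using that T0(4) chart_inv_left[OF M c] by (auto simp: T_def)
  let ?T' = "img_on d V"
  have T': "rel_open (Model N) ?T'" by (rule rel_open_chart_image[OF N V d(1)])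
  have FT: "?F ` T \<subseteq> ?T'" using TW f(2) by blast
  have ab: "alternating_bilinear (Model N) (local_form N d \<omega> y)" if "y \<in> ?T'" for y using that \<omega> chart_inv_left[OF N d(1)]
    by (intro alternating_local_form[OF N d(1)]) (auto simp: smooth_form2_on_def)
  have sm: "smooth_on (Model N) ?T' (\<lambda>y. local_form N d \<omega> y u v)" if "u \<in> Model N" "v \<in> Model N" for u v
    using \<omega> d(1) that by (auto simp: smooth_form2_on_def)
  have cl: "ext_d (local_form N d \<omega>) y u v w = 0"
    if "y \<in> ?T'" "u \<in> Model N" "v \<in> Model N" "w \<in> Model N" for y u v w
    using \<omega> d(1) that unfolding closed_form2_on_def by blast
  have eq: "local_form M c (pullback2 M N f \<omega>) y u v = local_form N d \<omega> (?F y) (dderiv ?F y u) (dderiv ?F y v)"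
    if "y \<in> T" "u \<in> ?E" "v \<in> ?E" for y u v
    by (rule local_form_pullback2[OF M N c d(1) TW(3)[OF that(1)] f(1)[OF TW(1)[OF that(1)]] TW(2)[OF that(1)] that(2,3)])
  have dd: "dderiv (\<lambda>y. local_form M c (pullback2 M N f \<omega>) y v w) x u =
      dderiv (\<lambda>y. local_form N d \<omega> (?F y) (dderiv ?F y v) (dderiv ?F y w)) x u"
    if "u \<in> ?E" "v \<in> ?E" "w \<in> ?E" for u v w
    by (rule dderiv_cong[OF T xT that(1) eq]) (use that in auto)
  show "\<exists>T. rel_open ?E T \<and> x \<in> T \<and> closed_at ?E T (local_form M c (pullback2 M N f \<omega>)) x"
  proof (intro exI[of _ T] conjI ballI)
    show "subspace ?E" "openin (top_of_set ?E) T" using T by auto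
    show "x \<in> T" by (rule xT)
    show "smooth_on ?E T (\<lambda>y. local_form M c (pullback2 M N f \<omega>) y u v)" if "u \<in> ?E" "v \<in> ?E" for u v
      by (rule smooth_on_cong[OF T smooth_pullback_linear[OF T T' Fs FT ab sm that] eq]) (use that in auto)
    show "ext_d (local_form M c (pullback2 M N f \<omega>)) x u v w = 0" if "u \<in> ?E" "v \<in> ?E" "w \<in> ?E" for u v w
      using closed_pullback_linear[OF T T' Fs FT ab sm cl xT that] that by (simp add: dd)
  qed
qed

lemma local_form_cong:
  assumes M: "premanifold M" and eq: "\<And>p u v. p \<in> W ==> u \<in> Model M ==> v \<in> Model M ==> \<omega>' p u v = \<omega> p u v"
    and c: "c \<in> Atlas M" and x: "x \<in> img_on c W" and uv: "u \<in> Model M" "v \<in> Model M"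
  shows "local_form M c \<omega>' x u v = local_form M c \<omega> x u v"
proof -
  have "x \<in> img c" "chart_inv c x \<in> W" using x chart_inv_left[OF M c] by auto
  then show ?thesis unfolding local_form_def using uv by (intro eq chart_vector_mem[OF M c]) auto
qed

text \<open>The tool for forms defined by cases: smoothness and the exterior derivative are local,
  so a different closed form may serve as comparison near each point.\<close>

lemma closed_smooth_form_local:
  assumes M: "premanifold M" and W: "open_in M W"
    and loc: "\<And>p. p \<in> W ==> \<exists>V \<omega>'. open_in M V \<and> p \<in> V \<and> closed_smooth_form M V \<omega>' \<and>
      (\<forall>q\<in>V. \<forall>u v. alternating_bilinear (Model M) (\<omega> q) \<and> (u \<in> Model M \<longrightarrow> v \<in> Model M \<longrightarrow> \<omega> q u v = \<omega>' q u v))"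
  shows "closed_smooth_form M W \<omega>"
proof (rule closed_smooth_formI[OF M W])
  show "alternating_bilinear (Model M) (\<omega> p)" if "p \<in> W" for p using loc[OF that] by blast
  fix c x assume c: "c \<in> Atlas M" and x: "x \<in> img_on c W"
  then obtain p where p: "p \<in> fst c" "p \<in> W" "x = snd c p" by auto
  obtain V \<omega>' where V: "open_in M V" "p \<in> V" "closed_smooth_form M V \<omega>'"
    "\<And>q u v. q \<in> V ==> u \<in> Model M ==> v \<in> Model M ==> \<omega> q u v = \<omega>' q u v" using loc[OF p(2)] by blast
  let ?T = "img_on c V"
  have T: "rel_open (Model M) ?T" by (rule rel_open_chart_image[OF M V(1) c])
  have xT: "x \<in> ?T" using p V(2) by auto
  have eq: "local_form M c \<omega> y u v = local_form M c \<omega>' y u v" if "y \<in> ?T" "u \<in> Model M" "v \<in> Model M" for y u v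
    by (rule local_form_cong[OF M V(4) c that])
  have dd: "dderiv (\<lambda>y. local_form M c \<omega> y v w) x u = dderiv (\<lambda>y. local_form M c \<omega>' y v w) x u"
    if "u \<in> Model M" "v \<in> Model M" "w \<in> Model M" for u v w
    by (rule dderiv_cong[OF T xT that(1) eq]) (use that in auto)
  have s: "smooth_on (Model M) ?T (\<lambda>y. local_form M c \<omega> y u v)" if "u \<in> Model M" "v \<in> Model M" for u v
  proof (rule smooth_on_cong[OF T _ eq])
    show "smooth_on (Model M) ?T (\<lambda>y. local_form M c \<omega>' y u v)" using V(3) c that by (auto simp: smooth_form2_on_def)
  qed (use that in auto)
  show "\<exists>T. rel_open (Model M) T \<and> x \<in> T \<and> closed_at (Model M) T (local_form M c \<omega>) x"
  proof (intro exI[of _ ?T] conjI ballI)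
    show "ext_d (local_form M c \<omega>) x u v w = 0" if uvw: "u \<in> Model M" "v \<in> Model M" "w \<in> Model M" for u v w
    proof -
      have "ext_d (local_form M c \<omega>') x u v w = 0" using V(3)[THEN conjunct2] c xT uvw unfolding closed_form2_on_def by blast
      then show ?thesis using uvw by (simp add: dd)
    qed
  qed (use T xT s in auto)
qed

lemma closed_smooth_form_add:
  assumes M: "premanifold M" and W: "open_in M W"
    and \<omega>: "closed_smooth_form M W \<omega>" and \<omega>': "closed_smooth_form M W \<omega>'"
  shows "closed_smooth_form M W (\<lambda>p u v. \<omega> p u v + \<omega>' p u v)"
proof (rule closed_smooth_formI[OF M W])
  show "alternating_bilinear (Model M) (\<lambda>u v. \<omega> p u v + \<omega>' p u v)" if "p \<in> W" for p
    using that \<omega> \<omega>' by (intro alternating_bilinear_plus) (auto simp: smooth_form2_on_def)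
  fix c x assume c: "c \<in> Atlas M" and x: "x \<in> img_on c W"
  let ?T = "img_on c W"
  have T: "rel_open (Model M) ?T" by (rule rel_open_chart_image[OF M W c])
  have e: "local_form M c (\<lambda>p u v. \<omega> p u v + \<omega>' p u v) = (\<lambda>x u v. local_form M c \<omega> x u v + local_form M c \<omega>' x u v)"
    by (simp add: local_form_def fun_eq_iff)
  have s: "smooth_on (Model M) ?T (\<lambda>y. local_form M c \<omega> y u v)" "smooth_on (Model M) ?T (\<lambda>y. local_form M c \<omega>' y u v)"
    if "u \<in> Model M" "v \<in> Model M" for u v
    using \<omega> \<omega>' c that by (auto simp: smooth_form2_on_def)
  have dd: "dderiv (\<lambda>y. local_form M c \<omega> y v w + local_form M c \<omega>' y v w) x u =
      dderiv (\<lambda>y. local_form M c \<omega> y v w) x u + dderiv (\<lambda>y. local_form M c \<omega>' y v w) x u"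
    if "u \<in> Model M" "v \<in> Model M" "w \<in> Model M" for u v w
    by (rule dderiv_add[OF T smooth_on_differentiable[OF s(1)[OF that(2,3)]] smooth_on_differentiable[OF s(2)[OF that(2,3)]] x that(1)])
  have cl: "ext_d (local_form M c \<omega>) x u v w = 0"
      "ext_d (local_form M c \<omega>') x u v w = 0" if "u \<in> Model M" "v \<in> Model M" "w \<in> Model M" for u v w
    using \<omega> \<omega>' c x that unfolding closed_form2_on_def by blast+
  show "\<exists>T. rel_open (Model M) T \<and> x \<in> T \<and> closed_at (Model M) T (local_form M c (\<lambda>p u v. \<omega> p u v + \<omega>' p u v)) x"
    unfolding e
  proof (intro exI[of _ ?T] conjI ballI)
    show "smooth_on (Model M) ?T (\<lambda>y. local_form M c \<omega> y u v + local_form M c \<omega>' y u v)"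
      if "u \<in> Model M" "v \<in> Model M" for u v by (rule smooth_on_add[OF T s[OF that]])
    show "dderiv (\<lambda>y. local_form M c \<omega> y v w + local_form M c \<omega>' y v w) x u +
        dderiv (\<lambda>y. local_form M c \<omega> y w u + local_form M c \<omega>' y w u) x v +
        dderiv (\<lambda>y. local_form M c \<omega> y u v + local_form M c \<omega>' y u v) x w = 0"
      if "u \<in> Model M" "v \<in> Model M" "w \<in> Model M" for u v w
      using cl[OF that] that by (simp add: dd)
  qed (use T x in auto)
qed

subsection \<open>Orbits of torus actions\<close>

abbreviation orbit where "orbit act X p \<equiv> \<lambda>t::real. act (torus_exp (t *\<^sub>R X)) p"

lemma torus_exp_0 [simp]: "torus_exp 0 = 1" by (simp add: torus_exp_def vec_eq_iff)

lemma torus_exp_in_torus: "X \<in> torus_lie J ==> torus_exp X \<in> torus J" by (auto simp: torus_exp_def torus_def torus_lie_def)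

lemma torus_lie_scaleR: "X \<in> torus_lie J ==> t *\<^sub>R X \<in> torus_lie J" by (simp add: torus_lie_def)

lemma subspace_torus_lie: "subspace (torus_lie J)" by (simp add: torus_lie_def subspace_def)

lemma torus_lie_UNIV [simp]: "torus_lie UNIV = UNIV" by (simp add: torus_lie_def)

lemma smooth_at_action:
  assumes M: "premanifold M" and act: "torus_action J M act" and p: "p \<in> points M" and X: "X \<in> torus_lie J"
  shows "smooth_at (prod_mfd (flat (torus_lie J)) M) M (\<lambda>(X, p). act (torus_exp X) p) (X, p)"
proof -
  note P = mfd_prod[OF mfd_flat[OF subspace_torus_lie] M]
  show ?thesis using act p X unfolding torus_action_def smooth_map_on_iff[OF P M] by simp
qed

lemma smooth_at_orbit:
  assumes M: "premanifold M" and act: "torus_action J M act" and p: "p \<in> points M" and X: "X \<in> torus_lie J"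
  shows "smooth_at (flat UNIV) M (orbit act X p) s"
proof -
  let ?L = "torus_lie J"
  note L = mfd_flat[OF subspace_torus_lie[of J]]
  have "smooth_at (flat UNIV) (flat ?L) (\<lambda>t::real. t *\<^sub>R X) s" by (rule smooth_at_flat[of UNIV UNIV])
      (use torus_lie_scaleR[OF X] in \<open>auto intro!: smooth_on_linear bounded_linear_scaleR_left\<close>)
  moreover have "smooth_at (flat UNIV) M (\<lambda>t::real. p) s" by (rule smooth_at_const) (use p in auto)
  ultimately have "smooth_at (flat UNIV) (prod_mfd (flat ?L) M) (\<lambda>t. (t *\<^sub>R X, p)) s" by (rule smooth_at_Pair[OF mfd_vec L M])
  from smooth_at_compose[OF mfd_vec mfd_prod[OF L M] M this
      smooth_at_action[OF M act p torus_lie_scaleR[OF X]]]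
  show ?thesis by simp
qed

lemma fundamental_field_eq_tmap:
  assumes "act 1 p = p"
  shows "fundamental_field M act X p = tmap (flat UNIV) M (orbit act X p) 0 1"
  by (simp add: fundamental_field_def tmap_eq dderiv_def chart_at_flat chart_inv_flat assms)

text \<open>Differentiates the equivariance along the orbit through \<open>p\<close>. Separate
  \<open>X\<close> and \<open>Y\<close> allow for maps that are equivariant over a homomorphism of
  tori, such as dropping or reversing one coordinate.\<close>

lemma tmap_fundamental_field:
  assumes M: "premanifold M" and N: "premanifold N" and f: "smooth_at M N f p"
    and orb: "smooth_at (flat UNIV) M (orbit act X p) 0"
    and one: "act 1 p = p" "act' 1 (f p) = f p"
    and eq: "\<And>t::real. f (act (torus_exp (t *\<^sub>R X)) p) = act' (torus_exp (t *\<^sub>R Y)) (f p)"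
  shows "tmap M N f p (fundamental_field M act X p) = fundamental_field N act' Y (f p)"
proof -
  have "smooth_at M N f (act (torus_exp ((0::real) *\<^sub>R X)) p)" using f one by simp
  from tmap_compose[OF mfd_vec M N orb this, of 1]
  show ?thesis by (simp add: fundamental_field_eq_tmap one eq)
qed

lemma tmap_fundamental_field_invariant:
  assumes M: "premanifold M" and N: "premanifold N" and f: "smooth_at M N f p"
    and orb: "smooth_at (flat UNIV) M (orbit act X p) 0"
    and one: "act 1 p = p" and eq: "\<And>t::real. f (act (torus_exp (t *\<^sub>R X)) p) = f p"
  shows "tmap M N f p (fundamental_field M act X p) = 0"
proof -
  have "smooth_at M N f (act (torus_exp ((0::real) *\<^sub>R X)) p)" using f one by simp
  from tmap_compose[OF mfd_vec M N orb this, of 1]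
  show ?thesis by (simp add: fundamental_field_eq_tmap one eq tmap_const)
qed

text \<open>In a chart the mean value theorem along segments inside a ball makes \<open>f\<close>
  locally constant. The level set of \<open>f p0\<close> and its complement are then both
  open.\<close>

lemma constant_of_tmap_zero:
  assumes M: "premanifold M" and conn: "connected_space (mtopology M)"
    and f: "\<And>p. p \<in> points M ==> smooth_vec M f p"
    and z: "\<And>p u. p \<in> points M ==> u \<in> Model M ==> dmap M f p u = (0::real)"
    and p0: "p0 \<in> points M" and p1: "p1 \<in> points M"
  shows "f p0 = f p1"
proof -
  have loc: "\<exists>S. open_in M S \<and> p \<in> S \<and> (\<forall>q\<in>S. f q = f p)" if p: "p \<in> points M" for p
  proof -
    obtain c where c: "c \<in> Atlas M" "p \<in> fst c" using p by (auto simp: points_def)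
    let ?E = "Model M" and ?F = "\<lambda>x. f (chart_inv c x)"
    note E = mfd_flat[OF mfd_subspace[OF M]]
    have T: "rel_open ?E (img c)" by (rule mfd_chart(2)[OF M c(1)])
    have pts: "chart_inv c x \<in> points M" if "x \<in> img c" for x by (rule chart_in_points[OF c(1) chart_inv_right(2)[OF that]])
    have Fs: "smooth_vec (flat ?E) ?F x" if "x \<in> img c" for x
      by (rule smooth_at_compose[OF E M mfd_vec smooth_at_chart_inv[OF M c(1) that] f[OF pts[OF that]]])
    have d0: "dderiv ?F x u = 0" if x: "x \<in> img c" and u: "u \<in> ?E" for x u
    proof -
      have xE: "x \<in> ?E" using x rel_open_subset[OF T] by blast
      note ci = smooth_at_chart_inv[OF M c(1) x]
      have "dderiv ?F x u = dmap (flat ?E) ?F x u" by (simp add: tmap_flat[OF mfd_subspace[OF M] xE u])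
      also have "\<dots> = dmap M f (chart_inv c x) (tmap (flat ?E) M (chart_inv c) x u)"
        by (rule tmap_compose[OF E M mfd_vec ci f[OF pts[OF x]]]) (simp add: u)
      also have "\<dots> = 0" by (rule z[OF pts[OF x] tmap_mem[OF E M ci]]) (simp add: u)
      finally show ?thesis .
    qed
    have Fd: "?F differentiable_on (img c)" unfolding differentiable_on_def
    proof
      fix x assume x: "x \<in> img c"
      have xE: "x \<in> ?E" using x rel_open_subset[OF T] by blast
      obtain T' where T': "rel_open ?E T'" "x \<in> T'" "T' \<subseteq> ?E"
          and s': "smooth_on ?E T' (\<lambda>y. ?F (chart_inv (?E, \<lambda>x. x) y))"
        by (rule smooth_at_flatD[OF E subspace_UNIV Fs[OF x], of "(?E, \<lambda>x. x)"]) (use xE in auto)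
      have "smooth_on ?E T' ?F" by (rule smooth_on_cong[OF T'(1) s']) (use chart_inv_flat[of _ ?E] T'(3) in auto)
      then have "?F differentiable (at x within T')" using smooth_on_differentiable[of ?E T' ?F] T'(2) unfolding differentiable_on_def by blast
      then show "?F differentiable (at x within img c)" using at_within_rel_open[OF x T'(2) T T'(1)] by simp
    qed
    have xp: "snd c p \<in> img c" using c by blast
    obtain e where e: "e > 0" "ball (snd c p) e \<inter> ?E \<subseteq> img c" using T xp by (metis openin_contains_ball)
    have const: "?F y = ?F (snd c p)" if y: "y \<in> ball (snd c p) e \<inter> ?E" for y
    proof -
      let ?x = "snd c p"
      have xE: "?x \<in> ?E" using xp rel_open_subset[OF T] by blast
      have uE: "y - ?x \<in> ?E" using y xE mfd_subspace[OF M] by (simp add: subspace_diff)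
      have in_T: "?x + t *\<^sub>R (y - ?x) \<in> img c" if t: "0 \<le> t" "t \<le> 1" for t
      proof -
        have "dist ?x (?x + t *\<^sub>R (y - ?x)) = t * dist ?x y" using t by (simp add: dist_norm norm_minus_commute)
        also have "\<dots> \<le> dist ?x y" using t by (simp add: mult_left_le_one_le)
        finally have "?x + t *\<^sub>R (y - ?x) \<in> ball ?x e" using y by auto
        moreover have "?x + t *\<^sub>R (y - ?x) \<in> ?E" using xE uE mfd_subspace[OF M] by (simp add: subspace_add subspace_scale)
        ultimately show ?thesis using e by blast
      qed
      define g where "g t = ?F (?x + t *\<^sub>R (y - ?x))" for t
      have "\<exists>z::real. 0 < z \<and> z < 1 \<and> g 1 - g 0 = (1 - 0) * 0"
      proof (rule MVT2[where f' = "\<lambda>_. 0"])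
        show "(g has_real_derivative 0) (at t)" if "0 \<le> t" "t \<le> 1" for t unfolding g_def
          using DERIV_line[OF T Fd in_T[OF that] uE] d0[OF in_T[OF that] uE] by simp
      qed simp
      then show ?thesis by (auto simp: g_def)
    qed
    let ?S = "chart_inv c ` (ball (snd c p) e \<inter> ?E)"
    have oB: "rel_open ?E (ball (snd c p) e \<inter> ?E)" using mfd_subspace[OF M] by (simp add: openin_open_Int Int_commute)
    have "open_in M ?S" by (rule openin_chart_inv_image[OF M c(1) oB e(2)])
    moreover have "p \<in> ?S" using e(1) xp rel_open_subset[OF T] chart_inv_left[OF M c] by (intro image_eqI[of _ _ "snd c p"]) auto
    moreover have "\<forall>q\<in>?S. f q = f p"
    proof
      fix q assume "q \<in> ?S"
      then obtain y where "y \<in> ball (snd c p) e \<inter> ?E" "q = chart_inv c y" by blast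
      then show "f q = f p" using const[of y] chart_inv_left[OF M c] by simp
    qed
    ultimately show ?thesis by blast
  qed
  let ?A = "{p \<in> points M. f p = f p0}" and ?B = "{p \<in> points M. f p \<noteq> f p0}"
  have o: "open_in M {p \<in> points M. Q (f p)}" for Q
  proof (subst openin_subopen, intro ballI)
    fix p assume p: "p \<in> {p \<in> points M. Q (f p)}"
    then obtain S where S: "open_in M S" "p \<in> S" "\<forall>q\<in>S. f q = f p" using loc[of p] by blast
    then have "S \<subseteq> points M" using mfd_openin[OF M] by blast
    then have "S \<subseteq> {p \<in> points M. Q (f p)}" using S(3) p by auto
    then show "\<exists>S. open_in M S \<and> p \<in> S \<and> S \<subseteq> {p \<in> points M. Q (f p)}" using S by blast
  qed
  have "open_in M ?A" "open_in M ?B" using o[of "\<lambda>x. x = f p0"] o[of "\<lambda>x. x \<noteq> f p0"] by simp_all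
  then have "?B = {}" using conn p0 unfolding connected_space_def topspace_mtopology[OF M] by blast
  then show ?thesis using p1 by auto
qed


section \<open>Top powers of alternating bilinear forms\<close>

abbreviation tswap where "tswap \<equiv> Transposition.transpose"

lemma wedge_power_comp: "wedge_power n (\<lambda>u v. B (L u) (L v)) v = wedge_power n B (\<lambda>i. L (v i))" by (simp add: wedge_power_def)

lemma wedge_power_cong:
  assumes "\<And>u v. u \<in> E ==> v \<in> E ==> B u v = B' u v" "\<And>i. v i \<in> E"
  shows "wedge_power n B v = wedge_power n B' v"
  by (simp add: wedge_power_def assms)

lemma alternating_multilinearD:
  assumes "alternating_multilinear E d A" "\<And>i. v i \<in> E"
  shows "i < d ==> u \<in> E ==> w \<in> E ==> A (v(i := a *\<^sub>R u + w)) = a * A (v(i := u)) + A (v(i := w))"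
    and "i < d ==> j < d ==> i \<noteq> j ==> v i = v j ==> A v = 0"
    and "(\<And>i. w' i \<in> E) ==> (\<And>i. i < d ==> w' i = v i) ==> A w' = A v"
  using assms unfolding alternating_multilinear_def by blast+

text \<open>For multilinearity, each permutation puts slot \<open>i\<close> into exactly one factor,
  as its first or second argument. For alternation, composing with the transposition of two equal
  slots preserves every product and reverses the sign of the permutation, so the sum equals its
  negative.\<close>

lemma alternating_multilinear_wedge_power:
  fixes B :: "'e::real_vector => 'e => real"
  assumes B: "alternating_bilinear E B" and E: "subspace E"
  shows "alternating_multilinear E (2 * n) (wedge_power n B)"
  unfolding alternating_multilinear_def
proof (intro allI impI conjI ballI)
  fix v :: "nat => 'e" assume v: "\<forall>i. v i \<in> E"
  have lin: "B (a *\<^sub>R u + v) w = a * B u w + B v w" "B w (a *\<^sub>R u + v) = a * B w u + B w v"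
    if "u \<in> E" "v \<in> E" "w \<in> E" for u v w a
    using B that unfolding alternating_bilinear_def by blast+
  {
    fix i a u w assume i: "i < 2 * n" and u: "u \<in> E" and w: "w \<in> E"
    define P where "P \<sigma> x = (\<Prod>j<n. B ((v(i := x)) (\<sigma> (2 * j))) ((v(i := x)) (\<sigma> (2 * j + 1))))" for \<sigma> x
    have P: "P \<sigma> (a *\<^sub>R u + w) = a * P \<sigma> u + P \<sigma> w" if \<sigma>: "\<sigma> permutes {..<2 * n}" for \<sigma>
    proof -
      \<comment> \<open>Slot \<open>i\<close> is read at position \<open>k\<close>, which belongs to
        the factor \<open>k div 2\<close>; the parity of \<open>k\<close> tells which argument of
        that factor is affected.\<close>
      define k where "k = inv \<sigma> i"
      have k: "\<sigma> k = i" "k < 2 * n"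
        using permutes_inverses(1)[OF \<sigma>] permutes_in_image[OF permutes_inv[OF \<sigma>], of i] i by (auto simp: k_def)
      have ik: "\<sigma> m = i \<longleftrightarrow> m = k" for m using k(1) permutes_inj[OF \<sigma>] by (auto dest: injD)
      define j where "j = k div 2"
      have j: "j \<in> {..<n}" using k(2) by (auto simp: j_def)
      define C where "C = (\<Prod>m\<in>{..<n} - {j}. B (v (\<sigma> (2 * m))) (v (\<sigma> (2 * m + 1))))"
      have PC: "P \<sigma> x = B ((v(i := x)) (\<sigma> (2 * j))) ((v(i := x)) (\<sigma> (2 * j + 1))) * C" for x
        unfolding P_def C_def prod.remove[OF finite_lessThan j] by (intro arg_cong2[where f = "(*)"] refl prod.cong) (auto simp: ik j_def)
      show ?thesis
      proof (cases "even k")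
        case True
        then have "\<sigma> (2 * j) = i" "\<sigma> (2 * j + 1) \<noteq> i" by (auto simp: ik j_def)
        then show ?thesis using lin u w v by (simp add: PC distrib_right)
      next
        case False
        then have "k = 2 * j + 1" by (auto simp: j_def elim: oddE)
        then have "\<sigma> (2 * j) \<noteq> i" "\<sigma> (2 * j + 1) = i" by (auto simp: ik)
        then show ?thesis using lin u w v by (simp add: PC distrib_right)
      qed
    qed
    have W: "wedge_power n B (v(i := x)) = (\<Sum>\<sigma> | \<sigma> permutes {..<2 * n}. of_int (sign \<sigma>) * P \<sigma> x) / 2 ^ n" for x
      by (simp only: wedge_power_def P_def)
    have "(\<Sum>\<sigma> | \<sigma> permutes {..<2 * n}. of_int (sign \<sigma>) * P \<sigma> (a *\<^sub>R u + w))
        = a * (\<Sum>\<sigma> | \<sigma> permutes {..<2 * n}. of_int (sign \<sigma>) * P \<sigma> u) + (\<Sum>\<sigma> | \<sigma> permutes {..<2 * n}. of_int (sign \<sigma>) * P \<sigma> w)"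
      unfolding sum_distrib_left sum.distrib[symmetric] by (rule sum.cong) (simp_all add: P distrib_left mult.left_commute)
    then show "wedge_power n B (v(i := a *\<^sub>R u + w)) = a * wedge_power n B (v(i := u)) + wedge_power n B (v(i := w))"
      by (simp add: W add_divide_distrib)
  }
  {
    fix i j assume i: "i < 2 * n" and j: "j < 2 * n" and ij: "i \<noteq> j \<and> v i = v j"
    let ?t = "tswap i j"
    have t: "?t permutes {..<2 * n}" using i j by (intro permutes_swap_id) auto
    have vt: "v (?t m) = v m" for m using ij by (auto simp: Transposition.transpose_def)
    define f where "f \<sigma> = of_int (sign \<sigma>) * (\<Prod>j<n. B (v (\<sigma> (2 * j))) (v (\<sigma> (2 * j + 1))))" for \<sigma>
    have "sum f {\<sigma>. \<sigma> permutes {..<2 * n}} = sum (\<lambda>\<sigma>. f (?t \<circ> \<sigma>)) {\<sigma>. \<sigma> permutes {..<2 * n}}"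
      by (rule setum_permutations_compose_left[OF t])
    also have "\<dots> = sum (\<lambda>\<sigma>. - f \<sigma>) {\<sigma>. \<sigma> permutes {..<2 * n}}"
    proof (rule sum.cong)
      fix \<sigma> assume "\<sigma> \<in> {\<sigma>. \<sigma> permutes {..<2 * n}}"
      then have "sign (?t \<circ> \<sigma>) = - sign \<sigma>"
        using ij by (subst sign_compose) (auto simp: sign_swap_id permutation_swap_id intro: permutes_imp_permutation[of "{..<2*n}"])
      then show "f (?t \<circ> \<sigma>) = - f \<sigma>" by (simp add: f_def vt)
    qed simp
    finally have "sum f {\<sigma>. \<sigma> permutes {..<2 * n}} = 0" by (simp add: sum_negf)
    then show "wedge_power n B v = 0" unfolding wedge_power_def f_def by simp
  }
  fix w assume w: "(\<forall>i. w i \<in> E) \<and> (\<forall>i<2 * n. w i = v i)"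
  have "w (\<sigma> (2 * m)) = v (\<sigma> (2 * m)) \<and> w (\<sigma> (2 * m + 1)) = v (\<sigma> (2 * m + 1))"
    if "\<sigma> permutes {..<2 * n}" "m < n" for \<sigma> m
    using w permutes_in_image[OF that(1), of "2 * m"] permutes_in_image[OF that(1), of "2 * m + 1"] that(2) by auto
  then show "wedge_power n B w = wedge_power n B v"
    unfolding wedge_power_def by (intro arg_cong2[where f = "(/)"] sum.cong refl arg_cong2[where f = "(*)"] prod.cong) auto
qed

text \<open>Polarization: with \<open>b x + b y\<close> in both slots the value is zero, and it
  expands into four terms, two of which have equal arguments.\<close>

lemma alternating_multilinear_swap:
  assumes A: "alternating_multilinear E d A" and E: "subspace E" and b: "\<And>i. b i \<in> E" and xy: "x < d" "y < d" "x \<noteq> y"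
  shows "A (b \<circ> tswap x y) = - A b"
proof -
  let ?p = "b x + b y"
  have p: "?p \<in> E" using b E by (simp add: subspace_add)
  have add: "A (w(i := u + u')) = A (w(i := u)) + A (w(i := u'))" if "\<And>i. w i \<in> E" "i < d" "u \<in> E" "u' \<in> E" for w i u u'
    using alternating_multilinearD(1)[OF A that(1) that(2-4), where a = 1] by simp
  have z: "A (b(y := u, x := u)) = 0" if "u \<in> E" for u by (rule alternating_multilinearD(2)[OF A _ xy]) (use that b in \<open>auto\<close>)
  have c: "b(y := ?p, x := b x) = (b(x := b x))(y := ?p)" "b(y := ?p, x := b y) = (b(x := b y))(y := ?p)"
    "(b(x := b x))(y := b x) = b(y := b x, x := b x)" "(b(x := b y))(y := b y) = b(y := b y, x := b y)"
    "(b(x := b x))(y := b y) = b" "(b(x := b y))(y := b x) = b \<circ> tswap x y"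
    using xy by (auto simp: fun_eq_iff Transposition.transpose_def)
  have "A (b(y := ?p, x := ?p)) = A (b(y := ?p, x := b x)) + A (b(y := ?p, x := b y))" by (rule add) (use p b xy in auto)
  moreover have "A ((b(x := b x))(y := ?p)) = A ((b(x := b x))(y := b x)) + A ((b(x := b x))(y := b y))" by (rule add) (use b xy in auto)
  moreover have "A ((b(x := b y))(y := ?p)) = A ((b(x := b y))(y := b x)) + A ((b(x := b y))(y := b y))" by (rule add) (use b xy in auto)
  ultimately show ?thesis unfolding c using z[OF p] z[OF b, of x] z[OF b, of y] by simp
qed

text \<open>Permutations of \<open>b\<close> are reached by transpositions and tuples with a
  repetition vanish by alternation; arbitrary vectors then enter one slot at a time by linearity.
  This takes the place of one-dimensionality of the space of top forms.\<close>

lemma alternating_multilinear_zero: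
  assumes A: "alternating_multilinear E d A" and E: "subspace E" and b: "\<And>i. b i \<in> E"
    and sp: "E \<subseteq> span (b ` {..<d})" and z: "A b = 0" and v: "\<And>i. v i \<in> E"
  shows "A v = 0"
proof -
  have perm: "\<forall>b. (\<forall>i. b i \<in> E) \<longrightarrow> A b = 0 \<longrightarrow> A (b \<circ> p) = 0" if "p permutes {..<d}" for p
    using that finite_lessThan[of d]
  proof (induction p rule: permutes_induct)
    case (swap x y p)
    show ?case
    proof (intro allI impI)
      fix b assume b: "\<forall>i. b i \<in> E" "A b = 0"
      have "A (b \<circ> tswap x y) = 0"
      proof (cases "x = y")
        case False
        then show ?thesis using alternating_multilinear_swap[OF A E, of b x y] b swap.hyps by simp
      qed (use b in simp)
      then have "A ((b \<circ> tswap x y) \<circ> p) = 0" by (intro swap.IH[rule_format]) (use b in auto)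
      then show "A (b \<circ> (tswap x y \<circ> p)) = 0" by (simp add: o_assoc)
    qed
  qed simp
  \<comment> \<open>Induction on the number \<open>m\<close> of initial slots that may hold
    arbitrary vectors; the slots from \<open>m\<close> on hold members of the tuple
    \<open>b\<close>.\<close>
  have "\<forall>w. (\<forall>i. w i \<in> E) \<longrightarrow> (\<forall>i. m \<le> i \<and> i < d \<longrightarrow> w i \<in> b ` {..<d}) \<longrightarrow> A w = 0" if "m \<le> d" for m
    using that
  proof (induction m)
    case 0
    show ?case
    proof (intro allI impI)
      fix w assume w: "\<forall>i. w i \<in> E" "\<forall>i. 0 \<le> i \<and> i < d \<longrightarrow> w i \<in> b ` {..<d}"
      then have "\<forall>i. \<exists>k. i < d \<longrightarrow> k < d \<and> w i = b k" by auto
      then obtain f where f: "\<And>i. i < d ==> f i < d \<and> w i = b (f i)" by metis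
      show "A w = 0"
      proof (cases "inj_on f {..<d}")
        case False
        then obtain i j where "i < d" "j < d" "i \<noteq> j" "f i = f j" by (auto simp: inj_on_def)
        then show ?thesis using alternating_multilinearD(2)[OF A, where v = w and i = i and j = j] w f by metis
      next
        case True
        define \<sigma> where "\<sigma> i = (if i < d then f i else i)" for i
        have "inj_on \<sigma> {..<d}" "\<sigma> ` {..<d} \<subseteq> {..<d}" using True f by (auto simp: \<sigma>_def inj_on_def)
        then have "bij_betw \<sigma> {..<d} {..<d}" by (simp add: bij_betw_def endo_inj_surj)
        then have "\<sigma> permutes {..<d}" by (rule bij_imp_permutes) (simp add: \<sigma>_def)
        then have "A (b \<circ> \<sigma>) = 0" using perm b z by blast
        moreover have "A w = A (b \<circ> \<sigma>)" by (rule alternating_multilinearD(3)[OF A]) (use w b f in \<open>auto simp: \<sigma>_def\<close>)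
        ultimately show ?thesis by simp
      qed
    qed
  next
    case (Suc m)
    show ?case
    proof (intro allI impI)
      fix w assume w: "\<forall>i. w i \<in> E" "\<forall>i. Suc m \<le> i \<and> i < d \<longrightarrow> w i \<in> b ` {..<d}"
      have md: "m < d" using Suc.prems by simp
      have lin: "A (w(m := a *\<^sub>R u + u')) = a * A (w(m := u)) + A (w(m := u'))" if "u \<in> E" "u' \<in> E" for a u u'
        by (rule alternating_multilinearD(1)[OF A]) (use w md that in auto)
      have 0: "A (w(m := 0)) = 0" using lin[of 0 0 1] subspace_0[OF E] by simp
      have S: "subspace {u. u \<in> E \<and> A (w(m := u)) = 0}" unfolding subspace_def
      proof (intro conjI ballI allI)
        show "0 \<in> {u. u \<in> E \<and> A (w(m := u)) = 0}" using 0 subspace_0[OF E] by simp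
        show "u + u' \<in> {u. u \<in> E \<and> A (w(m := u)) = 0}"
          if "u \<in> {u. u \<in> E \<and> A (w(m := u)) = 0}" "u' \<in> {u. u \<in> E \<and> A (w(m := u)) = 0}" for u u'
          using lin[of u u' 1] that E by (simp add: subspace_add)
        show "c *\<^sub>R u \<in> {u. u \<in> E \<and> A (w(m := u)) = 0}"
          if "u \<in> {u. u \<in> E \<and> A (w(m := u)) = 0}" for c u
          using lin[of u 0 c] that E 0 by (simp add: subspace_scale subspace_0)
      qed
      have "A (w(m := b k)) = 0" if "k < d" for k using Suc.IH[rule_format, of "w(m := b k)"] w b that md
        by (metis (no_types, lifting) Suc.prems Suc_leD Suc_leI fun_upd_apply image_eqI lessThan_iff order_le_imp_less_or_eq)
      then have "b ` {..<d} \<subseteq> {u. u \<in> E \<and> A (w(m := u)) = 0}" using b by auto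
      then have "w m \<in> {u. u \<in> E \<and> A (w(m := u)) = 0}" using span_minimal[OF _ S] sp w(1) by blast
      then show "A w = 0" by simp
    qed
  qed
  from this[OF order_refl] show ?thesis using v by (metis linorder_not_less)
qed

text \<open>Indices from \<open>d\<close> on get the default \<open>0\<close>, because tuples are
  total functions on the natural numbers and all their values must lie in \<open>E\<close>.\<close>

lemma indexed_basis:
  assumes "finite C" "card C = d" "C \<subseteq> E" "subspace E"
  obtains b :: "nat => 'e::euclidean_space" where "bij_betw b {..<d} C" "\<And>i. b i \<in> E"
proof -
  obtain h where h: "bij_betw h {0..<d} C" using ex_bij_betw_nat_finite[OF assms(1)] assms(2) by auto
  define b where "b i = (if i < d then h i else 0)" for i
  have "bij_betw b {..<d} C" using h bij_betw_cong[of "{..<d}" b h C] by (simp add: b_def lessThan_atLeast0)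
  moreover have "b i \<in> E" for i using h assms(3) subspace_0[OF assms(4)] by (auto simp: b_def bij_betw_def)
  ultimately show ?thesis using that by blast
qed

text \<open>The linear map \<open>R\<close> that stretches \<open>e\<close> by \<open>t\<close>
  preserves \<open>B\<close> and \<open>\<alpha>\<close> and multiplies \<open>\<beta>\<close> by
  \<open>t\<close>, so it pulls the form on the right back to the form on the left. The factor
  \<open>t\<close> is the determinant of \<open>R\<close>, obtained by comparing two alternating
  forms on one basis.\<close>

lemma wedge_power_scale_plane:
  fixes E :: "'e::euclidean_space set"
  assumes E: "subspace E" and dim: "dim E = 2 * n" and B: "alternating_bilinear E B"
    and \<alpha>: "\<And>a u v. u \<in> E ==> v \<in> E ==> \<alpha> (a *\<^sub>R u + v) = a * \<alpha> u + \<alpha> v"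
    and \<beta>: "\<And>a u v. u \<in> E ==> v \<in> E ==> \<beta> (a *\<^sub>R u + v) = a * \<beta> u + \<beta> v"
    and e: "e \<in> E" "\<alpha> e = 0" "\<beta> e = 1" "\<And>u. u \<in> E ==> B e u = 0"
    and v: "\<And>i. v i \<in> E"
  shows "wedge_power n (\<lambda>u v. B u v + t * (\<alpha> u * \<beta> v - \<alpha> v * \<beta> u)) v
    = t * wedge_power n (\<lambda>u v. B u v + (\<alpha> u * \<beta> v - \<alpha> v * \<beta> u)) v"
proof -
  let ?B = "\<lambda>u v. B u v + (\<alpha> u * \<beta> v - \<alpha> v * \<beta> u)"
  have B': "alternating_bilinear E ?B"
  proof (rule alternating_bilinear_plus[OF B])
    show "alternating_bilinear E (\<lambda>u v. \<alpha> u * \<beta> v - \<alpha> v * \<beta> u)"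
      by (simp add: alternating_bilinear_def \<alpha> \<beta>) (simp add: algebra_simps)
  qed
  define A where "A = wedge_power n ?B"
  have A: "alternating_multilinear E (2 * n) A" unfolding A_def by (rule alternating_multilinear_wedge_power[OF B' E])
  \<comment> \<open>The identity on the kernel of \<open>\<beta>\<close>, while \<open>e\<close>
    goes to \<open>t *\<^sub>R e\<close> because \<open>\<beta> e = 1\<close>.\<close>
  define R where "R u = ((t - 1) * \<beta> u) *\<^sub>R e + u" for u
  have RE: "R u \<in> E" if "u \<in> E" for u using that e(1) E by (simp add: R_def subspace_add subspace_scale)
  have Rlin: "R (a *\<^sub>R u + u') = a *\<^sub>R R u + R u'" if "u \<in> E" "u' \<in> E" for a u u'
    using \<beta>[OF that, of a] by (simp add: R_def algebra_simps)
  have BR: "B (R u) (R w) = B u w" if "u \<in> E" "w \<in> E" for u w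
  proof -
    have Bw: "B (R u) x = B u x" if x: "x \<in> E" for x
      using B e(1) e(4)[OF x] \<open>u \<in> E\<close> x unfolding alternating_bilinear_def R_def by simp
    have "B u (R w) = - B (R w) u" by (rule alternating_bilinear_left(4)[OF B E that(1) RE[OF that(2)] that(1)])
    also have "B (R w) u = B w u" using B e(1) e(4)[OF that(1)] that unfolding alternating_bilinear_def R_def by simp
    also have "- B w u = B u w" using alternating_bilinear_left(4)[OF B E that(1,2,1)] by simp
    finally show ?thesis using Bw[OF RE[OF that(2)]] by simp
  qed
  have \<alpha>R: "\<alpha> (R u) = \<alpha> u" "\<beta> (R u) = t * \<beta> u" if "u \<in> E" for u
    using \<alpha>[OF e(1) that] \<beta>[OF e(1) that] e by (simp_all add: R_def) (simp add: algebra_simps)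
  have eq: "B u w + t * (\<alpha> u * \<beta> w - \<alpha> w * \<beta> u) = ?B (R u) (R w)" if "u \<in> E" "w \<in> E" for u w
    using that by (simp add: BR \<alpha>R algebra_simps)
  \<comment> \<open>The claim is that this alternating form is zero at \<open>v\<close>; by
    \<open>alternating_multilinear_zero\<close> it is enough to evaluate it on one basis.\<close>
  define A' where "A' v = A (\<lambda>i. R (v i)) - t * A v" for v
  have A': "alternating_multilinear E (2 * n) A'" unfolding alternating_multilinear_def
  proof (intro allI impI conjI ballI)
    fix v :: "nat => 'e" assume v: "\<forall>i. v i \<in> E"
    have Rv: "R (v i) \<in> E" for i using v RE by blast
    {
      fix i a u w assume i: "i < 2 * n" and u: "u \<in> E" and w: "w \<in> E"
      have up: "(\<lambda>j. R ((v(i := x)) j)) = (\<lambda>j. R (v j))(i := R x)" for x by auto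
      show "A' (v(i := a *\<^sub>R u + w)) = a * A' (v(i := u)) + A' (v(i := w))" unfolding A'_def up Rlin[OF u w]
        using alternating_multilinearD(1)[OF A Rv i RE[OF u] RE[OF w], where a = a]
          alternating_multilinearD(1)[OF A _ i u w, where v = v and a = a] v by (simp add: algebra_simps)
    }
    {
      fix i j assume i: "i < 2 * n" and j: "j < 2 * n" and ij: "i \<noteq> j \<and> v i = v j"
      show "A' v = 0" using alternating_multilinearD(2)[OF A _ i j, where v = v] alternating_multilinearD(2)[OF A Rv i j] ij v by (simp add: A'_def)
    }
    fix w assume w: "(\<forall>i. w i \<in> E) \<and> (\<forall>i<2 * n. w i = v i)"
    then have "A w = A v" "A (\<lambda>i. R (w i)) = A (\<lambda>i. R (v i))"
      using alternating_multilinearD(3)[OF A, where v = v and w' = w] alternating_multilinearD(3)[OF A, where v = "\<lambda>i. R (v i)" and w' = "\<lambda>i. R (w i)"] v RE by auto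
    then show "A' w = A' v" by (simp add: A'_def)
  qed
  let ?K = "{x \<in> E. \<beta> x = 0}"
  have \<beta>0: "\<beta> 0 = 0" using \<beta>[of 0 0 1] subspace_0[OF E] by simp
  have K: "subspace ?K" unfolding subspace_def
  proof (intro conjI ballI allI)
    show "0 \<in> ?K" using \<beta>0 subspace_0[OF E] by simp
    show "x + y \<in> ?K" if "x \<in> ?K" "y \<in> ?K" for x y using that \<beta>[of x y 1] E by (simp add: subspace_add)
    show "c *\<^sub>R x \<in> ?K" if "x \<in> ?K" for c x using that \<beta>[of x 0 c] \<beta>0 E by (simp add: subspace_scale subspace_0)
  qed
  \<comment> \<open>The basis is adapted to \<open>R\<close>: besides \<open>e\<close> it consists
    of vectors in the kernel of \<open>\<beta>\<close>, which \<open>R\<close> fixes.\<close>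
  obtain C where C: "C \<subseteq> ?K" "independent C" "?K \<subseteq> span C" using maximal_independent_subset by blast
  have sC: "span C = ?K" using C K by (simp add: span_minimal subset_antisym)
  have eC: "e \<notin> span C" using sC e(3) by simp
  have ind: "independent (insert e C)" using C(2) eC by (simp add: independent_insert)
  have "E \<subseteq> span (insert e C)"
  proof
    fix x assume x: "x \<in> E"
    have "(- \<beta> x) *\<^sub>R e + x \<in> ?K" using \<beta>[OF e(1) x, of "- \<beta> x"] e(1,3) x E by (simp add: subspace_diff subspace_scale)
    then have "x - \<beta> x *\<^sub>R e \<in> span C" using sC by simp
    then show "x \<in> span (insert e C)" by (auto simp: span_insert)
  qed
  have CE: "insert e C \<subseteq> E" using C(1) e(1) by auto
  have card: "card (insert e C) = 2 * n" using basis_card_eq_dim[OF CE \<open>E \<subseteq> span (insert e C)\<close> ind] dim by simp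
  obtain b where b: "bij_betw b {..<2 * n} (insert e C)" "\<And>i. b i \<in> E"
    using indexed_basis[OF independent_imp_finite[OF ind] card CE E] by blast
  obtain k where k: "k < 2 * n" "b k = e" using b(1) by (metis bij_betw_def imageE insertI1 lessThan_iff)
  have Rb: "R (b i) = (b(k := t *\<^sub>R e)) i" if i: "i < 2 * n" for i
  proof (cases "i = k")
    case False
    then have "b i \<noteq> e" using b(1) k i by (metis bij_betw_def inj_onD lessThan_iff)
    then have "b i \<in> C" using b(1) i by (metis bij_betwE insertE lessThan_iff)
    then have "\<beta> (b i) = 0" using C by auto
    then show ?thesis using False by (simp add: R_def)
  qed (simp add: k R_def e algebra_simps)
  have bk: "b(k := e) = b" using k by auto
  have te: "t *\<^sub>R e \<in> E" using e(1) E by (simp add: subspace_scale)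
  have b0: "A (b(k := 0)) = 0" using alternating_multilinearD(1)[OF A b(2) k(1), where u = 0 and w = 0 and a = 1] subspace_0[OF E] by simp
  have "A (\<lambda>i. R (b i)) = A (b(k := t *\<^sub>R e))" by (rule alternating_multilinearD(3)[OF A]) (use b te RE Rb in auto)
  also have "\<dots> = t * A b" using alternating_multilinearD(1)[OF A b(2) k(1) e(1), where w = 0 and a = t] subspace_0[OF E] b0 bk by simp
  finally have "A' b = 0" by (simp add: A'_def)
  moreover have "E \<subseteq> span (b ` {..<2 * n})" using \<open>E \<subseteq> span (insert e C)\<close> b(1) by (simp add: bij_betw_def)
  ultimately have "A' v = 0" using alternating_multilinear_zero[where b = b and v = v, OF A' E b(2) _ _ v] by blast
  then have "A (\<lambda>i. R (v i)) = t * A v" by (simp add: A'_def)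
  moreover have "wedge_power n (\<lambda>u v. B u v + t * (\<alpha> u * \<beta> v - \<alpha> v * \<beta> u)) v = wedge_power n (\<lambda>u v. ?B (R u) (R v)) v"
    by (rule wedge_power_cong[OF eq v])
  moreover have "wedge_power n (\<lambda>u v. ?B (R u) (R v)) v = A (\<lambda>i. R (v i))" unfolding A_def by (rule wedge_power_comp)
  ultimately show ?thesis by (simp add: A_def)
qed

section \<open>Darboux bases and non-vanishing of the top power\<close>

definition darboux_coeff :: "nat => nat => real" where
  "darboux_coeff i j = (if even i \<and> j = i + 1 then 1 else if odd i \<and> i = j + 1 then - 1 else 0)"

text \<open>Symplectic Gram-Schmidt: \<open>u\<close> and a partner \<open>w\<close> with
  \<open>B u w = 1\<close> span a plane, and the induction continues on its complement with respect
  to \<open>B\<close>. That complement has dimension smaller by two, and \<open>B\<close> stays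
  non-degenerate on it.\<close>

lemma exists_darboux_basis:
  fixes E :: "'e::euclidean_space set"
  assumes "subspace E" "dim E = 2 * n" "alternating_bilinear E B"
    "\<And>u. u \<in> E ==> u \<noteq> 0 ==> \<exists>v\<in>E. B u v \<noteq> 0"
  shows "\<exists>v. (\<forall>i. v i \<in> E) \<and> (\<forall>i<2 * n. \<forall>j<2 * n. B (v i) (v j) = darboux_coeff i j)"
  using assms
proof (induction n arbitrary: E)
  case 0
  then show ?case by (intro exI[of _ "\<lambda>_. 0"]) (simp add: subspace_0)
next
  case (Suc n)
  note E = Suc.prems(1) and B = Suc.prems(3)
  note BL = alternating_bilinear_left[OF B E] and BR = alternating_bilinear_right[OF B E]
  have alt: "B u u = 0" if "u \<in> E" for u using B that unfolding alternating_bilinear_def by blast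
  have "E \<noteq> {0}" using Suc.prems(2) by auto
  then obtain u where u: "u \<in> E" "u \<noteq> 0" using subspace_0[OF E] by blast
  obtain w0 where w0: "w0 \<in> E" "B u w0 \<noteq> 0" using Suc.prems(4)[OF u] by blast
  define w where "w = (1 / B u w0) *\<^sub>R w0"
  have w: "w \<in> E" using w0 E by (simp add: w_def subspace_scale)
  have uw: "B u w = 1" using w0 BR(2)[OF w0(1) w0(1) u(1)] by (simp add: w_def)
  have wu: "B w u = - 1" using BL(4)[OF w u(1) w] uw by simp
  let ?E = "{x \<in> E. B u x = 0 \<and> B w x = 0}"
  have E': "subspace ?E" unfolding subspace_def using E u w by (auto simp: subspace_add subspace_scale subspace_0 BR)
  \<comment> \<open>Projection onto the \<open>B\<close>-orthogonal complement along the plane of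
    \<open>u\<close> and \<open>w\<close>; the coefficients are forced by \<open>B u w = 1\<close>
    and \<open>B w u = - 1\<close>.\<close>
  define pr where "pr x = x - B u x *\<^sub>R w + B w x *\<^sub>R u" for x
  have prE: "pr x \<in> E" if "x \<in> E" for x using that u w E by (simp add: pr_def subspace_add subspace_diff subspace_scale)
  have Bpr: "B y (pr x) = B y x - B u x * B y w + B w x * B y u" if "x \<in> E" "y \<in> E" for x y
  proof -
    have m: "(- B u x) *\<^sub>R w \<in> E" "B w x *\<^sub>R u \<in> E" "x + (- B u x) *\<^sub>R w \<in> E" using that u w E
      by (simp_all add: subspace_add subspace_diff subspace_scale subspace_neg)
    have "pr x = (x + (- B u x) *\<^sub>R w) + B w x *\<^sub>R u" by (simp add: pr_def)
    then show ?thesis using BR(1)[OF m(3,2) that(2)] BR(1)[OF that(1) m(1) that(2)] BR(2)[OF w w that(2)] BR(2)[OF u(1) u(1) that(2)]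
      by (simp del: scaleR_minus_left)
  qed
  have pr: "pr x \<in> ?E" if "x \<in> E" for x using prE[OF that] Bpr[OF that u(1)] Bpr[OF that w] alt[OF u(1)] alt[OF w] uw wu by simp
  \<comment> \<open>A partner \<open>y\<close> of \<open>x\<close> may be replaced by its
    projection, since \<open>x\<close> is \<open>B\<close>-orthogonal to the plane in which the two
    differ.\<close>
  have nd: "\<exists>v\<in>?E. B x v \<noteq> 0" if x: "x \<in> ?E" "x \<noteq> 0" for x
  proof -
    obtain y where y: "y \<in> E" "B x y \<noteq> 0" using Suc.prems(4)[of x] x by auto
    have "B x u = 0" "B x w = 0" using x BL(4)[of x u x] BL(4)[of x w x] u w by auto
    then have "B x (pr y) = B x y" using Bpr[OF y(1), of x] x by simp
    then show ?thesis using pr[OF y(1)] y(2) by metis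
  qed
  have sp: "span {u, w} \<subseteq> E" using u w E by (simp add: span_minimal)
  have int: "span {u, w} \<inter> ?E = {0}"
  proof (intro equalityI subsetI)
    fix x assume x: "x \<in> span {u, w} \<inter> ?E"
    then obtain a b where ab: "x = a *\<^sub>R u + b *\<^sub>R w" by (auto simp: span_insert span_empty; metis add_diff_cancel_left' diff_add_cancel add.commute)
    have m: "a *\<^sub>R u \<in> E" "b *\<^sub>R w \<in> E" using u w E by (simp_all add: subspace_scale)
    have "B u x = b" "B w x = - a"
      unfolding ab using BR(1)[OF m u(1)] BR(1)[OF m w] BR(2)[OF u(1) u(1) u(1)] BR(2)[OF w w u(1)] BR(2)[OF u(1) u(1) w] BR(2)[OF w w w]
        alt[OF u(1)] alt[OF w] uw wu by simp_all
    then show "x \<in> {0}" using x ab by simp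
  qed (use subspace_0[OF E'] span_zero in auto)
  have "u \<notin> span {w}"
  proof
    assume "u \<in> span {w}"
    then obtain k where "u = k *\<^sub>R w" by (auto simp: span_singleton)
    then show False using uw BL(2)[OF w w w, of k] alt[OF w] by simp
  qed
  moreover have "w \<noteq> 0" using uw BR(3)[OF u(1) u(1) u(1)] by auto
  ultimately have ind: "independent {u, w}" by (simp add: independent_insert)
  have "u \<noteq> w" using uw alt[OF w] by auto
  then have d2: "dim (span {u, w}) = 2" using dim_eq_card_independent[OF ind] by simp
  have "{x + y |x y. x \<in> span {u, w} \<and> y \<in> ?E} = E"
  proof (intro equalityI subsetI)
    fix x assume "x \<in> {x + y |x y. x \<in> span {u, w} \<and> y \<in> ?E}"
    then show "x \<in> E" using sp E by (auto simp: subspace_add)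
  next
    fix x assume x: "x \<in> E"
    have "x = (B u x *\<^sub>R w - B w x *\<^sub>R u) + pr x" by (simp add: pr_def)
    moreover have "B u x *\<^sub>R w - B w x *\<^sub>R u \<in> span {u, w}" by (intro span_diff span_scale span_base) auto
    ultimately show "x \<in> {x + y |x y. x \<in> span {u, w} \<and> y \<in> ?E}" using pr[OF x] by blast
  qed
  then have "dim E + dim (span {u, w} \<inter> ?E) = dim (span {u, w}) + dim ?E" using dim_sums_Int[OF subspace_span E', of "{u, w}"] by simp
  then have "dim ?E = 2 * n" using Suc.prems(2) d2 int by simp
  moreover have "alternating_bilinear ?E B" using B unfolding alternating_bilinear_def by auto
  ultimately obtain v where v: "\<And>i. v i \<in> ?E" "\<And>i j. i < 2 * n ==> j < 2 * n ==> B (v i) (v j) = darboux_coeff i j"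
    using Suc.IH[OF E' _ _ nd] by blast
  define v' where "v' i = (if i = 0 then u else if i = 1 then w else v (i - 2))" for i :: nat
  have "B (v' i) (v' j) = darboux_coeff i j" if ij: "i < 2 * Suc n" "j < 2 * Suc n" for i j
  proof -
    have vu: "B (v k) u = 0" "B (v k) w = 0" "B u (v k) = 0" "B w (v k) = 0" for k
      using v(1)[of k] BL(4)[of "v k" u u] BL(4)[of "v k" w w] u w by auto
    consider "i < 2" "j < 2" | "i < 2" "j \<ge> 2" | "i \<ge> 2" "j < 2" | i' j' where "i = i' + 2" "j = j' + 2"
      by (metis add.commute le_Suc_ex not_le)
    then show ?thesis
    proof cases
      case 1
      then have "i = 0 \<or> i = 1" "j = 0 \<or> j = 1" by auto
      then show ?thesis using alt u w uw wu by (auto simp: v'_def darboux_coeff_def)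
    next
      case 4
      then show ?thesis using v(2)[of i' j'] ij by (auto simp: v'_def darboux_coeff_def)
    qed (use vu in \<open>auto simp: v'_def darboux_coeff_def less_2_cases_iff\<close>)
  qed
  moreover have "v' i \<in> E" for i using v(1) u w by (auto simp: v'_def)
  ultimately show ?case by blast
qed

definition darboux_term :: "nat => (nat => nat) => real" where
  "darboux_term n \<sigma> = of_int (sign \<sigma>) * (\<Prod>i<n. darboux_coeff (\<sigma> (2 * i)) (\<sigma> (2 * i + 1)))"

text \<open>A nonzero term comes from a permutation that maps pairs to pairs. Permuting pairs is even, and
  flipping a pair changes both the sign of the permutation and the sign of one factor.\<close>

lemma darboux_term_nonneg: "\<sigma> permutes {..<2 * n} ==> darboux_term n \<sigma> \<ge> 0"
proof (induction n arbitrary: \<sigma>)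
  case 0
  then show ?case by (simp add: darboux_term_def)
next
  case (Suc n)
  show ?case
  proof (cases "darboux_term (Suc n) \<sigma> = 0")
    case False
    note \<sigma> = Suc.prems
    let ?N = "{..<2 * Suc n}"
    \<comment> \<open>The pair of positions that contains the value \<open>2 * n\<close> is moved to
      the end and then dropped.\<close>
    define k where "k = inv \<sigma> (2 * n)"
    have k: "\<sigma> k = 2 * n" "k < 2 * Suc n"
      using permutes_inverses(1)[OF \<sigma>] permutes_in_image[OF permutes_inv[OF \<sigma>], of "2 * n"] by (auto simp: k_def)
    define j where "j = k div 2"
    have j: "j < Suc n" using k(2) by (simp add: j_def)
    have kj: "k = 2 * j \<or> k = 2 * j + 1" by (auto simp: j_def)
    \<comment> \<open>Exchanges pair number \<open>j\<close> with the last pair. Being built from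
      two transpositions of the same kind it has sign \<open>1\<close>, and on pairs it acts as the
      single exchange \<open>s\<close>.\<close>
    define \<tau> where "\<tau> = tswap (2 * j) (2 * n) \<circ> tswap (2 * j + 1) (2 * n + 1)"
    define s where "s = tswap j n"
    have \<tau>s: "\<tau> (2 * i) = 2 * s i" "\<tau> (2 * i + 1) = 2 * s i + 1" for i by (auto simp: \<tau>_def s_def Transposition.transpose_def)
    have \<tau>: "\<tau> permutes ?N" unfolding \<tau>_def using j by (intro permutes_compose permutes_swap_id) auto
    have sg\<tau>: "sign \<tau> = 1" unfolding \<tau>_def by (simp add: sign_compose permutation_swap_id sign_swap_id)
    define \<sigma>1 where "\<sigma>1 = \<sigma> \<circ> \<tau>"
    have \<sigma>1: "\<sigma>1 permutes ?N" unfolding \<sigma>1_def by (rule permutes_compose[OF \<tau> \<sigma>])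
    have pm: "permutation p" if "p permutes ?N" for p using that permutes_imp_permutation[of ?N p] by simp
    have sg: "sign (p \<circ> q) = sign p * sign q" if "p permutes ?N" "q permutes ?N" for p q
      by (rule sign_compose[OF pm[OF that(1)] pm[OF that(2)]])
    have s: "s permutes {..<Suc n}" unfolding s_def using j by (intro permutes_swap_id) auto
    have T1: "darboux_term (Suc n) \<sigma>1 = darboux_term (Suc n) \<sigma>"
    proof -
      have "darboux_term (Suc n) \<sigma>1 = of_int (sign \<sigma>) * (\<Prod>i<Suc n. darboux_coeff (\<sigma> (2 * s i)) (\<sigma> (2 * s i + 1)))"
        by (simp only: darboux_term_def \<sigma>1_def sg[OF \<sigma> \<tau>] sg\<tau> o_apply \<tau>s mult_1_right)
      also have "(\<Prod>i<Suc n. darboux_coeff (\<sigma> (2 * s i)) (\<sigma> (2 * s i + 1))) = (\<Prod>i<Suc n. darboux_coeff (\<sigma> (2 * i)) (\<sigma> (2 * i + 1)))"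
        using prod.permute[OF s, of "\<lambda>i. darboux_coeff (\<sigma> (2 * i)) (\<sigma> (2 * i + 1))"] by (simp only: o_def)
      finally show ?thesis by (simp only: darboux_term_def)
    qed
    have "\<sigma>1 (2 * n) = 2 * n \<or> \<sigma>1 (2 * n + 1) = 2 * n" using kj k(1) \<tau>s[of n] by (auto simp: \<sigma>1_def s_def)
    moreover have "darboux_coeff (\<sigma>1 (2 * n)) (\<sigma>1 (2 * n + 1)) \<noteq> 0" using False T1 by (auto simp: darboux_term_def)
    \<comment> \<open>A nonzero coefficient at the last pair forces its values to be
      \<open>2 * n\<close> and \<open>2 * n + 1\<close>, in one of the two orders; the second order
      is then repaired by a flip.\<close>
    ultimately have cases: "\<sigma>1 (2 * n) = 2 * n \<and> \<sigma>1 (2 * n + 1) = 2 * n + 1 \<or> \<sigma>1 (2 * n) = 2 * n + 1 \<and> \<sigma>1 (2 * n + 1) = 2 * n"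
      by (auto simp: darboux_coeff_def split: if_splits)
    obtain \<sigma>2 where \<sigma>2: "\<sigma>2 permutes ?N" "\<sigma>2 (2 * n) = 2 * n" "\<sigma>2 (2 * n + 1) = 2 * n + 1"
      "darboux_term (Suc n) \<sigma>2 = darboux_term (Suc n) \<sigma>1"
    proof (cases "\<sigma>1 (2 * n) = 2 * n")
      case True
      then show ?thesis using that[of \<sigma>1] \<sigma>1 cases by auto
    next
      case False
      let ?t = "tswap (2 * n) (2 * n + 1)"
      have t: "?t permutes ?N" by (intro permutes_swap_id) auto
      have "darboux_term (Suc n) (\<sigma>1 \<circ> ?t) = darboux_term (Suc n) \<sigma>1"
      proof -
        have "(\<Prod>i<n. darboux_coeff ((\<sigma>1 \<circ> ?t) (2 * i)) ((\<sigma>1 \<circ> ?t) (2 * i + 1))) = (\<Prod>i<n. darboux_coeff (\<sigma>1 (2 * i)) (\<sigma>1 (2 * i + 1)))"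
          by (rule prod.cong) (auto simp: Transposition.transpose_def)
        moreover have "sign (\<sigma>1 \<circ> ?t) = - sign \<sigma>1" using sg[OF \<sigma>1 t] by (simp add: sign_swap_id)
        moreover have "darboux_coeff ((\<sigma>1 \<circ> ?t) (2 * n)) ((\<sigma>1 \<circ> ?t) (2 * n + 1)) = 1"
            "darboux_coeff (\<sigma>1 (2 * n)) (\<sigma>1 (2 * n + 1)) = - 1"
          using cases False by (auto simp: darboux_coeff_def)
        ultimately show ?thesis unfolding darboux_term_def prod.lessThan_Suc by (simp only:)
      qed
      then show ?thesis using that[of "\<sigma>1 \<circ> ?t"] permutes_compose[OF t \<sigma>1] cases False by auto
    qed
    have "\<sigma>2 permutes {..<2 * n}"
    proof (rule permutes_superset[OF \<sigma>2(1)])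
      fix x assume "x \<in> ?N - {..<2 * n}"
      then have "x = 2 * n \<or> x = 2 * n + 1" by auto
      then show "\<sigma>2 x = x" using \<sigma>2 by auto
    qed
    then have "darboux_term n \<sigma>2 \<ge> 0" by (rule Suc.IH)
    moreover have "darboux_term (Suc n) \<sigma>2 = darboux_term n \<sigma>2" using \<sigma>2 by (simp add: darboux_term_def darboux_coeff_def)
    ultimately show ?thesis using \<sigma>2(4) T1 by simp
  qed simp
qed

text \<open>In a Darboux basis every term of the permutation sum is nonnegative and the identity
  contributes a positive one, so nothing cancels.\<close>

lemma wedge_power_nondegenerate:
  fixes E :: "'e::euclidean_space set"
  assumes "subspace E" "dim E = 2 * n" "alternating_bilinear E B"
    "\<And>u. u \<in> E ==> u \<noteq> 0 ==> \<exists>v\<in>E. B u v \<noteq> 0"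
  shows "\<exists>v. (\<forall>i. v i \<in> E) \<and> wedge_power n B v \<noteq> 0"
proof -
  obtain v where v: "\<And>i. v i \<in> E" "\<And>i j. i < 2 * n ==> j < 2 * n ==> B (v i) (v j) = darboux_coeff i j"
    using exists_darboux_basis[OF assms] by blast
  have "wedge_power n B v = (\<Sum>\<sigma> | \<sigma> permutes {..<2 * n}. darboux_term n \<sigma>) / 2 ^ n"
    unfolding wedge_power_def darboux_term_def
  proof (intro arg_cong2[where f = "(/)"] sum.cong refl arg_cong2[where f = "(*)"] prod.cong)
    fix \<sigma> i assume "\<sigma> \<in> {\<sigma>. \<sigma> permutes {..<2 * n}}" "i \<in> {..<n}"
    then show "B (v (\<sigma> (2 * i))) (v (\<sigma> (2 * i + 1))) = darboux_coeff (\<sigma> (2 * i)) (\<sigma> (2 * i + 1))"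
      using permutes_in_image[of \<sigma> "{..<2 * n}" "2 * i"] permutes_in_image[of \<sigma> "{..<2 * n}" "2 * i + 1"] by (intro v(2)) auto
  qed
  moreover have "(\<Sum>\<sigma> | \<sigma> permutes {..<2 * n}. darboux_term n \<sigma>) > 0"
  proof (rule sum_pos2[where i = id])
    show "finite {\<sigma>. \<sigma> permutes {..<2 * n}}" by (simp add: finite_permutations)
    show "0 < darboux_term n id" by (simp add: darboux_term_def darboux_coeff_def)
  qed (auto simp: darboux_term_nonneg permutes_id)
  ultimately have "wedge_power n B v \<noteq> 0" by simp
  then show ?thesis using v(1) by blast
qed


section \<open>Smoothness of some special functions\<close>

lemma dderiv_field:
  fixes f :: "'a::{real_normed_field,euclidean_space} => 'a"
  assumes "(f has_field_derivative D) (at x)"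
  shows "dderiv f x u = D * u"
  by (rule dderiv_eq[of UNIV UNIV]) (use assms in \<open>auto simp: has_field_derivative_def\<close>)

text \<open>Over a field a directional derivative is the field derivative times the direction, so
  closure under differentiation and under constant factors is enough.\<close>

lemma smooth_on_field_coinduct:
  fixes f :: "'a::{real_normed_field,euclidean_space} => 'a"
  assumes S: "open S" and f: "C f"
    and D: "\<And>f. C f ==> \<exists>f'. C f' \<and> (\<forall>x\<in>S. (f has_field_derivative f' x) (at x))"
    and M: "\<And>f c. C f ==> C (\<lambda>x. f x * c)"
  shows "smooth_on UNIV S f"
proof (rule smooth_on_coinduct[of _ _ C])
  show "rel_open UNIV S" using S by simp
  fix f assume "C f"
  then obtain f' where f': "C f'" "\<And>x. x \<in> S ==> (f has_field_derivative f' x) (at x)" using D by blast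
  show "f differentiable_on S" unfolding differentiable_on_def
    using f'(2) field_differentiable_imp_differentiable differentiable_at_withinI field_differentiable_def by blast
  fix u
  show "\<exists>g. C g \<and> (\<forall>x\<in>S. dderiv f x u = g x)" using M[OF f'(1), of u] dderiv_field[OF f'(2), of _ u] by blast
qed (rule f)

lemma smooth_on_inverse: "smooth_on UNIV (- {0 :: 'a::{real_normed_field,euclidean_space}}) inverse"
proof (rule smooth_on_field_coinduct[where C = "\<lambda>f. \<exists>c n. f = (\<lambda>x. c * inverse x ^ n)"])
  show "\<exists>c n. inverse = (\<lambda>x::'a. c * inverse x ^ n)" by (rule exI[of _ 1], rule exI[of _ 1]) simp
  fix f :: "'a => 'a" assume "\<exists>c n. f = (\<lambda>x. c * inverse x ^ n)"
  then obtain c n where f: "f = (\<lambda>x. c * inverse x ^ n)" by blast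
  have "(f has_field_derivative (- c * of_nat n) * inverse x ^ (n + 1)) (at x)" if "x \<in> - {0}" for x
  proof -
    have "((\<lambda>x. c * inverse x ^ n) has_field_derivative
        c * (of_nat n * (- (inverse x ^ Suc (Suc 0)) * inverse x ^ (n - Suc 0)))) (at x)"
      using that by (intro DERIV_cmult DERIV_power DERIV_inverse) simp
    then show ?thesis unfolding f by (cases n) (simp_all add: mult_ac)
  qed
  then show "\<exists>f'. (\<exists>c n. f' = (\<lambda>x. c * inverse x ^ n)) \<and> (\<forall>x\<in>- {0}. (f has_field_derivative f' x) (at x))"
    by blast
  show "\<exists>c' n. (\<lambda>x. f x * k) = (\<lambda>x. c' * inverse x ^ n)" for k
    unfolding f by (rule exI[of _ "c * k"], rule exI[of _ n]) (simp add: mult_ac)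
qed auto

lemma smooth_on_exp: "smooth_on UNIV UNIV (exp :: 'a::{real_normed_field,banach,euclidean_space} => 'a)"
proof (rule smooth_on_field_coinduct[where C = "\<lambda>f. \<exists>c. f = (\<lambda>x. c * exp x)"])
  show "\<exists>c. exp = (\<lambda>x::'a. c * exp x)" by (rule exI[of _ 1]) simp
  fix f :: "'a => 'a" assume "\<exists>c. f = (\<lambda>x. c * exp x)"
  then obtain c where f: "f = (\<lambda>x. c * exp x)" by blast
  have "\<forall>x\<in>UNIV. (f has_field_derivative c * exp x) (at x)" unfolding f by (auto intro!: derivative_eq_intros)
  then show "\<exists>f'. (\<exists>c. f' = (\<lambda>x. c * exp x)) \<and> (\<forall>x\<in>UNIV. (f has_field_derivative f' x) (at x))" by blast
  show "\<exists>c'. (\<lambda>x. f x * k) = (\<lambda>x. c' * exp x)" for k unfolding f by (rule exI[of _ "c * k"]) (simp add: mult_ac)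
qed simp

lemma smooth_on_field_primitive:
  fixes f :: "'a::{real_normed_field,euclidean_space} => 'a"
  assumes S: "open S" and f: "\<And>x. x \<in> S ==> (f has_field_derivative f' x) (at x)" and f': "smooth_on UNIV S f'"
  shows "smooth_on UNIV S f"
proof (rule smooth_onI)
  have So: "rel_open UNIV S" using S by simp
  show "f differentiable_on S" unfolding differentiable_on_def
    using f field_differentiable_imp_differentiable differentiable_at_withinI field_differentiable_def by blast
  fix u :: 'a
  show "smooth_on UNIV S (\<lambda>x. dderiv f x u)" by (rule smooth_on_cong[OF So smooth_on_mult[OF So f' smooth_on_const[of UNIV S u]]])
      (simp_all add: dderiv_field[OF f])
qed

lemma smooth_on_ln: "smooth_on UNIV {0<..} (ln :: real => real)" by (rule smooth_on_field_primitive[where f' = inverse])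
    (auto intro!: smooth_on_subset[OF smooth_on_inverse] derivative_eq_intros simp: divide_inverse)

lemma smooth_on_Ln: "smooth_on UNIV (- \<real>\<^sub>\<le>\<^sub>0) Ln" by (rule smooth_on_field_primitive[where f' = inverse])
    (auto intro!: smooth_on_subset[OF smooth_on_inverse] has_field_derivative_Ln)

lemma smooth_on_Arg: "smooth_on UNIV (- \<real>\<^sub>\<le>\<^sub>0) Arg"
proof (rule smooth_on_cong)
  show "rel_open UNIV (- \<real>\<^sub>\<le>\<^sub>0 :: complex set)" by (simp add: open_Compl)
  then show "smooth_on UNIV (- \<real>\<^sub>\<le>\<^sub>0) (\<lambda>z. Im (Ln z))"
    by (rule smooth_on_compose_linear[OF _ smooth_on_Ln bounded_linear_Im])
  show "Arg z = Im (Ln z)" if "z \<in> - \<real>\<^sub>\<le>\<^sub>0" for z using that by (intro Arg_eq_Im_Ln) auto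
qed

lemma smooth_on_sqrt: "smooth_on UNIV {0<..} sqrt"
proof (rule smooth_on_cong)
  show o: "rel_open UNIV {0::real<..}" by simp
  have "smooth_on UNIV {0<..} (\<lambda>t::real. (1/2) *\<^sub>R ln t)"
    by (rule smooth_on_compose_linear[OF o smooth_on_ln bounded_linear_scaleR_right])
  then show "smooth_on UNIV {0<..} (\<lambda>t::real. exp ((1/2) *\<^sub>R ln t))"
    by (intro smooth_on_compose[OF o, of UNIV UNIV _ exp] smooth_on_exp) auto
  show "sqrt t = exp ((1/2) *\<^sub>R ln t)" if "t \<in> {0<..}" for t using that by (simp add: powr_half_sqrt[symmetric] powr_def)
qed

lemma smooth_on_cis: "smooth_on UNIV UNIV cis"
proof -
  have o: "rel_open UNIV (UNIV :: real set)" by simp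
  have "bounded_linear (\<lambda>t. \<i> * complex_of_real t)" by (intro bounded_linear_const_mult bounded_linear_of_real)
  then have "smooth_on UNIV UNIV (\<lambda>t. exp (\<i> * complex_of_real t))"
    by (intro smooth_on_compose[OF o, of UNIV UNIV _ exp] smooth_on_exp smooth_on_linear) auto
  then show ?thesis by (rule smooth_on_cong[OF o]) (simp add: cis_conv_exp)
qed

subsection \<open>Cutoff functions\<close>

definition flat_exp :: "real => real" where
  "flat_exp t = (if t > 0 then exp (- inverse t) else 0)"

lemma poly_exp_tendsto_0: "((\<lambda>x::real. x ^ k * poly p x * exp (- x)) \<longlongrightarrow> 0) at_top"
proof (induction p arbitrary: k)
  case 0
  then show ?case by simp
next
  case (pCons a p)
  have "((\<lambda>x::real. a * (x ^ k / exp x) + x ^ Suc k * poly p x * exp (- x)) \<longlongrightarrow> a * 0 + 0) at_top"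
    by (intro tendsto_intros tendsto_power_div_exp_0 pCons.IH)
  then show ?case by (simp add: exp_minus divide_inverse algebra_simps)
qed

text \<open>The family of functions \<open>p(1/t) exp(-1/t)\<close>, extended by zero, is closed
  under differentiation, with \<open>p\<close> replaced by \<open>x\<^sup>2 (p - p')\<close>. At
  \<open>0\<close> exponential decay beats every polynomial in \<open>1/t\<close>, including the
  extra factor from the difference quotient.\<close>

lemma flat_exp_poly_derivative:
  fixes p :: "real poly"
  defines "F \<equiv> \<lambda>p t. if t > 0 then poly p (inverse t) * exp (- inverse t) else 0"
  shows "(F p has_field_derivative F ([:0, 0, 1:] * (p - pderiv p)) t) (at t)"
proof -
  consider "t > 0" | "t < 0" | "t = 0" by linarith
  then show ?thesis
  proof cases
    case 1
    have "((\<lambda>t. poly p (inverse t) * exp (- inverse t)) has_field_derivative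
        F ([:0, 0, 1:] * (p - pderiv p)) t) (at t)"
      using 1 by (auto intro!: derivative_eq_intros DERIV_chain2[OF poly_DERIV] simp: F_def power2_eq_square algebra_simps)
    then show ?thesis by (rule has_field_derivative_transform_within_open[of _ _ _ "{0<..}"]) (use 1 in \<open>auto simp: F_def\<close>)
  next
    case 2
    have "((\<lambda>t::real. 0) has_field_derivative F ([:0, 0, 1:] * (p - pderiv p)) t) (at t)" using 2 by (simp add: F_def)
    then show ?thesis by (rule has_field_derivative_transform_within_open[of _ _ _ "{..<0}"]) (use 2 in \<open>auto simp: F_def\<close>)
  next
    case 3
    have "((\<lambda>t. inverse t ^ 1 * poly p (inverse t) * exp (- inverse t)) \<longlongrightarrow> 0) (at_right (0::real))"
      by (rule filterlim_compose[OF poly_exp_tendsto_0 filterlim_inverse_at_top_right])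
    then have r: "((\<lambda>t. F p t / t) \<longlongrightarrow> 0) (at_right 0)"
      by (rule Lim_transform_eventually[OF _ eventually_mono[OF eventually_at_right_less]])
        (auto simp: F_def divide_inverse mult_ac)
    have l: "((\<lambda>t. F p t / t) \<longlongrightarrow> 0) (at_left 0)" by (rule Lim_transform_eventually[OF tendsto_const])
        (auto simp: F_def eventually_at_filter)
    have "((\<lambda>t. F p t / t) \<longlongrightarrow> 0) (at 0)" using r l by (simp add: filterlim_at_split)
    then show ?thesis using 3 by (simp add: has_field_derivative_iff F_def)
  qed
qed

lemma smooth_on_flat_exp: "smooth_on UNIV UNIV flat_exp"
proof (rule smooth_on_field_coinduct[where C = "\<lambda>f. \<exists>p. f = (\<lambda>t. if t > 0 then poly p (inverse t) * exp (- inverse t) else 0)"])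
  show "\<exists>p. flat_exp = (\<lambda>t. if t > 0 then poly p (inverse t) * exp (- inverse t) else 0)"
    by (rule exI[of _ 1]) (simp add: flat_exp_def fun_eq_iff)
  fix f :: "real => real" assume "\<exists>p. f = (\<lambda>t. if t > 0 then poly p (inverse t) * exp (- inverse t) else 0)"
  then obtain p where f: "f = (\<lambda>t. if t > 0 then poly p (inverse t) * exp (- inverse t) else 0)" by blast
  show "\<exists>f'. (\<exists>p. f' = (\<lambda>t. if t > 0 then poly p (inverse t) * exp (- inverse t) else 0)) \<and>
      (\<forall>x\<in>UNIV. (f has_field_derivative f' x) (at x))"
    unfolding f using flat_exp_poly_derivative[of p] by blast
  show "\<exists>p. (\<lambda>x. f x * c) = (\<lambda>t. if t > 0 then poly p (inverse t) * exp (- inverse t) else 0)" for c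
    unfolding f by (rule exI[of _ "smult c p"]) (auto simp: fun_eq_iff)
qed simp

lemma flat_exp_nonneg: "flat_exp t \<ge> 0" and flat_exp_pos: "t > 0 ==> flat_exp t > 0"
  and flat_exp_zero: "t \<le> 0 ==> flat_exp t = 0"
  by (auto simp: flat_exp_def)

lemma flat_exp_mono: "t \<le> t' ==> flat_exp t \<le> flat_exp t'" by (auto simp: flat_exp_def le_imp_inverse_le)

definition cutoff :: "real => real => real => real" where
  "cutoff \<alpha> \<beta> t = flat_exp (\<beta> - t) / (flat_exp (\<beta> - t) + flat_exp (t - \<alpha>))"

context
  fixes \<alpha> \<beta> :: real
  assumes ab: "\<alpha> < \<beta>"
begin

lemma cutoff_denominator: "flat_exp (\<beta> - t) + flat_exp (t - \<alpha>) > 0"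
proof (cases "t < \<beta>")
  case True
  then show ?thesis using flat_exp_pos[of "\<beta> - t"] flat_exp_nonneg[of "t - \<alpha>"] by simp
next
  case False
  then show ?thesis using flat_exp_pos[of "t - \<alpha>"] flat_exp_nonneg[of "\<beta> - t"] ab by simp
qed

lemma cutoff_bounds: "0 \<le> cutoff \<alpha> \<beta> t" "cutoff \<alpha> \<beta> t \<le> 1"
  using cutoff_denominator[of t] flat_exp_nonneg by (auto simp: cutoff_def divide_simps)

lemma cutoff_one: "t \<le> \<alpha> ==> cutoff \<alpha> \<beta> t = 1" using cutoff_denominator[of t] by (simp add: cutoff_def flat_exp_zero)

lemma cutoff_zero: "\<beta> \<le> t ==> cutoff \<alpha> \<beta> t = 0" by (simp add: cutoff_def flat_exp_zero)

text \<open>Cross multiplication by the positive denominators cancels a common product and leaves an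
  inequality between two products of values of the monotone function
  \<open>flat_exp\<close>.\<close>

lemma cutoff_antimono:
  assumes "t \<le> t'"
  shows "cutoff \<alpha> \<beta> t' \<le> cutoff \<alpha> \<beta> t"
proof -
  have "flat_exp (\<beta> - t') * flat_exp (t - \<alpha>) \<le> flat_exp (\<beta> - t) * flat_exp (t' - \<alpha>)"
    using assms by (intro mult_mono flat_exp_mono flat_exp_nonneg) auto
  then have "flat_exp (\<beta> - t') * (flat_exp (\<beta> - t) + flat_exp (t - \<alpha>)) \<le> flat_exp (\<beta> - t) * (flat_exp (\<beta> - t') + flat_exp (t' - \<alpha>))"
    by (simp add: algebra_simps)
  then show ?thesis unfolding cutoff_def using cutoff_denominator[of t] cutoff_denominator[of t'] by (simp add: divide_le_eq le_divide_eq mult_ac)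
qed

lemma smooth_on_cutoff: "smooth_on UNIV UNIV (cutoff \<alpha> \<beta>)"
proof -
  have o: "rel_open UNIV (UNIV :: real set)" by simp
  have lin: "smooth_on UNIV UNIV (\<lambda>t. \<beta> - t)" "smooth_on UNIV UNIV (\<lambda>t. t - \<alpha>)"
    by (intro smooth_on_diff[OF o] smooth_on_const smooth_on_linear[OF o] bounded_linear_ident; simp)+
  have f: "smooth_on UNIV UNIV (\<lambda>t. flat_exp (\<beta> - t))" "smooth_on UNIV UNIV (\<lambda>t. flat_exp (t - \<alpha>))"
    by (rule smooth_on_compose[OF o o _ lin(1) smooth_on_flat_exp] smooth_on_compose[OF o o _ lin(2) smooth_on_flat_exp]; simp)+
  have d: "smooth_on UNIV UNIV (\<lambda>t. flat_exp (\<beta> - t) + flat_exp (t - \<alpha>))" by (rule smooth_on_add[OF o f])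
  have "smooth_on UNIV UNIV (\<lambda>t. inverse (flat_exp (\<beta> - t) + flat_exp (t - \<alpha>)))"
    by (rule smooth_on_compose[OF o _ _ d smooth_on_inverse]) (use cutoff_denominator in \<open>auto simp: less_imp_neq[symmetric] intro: less_imp_neq\<close>)
  from smooth_on_mult[OF o f(1) this] show ?thesis by (rule smooth_on_cong[OF o]) (simp add: cutoff_def divide_inverse)
qed

end

text \<open>Near zero the function is \<open>ln \<bar>h\<bar>\<close>, far away it is \<open>\<bar>h\<bar>\<close>. Its derivative does not vanish in between because the
  cutoff decreases while \<open>ln \<bar>h\<bar> < \<bar>h\<bar>\<close>.\<close>

lemma log_profile:
  fixes a :: real
  assumes a: "0 < a" "a < 1"
  obtains G \<gamma> w :: "real => real" and \<delta> :: real
  where "\<And>h. h \<noteq> 0 ==> (G has_real_derivative \<gamma> h) (at h)" "smooth_on UNIV (- {0}) G" "smooth_on UNIV (- {0}) \<gamma>"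
    "smooth_on UNIV UNIV w" "\<And>h. h \<noteq> 0 ==> w h = h * \<gamma> h" "\<And>h. \<bar>h\<bar> < 1 ==> w h > 0"
    "\<And>h. \<bar>h\<bar> \<ge> a ==> G h = \<bar>h\<bar>" "\<delta> > 0" "\<And>h. h \<noteq> 0 ==> \<bar>h\<bar> < \<delta> ==> G h = ln \<bar>h\<bar>"
proof -
  \<comment> \<open>The construction runs in the variable \<open>t = h\<^sup>2\<close>, so the
    thresholds are the squares of \<open>a / 2\<close> and \<open>a\<close>; evenness in
    \<open>h\<close> then comes for free.\<close>
  define \<alpha> \<beta> where "\<alpha> = (a / 2)\<^sup>2" and "\<beta> = a\<^sup>2"
  have ab: "\<alpha> < \<beta>" using a by (simp add: \<alpha>_def \<beta>_def power2_eq_square)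
  define S where "S = cutoff \<alpha> \<beta>"
  \<comment> \<open>In the variable \<open>t\<close> the function \<open>ln \<bar>h\<bar>\<close> is
    \<open>ln t / 2\<close> and \<open>\<bar>h\<bar>\<close> is \<open>sqrt t\<close>; the cutoff
    interpolates between them.\<close>
  define K where "K t = S t * (ln t / 2) + (1 - S t) * sqrt t" for t
  have o: "rel_open UNIV {0::real<..}" and o1: "rel_open UNIV (UNIV :: real set)" and o0: "rel_open UNIV (- {0::real})" by auto
  have Ss: "smooth_on UNIV UNIV S" unfolding S_def by (rule smooth_on_cutoff[OF ab])
  define S' where "S' t = dderiv S t 1" for t
  have S': "(S has_real_derivative S' t) (at t)" for t using DERIV_line[OF o1 smooth_on_differentiable[OF Ss], of 0 t 1] by (simp add: S'_def)
  have S'_nonpos: "S' t \<le> 0" for t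
  proof (rule ccontr)
    assume "\<not> S' t \<le> 0"
    then obtain d where "d > 0" "\<And>h. 0 < h ==> h < d ==> S t < S (t + h)" using DERIV_pos_inc_right[OF S'[of t]] by auto
    from this(2)[of "d / 2"] this(1) show False using cutoff_antimono[OF ab, of t "t + d / 2"] by (simp add: S_def)
  qed
  define K' where "K' t = S' t * (ln t / 2 - sqrt t) + S t / (2 * t) + (1 - S t) / (2 * sqrt t)" for t
  have K': "(K has_real_derivative K' t) (at t)" if "t > 0" for t unfolding K_def K'_def using that
    by (auto intro!: derivative_eq_intros S' simp: divide_simps) (simp add: algebra_simps)
  have lnK: "smooth_on UNIV {0<..} (\<lambda>t::real. (1/2) *\<^sub>R ln t)"
    by (rule smooth_on_compose_linear[OF o smooth_on_ln bounded_linear_scaleR_right])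
  have S0: "smooth_on UNIV {0<..} S" by (rule smooth_on_subset[OF Ss]) simp
  have "smooth_on UNIV {0<..} (\<lambda>t. S t * ((1/2) *\<^sub>R ln t) + (1 - S t) * sqrt t)"
    by (intro smooth_on_add[OF o] smooth_on_mult[OF o] S0 lnK smooth_on_sqrt smooth_on_diff[OF o] smooth_on_const) simp
  then have Ks: "smooth_on UNIV {0<..} K" by (rule smooth_on_cong[OF o]) (simp add: K_def)
  define G where "G h = K (h\<^sup>2)" for h
  define \<gamma> where "\<gamma> h = 2 * h * K' (h\<^sup>2)" for h
  \<comment> \<open>Near \<open>0\<close> the product \<open>h * \<gamma> h\<close> is constantly
    \<open>1\<close>, because \<open>\<gamma>\<close> is there the derivative of
    \<open>ln \<bar>h\<bar>\<close>; hence the value at \<open>0\<close>.\<close>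
  define w where "w h = (if h = 0 then 1 else h * \<gamma> h)" for h
  have G\<gamma>: "(G has_real_derivative \<gamma> h) (at h)" if "h \<noteq> 0" for h
  proof -
    have "((\<lambda>h. K (h\<^sup>2)) has_real_derivative K' (h\<^sup>2) * (2 * h)) (at h)"
      by (rule DERIV_chain2[OF K']) (use that in \<open>auto intro!: derivative_eq_intros\<close>)
    then show ?thesis by (simp add: G_def[abs_def] \<gamma>_def mult_ac)
  qed
  have sq: "smooth_on UNIV (- {0}) (\<lambda>h::real. h\<^sup>2)"
    unfolding power2_eq_square by (intro smooth_on_mult[OF o0] smooth_on_linear[OF o0] bounded_linear_ident)
  have Gs: "smooth_on UNIV (- {0}) G" unfolding G_def by (rule smooth_on_compose[OF o0 o _ sq Ks]) auto
  have \<gamma>s: "smooth_on UNIV (- {0}) \<gamma>"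
    by (rule smooth_on_cong[OF o0 smooth_on_dderiv[OF Gs, of 1]]) (simp_all add: dderiv_field[OF G\<gamma>])
  have Gln: "G h = ln \<bar>h\<bar>" if "h \<noteq> 0" "\<bar>h\<bar> < a / 2" for h
  proof -
    have "h\<^sup>2 \<le> \<alpha>" unfolding \<alpha>_def using that by (intro power2_le_iff_abs_le[THEN iffD2]) auto
    then have "S (h\<^sup>2) = 1" unfolding S_def by (rule cutoff_one[OF ab])
    then show ?thesis using that ln_realpow[of "\<bar>h\<bar>" 2] by (simp add: G_def K_def)
  qed
  have w1: "w h = 1" if "\<bar>h\<bar> < a / 2" for h
  proof (cases "h = 0")
    case False
    have "(G has_real_derivative 1 / h) (at h)"
    proof (rule has_field_derivative_transform_within_open)
      show "((\<lambda>h. ln \<bar>h\<bar>) has_real_derivative 1 / h) (at h)"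
      proof (cases "h > 0")
        case True
        show ?thesis by (rule has_field_derivative_transform_within_open[where f = ln and S = "{0<..}"])
            (use True in \<open>auto intro!: derivative_eq_intros\<close>)
      next
        case False
        with \<open>h \<noteq> 0\<close> have h: "h < 0" by simp
        show ?thesis by (rule has_field_derivative_transform_within_open[where f = "\<lambda>h. ln (- h)" and S = "{..<0}"])
            (use h in \<open>auto intro!: derivative_eq_intros simp: divide_simps\<close>)
      qed
      show "open ({- (a / 2)<..<a / 2} - {0})" by auto
    qed (use False that Gln in auto)
    then have "\<gamma> h = 1 / h" using DERIV_unique G\<gamma>[OF False] by blast
    then show ?thesis using False by (simp add: w_def)
  qed (simp add: w_def)
  have ws: "smooth_on UNIV UNIV w"
  proof (rule smooth_on_local[OF o1])
    fix h :: real
    show "\<exists>T. rel_open UNIV T \<and> h \<in> T \<and> smooth_on UNIV T w"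
    proof (cases "h = 0")
      case True
      have ob: "rel_open UNIV (ball 0 (a / 2) :: real set)" by simp
      have "smooth_on UNIV (ball 0 (a / 2)) w" by (rule smooth_on_cong[OF ob smooth_on_const[of UNIV _ 1]]) (auto simp: w1)
      then show ?thesis using ob True a by (intro exI[of _ "ball 0 (a / 2)"]) auto
    next
      case False
      have "smooth_on UNIV (- {0}) w"
        by (rule smooth_on_cong[OF o0 smooth_on_mult[OF o0 smooth_on_linear[OF o0 bounded_linear_ident] \<gamma>s]]) (simp add: w_def)
      then show ?thesis using o0 False by (intro exI[of _ "- {0}"]) auto
    qed
  qed
  have wpos: "w h > 0" if "\<bar>h\<bar> < 1" for h
  proof (cases "h = 0")
    case False
    define t where "t = h\<^sup>2"
    have t: "0 < t" "t < 1" using False that by (auto simp: t_def abs_square_less_1)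
    have s: "0 \<le> S t" "S t \<le> 1" unfolding S_def by (rule cutoff_bounds[OF ab])+
    \<comment> \<open>For \<open>t < 1\<close> the logarithm is negative. Together with
      \<open>S' t \<le> 0\<close> this makes the contribution of the derivative of the cutoff
      nonnegative.\<close>
    have "ln t / 2 - sqrt t \<le> 0" using t ln_less_zero[of t] real_sqrt_gt_zero[of t] by linarith
    then have "0 \<le> S' t * (ln t / 2 - sqrt t)" using S'_nonpos[of t] by (simp add: mult_nonpos_nonpos)
    then have "0 \<le> 2 * t * (S' t * (ln t / 2 - sqrt t))" using t by simp
    moreover have "0 < S t + (1 - S t) * sqrt t"
    proof (cases "S t = 0")
      case False
      then show ?thesis using s t by (intro add_pos_nonneg) auto
    qed (use t in simp)
    moreover have "w h = 2 * t * (S' t * (ln t / 2 - sqrt t)) + (S t + (1 - S t) * (t / sqrt t))"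
      using False t by (simp add: w_def \<gamma>_def K'_def t_def[symmetric] power2_eq_square[symmetric] field_simps)
        (simp add: t_def power2_eq_square algebra_simps)?
    ultimately show ?thesis using t by (simp add: real_div_sqrt)
  qed (simp add: w_def)
  have Gabs: "G h = \<bar>h\<bar>" if "\<bar>h\<bar> \<ge> a" for h
  proof -
    have "\<beta> \<le> h\<^sup>2" unfolding \<beta>_def using that a by (simp add: power2_le_iff_abs_le abs_le_square_iff[symmetric])
    then have "S (h\<^sup>2) = 0" unfolding S_def by (rule cutoff_zero[OF ab])
    then show ?thesis by (simp add: G_def K_def)
  qed
  show ?thesis by (rule that[of G \<gamma> w "a / 2", OF G\<gamma> Gs \<gamma>s ws _ wpos Gabs _ Gln]) (use a in \<open>auto simp: w_def\<close>)
qed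


section \<open>Polar caps and cylinders\<close>

lemma openin_flat_UNIV [simp]: "open_in (flat UNIV) D \<longleftrightarrow> open D" by (simp add: mfd_openin)

lemma smooth_at_flat_preimage:
  assumes M: "premanifold M" and f: "smooth_vec M f p" and D: "open D" "f p \<in> D"
  obtains S where "open_in M S" "p \<in> S" "\<And>q. q \<in> S ==> f q \<in> D"
proof -
  have p: "p \<in> points M" using smooth_at_points[OF f M] by simp
  then obtain c where c: "c \<in> Atlas M" "p \<in> fst c" by (auto simp: points_def)
  obtain T where T: "rel_open (Model M) T" "snd c p \<in> T" "T \<subseteq> img c" "smooth_on (Model M) T (\<lambda>x. f (chart_inv c x))"
    by (rule smooth_at_flatD[OF M subspace_UNIV f c]) blast
  let ?T = "T \<inter> (\<lambda>x. f (chart_inv c x)) -` D"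
  have "rel_open (Model M) ?T" by (rule rel_open_preimage[OF T(1) smooth_on_continuous[OF T(4)], of UNIV]) (use D in auto)
  then have "open_in M (chart_inv c ` ?T)" using T(3) by (intro openin_chart_inv_image[OF M c(1)]) auto
  moreover have "p \<in> chart_inv c ` ?T" using T(2) D(2) chart_inv_left[OF M c] by (intro image_eqI[of _ _ "snd c p"]) auto
  ultimately show ?thesis using that by blast
qed

lemma smooth_at_into_chart:
  assumes M: "premanifold M" and d: "d \<in> Atlas N" and S: "open_in M S" "p \<in> S"
    and f: "\<And>q. q \<in> S ==> f q \<in> fst d" "smooth_vec M (\<lambda>q. snd d (f q)) p"
  shows "smooth_at M N f p"
proof -
  have p: "p \<in> points M" using smooth_at_points[OF f(2) M] by simp
  then obtain c where c: "c \<in> Atlas M" "p \<in> fst c" by (auto simp: points_def)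
  obtain T where T: "rel_open (Model M) T" "snd c p \<in> T" "T \<subseteq> img c" "smooth_on (Model M) T (\<lambda>x. snd d (f (chart_inv c x)))"
    by (rule smooth_at_flatD[OF M subspace_UNIV f(2) c]) blast
  let ?T = "T \<inter> img_on c S"
  have TT: "rel_open (Model M) ?T" by (rule rel_open_Int[OF T(1) rel_open_chart_image[OF M S(1) c(1)]])
  show ?thesis
  proof (rule smooth_atI[OF c(1) d c(2) TT])
    show "f (chart_inv c x) \<in> fst d" if "x \<in> ?T" for x using that f(1) chart_inv_left[OF M c(1)] by auto
    show "smooth_on (Model M) ?T (\<lambda>x. snd d (f (chart_inv c x)))" by (rule smooth_on_subset[OF T(4)]) blast
  qed (use T c S in auto)
qed

section \<open>Height and chart of a polar cap\<close>

lemma points_cap: "points (cap s \<epsilon>) = {(z, h). (cmod z)\<^sup>2 + (h - s)\<^sup>2 = 1 \<and> \<bar>h\<bar> < \<epsilon>}"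
  by (simp add: cap_def points_def)

lemma cap_simps [simp]: "Model (cap s \<epsilon>) = UNIV" "Atlas (cap s \<epsilon>) = {(points (cap s \<epsilon>), fst)}"
  by (simp_all add: points_cap) (simp_all add: cap_def)

locale polar_cap =
  fixes s \<epsilon> :: real
  assumes s: "s = 1 \<or> s = - 1" and eps: "0 < \<epsilon>" "\<epsilon> \<le> 1"
begin

abbreviation Cap where "Cap \<equiv> cap s \<epsilon>"
abbreviation Cyl where "Cyl \<equiv> cylinder \<epsilon>"

lemma height: "p \<in> points Cap ==> snd p = s * (1 - sqrt (1 - (cmod (fst p))\<^sup>2))"
  using cap_height[of s \<epsilon> "fst p" "snd p"] s eps by auto

lemma ss: "s * s = 1" "s * (s * x) = x" using s by auto

lemma cmod_cap: "p \<in> points Cap ==> (cmod (fst p))\<^sup>2 < 1"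
proof -
  assume p: "p \<in> points Cap"
  then have "snd p \<noteq> s" "(cmod (fst p))\<^sup>2 = 1 - (snd p - s)\<^sup>2" using s eps by (auto simp: points_cap)
  then show ?thesis by simp
qed

text \<open>The bound \<open>2 * \<epsilon> - \<epsilon>\<^sup>2\<close> is the squared radius of
  the latitude circle at height \<open>\<epsilon>\<close> from the pole. With
  \<open>\<epsilon> \<le> 1\<close> the cap stays within a hemisphere, where this radius increases
  with the distance from the pole.\<close>

lemma cap_image: "fst ` points Cap = {z. (cmod z)\<^sup>2 < 2 * \<epsilon> - \<epsilon>\<^sup>2}"
proof (intro equalityI subsetI)
  fix z assume "z \<in> fst ` points Cap"
  then obtain h where zh: "(z, h) \<in> points Cap" by auto
  define r where "r = sqrt (1 - (cmod z)\<^sup>2)"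
  have r: "r \<ge> 0" "r\<^sup>2 = 1 - (cmod z)\<^sup>2" using cmod_cap[OF zh] by (auto simp: r_def)
  have "\<bar>h\<bar> = \<bar>1 - r\<bar>" using height[OF zh] s by (auto simp: r_def)
  then have "1 - r < \<epsilon>" using zh by (auto simp: points_cap)
  then have "(1 - \<epsilon>)\<^sup>2 < r\<^sup>2" using eps by (intro power_strict_mono) auto
  then show "z \<in> {z. (cmod z)\<^sup>2 < 2 * \<epsilon> - \<epsilon>\<^sup>2}" using r(2) by (simp add: power2_eq_square algebra_simps)
next
  fix z assume z: "z \<in> {z. (cmod z)\<^sup>2 < 2 * \<epsilon> - \<epsilon>\<^sup>2}"
  define r where "r = sqrt (1 - (cmod z)\<^sup>2)"
  have "(1 - \<epsilon>)\<^sup>2 < 1 - (cmod z)\<^sup>2" using z by (simp add: power2_eq_square algebra_simps)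
  then have r: "1 - \<epsilon> < r" unfolding r_def by (rule real_less_rsqrt)
  have nn: "0 \<le> 1 - (cmod z)\<^sup>2" using \<open>(1 - \<epsilon>)\<^sup>2 < 1 - (cmod z)\<^sup>2\<close> by (meson less_imp_le order_trans zero_le_power2)
  have r1: "r \<le> 1" unfolding r_def by simp
  have r2: "r\<^sup>2 = 1 - (cmod z)\<^sup>2" using nn by (simp add: r_def)
  have "(s * (1 - r) - s)\<^sup>2 = r\<^sup>2" using s by (auto simp: power2_eq_square algebra_simps)
  then have "(z, s * (1 - r)) \<in> points Cap" using r r1 r2 s by (auto simp: points_cap abs_mult)
  then show "z \<in> fst ` points Cap" by force
qed

lemma cap_inj: "inj_on fst (points Cap)" by (intro inj_onI) (metis height prod_eq_iff)

lemma open_cap_image: "open (fst ` points Cap)" unfolding cap_image by (intro open_Collect_less continuous_intros)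

lemma mfd_cap: "premanifold Cap"
proof -
  have o: "rel_open UNIV (fst ` points Cap)" using open_cap_image by simp
  have "smooth_on UNIV (fst ` points Cap) (\<lambda>x. fst (inv_into (points Cap) fst x))"
    by (rule smooth_on_cong[OF o smooth_on_linear[OF o bounded_linear_ident]]) (simp add: f_inv_into_f)
  then show ?thesis unfolding premanifold_def using cap_inj o by (simp add: charts_compatible_def o_def)
qed

lemma smooth_at_into_cap:
  assumes M: "premanifold M" and S: "open_in M S" "p \<in> S"
    and f: "\<And>q. q \<in> S ==> f q \<in> points Cap" "smooth_vec M (\<lambda>q. fst (f q)) p"
  shows "smooth_at M Cap f p"
  by (rule smooth_at_into_chart[OF M, of "(points Cap, fst)", OF _ S]) (use f in auto)

lemma smooth_at_cap_fst: "p \<in> points Cap ==> smooth_vec Cap fst p" using smooth_at_chart[OF mfd_cap, of "(points Cap, fst)" p] by simp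

text \<open>The chart of the cap shows only \<open>z\<close>; the height is a smooth function of
  \<open>z\<close> because the argument of the square root in \<open>height\<close> stays positive
  on the cap.\<close>

lemma smooth_at_cap_snd:
  assumes p: "p \<in> points Cap"
  shows "smooth_vec Cap snd p"
proof (rule smooth_at_cong[OF mfd_cap _ openin_points[OF mfd_cap] p])
  let ?D = "{z. (cmod z)\<^sup>2 < 1}"
  have oD: "rel_open UNIV ?D" by (auto intro!: open_Collect_less continuous_intros)
  have "smooth_on UNIV ?D (\<lambda>z. 1 - z \<bullet> z)"
    by (intro smooth_on_diff[OF oD] smooth_on_const smooth_on_bilinear[OF oD bounded_bilinear_inner]
        smooth_on_linear[OF oD] bounded_linear_ident) simp
  then have "smooth_on UNIV ?D (\<lambda>z. sqrt (1 - z \<bullet> z))"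
    by (intro smooth_on_compose[OF oD, of UNIV "{0<..}" _ sqrt] smooth_on_sqrt) (auto simp: power2_norm_eq_inner)
  then have "smooth_on UNIV ?D (\<lambda>z. s * (1 - sqrt (1 - z \<bullet> z)))"
    by (intro smooth_on_mult[OF oD] smooth_on_diff[OF oD] smooth_on_const) auto
  then show "smooth_vec Cap (\<lambda>q. s * (1 - sqrt (1 - fst q \<bullet> fst q))) p"
    using cmod_cap[OF p] oD by (intro smooth_at_compose_flat[OF mfd_cap smooth_at_cap_fst[OF p], of ?D]) auto
  show "snd q = s * (1 - sqrt (1 - fst q \<bullet> fst q))" if "q \<in> points Cap" for q using height[OF that] by (simp add: power2_norm_eq_inner)
qed

lemma tmap_cap:
  assumes "f p \<in> points Cap"
  shows "tmap M Cap f p u = dmap M (\<lambda>q. fst (f q)) p u"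
proof -
  have "chart_at Cap (f p) = (points Cap, fst)" using chart_at(1)[OF assms] by simp
  then show ?thesis by (simp add: tmap_eq chart_at_flat)
qed

end

section \<open>Coordinates and area forms on the cylinder\<close>

definition cyl_chart :: "real => complex => (complex \<times> real, complex) chart" where
  "cyl_chart \<epsilon> a = ({(z, h). cmod z = 1 \<and> z \<noteq> - a \<and> \<bar>h\<bar> < \<epsilon>}, \<lambda>(z, h). Complex (Arg (z / a)) h)"

lemma cylinder_simps [simp]: "Model (cylinder \<epsilon>) = UNIV" "Atlas (cylinder \<epsilon>) = cyl_chart \<epsilon> ` {a. cmod a = 1}"
  by (auto simp: cylinder_def cyl_chart_def)

lemma points_cylinder: "points (cylinder \<epsilon>) = {(z, h). cmod z = 1 \<and> \<bar>h\<bar> < \<epsilon>}"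
proof -
  have "(z, h) \<in> (\<Union>a\<in>{a. cmod a = 1}. fst (cyl_chart \<epsilon> a))" if "cmod z = 1" "\<bar>h\<bar> < \<epsilon>" for z h
    using that by (intro UN_I[of z]) (auto simp: cyl_chart_def eq_neg_iff_add_eq_0)
  then show ?thesis by (auto simp: points_def cyl_chart_def)
qed

lemma unit_nonpos_Reals: "cmod z = 1 ==> z \<in> \<real>\<^sub>\<le>\<^sub>0 \<longleftrightarrow> z = - 1"
proof -
  assume z: "cmod z = 1"
  show ?thesis
  proof
    assume "z \<in> \<real>\<^sub>\<le>\<^sub>0"
    then obtain r where "z = of_real r" "r \<le> 0" by (auto simp: nonpos_Reals_def)
    with z show "z = - 1" by auto
  next
    assume "z = - 1"
    then show "z \<in> \<real>\<^sub>\<le>\<^sub>0" by simp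
  qed
qed

lemma Arg_cis: "\<bar>\<theta>\<bar> < pi ==> Arg (cis \<theta>) = \<theta>" by (rule cis_Arg_unique) (auto simp: sgn_eq)

lemma cis_neq_minus_1: "\<bar>\<theta>\<bar> < pi ==> cis \<theta> \<noteq> - 1"
proof
  assume a: "\<bar>\<theta>\<bar> < pi" "cis \<theta> = - 1"
  have "Arg (of_real (-1)) = pi" by (simp only: Arg_of_real) simp
  then show False using Arg_cis[OF a(1)] a by simp
qed

context
  fixes \<epsilon> :: real and a :: complex
  assumes a: "cmod a = 1"
begin

lemma a_nz: "a \<noteq> 0" using a by auto

lemma cyl_chart_image: "snd (cyl_chart \<epsilon> a) ` fst (cyl_chart \<epsilon> a) = {w. \<bar>Re w\<bar> < pi \<and> \<bar>Im w\<bar> < \<epsilon>}"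
proof (intro equalityI subsetI)
  fix w assume "w \<in> snd (cyl_chart \<epsilon> a) ` fst (cyl_chart \<epsilon> a)"
  then obtain z h where zh: "cmod z = 1" "z \<noteq> - a" "\<bar>h\<bar> < \<epsilon>" "w = Complex (Arg (z / a)) h" by (auto simp: cyl_chart_def)
  have "Arg (z / a) \<noteq> pi"
  proof
    assume "Arg (z / a) = pi"
    moreover have "cis (Arg (z / a)) = z / a" using zh a a_nz by (subst cis_Arg) (auto simp: sgn_eq norm_divide)
    ultimately have "z / a = - 1" by simp
    then show False using zh(2) a_nz by (simp add: field_simps)
  qed
  then show "w \<in> {w. \<bar>Re w\<bar> < pi \<and> \<bar>Im w\<bar> < \<epsilon>}" using Arg_bounded[of "z / a"] zh by auto
next
  fix w assume w: "w \<in> {w. \<bar>Re w\<bar> < pi \<and> \<bar>Im w\<bar> < \<epsilon>}"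
  have "a * cis (Re w) \<noteq> - a" using cis_neq_minus_1[of "Re w"] w a_nz by (metis (mono_tags, lifting) mem_Collect_eq mult_cancel_left mult_minus1_right)
  moreover have "w = Complex (Arg (a * cis (Re w) / a)) (Im w)" using Arg_cis[of "Re w"] w a_nz by (simp add: complex_eq_iff)
  ultimately show "w \<in> snd (cyl_chart \<epsilon> a) ` fst (cyl_chart \<epsilon> a)"
    using w a by (intro image_eqI[of _ _ "(a * cis (Re w), Im w)"]) (auto simp: cyl_chart_def norm_mult)
qed

lemma cyl_chart_inverse: "p \<in> fst (cyl_chart \<epsilon> a) ==>
  (a * cis (Re (snd (cyl_chart \<epsilon> a) p)), Im (snd (cyl_chart \<epsilon> a) p)) = p"
proof -
  assume "p \<in> fst (cyl_chart \<epsilon> a)"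
  then have z: "cmod (fst p) = 1" by (auto simp: cyl_chart_def)
  then have "fst p / a \<noteq> 0" "cmod (fst p / a) = 1" using a a_nz by (auto simp: norm_divide)
  then have "cis (Arg (fst p / a)) = fst p / a" by (simp add: cis_Arg sgn_div_norm)
  then show ?thesis using a_nz by (simp add: cyl_chart_def case_prod_unfold)
qed

lemma cyl_chart_inj: "inj_on (snd (cyl_chart \<epsilon> a)) (fst (cyl_chart \<epsilon> a))"
  by (rule inj_on_inverseI[of _ "\<lambda>w. (a * cis (Re w), Im w)"]) (rule cyl_chart_inverse)

lemma chart_inv_cyl_chart:
  assumes "w \<in> snd (cyl_chart \<epsilon> a) ` fst (cyl_chart \<epsilon> a)"
  shows "chart_inv (cyl_chart \<epsilon> a) w = (a * cis (Re w), Im w)"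
  using cyl_chart_inverse[OF chart_inv_right(2)[OF assms]] chart_inv_right(1)[OF assms] by simp

lemma open_cyl_chart_image: "open (snd (cyl_chart \<epsilon> a) ` fst (cyl_chart \<epsilon> a))" unfolding cyl_chart_image
  by (intro open_Collect_conj open_Collect_less continuous_intros)

lemma smooth_on_cis_Re: "smooth_on UNIV UNIV (\<lambda>w. a * cis (Re w))"
proof -
  have o: "rel_open UNIV (UNIV :: complex set)" by simp
  have "smooth_on UNIV UNIV (\<lambda>w. cis (Re w))" by (rule smooth_on_compose[OF o, of UNIV UNIV Re cis])
      (auto intro: smooth_on_cis smooth_on_linear bounded_linear_Re)
  then show ?thesis by (intro smooth_on_mult[OF o] smooth_on_const) auto
qed

end

lemma has_derivative_cis_Re:
  "((\<lambda>w. cis (Re w)) has_derivative (\<lambda>u. (\<i> * cis (Re w)) * complex_of_real (Re u))) (at w)"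
  using has_derivative_cis[OF bounded_linear_imp_has_derivative[OF bounded_linear_Re], where x = w and A = UNIV]
  by (simp add: scaleR_conv_of_real mult.commute)

lemma smooth_on_cyl_coordinate:
  assumes b: "cmod b = 1"
  shows "smooth_on UNIV {p :: complex \<times> real. fst p / b \<notin> \<real>\<^sub>\<le>\<^sub>0} (\<lambda>p. Complex (Arg (fst p / b)) (snd p))"
    and "open {p :: complex \<times> real. fst p / b \<notin> \<real>\<^sub>\<le>\<^sub>0}"
proof -
  have nz: "b \<noteq> 0" using b by auto
  have lin: "bounded_linear (\<lambda>p::complex \<times> real. fst p / b)"
    by (intro bounded_linear_compose[OF bounded_linear_divide] bounded_linear_fst)
  have "open ((\<lambda>p::complex \<times> real. fst p / b) -` (- \<real>\<^sub>\<le>\<^sub>0))"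
    by (intro open_vimage continuous_intros) (auto simp: nz open_Compl)
  moreover have "(\<lambda>p::complex \<times> real. fst p / b) -` (- \<real>\<^sub>\<le>\<^sub>0) = {p. fst p / b \<notin> \<real>\<^sub>\<le>\<^sub>0}" by auto
  ultimately show oD: "open {p :: complex \<times> real. fst p / b \<notin> \<real>\<^sub>\<le>\<^sub>0}" by simp
  let ?D = "{p :: complex \<times> real. fst p / b \<notin> \<real>\<^sub>\<le>\<^sub>0}"
  have o: "rel_open UNIV ?D" using oD by simp
  have A: "smooth_on UNIV ?D (\<lambda>p. Arg (fst p / b))"
    by (rule smooth_on_compose[OF o _ _ smooth_on_linear[OF o lin] smooth_on_Arg]) (auto simp: open_Compl)
  have "bounded_linear (\<lambda>t. \<i> * complex_of_real t)" by (intro bounded_linear_const_mult bounded_linear_of_real)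
  then have "bounded_linear (\<lambda>p::complex \<times> real. \<i> * complex_of_real (snd p))"
    using bounded_linear_compose bounded_linear_snd by blast
  from smooth_on_add[OF o smooth_on_compose_linear[OF o A bounded_linear_of_real] smooth_on_linear[OF o this]]
  show "smooth_on UNIV ?D (\<lambda>p. Complex (Arg (fst p / b)) (snd p))" by (rule smooth_on_cong[OF o]) (simp add: complex_eq_iff)
qed

lemma mfd_cylinder: "premanifold (cylinder \<epsilon>)" unfolding premanifold_def
proof (intro conjI ballI)
  show "subspace (Model (cylinder \<epsilon>))" by simp
  fix c assume "c \<in> Atlas (cylinder \<epsilon>)"
  then obtain a where a: "cmod a = 1" "c = cyl_chart \<epsilon> a" by auto
  show "case c of (U, \<phi>) => inj_on \<phi> U \<and> openin (top_of_set (Model (cylinder \<epsilon>))) (\<phi> ` U)"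
    using cyl_chart_inj[OF a(1)] open_cyl_chart_image[OF a(1)] by (simp add: a(2) case_prod_unfold)
  fix d assume "d \<in> Atlas (cylinder \<epsilon>)"
  then obtain b where b: "cmod b = 1" "d = cyl_chart \<epsilon> b" by auto
  have nz: "b \<noteq> 0" using b by auto
  let ?R = "img c"
  define A where "A = snd c ` (fst c \<inter> fst d)"
  have im: "A = ?R \<inter> (\<lambda>w. a * cis (Re w)) -` (- {- b})"
  proof (intro equalityI subsetI)
    fix w assume "w \<in> A"
    then obtain p where p: "p \<in> fst c" "p \<in> fst d" "w = snd c p" by (auto simp: A_def)
    then show "w \<in> ?R \<inter> (\<lambda>w. a * cis (Re w)) -` (- {- b})"
      using cyl_chart_inverse[OF a(1), of p \<epsilon>] unfolding a(2) b(2) by (auto simp: cyl_chart_def[of \<epsilon> b])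
  next
    fix w assume w: "w \<in> ?R \<inter> (\<lambda>w. a * cis (Re w)) -` (- {- b})"
    then obtain p where p: "p \<in> fst c" "w = snd c p" by auto
    have "p \<in> fst d" using w cyl_chart_inverse[OF a(1), of p \<epsilon>] p unfolding a(2) b(2) by (auto simp: cyl_chart_def)
    then show "w \<in> A" using p by (auto simp: A_def)
  qed
  have "open (?R \<inter> (\<lambda>w. a * cis (Re w)) -` (- {- b}))" using open_cyl_chart_image[OF a(1)] unfolding a(2)
    by (intro open_Int open_vimage continuous_intros) auto
  then have o: "rel_open UNIV A" using im by simp
  have ci: "chart_inv c w = (a * cis (Re w), Im w)" "a * cis (Re w) \<noteq> - b" if "w \<in> A" for w
    using that chart_inv_cyl_chart[OF a(1)] unfolding im a(2) by auto
  have ns: "a * cis (Re w) / b \<notin> \<real>\<^sub>\<le>\<^sub>0" if "w \<in> A" for w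
    using ci(2)[OF that] a(1) b(1) nz by (subst unit_nonpos_Reals) (auto simp: norm_divide norm_mult field_simps)
  have s1: "smooth_on UNIV A (\<lambda>w. (a * cis (Re w), Im w))"
    by (intro smooth_on_Pair[OF o] smooth_on_subset[OF smooth_on_cis_Re[OF a(1)]] smooth_on_linear[OF o] bounded_linear_Im) simp
  have "smooth_on UNIV A (\<lambda>w. Complex (Arg (fst (a * cis (Re w), Im w) / b)) (snd (a * cis (Re w), Im w)))"
    by (rule smooth_on_compose[OF o _ _ s1 smooth_on_cyl_coordinate(1)[OF b(1)]])
      (use smooth_on_cyl_coordinate(2)[OF b(1)] ns in auto)
  then have "smooth_on UNIV A (snd d \<circ> inv_into (fst c) (snd c))"
    by (rule smooth_on_cong[OF o]) (use ci in \<open>simp add: b(2) cyl_chart_def[of \<epsilon> b] chart_inv_def[symmetric]\<close>)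
  then show "charts_compatible (Model (cylinder \<epsilon>)) c d" using o unfolding charts_compatible_def A_def by simp
qed

text \<open>The target chart is the one centred at the value \<open>fst (f p)\<close>, which keeps
  the argument away from its branch cut; smoothness of the two ambient coordinates then
  suffices.\<close>

lemma smooth_at_into_cylinder:
  assumes M: "premanifold M" and S: "open_in M S" "p \<in> S"
    and f: "\<And>q. q \<in> S ==> f q \<in> points (cylinder \<epsilon>)"
    "smooth_vec M (\<lambda>q. fst (f q)) p" "smooth_vec M (\<lambda>q. snd (f q)) p"
  shows "smooth_at M (cylinder \<epsilon>) f p"
proof -
  define a where "a = fst (f p)"
  have a: "cmod a = 1" using f(1)[OF S(2)] by (auto simp: a_def points_cylinder)
  then have nz: "a \<noteq> 0" "a \<noteq> - a" by (auto simp: eq_neg_iff_add_eq_0)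
  obtain S' where S': "open_in M S'" "p \<in> S'" "\<And>q. q \<in> S' ==> fst (f q) \<in> - {- a}"
    by (rule smooth_at_flat_preimage[OF M f(2), of "- {- a}"]) (use nz in \<open>auto simp: a_def[symmetric]\<close>)
  have "smooth_vec M (\<lambda>q. Complex (Arg (fst (fst (f q), snd (f q)) / a)) (snd (fst (f q), snd (f q)))) p"
    by (rule smooth_at_compose_flat[OF M smooth_at_Pair_flat(1)[OF M f(2,3)] smooth_on_cyl_coordinate(2)[OF a] _ smooth_on_cyl_coordinate(1)[OF a]])
      (use nz in \<open>simp add: a_def[symmetric]\<close>)
  then have "smooth_vec M (\<lambda>q. snd (cyl_chart \<epsilon> a) (f q)) p" by (simp add: cyl_chart_def case_prod_unfold)
  moreover have "f q \<in> fst (cyl_chart \<epsilon> a)" if "q \<in> S \<inter> S'" for q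
    using f(1)[of q] S'(3)[of q] that by (auto simp: points_cylinder cyl_chart_def case_prod_unfold)
  ultimately show ?thesis using S S'(1,2) a by (intro smooth_at_into_chart[OF M, of "cyl_chart \<epsilon> a" _ "S \<inter> S'"]) auto
qed

text \<open>In the coordinate \<open>\<theta> + \<i> h\<close> a tangent vector \<open>u\<close> has
  angular part \<open>Re u\<close> and vertical part \<open>Im u\<close>; the formula for
  \<open>fst\<close> is the derivative of \<open>a * cis \<theta>\<close>.\<close>

lemma cylinder_coordinates:
  assumes p: "p \<in> points (cylinder \<epsilon>)"
  shows "smooth_vec (cylinder \<epsilon>) fst p" "smooth_vec (cylinder \<epsilon>) snd p"
    and "dmap (cylinder \<epsilon>) fst p u = \<i> * fst p * complex_of_real (Re u)"
    and "dmap (cylinder \<epsilon>) snd p u = Im u"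
proof -
  let ?c = "chart_at (cylinder \<epsilon>) p"
  obtain a where a: "cmod a = 1" "?c = cyl_chart \<epsilon> a" using chart_at(1)[OF p] by auto
  have c: "?c \<in> Atlas (cylinder \<epsilon>)" "p \<in> fst ?c" by (rule chart_at[OF p])+
  let ?R = "img ?c"
  have o: "rel_open UNIV ?R" using open_cyl_chart_image[OF a(1)] by (simp add: a(2))
  have oM: "rel_open (Model (cylinder \<epsilon>)) ?R" using o by simp
  have x: "snd ?c p \<in> ?R" using c by blast
  have ci: "chart_inv ?c w = (a * cis (Re w), Im w)" if "w \<in> ?R" for w using that chart_inv_cyl_chart[OF a(1)] unfolding a(2) by blast
  have pe: "a * cis (Re (snd ?c p)) = fst p" using cyl_chart_inverse[OF a(1), of p \<epsilon>] c(2) unfolding a(2) by (metis fst_conv)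
  show "smooth_vec (cylinder \<epsilon>) fst p"
  proof (rule smooth_at_flatI[OF c oM x])
    show "smooth_on (Model (cylinder \<epsilon>)) ?R (\<lambda>x. fst (chart_inv ?c x))" unfolding cylinder_simps
      by (rule smooth_on_cong[OF o smooth_on_subset[OF smooth_on_cis_Re[OF a(1)]]]) (simp_all add: ci)
  qed auto
  show "smooth_vec (cylinder \<epsilon>) snd p"
  proof (rule smooth_at_flatI[OF c oM x])
    show "smooth_on (Model (cylinder \<epsilon>)) ?R (\<lambda>x. snd (chart_inv ?c x))" unfolding cylinder_simps
      by (rule smooth_on_cong[OF o smooth_on_linear[OF o bounded_linear_Im]]) (simp_all add: ci)
  qed auto
  have "dmap (cylinder \<epsilon>) fst p u = dderiv (\<lambda>w. a * cis (Re w)) (snd ?c p) u"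
    unfolding tmap_eq chart_at_flat[OF UNIV_I] snd_conv by (rule dderiv_cong[OF o x UNIV_I]) (simp add: ci)
  also have "\<dots> = a * (\<i> * cis (Re (snd ?c p)) * complex_of_real (Re u))"
    by (rule dderiv_eq[of UNIV UNIV]) (use has_derivative_mult_right[OF has_derivative_cis_Re] in auto)
  also have "\<dots> = \<i> * fst p * complex_of_real (Re u)" using pe by (simp add: mult_ac)
  finally show "dmap (cylinder \<epsilon>) fst p u = \<i> * fst p * complex_of_real (Re u)" .
  have "dmap (cylinder \<epsilon>) snd p u = dderiv Im (snd ?c p) u"
    unfolding tmap_eq chart_at_flat[OF UNIV_I] snd_conv by (rule dderiv_cong[OF o x UNIV_I]) (simp add: ci)
  also have "\<dots> = Im u" by (rule dderiv_eq[of UNIV UNIV]) (use bounded_linear_imp_has_derivative[OF bounded_linear_Im] in auto)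
  finally show "dmap (cylinder \<epsilon>) snd p u = Im u" .
qed

lemma tmap_cylinder:
  assumes M: "premanifold M" and f: "smooth_at M (cylinder \<epsilon>) f p" and u: "u \<in> Model M"
  shows "dmap M (\<lambda>q. fst (f q)) p u = \<i> * fst (f p) * complex_of_real (Re (tmap M (cylinder \<epsilon>) f p u))"
    and "dmap M (\<lambda>q. snd (f q)) p u = Im (tmap M (cylinder \<epsilon>) f p u)"
    and "smooth_vec M (\<lambda>q. fst (f q)) p" "smooth_vec M (\<lambda>q. snd (f q)) p"
proof -
  have fp: "f p \<in> points (cylinder \<epsilon>)" using smooth_at_points[OF f M] by simp
  note c = cylinder_coordinates[OF fp]
  show "dmap M (\<lambda>q. fst (f q)) p u = \<i> * fst (f p) * complex_of_real (Re (tmap M (cylinder \<epsilon>) f p u))"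
    "dmap M (\<lambda>q. snd (f q)) p u = Im (tmap M (cylinder \<epsilon>) f p u)"
    using tmap_compose[OF M mfd_cylinder mfd_vec f c(1) u]
      tmap_compose[OF M mfd_cylinder mfd_vec f c(2) u] c(3,4) by simp_all
  show "smooth_vec M (\<lambda>q. fst (f q)) p" "smooth_vec M (\<lambda>q. snd (f q)) p" by (rule smooth_at_compose[OF M mfd_cylinder mfd_vec f c(1)]
        smooth_at_compose[OF M mfd_cylinder mfd_vec f c(2)])+
qed

text \<open>This is \<open>\<gamma>(h) dh \<and> d\<theta>\<close>, since \<open>Im\<close> and
  \<open>Re\<close> of a tangent vector are its values under \<open>dh\<close> and
  \<open>d\<theta>\<close>.\<close>

definition cyl_form :: "(real => real) => (complex \<times> real, complex) form2" where
  "cyl_form \<gamma> p u v = \<gamma> (snd p) * (Im u * Re v - Im v * Re u)"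

lemma alternating_cyl_form: "alternating_bilinear UNIV (cyl_form \<gamma> p)" by (simp add: alternating_bilinear_def cyl_form_def algebra_simps)

text \<open>Charts of the cylinder differ by translations of the angle, so components of a vector
  are the same in all of them. They are recovered from the derivatives of the two ambient
  coordinates, one for each of the real and imaginary parts.\<close>

lemma chart_vector_cylinder:
  assumes c: "c \<in> Atlas (cylinder \<epsilon>)" and x: "x \<in> img c"
  shows "chart_vector (cylinder \<epsilon>) c x u = u" "snd (chart_inv c x) = Im x"
proof -
  obtain a where a: "cmod a = 1" "c = cyl_chart \<epsilon> a" using c by auto
  have o: "rel_open UNIV (img c)" using open_cyl_chart_image[OF a(1)] by (simp add: a(2))
  have ci: "chart_inv c w = (a * cis (Re w), Im w)" if "w \<in> img c" for w using that chart_inv_cyl_chart[OF a(1)] unfolding a(2) by blast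
  show "snd (chart_inv c x) = Im x" by (simp add: ci[OF x])
  let ?v = "chart_vector (cylinder \<epsilon>) c x u"
  have v: "?v = tmap (flat UNIV) (cylinder \<epsilon>) (chart_inv c) x u" using chart_vector_eq_tmap[OF mfd_cylinder c x, of u] by simp
  have sm: "smooth_at (flat UNIV) (cylinder \<epsilon>) (chart_inv c) x" using smooth_at_chart_inv[OF mfd_cylinder c x] by simp
  note t = tmap_cylinder[OF mfd_vec sm, of u, simplified, folded v]
  have oF: "open_in (flat UNIV) (img c)" using o by simp
  have "dmap (flat UNIV) (\<lambda>q. snd (chart_inv c q)) x u = dmap (flat UNIV) Im x u" by (rule tmap_cong[OF mfd_vec oF x]) (simp_all add: ci)
  also have "\<dots> = Im u" by (subst tmap_flat) (auto intro!: dderiv_eq[of UNIV UNIV] bounded_linear_imp_has_derivative bounded_linear_Im)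
  finally have im: "Im ?v = Im u" using t(2) by simp
  have "dmap (flat UNIV) (\<lambda>q. fst (chart_inv c q)) x u = dmap (flat UNIV) (\<lambda>w. a * cis (Re w)) x u"
    by (rule tmap_cong[OF mfd_vec oF x]) (simp_all add: ci)
  also have "\<dots> = dderiv (\<lambda>w. a * cis (Re w)) x u" by (subst tmap_flat) auto
  also have "\<dots> = a * (\<i> * cis (Re x) * complex_of_real (Re u))"
    by (rule dderiv_eq[of UNIV UNIV]) (use has_derivative_mult_right[OF has_derivative_cis_Re] in auto)
  also have "\<dots> = \<i> * (a * cis (Re x)) * complex_of_real (Re u)" by (simp add: mult_ac)
  finally have "\<i> * (a * cis (Re x)) * complex_of_real (Re ?v) = \<i> * (a * cis (Re x)) * complex_of_real (Re u)" using t(1) ci[OF x] by simp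
  moreover have "\<i> * (a * cis (Re x)) \<noteq> 0" using a(1) by auto
  ultimately have "Re ?v = Re u" by (metis mult_cancel_left of_real_eq_iff)
  then show "?v = u" using im by (simp add: complex_eq_iff)
qed

lemma local_form_cyl_form:
  assumes "c \<in> Atlas (cylinder \<epsilon>)" "x \<in> img c"
  shows "local_form (cylinder \<epsilon>) c (cyl_form \<gamma>) x u v = \<gamma> (Im x) * (Im u * Re v - Im v * Re u)"
  by (simp add: local_form_def cyl_form_def chart_vector_cylinder[OF assms])

lemma openin_cylinder_height: "open D ==> open_in (cylinder \<epsilon>) {p \<in> points (cylinder \<epsilon>). snd p \<in> D}"
proof -
  assume "open D"
  then have "open_in (cylinder \<epsilon>) (points (cylinder \<epsilon>) \<inter> snd -` D)"
    by (intro smooth_at_openin_preimage[OF mfd_cylinder mfd_vec openin_points[OF mfd_cylinder]]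
        cylinder_coordinates) auto
  moreover have "points (cylinder \<epsilon>) \<inter> snd -` D = {p \<in> points (cylinder \<epsilon>). snd p \<in> D}" by auto
  ultimately show ?thesis by simp
qed

text \<open>The coefficient depends on \<open>h\<close> alone, so the exterior derivative is
  \<open>\<gamma>'(h) dh \<and> dh \<and> d\<theta>\<close>, which is zero.\<close>

lemma closed_smooth_cyl_form:
  assumes D: "open D" and \<gamma>: "smooth_on UNIV D \<gamma>"
  shows "closed_smooth_form (cylinder \<epsilon>) {p \<in> points (cylinder \<epsilon>). snd p \<in> D} (cyl_form \<gamma>)"
proof (rule closed_smooth_formI[OF mfd_cylinder openin_cylinder_height[OF D]])
  let ?M = "cylinder \<epsilon>" and ?W = "{p \<in> points (cylinder \<epsilon>). snd p \<in> D}"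
  show "alternating_bilinear (Model ?M) (cyl_form \<gamma> p)" for p by (simp add: alternating_cyl_form)
  fix c x assume c: "c \<in> Atlas ?M" and x: "x \<in> snd c ` (fst c \<inter> ?W)"
  let ?T = "snd c ` (fst c \<inter> ?W)"
  have T: "rel_open UNIV ?T" using rel_open_chart_image[OF mfd_cylinder openin_cylinder_height[OF D] c] by simp
  have TR: "y \<in> img c" "Im y \<in> D" if y: "y \<in> ?T" for y
  proof -
    show 1: "y \<in> img c" using y by auto
    obtain p where "p \<in> fst c" "snd p \<in> D" "y = snd c p" using y by auto
    then show "Im y \<in> D" using chart_vector_cylinder(2)[OF c 1] chart_inv_left[OF mfd_cylinder c] by metis
  qed
  have eq: "local_form ?M c (cyl_form \<gamma>) y u v = \<gamma> (Im y) * (Im u * Re v - Im v * Re u)" if "y \<in> ?T" for y u v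
    by (rule local_form_cyl_form[OF c TR(1)[OF that]])
  have oD: "rel_open UNIV D" using D by simp
  have gI: "smooth_on UNIV ?T (\<lambda>y. \<gamma> (Im y))"
    by (rule smooth_on_compose[OF T oD _ smooth_on_linear[OF T bounded_linear_Im] \<gamma>]) (use TR in auto)
  have dd: "dderiv (\<lambda>y. local_form ?M c (cyl_form \<gamma>) y v w) x u = dderiv (\<lambda>y. \<gamma> (Im y)) x u * (Im v * Re w - Im w * Re v)" for u v w
  proof -
    have "dderiv (\<lambda>y. local_form ?M c (cyl_form \<gamma>) y v w) x u = dderiv (\<lambda>y. \<gamma> (Im y) * (Im v * Re w - Im w * Re v)) x u"
      by (rule dderiv_cong[OF T x UNIV_I eq])
    also have "\<dots> = dderiv (\<lambda>y. \<gamma> (Im y)) x u * (Im v * Re w - Im w * Re v)"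
      by (rule dderiv_bounded_linear[OF T smooth_on_differentiable[OF gI] x UNIV_I bounded_linear_mult_left])
    finally show ?thesis .
  qed
  have g': "dderiv (\<lambda>y. \<gamma> (Im y)) x u = dderiv \<gamma> (Im x) 1 * Im u" for u
  proof -
    have "dderiv (\<lambda>y. \<gamma> (Im y)) x u = dderiv \<gamma> (Im x) (dderiv Im x u)"
      by (rule dderiv_compose(1)[OF T _ x UNIV_I oD smooth_on_differentiable[OF \<gamma>]])
        (use TR smooth_on_differentiable[OF smooth_on_linear[OF T bounded_linear_Im]] in auto)
    also have "dderiv Im x u = (\<Sum>i\<in>{()}. Im u *\<^sub>R 1)"
      using dderiv_eq[OF T x UNIV_I bounded_linear_imp_has_derivative[OF bounded_linear_Im], of u] by simp
    also have "dderiv \<gamma> (Im x) (\<Sum>i\<in>{()}. Im u *\<^sub>R 1) = (\<Sum>i\<in>{()}. Im u *\<^sub>R dderiv \<gamma> (Im x) 1)"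
      by (rule dderiv_linear[OF oD smooth_on_differentiable[OF \<gamma>] TR(2)[OF x]]) auto
    finally show ?thesis by simp
  qed
  show "\<exists>T. rel_open (Model ?M) T \<and> x \<in> T \<and> (\<forall>u\<in>Model ?M. \<forall>v\<in>Model ?M. smooth_on (Model ?M) T (\<lambda>y. local_form ?M c (cyl_form \<gamma>) y u v)) \<and>
        (\<forall>u\<in>Model ?M. \<forall>v\<in>Model ?M. \<forall>w\<in>Model ?M. ext_d (local_form ?M c (cyl_form \<gamma>)) x u v w = 0)"
    unfolding cylinder_simps
  proof (intro exI[of _ ?T] conjI ballI)
    show "smooth_on UNIV ?T (\<lambda>y. local_form ?M c (cyl_form \<gamma>) y u v)" for u v
      by (rule smooth_on_cong[OF T smooth_on_mult[OF T gI smooth_on_const[of UNIV]] eq]) auto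
    show "ext_d (local_form ?M c (cyl_form \<gamma>)) x u v w = 0" for u v w unfolding dd g' by (simp add: algebra_simps)
  qed (use T x in auto)
qed

subsection \<open>The cap without its pole as half of a cylinder\<close>

text \<open>The map \<open>\<rho>\<close> acts on angles as multiplication by
  \<open>\<sigma>\<close>. It is used on the whole plane, where it is real linear and
  multiplicative, so that one argument serves both gluings.\<close>

locale half_cylinder = polar_cap s \<epsilon> for s \<epsilon> :: real +
  fixes \<rho> :: "complex => complex" and \<sigma> :: real
  assumes flip: "\<rho> = id \<and> \<sigma> = 1 \<or> \<rho> = cnj \<and> \<sigma> = - 1"
begin

lemma \<rho>: "bounded_linear \<rho>" "\<rho> (\<rho> z) = z" "cmod (\<rho> z) = cmod z" "\<rho> (z * w) = \<rho> z * \<rho> w"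
  "\<rho> (complex_of_real r) = complex_of_real r" "\<rho> 1 = 1" "\<rho> 0 = 0" "\<rho> (r *\<^sub>R z) = r *\<^sub>R \<rho> z" "\<rho> z = 0 \<longleftrightarrow> z = 0"
  using flip bounded_linear_ident bounded_linear_cnj by (auto simp: id_def)

lemma \<sigma>: "\<sigma> * \<sigma> = 1" "\<sigma> * (\<sigma> * x) = x" "\<sigma> \<noteq> 0" using flip by auto

definition cyl_half where "cyl_half = {p \<in> points Cyl. s * snd p > 0}"

definition to_cap where "to_cap = (\<lambda>(z, h). cap_point (\<rho> z) h)"

definition of_cap where "of_cap = (\<lambda>(w, h::real). (\<rho> (sgn w), h))"

lemma openin_cyl_half: "open_in Cyl cyl_half"
proof -
  have "open {h. s * h > 0}" by (intro open_Collect_less continuous_intros)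
  from openin_cylinder_height[OF this] show ?thesis by (simp add: cyl_half_def)
qed

lemma cyl_half_facts:
  assumes "p \<in> cyl_half"
  shows "0 < 2 * (s * snd p) - (snd p)\<^sup>2" "\<bar>snd p\<bar> = s * snd p" "0 < s * snd p" "s * snd p < 1" "cmod (fst p) = 1" "snd p \<noteq> 0"
proof -
  have *: "\<bar>snd p\<bar> < \<epsilon>" "0 < s * snd p" "cmod (fst p) = 1" using assms by (auto simp: cyl_half_def points_cylinder)
  then show "cmod (fst p) = 1" "0 < s * snd p" "snd p \<noteq> 0" by auto
  show a: "\<bar>snd p\<bar> = s * snd p" using s * by auto
  then show b: "s * snd p < 1" using * eps by simp
  have "(snd p)\<^sup>2 = (s * snd p) * (s * snd p)" using s by (auto simp: power2_eq_square)
  also have "\<dots> < (s * snd p) * 1" using b *(2) by (intro mult_strict_left_mono) auto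
  finally show "0 < 2 * (s * snd p) - (snd p)\<^sup>2" using *(2) by simp
qed

lemma to_cap_eq: "p \<in> cyl_half ==> to_cap p = (sqrt (2 * (s * snd p) - (snd p)\<^sup>2) *\<^sub>R \<rho> (fst p), snd p)"
  using cyl_half_facts(2)[of p] by (simp add: to_cap_def cap_point_def case_prod_unfold scaleR_conv_of_real)

lemma to_cap_points: "p \<in> cyl_half ==> to_cap p \<in> points Cap"
proof -
  assume p: "p \<in> cyl_half"
  note f = cyl_half_facts[OF p]
  have "(cmod (sqrt (2 * (s * snd p) - (snd p)\<^sup>2) *\<^sub>R \<rho> (fst p)))\<^sup>2 = 2 * (s * snd p) - (snd p)\<^sup>2"
    using f \<rho>(3) by (simp add: power_mult_distrib)
  moreover have "(snd p - s)\<^sup>2 = (snd p)\<^sup>2 - 2 * (s * snd p) + 1" using s by (auto simp: power2_eq_square algebra_simps)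
  ultimately show ?thesis using p unfolding to_cap_eq[OF p] by (auto simp: points_cap cyl_half_def points_cylinder)
qed

lemma to_cap_nonzero: "p \<in> cyl_half ==> fst (to_cap p) \<noteq> 0"
proof -
  assume p: "p \<in> cyl_half"
  have "fst p \<noteq> 0" using cyl_half_facts(5)[OF p] by auto
  then show ?thesis unfolding to_cap_eq[OF p] using cyl_half_facts(1)[OF p] by (simp add: \<rho>)
qed

lemma of_cap_to_cap: "p \<in> cyl_half ==> of_cap (to_cap p) = p"
proof -
  assume p: "p \<in> cyl_half"
  note f = cyl_half_facts[OF p]
  have "sgn (sqrt (2 * (s * snd p) - (snd p)\<^sup>2) *\<^sub>R \<rho> (fst p)) = \<rho> (fst p)"
    using f \<rho>(3) by (simp add: sgn_scaleR sgn_div_norm)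
  then show ?thesis unfolding to_cap_eq[OF p] of_cap_def by (simp add: \<rho>)
qed

lemma of_cap_half:
  assumes "q \<in> points Cap" "fst q \<noteq> 0"
  shows "of_cap q \<in> cyl_half" "to_cap (of_cap q) = q"
proof -
  have z: "(cmod (fst q))\<^sup>2 + (snd q - s)\<^sup>2 = 1" "\<bar>snd q\<bar> < \<epsilon>" using assms by (auto simp: points_cap)
  have "(cmod (fst q))\<^sup>2 = 2 * (s * snd q) - (snd q)\<^sup>2" using z(1) s by (auto simp: power2_eq_square algebra_simps)
  then have m: "cmod (fst q) = sqrt (2 * (s * snd q) - (snd q)\<^sup>2)" by (metis norm_ge_zero real_sqrt_unique)
  have "1 - (cmod (fst q))\<^sup>2 < 1" using assms(2) by simp
  then have "0 < s * snd q" using height[OF assms(1)] s by (auto simp: mult.assoc[symmetric])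
  then show h: "of_cap q \<in> cyl_half" using z(2) assms(2) by (auto simp: of_cap_def cyl_half_def points_cylinder case_prod_unfold \<rho> norm_sgn)
  show "to_cap (of_cap q) = q"
  proof -
    have "cmod (fst q) *\<^sub>R sgn (fst q) = fst q" using assms(2) by (simp add: sgn_div_norm)
    moreover have "fst (of_cap q) = \<rho> (sgn (fst q))" "snd (of_cap q) = snd q" by (simp_all add: of_cap_def case_prod_unfold)
    ultimately show ?thesis unfolding to_cap_eq[OF h] by (simp add: \<rho> m[symmetric])
  qed
qed

text \<open>The radius satisfies \<open>r\<^sup>2 = 2 s h - h\<^sup>2\<close>, so
  \<open>dr = (s - h) dh / r\<close>. This and the derivative of the unit vector give the two
  summands of the tangent map.\<close>

lemma smooth_to_cap:
  assumes p: "p \<in> cyl_half"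
  shows "smooth_at Cyl Cap to_cap p"
    and "fst (to_cap p) = r *\<^sub>R \<rho> (fst p) ==> r = sqrt (2 * (s * snd p) - (snd p)\<^sup>2) ==>
      tmap Cyl Cap to_cap p u = r *\<^sub>R \<rho> (\<i> * fst p * complex_of_real (Re u)) + ((s - snd p) * Im u / r) *\<^sub>R \<rho> (fst p)"
proof -
  note M = mfd_cylinder[of \<epsilon>] and f = cyl_half_facts[OF p]
  have pp: "p \<in> points Cyl" using p by (simp add: cyl_half_def)
  note c = cylinder_coordinates[OF pp]
  define N where "N x = sqrt (2 * (s * snd x) - (snd x)\<^sup>2) *\<^sub>R \<rho> (fst x)" for x :: "complex \<times> real"
  let ?D = "{x :: complex \<times> real. 0 < 2 * (s * snd x) - (snd x)\<^sup>2}"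
  have oD: "open ?D" by (intro open_Collect_less continuous_intros)
  then have o: "rel_open UNIV ?D" by simp
  have "smooth_on UNIV ?D (\<lambda>x. 2 * (s * snd x) - snd x * snd x)"
    by (intro smooth_on_diff[OF o] smooth_on_mult[OF o] smooth_on_const smooth_on_linear[OF o] bounded_linear_snd) auto
  then have "smooth_on UNIV ?D (\<lambda>x. sqrt (2 * (s * snd x) - snd x * snd x))"
    by (intro smooth_on_compose[OF o, of UNIV "{0<..}" _ sqrt] smooth_on_sqrt) (auto simp: power2_eq_square)
  then have sN: "smooth_on UNIV ?D N" unfolding N_def power2_eq_square by (rule smooth_on_scaleR[rotated])
      (use oD in \<open>auto simp: power2_eq_square intro!: smooth_on_linear bounded_linear_compose[OF \<rho>(1)] bounded_linear_fst\<close>)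
  have pD: "(fst p, snd p) \<in> ?D" using f(1) by simp
  note P = smooth_at_Pair_flat[OF M c(1,2)]
  have sm: "smooth_vec Cyl (\<lambda>q. N (fst q, snd q)) p" by (rule smooth_at_compose_flat[OF M P(1) oD pD sN])
  have eq: "fst (to_cap q) = N (fst q, snd q)" if "q \<in> cyl_half" for q using to_cap_eq[OF that] by (simp add: N_def)
  have sm': "smooth_vec Cyl (\<lambda>q. fst (to_cap q)) p" by (rule smooth_at_cong[OF M sm openin_cyl_half p eq])
  show "smooth_at Cyl Cap to_cap p" by (rule smooth_at_into_cap[OF M openin_cyl_half p to_cap_points sm'])
  assume r: "r = sqrt (2 * (s * snd p) - (snd p)\<^sup>2)"
  have r0: "r > 0" using f(1) r by simp
  define N' where "N' d = r *\<^sub>R \<rho> (fst d) + ((s - snd p) * snd d / r) *\<^sub>R \<rho> (fst p)" for d :: "complex \<times> real"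
  have NS: "(N has_derivative N') (at (fst p, snd p))"
  proof -
    have 1: "((\<lambda>x. sqrt (2 * (s * snd x) - (snd x)\<^sup>2)) has_derivative (\<lambda>d. (s - snd p) * snd d / r)) (at (fst p, snd p))"
      using f(1) r r0 by (auto intro!: derivative_eq_intros simp: field_simps)
    have 2: "((\<lambda>x. \<rho> (fst x)) has_derivative (\<lambda>d. \<rho> (fst d))) (at (fst p, snd p))"
      by (intro bounded_linear.has_derivative[OF \<rho>(1)] derivative_intros)
    show ?thesis using has_derivative_scaleR[OF 1 2] unfolding N_def[abs_def] N'_def[abs_def] by (simp add: r)
  qed
  have "tmap Cyl Cap to_cap p u = dmap Cyl (\<lambda>q. fst (to_cap q)) p u" by (rule tmap_cap) (rule to_cap_points[OF p])
  also have "\<dots> = dmap Cyl (\<lambda>q. N (fst q, snd q)) p u" by (rule tmap_cong[OF M openin_cyl_half p eq]) auto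
  also have "\<dots> = N' (dmap Cyl (\<lambda>q. (fst q, snd q)) p u)" by (rule tmap_compose_flat[OF M P(1) oD pD sN NS]) simp
  also have "dmap Cyl (\<lambda>q. (fst q, snd q)) p u = (\<i> * fst p * complex_of_real (Re u), Im u)" using P(2)[of u] c(3,4) by simp
  finally show "tmap Cyl Cap to_cap p u = r *\<^sub>R \<rho> (\<i> * fst p * complex_of_real (Re u)) + ((s - snd p) * Im u / r) *\<^sub>R \<rho> (fst p)"
    by (simp add: N'_def)
qed

text \<open>On the sphere \<open>s r dr = (1 - s h) dh\<close>, and \<open>1 - s h\<close> is also
  the square root in the denominator of \<open>cap_form\<close>; the quotient leaves
  \<open>dh\<close>. The angle of the image is \<open>\<sigma> \<theta>\<close>, whence the factor
  \<open>\<sigma>\<close>.\<close>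

lemma pullback_cap_form:
  assumes p: "p \<in> cyl_half"
  shows "pullback2 Cyl Cap to_cap (cap_form s) p u v = \<sigma> * cyl_form (\<lambda>_. 1) p u v"
proof -
  note f = cyl_half_facts[OF p]
  define r where "r = sqrt (2 * (s * snd p) - (snd p)\<^sup>2)"
  have r: "r > 0" "r\<^sup>2 = 2 * (s * snd p) - (snd p)\<^sup>2" using f(1) by (auto simp: r_def)
  have fp: "fst (to_cap p) = r *\<^sub>R \<rho> (fst p)" using to_cap_eq[OF p] by (simp add: r_def)
  note t = smooth_to_cap(2)[OF p fp r_def]
  let ?e = "\<rho> (fst p)"
  have ie: "\<rho> (\<i> * fst p * complex_of_real x) = (\<sigma> * x) *\<^sub>R (\<i> * ?e)" for x using flip by (auto simp: scaleR_conv_of_real)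
  have ne: "(Re ?e)\<^sup>2 + (Im ?e)\<^sup>2 = 1" using f(5) \<rho>(3)[of "fst p"] by (metis cmod_power2 one_power2)
  have cross: "Re (a *\<^sub>R (\<i> * ?e) + b *\<^sub>R ?e) * Im (c *\<^sub>R (\<i> * ?e) + d *\<^sub>R ?e) - Im (a *\<^sub>R (\<i> * ?e) + b *\<^sub>R ?e) * Re (c *\<^sub>R (\<i> * ?e) + d *\<^sub>R ?e)
      = (b * c - a * d) * ((Re ?e)\<^sup>2 + (Im ?e)\<^sup>2)" for a b c d
    by (simp add: power2_eq_square algebra_simps)
  have "(cmod (fst (to_cap p)))\<^sup>2 = r\<^sup>2" unfolding fp using \<rho>(3) f(5) r(1) by simp
  also have "\<dots> = 1 - (1 - s * snd p)\<^sup>2" using r(2) s by (auto simp: power2_eq_square algebra_simps)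
  finally have sq: "sqrt (1 - (cmod (fst (to_cap p)))\<^sup>2) = 1 - s * snd p" using f(4) by simp
  have "pullback2 Cyl Cap to_cap (cap_form s) p u v
     = s * (((s - snd p) * Im u / r) * (r * (\<sigma> * Re v)) - (r * (\<sigma> * Re u)) * ((s - snd p) * Im v / r)) / (1 - s * snd p)"
    unfolding pullback2_def cap_form_def sq t ie scaleR_scaleR cross ne by simp
  also have "\<dots> = (s * (s - snd p) / (1 - s * snd p)) * \<sigma> * (Im u * Re v - Im v * Re u)"
  proof -
    have "((s - snd p) * Im u / r) * (r * (\<sigma> * Re v)) = (s - snd p) * Im u * (\<sigma> * Re v)"
      "(r * (\<sigma> * Re u)) * ((s - snd p) * Im v / r) = (s - snd p) * Im v * (\<sigma> * Re u)"
      using r(1) by simp_all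
    then show ?thesis by (simp only:) (simp add: algebra_simps)
  qed
  also have "s * (s - snd p) / (1 - s * snd p) = 1" using f(4) ss by (simp add: algebra_simps)
  finally show ?thesis by (simp add: cyl_form_def)
qed

lemma smooth_of_cap:
  assumes q: "q \<in> points Cap" "fst q \<noteq> 0"
  shows "smooth_at Cap Cyl of_cap q"
proof -
  note M = mfd_cap
  note cf = smooth_at_cap_fst[OF q(1)]
  obtain S where S: "open_in Cap S" "q \<in> S" "\<And>x. x \<in> S ==> fst x \<in> - {0}"
    by (rule smooth_at_flat_preimage[OF M cf, of "- {0}"]) (use q in auto)
  have Sp: "S \<subseteq> points Cap" using S(1) mfd_openin[OF M] by blast
  have o: "rel_open UNIV (- {0::complex})" by auto
  have "smooth_on UNIV (- {0}) (\<lambda>w::complex. w \<bullet> w)"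
    by (intro smooth_on_bilinear[OF o bounded_bilinear_inner] smooth_on_linear[OF o] bounded_linear_ident)
  then have "smooth_on UNIV (- {0}) (\<lambda>w::complex. sqrt (w \<bullet> w))"
    by (intro smooth_on_compose[OF o, of UNIV "{0<..}" _ sqrt] smooth_on_sqrt) auto
  then have "smooth_on UNIV (- {0}) (\<lambda>w::complex. inverse (sqrt (w \<bullet> w)))"
    by (intro smooth_on_compose[OF o, of UNIV "- {0}" _ inverse] smooth_on_inverse) auto
  then have "smooth_on UNIV (- {0}) (\<lambda>w::complex. inverse (sqrt (w \<bullet> w)) *\<^sub>R w)"
    by (rule smooth_on_scaleR[OF o _ smooth_on_linear[OF o bounded_linear_ident]])
  then have "smooth_on UNIV (- {0}) (\<lambda>w::complex. \<rho> (inverse (sqrt (w \<bullet> w)) *\<^sub>R w))"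
    by (rule smooth_on_compose_linear[OF o _ \<rho>(1)])
  then have "smooth_on UNIV (- {0}) (\<lambda>w::complex. \<rho> (sgn w))" by (rule smooth_on_cong[OF o]) (simp add: sgn_div_norm norm_eq_sqrt_inner)
  then have "smooth_vec Cap (\<lambda>x. \<rho> (sgn (fst x))) q" using q by (intro smooth_at_compose_flat[OF M cf, of "- {0}"]) auto
  then show ?thesis using smooth_at_cap_snd[OF q(1)] of_cap_half(1) Sp S
    by (intro smooth_at_into_cylinder[OF M S(1,2)]) (auto simp: of_cap_def case_prod_unfold cyl_half_def)
qed

end


section \<open>Topology of manifolds\<close>

text \<open>A base is formed by the preimages, under countably many covering charts, of a countable
  base of the model space.\<close>

lemma second_countable_mtopology:
  assumes M: "premanifold M" and C: "countable C" "C \<subseteq> Atlas M" "points M \<subseteq> \<Union>(fst ` C)"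
  shows "second_countable (mtopology M)"
proof -
  obtain D :: "'b set set" where D: "countable D" "\<And>B. B \<in> D ==> open B" "\<And>S. open S ==> \<exists>U. U \<subseteq> D \<and> S = \<Union>U"
    using univ_second_countable by blast
  define V where "V c B = chart_inv c ` (B \<inter> img c)" for c :: "('a, 'b) chart" and B
  define BB where "BB = (\<lambda>(c, B). V c B) ` (C \<times> D)"
  have cnt: "countable BB" unfolding BB_def using C D by (intro countable_image countable_SIGMA) auto
  have op: "open_in M U" if U: "U \<in> BB" for U
  proof -
    obtain c B where cB: "c \<in> C" "B \<in> D" "U = V c B" using U by (auto simp: BB_def)
    have c: "c \<in> Atlas M" using C cB by blast
    have "rel_open (Model M) (B \<inter> img c)" using mfd_chart(2)[OF M c] openin_Int_open[of "Model M" "img c" B] D(2)[OF cB(2)]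
      by (simp add: Int_commute)
    then show ?thesis unfolding cB(3) V_def by (intro openin_chart_inv_image[OF M c]) auto
  qed
  have bas: "\<exists>U'\<in>BB. x \<in> U' \<and> U' \<subseteq> U" if U: "open_in M U" and x: "x \<in> U" for U x
  proof -
    have "x \<in> points M" using U x mfd_openin[OF M] by blast
    then obtain c where c: "c \<in> C" "x \<in> fst c" using C by blast
    have cA: "c \<in> Atlas M" using c C by blast
    obtain S where S: "open S" "img_on c U = Model M \<inter> S" using rel_open_chart_image[OF M U cA] by (auto simp: openin_open)
    have xS: "snd c x \<in> S" using S(2) c x by blast
    obtain B where B: "B \<in> D" "snd c x \<in> B" "B \<subseteq> S" using D(3)[OF S(1)] xS by blast
    have "V c B \<subseteq> U"
    proof
      fix y assume "y \<in> V c B"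
      then obtain q where q: "q \<in> fst c" "snd c q \<in> B" "y = q" using chart_inv_left[OF M cA] by (auto simp: V_def)
      have "snd c q \<in> Model M" using rel_open_subset[OF mfd_chart(2)[OF M cA]] q(1) by blast
      then have "snd c q \<in> img_on c U" using S(2) q(2) B(3) by blast
      then show "y \<in> U" using mfd_chart(1)[OF M cA] q by (auto dest: inj_onD)
    qed
    moreover have "x \<in> V c B" using c B chart_inv_left[OF M cA c(2)] by (force simp: V_def)
    moreover have "V c B \<in> BB" using c B by (auto simp: BB_def)
    ultimately show ?thesis by blast
  qed
  show ?thesis unfolding second_countable_def using cnt op bas by (intro exI[of _ BB]) blast
qed

lemma compact_finite_atlas:
  assumes M: "premanifold M" and "compact_space (mtopology M)"
  obtains C where "finite C" "C \<subseteq> Atlas M" "points M \<subseteq> \<Union>(fst ` C)"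
proof -
  have "compactin (mtopology M) (points M)" using assms(2) by (simp add: compact_space_def topspace_mtopology[OF M])
  moreover have "\<forall>U\<in>fst ` Atlas M. open_in M U" using openin_chart_domain[OF M] by blast
  moreover have "points M \<subseteq> \<Union>(fst ` Atlas M)" by (simp add: points_def)
  ultimately obtain F where F: "finite F" "F \<subseteq> fst ` Atlas M" "points M \<subseteq> \<Union>F" unfolding compactin_def by blast
  obtain C where "finite C" "C \<subseteq> Atlas M" "F = fst ` C" using finite_subset_image[OF F(1,2)] by blast
  then show ?thesis using that F(3) by blast
qed

lemma smooth_continuous_map:
  assumes M: "premanifold M" and N: "premanifold N" and W: "open_in M W"
    and f: "\<And>p. p \<in> W ==> smooth_at M N f p"
  shows "continuous_map (subtopology (mtopology M) W) (mtopology N) f"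
  unfolding continuous_map_def
proof (intro conjI allI impI)
  have WM: "W \<subseteq> points M" using W mfd_openin[OF M] by blast
  then have ts: "topspace (subtopology (mtopology M) W) = W" using topspace_mtopology[OF M] by auto
  show "f \<in> topspace (subtopology (mtopology M) W) \<rightarrow> topspace (mtopology N)"
    unfolding ts topspace_mtopology[OF N] using smooth_at_points[OF f M] by auto
  fix V assume V: "open_in N V"
  have "open_in M (W \<inter> f -` V)" by (rule smooth_at_openin_preimage[OF M N W f V])
  moreover have "{x \<in> topspace (subtopology (mtopology M) W). f x \<in> V} = W \<inter> (W \<inter> f -` V)" unfolding ts by auto
  ultimately show "openin (subtopology (mtopology M) W) {x \<in> topspace (subtopology (mtopology M) W). f x \<in> V}"
    by (simp only: openin_subtopology_Int2)
qed

text \<open>Preimages of disjoint neighbourhoods under a smooth map. Applied to projections and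
  ambient coordinates it yields the Hausdorff property of products and cylinders.\<close>

lemma smooth_separation:
  assumes M: "premanifold M" and N: "premanifold N" and H: "Hausdorff_space (mtopology N)"
    and f: "\<And>p. p \<in> points M ==> smooth_at M N f p" and pq: "p \<in> points M" "q \<in> points M" "f p \<noteq> f q"
  shows "\<exists>U V. open_in M U \<and> open_in M V \<and> p \<in> U \<and> q \<in> V \<and> disjnt U V"
proof -
  have "f p \<in> topspace (mtopology N)" "f q \<in> topspace (mtopology N)" using smooth_at_points[OF f M] pq topspace_mtopology[OF N] by auto
  then obtain U V where UV: "open_in N U" "open_in N V" "f p \<in> U" "f q \<in> V" "disjnt U V" using H pq(3) unfolding Hausdorff_space_def by blast
  have "open_in M (points M \<inter> f -` U)" "open_in M (points M \<inter> f -` V)"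
    by (rule smooth_at_openin_preimage[OF M N openin_points[OF M] f UV(1)]
        smooth_at_openin_preimage[OF M N openin_points[OF M] f UV(2)]; assumption)+
  then show ?thesis using UV pq by (intro exI[of _ "points M \<inter> f -` U"] exI[of _ "points M \<inter> f -` V"]) (auto simp: disjnt_def)
qed

lemma mtopology_flat_UNIV: "mtopology (flat (UNIV :: 'e::euclidean_space set)) = euclidean" by (simp add: topology_eq open_openin[symmetric])

lemma Hausdorff_flat_UNIV: "Hausdorff_space (mtopology (flat (UNIV :: 'e::euclidean_space set)))" by (simp add: mtopology_flat_UNIV)

lemma Hausdorff_prod_mfd:
  assumes M: "premanifold M" and N: "premanifold N" and "Hausdorff_space (mtopology M)" "Hausdorff_space (mtopology N)"
  shows "Hausdorff_space (mtopology (prod_mfd M N))"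
  unfolding Hausdorff_space_def topspace_mtopology[OF mfd_prod[OF M N]]
proof (intro allI impI)
  fix p q assume pq: "p \<in> points (prod_mfd M N) \<and> q \<in> points (prod_mfd M N) \<and> p \<noteq> q"
  note P = mfd_prod[OF M N]
  consider "fst p \<noteq> fst q" | "snd p \<noteq> snd q" using pq by (auto simp: prod_eq_iff)
  then show "\<exists>U V. open_in (prod_mfd M N) U \<and> open_in (prod_mfd M N) V \<and> p \<in> U \<and> q \<in> V \<and> disjnt U V"
  proof cases
    case 1
    show ?thesis by (rule smooth_separation[OF P M assms(3) smooth_at_fst_snd(1)[OF M N] _ _ 1]) (use pq in auto)
  next
    case 2
    show ?thesis by (rule smooth_separation[OF P N assms(4) smooth_at_fst_snd(2)[OF M N] _ _ 2]) (use pq in auto)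
  qed
qed

lemma Hausdorff_cylinder: "Hausdorff_space (mtopology (cylinder \<epsilon>))" unfolding Hausdorff_space_def topspace_mtopology[OF mfd_cylinder]
proof (intro allI impI)
  fix p q assume pq: "p \<in> points (cylinder \<epsilon>) \<and> q \<in> points (cylinder \<epsilon>) \<and> p \<noteq> q"
  note P = mfd_cylinder[of \<epsilon>]
  consider "fst p \<noteq> fst q" | "snd p \<noteq> snd q" using pq by (auto simp: prod_eq_iff)
  then show "\<exists>U V. open_in (cylinder \<epsilon>) U \<and> open_in (cylinder \<epsilon>) V \<and> p \<in> U \<and> q \<in> V \<and> disjnt U V"
  proof cases
    case 1
    show ?thesis by (rule smooth_separation[OF P mfd_vec Hausdorff_flat_UNIV cylinder_coordinates(1) _ _ 1]) (use pq in auto)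
  next
    case 2
    show ?thesis by (rule smooth_separation[OF P mfd_vec Hausdorff_flat_UNIV cylinder_coordinates(2) _ _ 2]) (use pq in auto)
  qed
qed

lemma cylinder_countable_atlas: "points (cylinder \<epsilon>) \<subseteq> fst (cyl_chart \<epsilon> 1) \<union> fst (cyl_chart \<epsilon> (- 1))"
proof
  fix p assume "p \<in> points (cylinder \<epsilon>)"
  then have "cmod (fst p) = 1" "\<bar>snd p\<bar> < \<epsilon>" by (auto simp: points_cylinder)
  moreover have "fst p \<noteq> - 1 \<or> fst p \<noteq> 1" by auto
  ultimately show "p \<in> fst (cyl_chart \<epsilon> 1) \<union> fst (cyl_chart \<epsilon> (- 1))" by (auto simp: cyl_chart_def case_prod_unfold)
qed

text \<open>Gives continuity of the identity from the product topology to the topology of the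
  product manifold, through which compactness of products is transported.\<close>

lemma openin_prod_mfd_imp:
  assumes M: "premanifold M" and N: "premanifold N" and S: "open_in (prod_mfd M N) S"
  shows "openin (prod_topology (mtopology M) (mtopology N)) S"
  unfolding openin_prod_topology_alt
proof (intro allI impI)
  fix x y assume xy: "(x, y) \<in> S"
  note P = mfd_prod[OF M N]
  have "(x, y) \<in> points (prod_mfd M N)" using S xy mfd_openin[OF P] by blast
  then have "x \<in> points M" "y \<in> points N" by simp_all
  then obtain c d where c: "c \<in> Atlas M" "x \<in> fst c" and d: "d \<in> Atlas N" "y \<in> fst d" by (auto simp: points_def)
  note i = mfd_chart[OF M c(1)] mfd_chart[OF N d(1)]
  let ?e = "prod_chart c d"
  have e: "?e \<in> Atlas (prod_mfd M N)" by (rule prod_chart_Atlas[OF c(1) d(1)])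
  have o1: "openin (top_of_set (Model M \<times> Model N)) (img_on ?e S)" using rel_open_chart_image[OF P S e] by simp
  have e1: "top_of_set (Model M \<times> Model N) = prod_topology (top_of_set (Model M)) (top_of_set (Model N))"
    by (simp add: subtopology_Times[symmetric] euclidean_product_topology[symmetric])
  have oS: "openin (prod_topology (top_of_set (Model M)) (top_of_set (Model N))) (img_on ?e S)" using o1 unfolding e1 .
  have inS: "(snd c x, snd d y) \<in> img_on ?e S" using xy c d by (intro image_eqI[of _ _ "(x, y)"]) auto
  obtain U V where UV: "openin (top_of_set (Model M)) U" "openin (top_of_set (Model N)) V"
    "snd c x \<in> U" "snd d y \<in> V" "U \<times> V \<subseteq> img_on ?e S"
    using openin_prod_topology_alt[THEN iffD1, rule_format, OF oS inS] by blast
  define U' V' where "U' = U \<inter> img c" and "V' = V \<inter> img d"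
  have o: "rel_open (Model M) U'" "rel_open (Model N) V'" unfolding U'_def V'_def using rel_open_Int i(2,4) UV(1,2) mfd_subspace M N by blast+
  have "open_in M (chart_inv c ` U')" "open_in N (chart_inv d ` V')"
    by (rule openin_chart_inv_image[OF M c(1) o(1)] openin_chart_inv_image[OF N d(1) o(2)]; simp add: U'_def V'_def)+
  moreover have "x \<in> chart_inv c ` U'" using chart_inv_left[OF M c] UV(3) c(2) by (intro image_eqI[of _ _ "snd c x"]) (auto simp: U'_def)
  moreover have "y \<in> chart_inv d ` V'" using chart_inv_left[OF N d] UV(4) d(2) by (intro image_eqI[of _ _ "snd d y"]) (auto simp: V'_def)
  moreover have "chart_inv c ` U' \<times> chart_inv d ` V' \<subseteq> S"
  proof
    fix p assume "p \<in> chart_inv c ` U' \<times> chart_inv d ` V'"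
    then obtain x' y' where p: "p = (x', y')" "x' \<in> fst c" "y' \<in> fst d" "snd c x' \<in> U" "snd d y' \<in> V"
      using chart_inv_left[OF M c(1)] chart_inv_left[OF N d(1)] by (auto simp: U'_def V'_def)
    then have "(snd c x', snd d y') \<in> img_on ?e S" using UV(5) by blast
    then obtain x'' y'' where "x'' \<in> fst c" "y'' \<in> fst d" "(x'', y'') \<in> S" "snd c x'' = snd c x'" "snd d y'' = snd d y'" by auto
    then show "p \<in> S" using i(1,3) p by (metis inj_onD)
  qed
  ultimately show "\<exists>U V. open_in M U \<and> open_in N V \<and> x \<in> U \<and> y \<in> V \<and> U \<times> V \<subseteq> S" by blast
qed

context polar_cap
begin

text \<open>The set is the image under the inverse chart of the closed disc bounded by the latitude
  circle of height \<open>b\<close>; the condition \<open>b < \<epsilon>\<close> keeps this disc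
  inside the chart.\<close>

lemma compact_cap_part:
  assumes b: "0 \<le> b" "b < \<epsilon>"
  shows "compactin (mtopology Cap) {p \<in> points Cap. \<bar>snd p\<bar> \<le> b}"
proof -
  let ?I = "fst ` points Cap" and ?c = "(points Cap, fst :: complex \<times> real => complex)"
  let ?K = "cball (0 :: complex) (sqrt (2 * b - b\<^sup>2))"
  have nn: "0 \<le> 2 * b - b\<^sup>2"
  proof -
    have "b * b \<le> 1 * b" using b eps by (intro mult_right_mono) auto
    then show ?thesis using b by (simp add: power2_eq_square)
  qed
  have KI: "?K \<subseteq> ?I"
  proof
    fix z assume "z \<in> ?K"
    then have "(cmod z)\<^sup>2 \<le> (sqrt (2 * b - b\<^sup>2))\<^sup>2" by (intro power_mono) auto
    also have "\<dots> = 1 - (1 - b)\<^sup>2" using nn by (simp add: power2_eq_square algebra_simps)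
    also have "\<dots> < 1 - (1 - \<epsilon>)\<^sup>2" using b eps by (simp add: power_strict_mono)
    finally show "z \<in> ?I" unfolding cap_image by (simp add: power2_eq_square algebra_simps)
  qed
  have "continuous_map (subtopology (mtopology (flat UNIV)) ?I) (mtopology Cap) (chart_inv ?c)"
  proof (rule smooth_continuous_map[OF mfd_vec mfd_cap])
    show "open_in (flat UNIV) ?I" using open_cap_image by simp
    show "smooth_at (flat UNIV) Cap (chart_inv ?c) p" if "p \<in> ?I" for p using smooth_at_chart_inv[OF mfd_cap, of ?c p] that by simp
  qed
  moreover have "compactin (subtopology (mtopology (flat UNIV)) ?I) ?K" using KI by (simp add: mtopology_flat_UNIV compactin_subtopology)
  ultimately have "compactin (mtopology Cap) (chart_inv ?c ` ?K)" by (rule image_compactin[rotated])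
  moreover have "chart_inv ?c ` ?K = {p \<in> points Cap. \<bar>snd p\<bar> \<le> b}"
  proof -
    have iff: "z \<in> ?K \<longleftrightarrow> 1 - sqrt (1 - (cmod z)\<^sup>2) \<le> b" if "(cmod z)\<^sup>2 < 1" for z
    proof -
      have "z \<in> ?K \<longleftrightarrow> sqrt ((cmod z)\<^sup>2) \<le> sqrt (2 * b - b\<^sup>2)" by simp
      also have "\<dots> \<longleftrightarrow> (cmod z)\<^sup>2 \<le> 2 * b - b\<^sup>2" by (rule real_sqrt_le_iff)
      also have "\<dots> \<longleftrightarrow> (1 - b)\<^sup>2 \<le> 1 - (cmod z)\<^sup>2" by (simp add: power2_eq_square algebra_simps)
      also have "\<dots> \<longleftrightarrow> 1 - b \<le> sqrt (1 - (cmod z)\<^sup>2)"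
      proof
        assume "1 - b \<le> sqrt (1 - (cmod z)\<^sup>2)"
        then have "(1 - b)\<^sup>2 \<le> (sqrt (1 - (cmod z)\<^sup>2))\<^sup>2" using b eps by (intro power_mono) auto
        then show "(1 - b)\<^sup>2 \<le> 1 - (cmod z)\<^sup>2" using that by simp
      qed (rule real_le_rsqrt)
      finally show ?thesis by linarith
    qed
    have habs: "\<bar>snd p\<bar> = 1 - sqrt (1 - (cmod (fst p))\<^sup>2)" if "p \<in> points Cap" for p using height[OF that] s by auto
    show ?thesis
    proof (intro equalityI subsetI)
      fix p assume "p \<in> chart_inv ?c ` ?K"
      then obtain z where z: "z \<in> ?K" "p = chart_inv ?c z" by blast
      have zI: "z \<in> ?I" using KI z by blast
      have "p \<in> points Cap" "fst p = z" using chart_inv_right[of z ?c] zI z(2) by auto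
      then show "p \<in> {p \<in> points Cap. \<bar>snd p\<bar> \<le> b}" using habs iff[of z] z(1) cmod_cap[of p] by auto
    next
      fix p assume p: "p \<in> {p \<in> points Cap. \<bar>snd p\<bar> \<le> b}"
      then have "fst p \<in> ?K" using habs[of p] iff[of "fst p"] cmod_cap[of p] by auto
      moreover have "chart_inv ?c (fst p) = p" using chart_inv_left[OF mfd_cap, of ?c p] p by simp
      ultimately show "p \<in> chart_inv ?c ` ?K" by (metis image_eqI)
    qed
  qed
  ultimately show ?thesis by simp
qed

end

section \<open>Fundamental fields in cylinder coordinates\<close>

lemma smooth_at_flat_DERIV:
  fixes g :: "real => real"
  assumes "smooth_vec (flat UNIV) g x"
  shows "(g has_real_derivative dmap (flat UNIV) g x 1) (at x)"
proof -
  obtain T where T: "rel_open (Model (flat (UNIV :: real set))) T" "x \<in> T" "smooth_on (Model (flat UNIV)) T (\<lambda>y. g (chart_inv (UNIV, \<lambda>x. x) y))"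
    by (rule smooth_at_flatD[OF mfd_vec subspace_UNIV assms, of "(UNIV, \<lambda>x. x)"]) auto
  then have "rel_open UNIV T" "smooth_on UNIV T g" by (simp_all add: chart_inv_flat)
  then have "((\<lambda>t. g (0 + t *\<^sub>R 1)) has_real_derivative dderiv g (0 + x *\<^sub>R 1) 1) (at x)"
    using T(2) by (intro DERIV_line[of UNIV T] smooth_on_differentiable[of UNIV]) auto
  then show ?thesis by (simp add: tmap_flat)
qed

text \<open>Differentiating \<open>cis (t * k) * z\<close> at \<open>0\<close> gives
  \<open>\<i> * k * z\<close>, and cancelling \<open>\<i> * z\<close> leaves the angular velocity
  \<open>k\<close>. The imaginary part vanishes because the height is constant along the
  orbit.\<close>

lemma tmap_fundamental_field_cylinder:
  assumes M: "premanifold M" and f: "smooth_at M (cylinder \<epsilon>) f p"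
    and orb: "smooth_at (flat UNIV) M (orbit act X p) 0" and one: "act 1 p = p"
    and eq: "\<And>t::real. f (act (torus_exp (t *\<^sub>R X)) p) = (cis (t * k) * fst (f p), snd (f p))"
    and X: "fundamental_field M act X p \<in> Model M"
  shows "tmap M (cylinder \<epsilon>) f p (fundamental_field M act X p) = complex_of_real k"
proof -
  note t = tmap_cylinder[OF M f X]
  let ?V = "tmap M (cylinder \<epsilon>) f p (fundamental_field M act X p)"
  have s: "smooth_vec M (\<lambda>q. fst (f q)) (act (torus_exp ((0::real) *\<^sub>R X)) p)"
     "smooth_vec M (\<lambda>q. snd (f q)) (act (torus_exp ((0::real) *\<^sub>R X)) p)"
    using t(3,4) one by simp_all
  have "dmap M (\<lambda>q. snd (f q)) p (fundamental_field M act X p) = 0" using tmap_compose[OF mfd_vec M mfd_vec orb s(2), of 1]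
    by (simp add: fundamental_field_eq_tmap one eq tmap_const)
  then have im: "Im ?V = 0" using t(2) by simp
  have "dmap M (\<lambda>q. fst (f q)) p (fundamental_field M act X p)
      = dmap (flat UNIV) (\<lambda>t::real. cis (t * k) * fst (f p)) 0 1"
    using tmap_compose[OF mfd_vec M mfd_vec orb s(1), of 1] by (simp add: fundamental_field_eq_tmap one eq)
  also have "\<dots> = (1 * k) *\<^sub>R (\<i> * cis (0 * k)) * fst (f p)"
  proof (subst tmap_flat, goal_cases)
    case 5
    have "((\<lambda>t::real. t * k) has_derivative (\<lambda>t. t * k)) (at 0)" by (auto intro!: derivative_eq_intros)
    from has_derivative_mult_left[OF has_derivative_cis[OF this]]
    show ?case by (intro dderiv_eq[of UNIV UNIV]) auto
  qed auto
  finally have "\<i> * fst (f p) * complex_of_real (Re ?V) = \<i> * fst (f p) * complex_of_real k"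
    using t(1) by (simp add: scaleR_conv_of_real mult_ac)
  moreover have "f p \<in> points (cylinder \<epsilon>)" using smooth_at_points[OF f M] by simp
  then have "\<i> * fst (f p) \<noteq> 0" by (auto simp: points_cylinder)
  ultimately have "Re ?V = k" by (metis mult_cancel_left of_real_eq_iff)
  then show ?thesis using im by (simp add: complex_eq_iff)
qed

lemma fundamental_field_mem:
  assumes M: "premanifold M" and orb: "smooth_at (flat UNIV) M (orbit act X p) 0" and one: "act 1 p = p"
  shows "fundamental_field M act X p \<in> Model M"
proof -
  have "fundamental_field M act X p = tmap (flat UNIV) M (orbit act X p) 0 1" by (rule fundamental_field_eq_tmap) (rule one)
  then show ?thesis using tmap_mem[OF mfd_vec M orb, of 1] by simp
qed


section \<open>One side of the gluing\<close>

definition drop_circle :: "'n => complex ^ 'n => complex ^ 'n::finite" where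
  "drop_circle l z = (\<chi> i. if i = l then 1 else z $ i)"

lemma drop_circle_torus: "z \<in> torus UNIV ==> drop_circle l z \<in> torus (- {l})" by (auto simp: torus_def drop_circle_def)

lemma drop_coord_lie: "drop_coord l X \<in> torus_lie (- {l})" by (auto simp: torus_lie_def drop_coord_def)

lemma drop_circle_exp: "drop_circle l (torus_exp (t *\<^sub>R X)) = torus_exp (t *\<^sub>R drop_coord l X)"
  by (simp add: drop_circle_def torus_exp_def drop_coord_def vec_eq_iff)

lemma torus_exp_UNIV: "torus_exp X \<in> torus UNIV" by (rule torus_exp_in_torus) simp

lemma toric_structureD:
  assumes "toric_structure J M \<omega> act \<mu>"
  shows "premanifold M" "Hausdorff_space (mtopology M)" "torus_action J M act" "closed_smooth_form M (points M) \<omega>"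
    "\<And>p. p \<in> points M ==> alternating_bilinear (Model M) (\<omega> p)"
    "\<And>p u. p \<in> points M ==> u \<in> Model M ==> u \<noteq> 0 ==> \<exists>v\<in>Model M. \<omega> p u v \<noteq> 0"
    "\<And>p. p \<in> points M ==> act 1 p = p" "\<And>z p. z \<in> torus J ==> p \<in> points M ==> act z p \<in> points M"
    "\<And>z w p. z \<in> torus J ==> w \<in> torus J ==> p \<in> points M ==> act (z * w) p = act z (act w p)"
    "\<And>p. p \<in> points M ==> smooth_at M (flat (torus_lie J)) \<mu> p"
    "\<And>z p. z \<in> torus J ==> p \<in> points M ==> \<mu> (act z p) = \<mu> p"
    "\<And>X p u. X \<in> torus_lie J ==> p \<in> points M ==> u \<in> Model M ==>
        dmap M (\<lambda>q. \<mu> q \<bullet> X) p u = - \<omega> p (fundamental_field M act X p) u"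
    "effective_action J M act"
  using assms smooth_map_on_iff[OF _ mfd_flat[OF subspace_torus_lie], of M "points M" J \<mu>]
  by (auto simp: toric_structure_def smooth_manifold_iff symplectic_form_def torus_action_def moment_map_def smooth_form2_on_def)

text \<open>The two sides obey the same axioms: \<open>s = 1\<close> with \<open>\<rho> = id\<close>
  for the first, \<open>s = - 1\<close> with \<open>\<rho>\<close> the identity or conjugation for
  the second. Everything about a single end is proved once, here.\<close>

locale glue_side = half_cylinder s \<epsilon> \<rho> \<sigma> for s \<epsilon> :: real and \<rho> \<sigma> +
  fixes l :: "'n::finite"
    and XF :: "('f, complex ^ 'n) mfd" and \<omega>F actF and \<mu>F :: "'f => real ^ 'n"
    and X :: "('a, complex ^ 'n) mfd" and \<omega> act and \<mu> :: "'a => real ^ 'n"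
    and W \<Phi>
  assumes F: "toric_structure (- {l}) XF \<omega>F actF \<mu>F" and F_compact: "compact_space (mtopology XF)"
    and F_connected: "connected_space (mtopology XF)" and F_nonempty: "points XF \<noteq> {}"
    and F_Model: "Model XF = {z. z $ l = 0}"
    and T: "toric_structure UNIV X \<omega> act \<mu>" and X_compact: "compact_space (mtopology X)" and X_Model: "Model X = UNIV"
    and lm: "local_model l s \<epsilon> XF \<omega>F actF X \<omega> act W \<Phi>"
begin

lemmas FT = toric_structureD[OF F]
lemmas XT = toric_structureD[OF T]

abbreviation P where "P \<equiv> prod_mfd XF Cyl"
abbreviation PC where "PC \<equiv> prod_mfd XF Cap"

lemma pm: "premanifold XF" "premanifold X" "premanifold P" "premanifold PC" using FT(1) XT(1) mfd_prod mfd_cylinder mfd_cap by blast+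

lemma lm_facts:
  shows bij: "bij_betw \<Phi> W (points PC)"
    and W_open: "open_in X W"
    and \<Phi>_smooth: "p \<in> W ==> smooth_at X PC \<Phi> p"
    and \<Phi>_inv_smooth: "q \<in> points PC ==> smooth_at PC X (inv_into W \<Phi>) q"
    and \<Phi>_form: "p \<in> W ==> pullback2 X PC \<Phi> (prod_form XF \<omega>F Cap (cap_form s)) p u v = \<omega> p u v"
    and \<Phi>_act: "z \<in> torus UNIV ==> p \<in> W ==> act z p \<in> W"
      "z \<in> torus UNIV ==> p \<in> W ==> \<Phi> (act z p) =
        (actF (drop_circle l z) (fst (\<Phi> p)), z $ l * fst (snd (\<Phi> p)), snd (snd (\<Phi> p)))"
  using lm smooth_map_on_iff[OF pm(2,4), of W \<Phi>] smooth_map_on_iff[OF pm(4,2), of "points PC" "inv_into W \<Phi>"]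
  unfolding local_model_def Let_def drop_circle_def case_prod_unfold X_Model by (blast | simp)+

definition half where "half = points XF \<times> cyl_half"
text \<open>The inclusion of one half of the neck into the given manifold, read off from the local
  model; \<open>of_X\<close> inverts it on \<open>Wcut\<close>, the end without its pole
  set.\<close>

definition to_X where "to_X q = inv_into W \<Phi> (fst q, to_cap (snd q))"
definition of_X where "of_X p = (fst (\<Phi> p), of_cap (snd (\<Phi> p)))"
definition Wcut where "Wcut = W \<inter> cut_points X W \<Phi>"

lemma half_points: "half \<subseteq> points P" by (auto simp: half_def cyl_half_def)

lemma openin_half: "open_in P half"
proof -
  have "open_in P (points P \<inter> snd -` cyl_half)"
    by (rule smooth_at_openin_preimage[OF pm(3) mfd_cylinder openin_points[OF pm(3)] smooth_at_fst_snd(2)[OF pm(1) mfd_cylinder] openin_cyl_half])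
      simp
  moreover have "points P \<inter> snd -` cyl_half = half" by (auto simp: half_def cyl_half_def)
  ultimately show ?thesis by simp
qed

lemma \<Phi>_points: "p \<in> W ==> fst (\<Phi> p) \<in> points XF" "p \<in> W ==> snd (\<Phi> p) \<in> points Cap"
  using bij by (auto simp: bij_betw_def mem_Times_iff dest!: equalityD1)

lemma W_points: "W \<subseteq> points X" using W_open mfd_openin[OF pm(2)] by blast

lemma pole_iff: "q \<in> points Cap ==> q = (0, 0) \<longleftrightarrow> fst q = 0" using height[of q] by (auto simp: prod_eq_iff)

lemma Wcut_eq: "Wcut = {p \<in> W. fst (snd (\<Phi> p)) \<noteq> 0}"
  using W_points pole_iff[OF \<Phi>_points(2)] by (auto simp: Wcut_def cut_points_def)

lemma Wcut_W: "p \<in> Wcut ==> p \<in> W" and Wcut_cut: "p \<in> Wcut ==> p \<in> cut_points X W \<Phi>"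
  and Wcut_points: "p \<in> Wcut ==> p \<in> points X" and cut_points: "p \<in> cut_points X W \<Phi> ==> p \<in> points X"
  by (auto simp: Wcut_def cut_points_def)

lemma of_X_half: "p \<in> Wcut ==> of_X p \<in> half" using \<Phi>_points of_cap_half(1) by (auto simp: Wcut_eq of_X_def half_def)

lemma to_X_of_X: "p \<in> Wcut ==> to_X (of_X p) = p" using \<Phi>_points(2)[of p] of_cap_half(2)[of "snd (\<Phi> p)"] bij
  by (auto simp: Wcut_eq of_X_def to_X_def bij_betw_def)

lemma to_X_facts:
  assumes q: "q \<in> half"
  shows "to_X q \<in> Wcut" "of_X (to_X q) = q" "\<Phi> (to_X q) = (fst q, to_cap (snd q))"
proof -
  have c: "snd q \<in> cyl_half" "fst q \<in> points XF" using q by (auto simp: half_def)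
  then have PCp: "(fst q, to_cap (snd q)) \<in> \<Phi> ` W" using to_cap_points bij by (auto simp: bij_betw_def)
  then show e: "\<Phi> (to_X q) = (fst q, to_cap (snd q))" by (simp add: to_X_def f_inv_into_f)
  have "to_X q \<in> W" using PCp by (simp add: to_X_def inv_into_into)
  then show "to_X q \<in> Wcut" using e to_cap_nonzero[OF c(1)] by (simp add: Wcut_eq)
  show "of_X (to_X q) = q" using e of_cap_to_cap[OF c(1)] by (simp add: of_X_def)
qed

lemma smooth_snd_\<Phi>:
  assumes "p \<in> W"
  shows "smooth_at X XF (\<lambda>p. fst (\<Phi> p)) p" "smooth_at X Cap (\<lambda>p. snd (\<Phi> p)) p"
proof -
  have "\<Phi> p \<in> points XF \<times> points Cap" using \<Phi>_points[OF assms] by (simp add: mem_Times_iff)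
  note fs = smooth_at_fst_snd[OF pm(1) mfd_cap this]
  show "smooth_at X XF (\<lambda>p. fst (\<Phi> p)) p" "smooth_at X Cap (\<lambda>p. snd (\<Phi> p)) p"
    by (rule smooth_at_compose[OF pm(2,4,1) \<Phi>_smooth[OF assms] fs(1)]
        smooth_at_compose[OF pm(2,4) mfd_cap \<Phi>_smooth[OF assms] fs(2)])+
qed

lemma openin_Wcut: "open_in X Wcut"
proof -
  have "smooth_vec X (\<lambda>p. fst (snd (\<Phi> p))) p" if "p \<in> W" for p
    by (rule smooth_at_compose[OF pm(2) mfd_cap mfd_vec smooth_snd_\<Phi>(2)[OF that] smooth_at_cap_fst[OF \<Phi>_points(2)[OF that]]])
  then have "open_in X (W \<inter> (\<lambda>p. fst (snd (\<Phi> p))) -` (- {0}))" by (intro smooth_at_openin_preimage[OF pm(2) mfd_vec W_open]) auto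
  moreover have "W \<inter> (\<lambda>p. fst (snd (\<Phi> p))) -` (- {0}) = Wcut" by (auto simp: Wcut_eq)
  ultimately show ?thesis by simp
qed

lemma smooth_of_X:
  assumes p: "p \<in> Wcut"
  shows "smooth_at X XF (\<lambda>p. fst (of_X p)) p" "smooth_at X Cyl (\<lambda>p. snd (of_X p)) p" "smooth_at X P of_X p"
proof -
  have W: "p \<in> W" "fst (snd (\<Phi> p)) \<noteq> 0" using p by (auto simp: Wcut_eq)
  show 1: "smooth_at X XF (\<lambda>p. fst (of_X p)) p" using smooth_snd_\<Phi>(1)[OF W(1)] by (simp add: of_X_def)
  have "smooth_at X Cyl (\<lambda>p. of_cap (snd (\<Phi> p))) p"
    by (rule smooth_at_compose[OF pm(2) mfd_cap mfd_cylinder smooth_snd_\<Phi>(2)[OF W(1)] smooth_of_cap[OF \<Phi>_points(2)[OF W(1)] W(2)]])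
  then show 2: "smooth_at X Cyl (\<lambda>p. snd (of_X p)) p" by (simp add: of_X_def)
  show "smooth_at X P of_X p" using smooth_at_Pair[OF pm(2,1) mfd_cylinder 1 2] by simp
qed

lemma smooth_to_X:
  assumes q: "q \<in> half"
  shows "smooth_at P X to_X q"
proof -
  have c: "snd q \<in> cyl_half" "fst q \<in> points XF" "q \<in> points XF \<times> points Cyl" using q half_points by (auto simp: half_def)
  note fs = smooth_at_fst_snd[OF pm(1) mfd_cylinder c(3)]
  have "smooth_at P Cap (\<lambda>q. to_cap (snd q)) q" by (rule smooth_at_compose[OF pm(3) mfd_cylinder mfd_cap fs(2) smooth_to_cap(1)[OF c(1)]])
  note P1 = smooth_at_Pair[OF pm(3,1) mfd_cap fs(1) this]
  have "(fst q, to_cap (snd q)) \<in> points PC" using c to_cap_points by simp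
  from smooth_at_compose[OF pm(3,4,2) P1 \<Phi>_inv_smooth[OF this]]
  show ?thesis by (simp add: to_X_def[abs_def])
qed

text \<open>This set is the image of the compact product of \<open>XF\<close> with a closed part of
  the cap, and compact sets are closed in the Hausdorff manifold \<open>X\<close>. It is what keeps
  points outside \<open>W\<close> away from the pole set.\<close>

lemma closedin_core:
  assumes b: "0 \<le> b" "b < \<epsilon>"
  shows "closedin (mtopology X) {p \<in> W. \<bar>snd (snd (\<Phi> p))\<bar> \<le> b}"
proof -
  let ?K = "points XF \<times> {p \<in> points Cap. \<bar>snd p\<bar> \<le> b}"
  let ?Q = "prod_topology (mtopology XF) (mtopology Cap)"
  have "compactin (mtopology XF) (points XF)" using F_compact by (simp add: compact_space_def topspace_mtopology[OF pm(1)])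
  then have K: "compactin ?Q ?K" using compact_cap_part[OF b] by (simp add: compactin_Times)
  have "continuous_map (subtopology (mtopology PC) (points PC)) (mtopology X) (inv_into W \<Phi>)"
    by (rule smooth_continuous_map[OF pm(4,2) openin_points[OF pm(4)] \<Phi>_inv_smooth])
  moreover have "subtopology (mtopology PC) (points PC) = mtopology PC"
    using subtopology_topspace[of "mtopology PC"] topspace_mtopology[OF pm(4)] by simp
  moreover have "continuous_map ?Q (mtopology PC) (\<lambda>x. x)" unfolding continuous_map_def
  proof (intro conjI allI impI)
    show "(\<lambda>x. x) \<in> topspace ?Q \<rightarrow> topspace (mtopology PC)"
      by (simp add: topspace_mtopology[OF pm(4)] topspace_mtopology[OF pm(1)] topspace_mtopology[OF mfd_cap])
    fix U assume U: "open_in PC U"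
    have "openin ?Q U" by (rule openin_prod_mfd_imp[OF pm(1) mfd_cap U])
    moreover have "{x \<in> topspace ?Q. x \<in> U} = U" using openin_subset[OF \<open>openin ?Q U\<close>] by auto
    ultimately show "openin ?Q {x \<in> topspace ?Q. x \<in> U}" by simp
  qed
  ultimately have "continuous_map ?Q (mtopology X) (inv_into W \<Phi>)"
    using continuous_map_compose[of ?Q "mtopology PC" "\<lambda>x. x" "mtopology X" "inv_into W \<Phi>"] by (simp add: o_def)
  then have "compactin (mtopology X) (inv_into W \<Phi> ` ?K)" by (rule image_compactin[OF K])
  then have "closedin (mtopology X) (inv_into W \<Phi> ` ?K)" by (rule compactin_imp_closedin[OF XT(2)])
  moreover have "inv_into W \<Phi> ` ?K = {p \<in> W. \<bar>snd (snd (\<Phi> p))\<bar> \<le> b}"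
  proof (intro equalityI subsetI)
    fix p assume "p \<in> inv_into W \<Phi> ` ?K"
    then obtain k where k: "k \<in> ?K" "p = inv_into W \<Phi> k" by blast
    then have "k \<in> \<Phi> ` W" using bij by (auto simp: bij_betw_def)
    then have "\<Phi> p = k" "p \<in> W" using k(2) by (simp_all add: f_inv_into_f inv_into_into)
    moreover have "\<bar>snd (snd k)\<bar> \<le> b" using k(1) by (cases k) auto
    ultimately show "p \<in> {p \<in> W. \<bar>snd (snd (\<Phi> p))\<bar> \<le> b}" by simp
  next
    fix p assume p: "p \<in> {p \<in> W. \<bar>snd (snd (\<Phi> p))\<bar> \<le> b}"
    then have e: "p = inv_into W \<Phi> (\<Phi> p)" using bij by (simp add: bij_betw_def)
    have K: "\<Phi> p \<in> ?K" using p \<Phi>_points[of p] by (auto simp: mem_Times_iff)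
    show "p \<in> inv_into W \<Phi> ` ?K" by (subst e) (rule imageI[OF K])
  qed
  ultimately show ?thesis by simp
qed

lemma openin_cut_points: "open_in X (cut_points X W \<Phi>)"
proof -
  have "{p \<in> W. snd (\<Phi> p) = (0, 0)} = {p \<in> W. \<bar>snd (snd (\<Phi> p))\<bar> \<le> 0}"
  proof -
    have "snd (\<Phi> p) = (0, 0) \<longleftrightarrow> snd (snd (\<Phi> p)) = 0" if "p \<in> W" for p
      using \<Phi>_points(2)[OF that] s by (auto simp: points_cap prod_eq_iff)
    then show ?thesis by auto
  qed
  then have "closedin (mtopology X) {p \<in> W. snd (\<Phi> p) = (0, 0)}" using closedin_core[of 0] eps by simp
  then show ?thesis using topspace_mtopology[OF pm(2)] unfolding closedin_def cut_points_def by simp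
qed

lemma snd_of_X: "snd (snd (of_X p)) = snd (snd (\<Phi> p))" by (simp add: of_X_def of_cap_def case_prod_unfold)

text \<open>Provides the open sets on which the given structure is kept unchanged, and the
  neighbourhoods that separate points outside the neck from the cut locus.\<close>

lemma openin_far:
  assumes b: "0 \<le> b" "b < \<epsilon>"
  shows "open_in X (cut_points X W \<Phi> - {p \<in> Wcut. \<bar>snd (snd (of_X p))\<bar> \<le> b})"
proof -
  have "cut_points X W \<Phi> - {p \<in> Wcut. \<bar>snd (snd (of_X p))\<bar> \<le> b} = cut_points X W \<Phi> - {p \<in> W. \<bar>snd (snd (\<Phi> p))\<bar> \<le> b}"
    by (auto simp: Wcut_def snd_of_X)
  then show ?thesis using openin_diff[OF openin_cut_points closedin_core[OF b]] by simp
qed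

lemma act_Wcut:
  assumes z: "z \<in> torus UNIV" and p: "p \<in> Wcut"
  shows "act z p \<in> Wcut"
    "of_X (act z p) = (actF (drop_circle l z) (fst (of_X p)), \<rho> (z $ l) * fst (snd (of_X p)), snd (snd (of_X p)))"
proof -
  have W: "p \<in> W" "fst (snd (\<Phi> p)) \<noteq> 0" using p by (auto simp: Wcut_eq)
  have zl: "cmod (z $ l) = 1" using z by (simp add: torus_def)
  note e = \<Phi>_act[OF z W(1)]
  show "act z p \<in> Wcut" using e W zl by (auto simp: Wcut_eq)
  have "sgn (z $ l * fst (snd (\<Phi> p))) = z $ l * sgn (fst (snd (\<Phi> p)))" 
  proof -
    have "sgn (z $ l) = z $ l" using zl by (simp add: sgn_div_norm)
    then show ?thesis by (simp add: sgn_mult)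
  qed
  then show "of_X (act z p) = (actF (drop_circle l z) (fst (of_X p)), \<rho> (z $ l) * fst (snd (of_X p)), snd (snd (of_X p)))"
    by (simp add: of_X_def e of_cap_def case_prod_unfold \<rho>)
qed

lemma torus_inverse: "z \<in> torus J ==> (\<chi> i. cnj (z $ i)) \<in> torus J \<and> (\<chi> i. cnj (z $ i)) * z = 1"
  by (auto simp: torus_def vec_eq_iff complex_norm_square[symmetric] mult.commute)

text \<open>If a point were moved into the pole set, the inverse torus element would move it back
  there, because rotation fixes the centre of the cap.\<close>

lemma act_cut:
  assumes z: "z \<in> torus UNIV" and p: "p \<in> cut_points X W \<Phi>"
  shows "act z p \<in> cut_points X W \<Phi>"
proof (rule ccontr)
  assume n: "act z p \<notin> cut_points X W \<Phi>"
  have pX: "p \<in> points X" using p by (rule cut_points)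
  then have "act z p \<in> points X" by (rule XT(8)[OF z])
  then have W: "act z p \<in> W" "snd (\<Phi> (act z p)) = (0, 0)" using n by (auto simp: cut_points_def)
  let ?i = "\<chi> i. cnj (z $ i)"
  have i: "?i \<in> torus UNIV" "?i * z = 1" using torus_inverse[OF z] by auto
  have "act ?i (act z p) = p" using XT(9)[OF i(1) z pX] XT(7)[OF pX] i(2) by simp
  then have "p \<in> W" "fst (snd (\<Phi> p)) = 0" using \<Phi>_act[OF i(1) W(1)] W(2) by auto
  then have "snd (\<Phi> p) = (0, 0)" using pole_iff[OF \<Phi>_points(2)] by blast
  then show False using p \<open>p \<in> W\<close> by (simp add: cut_points_def)
qed

section \<open>Symplectic form and moment map on an end\<close>

abbreviation \<pi>F where "\<pi>F \<equiv> \<lambda>p. fst (of_X p)"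
abbreviation \<pi>C where "\<pi>C \<equiv> \<lambda>p. snd (of_X p)"

text \<open>Off the pole set, the cap component of \<open>\<Phi>\<close> factors as
  \<open>to_cap\<close> after \<open>\<pi>C\<close>; functoriality of pullback then reduces the
  second summand to \<open>pullback_cap_form\<close>.\<close>

lemma form_Wcut:
  assumes p: "p \<in> Wcut"
  shows "\<omega> p u v = pullback2 X XF \<pi>F \<omega>F p u v + \<sigma> * pullback2 X Cyl \<pi>C (cyl_form (\<lambda>_. 1)) p u v"
proof -
  have W: "p \<in> W" by (rule Wcut_W[OF p])
  have uv: "u \<in> Model X" "v \<in> Model X" by (simp_all add: X_Model)
  have "\<Phi> p \<in> points XF \<times> points Cap" using \<Phi>_points[OF W] by (simp add: mem_Times_iff)
  note fs = smooth_at_fst_snd[OF pm(1) mfd_cap this]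
  have "\<omega> p u v = pullback2 X PC \<Phi> (prod_form XF \<omega>F Cap (cap_form s)) p u v" using \<Phi>_form[OF W] by simp
  also have "\<dots> = pullback2 X PC \<Phi> (pullback2 PC XF fst \<omega>F) p u v + pullback2 X PC \<Phi> (pullback2 PC Cap snd (cap_form s)) p u v"
    by (simp add: pullback2_def prod_form_def)
  also have "pullback2 X PC \<Phi> (pullback2 PC XF fst \<omega>F) p u v = pullback2 X XF \<pi>F \<omega>F p u v"
    using pullback2_compose[OF pm(2,4,1) \<Phi>_smooth[OF W] fs(1) uv, of \<omega>F] by (simp add: of_X_def)
  also have "pullback2 X PC \<Phi> (pullback2 PC Cap snd (cap_form s)) p u v = pullback2 X Cap (\<lambda>q. snd (\<Phi> q)) (cap_form s) p u v"
    by (rule pullback2_compose[OF pm(2,4) mfd_cap \<Phi>_smooth[OF W] fs(2) uv, symmetric])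
  also have "\<dots> = pullback2 X Cap (\<lambda>q. to_cap (\<pi>C q)) (cap_form s) p u v"
  proof (rule pullback2_cong[OF pm(2) openin_Wcut p _ uv])
    show "snd (\<Phi> q) = to_cap (\<pi>C q)" if "q \<in> Wcut" for q
      using of_cap_half(2)[OF \<Phi>_points(2)[of q]] that by (simp add: of_X_def Wcut_eq)
  qed
  also have "\<dots> = pullback2 X Cyl \<pi>C (pullback2 Cyl Cap to_cap (cap_form s)) p u v"
  proof (rule pullback2_compose[OF pm(2) mfd_cylinder mfd_cap smooth_of_X(2)[OF p] _ uv])
    show "smooth_at Cyl Cap to_cap (\<pi>C p)" using of_X_half[OF p] by (intro smooth_to_cap(1)) (simp add: half_def mem_Times_iff)
  qed
  also have "\<dots> = \<sigma> * pullback2 X Cyl \<pi>C (cyl_form (\<lambda>_. 1)) p u v" using of_X_half[OF p] unfolding pullback2_def[of X]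
    by (intro pullback_cap_form) (simp add: half_def mem_Times_iff)
  finally show ?thesis .
qed

lemma \<rho>_cis: "\<rho> (cis x) = cis (\<sigma> * x)" using flip by (auto simp: cis_cnj)

lemma fundamental_Wcut:
  assumes p: "p \<in> Wcut"
  shows "tmap X XF \<pi>F p (fundamental_field X act Y p) = fundamental_field XF actF (drop_coord l Y) (\<pi>F p)"
    "tmap X Cyl \<pi>C p (fundamental_field X act Y p) = complex_of_real (\<sigma> * Y $ l)"
proof -
  have pX: "p \<in> points X" by (rule Wcut_points[OF p])
  have orb: "smooth_at (flat UNIV) X (orbit act Y p) 0" by (rule smooth_at_orbit[OF pm(2) XT(3) pX]) simp
  have xF: "\<pi>F p \<in> points XF" using of_X_half[OF p] by (simp add: half_def mem_Times_iff)
  have e: "of_X (act (torus_exp (t *\<^sub>R Y)) p) = (actF (torus_exp (t *\<^sub>R drop_coord l Y)) (\<pi>F p), cis (t * (\<sigma> * Y $ l)) * fst (\<pi>C p), snd (\<pi>C p))" for t :: real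
    using act_Wcut(2)[OF torus_exp_UNIV p, of "t *\<^sub>R Y"] by (simp add: drop_circle_exp) (simp add: torus_exp_def \<rho>_cis mult_ac)
  show "tmap X XF \<pi>F p (fundamental_field X act Y p) = fundamental_field XF actF (drop_coord l Y) (\<pi>F p)"
    by (rule tmap_fundamental_field[where act = act and act' = actF, OF pm(2,1) smooth_of_X(1)[OF p] orb XT(7)[OF pX] FT(7)[OF xF]]) (simp add: e)
  show "tmap X Cyl \<pi>C p (fundamental_field X act Y p) = complex_of_real (\<sigma> * Y $ l)"
    by (rule tmap_fundamental_field_cylinder[where act = act, OF pm(2) smooth_of_X(2)[OF p] orb XT(7)[OF pX] _
      fundamental_field_mem[where act = act, OF pm(2) orb XT(7)[OF pX]]]) (simp add: e)
qed

text \<open>Values of \<open>\<mu>F\<close> have vanishing component \<open>l\<close>, so the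
  pairing ignores that component of \<open>Y\<close>. This reduces a general \<open>Y\<close> to the
  Lie algebra of the smaller torus.\<close>

lemma moment_F:
  assumes x: "x \<in> points XF"
  shows "smooth_vec XF \<mu>F x" "smooth_vec XF (\<lambda>x. \<mu>F x \<bullet> Y) x"
    "u \<in> Model XF ==> dmap XF (\<lambda>x. \<mu>F x \<bullet> Y) x u = - \<omega>F x (fundamental_field XF actF (drop_coord l Y) x) u"
proof -
  show 1: "smooth_vec XF \<mu>F x" by (rule smooth_at_into_flat_UNIV[OF pm(1) subspace_torus_lie FT(10)[OF x]])
  show "smooth_vec XF (\<lambda>x. \<mu>F x \<bullet> Y) x" by (rule smooth_at_linear_flat(1)[OF pm(1) 1 bounded_linear_inner_left])
  assume u: "u \<in> Model XF"
  have "\<mu>F y \<bullet> Y = \<mu>F y \<bullet> drop_coord l Y" if "y \<in> points XF" for y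
  proof -
    have "\<mu>F y \<in> torus_lie (- {l})" using smooth_at_points[OF FT(10)[OF that] pm(1)] by simp
    then have "\<mu>F y $ i * Y $ i = \<mu>F y $ i * drop_coord l Y $ i" for i by (simp add: torus_lie_def drop_coord_def)
    then show ?thesis by (simp only: inner_vec_def inner_real_def)
  qed
  then have "dmap XF (\<lambda>x. \<mu>F x \<bullet> Y) x u = dmap XF (\<lambda>x. \<mu>F x \<bullet> drop_coord l Y) x u"
    by (rule tmap_cong[OF pm(1) openin_points[OF pm(1)] x _ u])
  then show "dmap XF (\<lambda>x. \<mu>F x \<bullet> Y) x u = - \<omega>F x (fundamental_field XF actF (drop_coord l Y) x) u"
    using FT(12)[OF drop_coord_lie x u] by simp
qed

text \<open>The moment map expected on the end is \<open>\<mu>F\<close> plus the height in component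
  \<open>l\<close>. The difference is paired with a fixed \<open>Y\<close> because the moment map
  condition is stated for such pairings.\<close>

definition defect where "defect Y p = \<mu> p \<bullet> Y + - (\<mu>F (\<pi>F p) \<bullet> Y + Y $ l * snd (\<pi>C p))"

lemma smooth_moment: "p \<in> points X ==> smooth_vec X \<mu> p" using XT(10) by simp

lemma defect_tmap:
  assumes p: "p \<in> Wcut"
  shows "smooth_vec X (defect Y) p" "dmap X (defect Y) p u = 0"
proof -
  have pX: "p \<in> points X" by (rule Wcut_points[OF p])
  have h: "of_X p \<in> half" by (rule of_X_half[OF p])
  have xF: "\<pi>F p \<in> points XF" using h by (simp add: half_def mem_Times_iff)
  have u: "u \<in> Model X" by (simp add: X_Model)
  note sF = smooth_of_X(1)[OF p] and sC = smooth_of_X(2)[OF p]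
  have 1: "smooth_vec X (\<lambda>q. \<mu> q \<bullet> Y) p"
    by (rule smooth_at_linear_flat(1)[OF pm(2) smooth_moment[OF pX] bounded_linear_inner_left])
  have 2: "smooth_vec X (\<lambda>q. \<mu>F (\<pi>F q) \<bullet> Y) p" by (rule smooth_at_compose[OF pm(2,1) mfd_vec sF moment_F(2)[OF xF]])
  have 3: "smooth_vec X (\<lambda>q. Y $ l * snd (\<pi>C q)) p"
    by (rule smooth_at_linear_flat(1)[OF pm(2) tmap_cylinder(4)[OF pm(2) sC u] bounded_linear_mult_right])
  note 23 = smooth_at_add_flat[OF pm(2) 2 3]
  have m: "bounded_linear (\<lambda>x::real. - x)" by (intro bounded_linear_minus bounded_linear_ident)
  note 4 = smooth_at_linear_flat[OF pm(2) 23(1) m]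
  note 5 = smooth_at_add_flat[OF pm(2) 1 4(1)]
  show "smooth_vec X (defect Y) p" using 5(1) by (simp add: defect_def[abs_def])
  let ?uF = "tmap X XF \<pi>F p u" and ?uC = "tmap X Cyl \<pi>C p u"
  have uF: "?uF \<in> Model XF" by (rule tmap_mem[OF pm(2,1) sF u])
  \<comment> \<open>The sign \<open>\<sigma>\<close> occurs twice, in the form and in the angular
    velocity of the fundamental field, and cancels. Hence the height enters with the same sign for
    both choices of \<open>\<rho>\<close>.\<close>
  have t1: "dmap X (\<lambda>q. \<mu> q \<bullet> Y) p u = - (\<omega>F (\<pi>F p) (fundamental_field XF actF (drop_coord l Y) (\<pi>F p)) ?uF - Y $ l * Im ?uC)"
    using XT(12)[of Y p u] pX form_Wcut[OF p, of "fundamental_field X act Y p" u]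
    by (simp add: X_Model pullback2_def fundamental_Wcut[OF p] cyl_form_def \<sigma>)
  have t2: "dmap X (\<lambda>q. \<mu>F (\<pi>F q) \<bullet> Y) p u = - \<omega>F (\<pi>F p) (fundamental_field XF actF (drop_coord l Y) (\<pi>F p)) ?uF"
    using tmap_compose[OF pm(2,1) mfd_vec sF moment_F(2)[OF xF] u] moment_F(3)[OF xF uF] by simp
  have t3: "dmap X (\<lambda>q. Y $ l * snd (\<pi>C q)) p u = Y $ l * Im ?uC"
    using smooth_at_linear_flat(2)[OF pm(2) tmap_cylinder(4)[OF pm(2) sC u] bounded_linear_mult_right u] tmap_cylinder(2)[OF pm(2) sC u] by simp
  show "dmap X (defect Y) p u = 0" unfolding defect_def[abs_def] 5(2)[OF u] 4(2)[OF u] 23(2)[OF u] t1 t2 t3 by simp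
qed

lemma defect_along:
  assumes N: "premanifold N" and c: "smooth_at N X c y" "c y \<in> Wcut"
  shows "smooth_vec N (\<lambda>y. defect Y (c y)) y"
    "u \<in> Model N ==> dmap N (\<lambda>y. defect Y (c y)) y u = 0"
  using smooth_at_compose[OF N pm(2) mfd_vec c(1) defect_tmap(1)[OF c(2)]]
    tmap_compose[OF N pm(2) mfd_vec c(1) defect_tmap(1)[OF c(2)]] defect_tmap(2)[OF c(2)] by simp_all

text \<open>A path leads from \<open>p\<close> to one reference point: invariance under the torus
  moves the angle to \<open>1\<close>, the vanishing derivative moves the height within an interval,
  and connectedness of \<open>XF\<close> moves the base point.\<close>

lemma defect_constant:
  assumes p: "p \<in> Wcut" and x0: "x0 \<in> points XF"
  shows "defect Y p = defect Y (to_X (x0, 1, s * (\<epsilon> / 2)))"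
proof -
  define x where "x = \<pi>F p"
  define z where "z = fst (\<pi>C p)"
  define h where "h = snd (\<pi>C p)"
  have q: "of_X p = (x, z, h)" by (simp add: x_def z_def h_def)
  have xzh: "(x, z, h) \<in> half" using of_X_half[OF p] q by simp
  then have xF: "x \<in> points XF" and z: "cmod z = 1" and hh: "\<bar>h\<bar> < \<epsilon>" "s * h > 0"
    by (auto simp: half_def cyl_half_def points_cylinder)
  define A where "A = {h. \<bar>h\<bar> < \<epsilon> \<and> s * h > 0}"
  have half1: "(y, 1, h) \<in> half" if "y \<in> points XF" "h \<in> A" for y h using that by (auto simp: half_def cyl_half_def points_cylinder A_def)
  have h0: "s * (\<epsilon> / 2) \<in> A" and hA: "h \<in> A" using eps s hh by (auto simp: A_def)
  \<comment> \<open>The torus element that rotates the angle of \<open>p\<close> back to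
    \<open>1\<close>; its \<open>\<rho>\<close> compensates the one in
    \<open>act_Wcut\<close>.\<close>
  define t where "t = (\<chi> i. if i = l then \<rho> (cnj z) else 1)"
  have t: "t \<in> torus UNIV" "drop_circle l t = 1" "t $ l = \<rho> (cnj z)"
    using z by (auto simp: t_def torus_def drop_circle_def vec_eq_iff \<rho>)
  have zz: "cnj z * z = 1" using z by (simp add: complex_norm_square[symmetric] mult.commute)
  have "of_X (act t p) = (x, 1, h)" using act_Wcut(2)[OF t(1) p] q t(2,3) FT(7)[OF xF] zz by (simp add: \<rho>)
  then have e: "act t p = to_X (x, 1, h)" using to_X_of_X[OF act_Wcut(1)[OF t(1) p]] by simp
  have "defect Y (act t p) = defect Y p" using XT(11)[OF t(1) Wcut_points[OF p]] \<open>of_X (act t p) = (x, 1, h)\<close> q by (simp add: defect_def)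
  then have 1: "defect Y p = defect Y (to_X (x, 1, h))" using e by simp
  have "convex A"
  proof -
    have "A = (if s = 1 then {0<..<\<epsilon>} else {-\<epsilon><..<0})" using s by (auto simp: A_def)
    then show ?thesis by simp
  qed
  have oA: "open A" unfolding A_def by (intro open_Collect_conj open_Collect_less continuous_intros)
  have "\<exists>k. \<forall>h\<in>A. defect Y (to_X (x, 1, h)) = k"
  proof (rule has_field_derivative_zero_constant[OF \<open>convex A\<close>])
    fix h assume h: "h \<in> A"
    have "smooth_at (flat UNIV) Cyl (\<lambda>h. (1::complex, h)) h"
    proof (rule smooth_at_into_cylinder[OF mfd_vec, of A])
      show "open_in (flat UNIV) A" using oA by simp
      show "smooth_vec (flat UNIV) (\<lambda>h. snd (1::complex, h)) h" using smooth_at_id[OF mfd_vec] by simp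
      show "smooth_vec (flat UNIV) (\<lambda>h. fst (1::complex, h)) h" using smooth_at_const[OF mfd_vec, of h "1::complex" "flat UNIV"] by simp
    qed (use h in \<open>auto simp: A_def points_cylinder\<close>)
    moreover have "smooth_at (flat UNIV) XF (\<lambda>h::real. x) h" by (rule smooth_at_const) (use xF in auto)
    ultimately have "smooth_at (flat UNIV) P (\<lambda>h. (x, 1, h)) h" by (intro smooth_at_Pair[OF mfd_vec pm(1) mfd_cylinder])
    from smooth_at_compose[OF mfd_vec pm(3,2) this smooth_to_X[OF half1[OF xF h]]]
    have c: "smooth_at (flat UNIV) X (\<lambda>h. to_X (x, 1, h)) h" .
    note d = defect_along[OF mfd_vec c to_X_facts(1)[OF half1[OF xF h]], where Y = Y]
    show "((\<lambda>h. defect Y (to_X (x, 1, h))) has_field_derivative 0) (at h within A)"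
      using smooth_at_flat_DERIV[OF d(1)] d(2)[of 1] by (auto intro: has_field_derivative_at_within)
  qed
  then have 2: "defect Y (to_X (x, 1, h)) = defect Y (to_X (x, 1, s * (\<epsilon> / 2)))" using hA h0 by auto
  have c: "smooth_at XF X (\<lambda>x. to_X (x, 1, s * (\<epsilon> / 2))) y" if y: "y \<in> points XF" for y
  proof -
    have "smooth_at XF Cyl (\<lambda>x. (1, s * (\<epsilon> / 2))) y"
      by (rule smooth_at_const[OF pm(1) y]) (use h0 in \<open>auto simp: points_cylinder A_def\<close>)
    from smooth_at_Pair[OF pm(1,1) mfd_cylinder smooth_at_id[OF pm(1) y] this]
    have "smooth_at XF P (\<lambda>x. (x, 1, s * (\<epsilon> / 2))) y" .
    from smooth_at_compose[OF pm(1,3,2) this smooth_to_X[OF half1[OF y h0]]] show ?thesis .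
  qed
  have "defect Y (to_X (x, 1, s * (\<epsilon> / 2))) = defect Y (to_X (x0, 1, s * (\<epsilon> / 2)))"
    by (rule constant_of_tmap_zero[OF pm(1) F_connected _ _ xF x0])
      (use defect_along[OF pm(1) c to_X_facts(1)[OF half1[OF _ h0]]] in auto)
  then show ?thesis using 1 2 by simp
qed

lemma moment_Wcut: "\<exists>k. \<forall>p\<in>Wcut. \<mu> p = \<mu>F (\<pi>F p) + axis l (snd (\<pi>C p)) + k"
proof -
  obtain x0 where x0: "x0 \<in> points XF" using F_nonempty by blast
  define D where "D p = \<mu> p - (\<mu>F (\<pi>F p) + axis l (snd (\<pi>C p)))" for p
  have D: "D p \<bullet> Y = defect Y p" for p Y by (simp add: D_def defect_def inner_diff_left inner_add_left inner_axis' algebra_simps)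
  have "D p = D (to_X (x0, 1, s * (\<epsilon> / 2)))" if "p \<in> Wcut" for p using D defect_constant[OF that x0] by (metis vector_eq_rdot)
  then have "\<forall>p\<in>Wcut. \<mu> p = \<mu>F (\<pi>F p) + axis l (snd (\<pi>C p)) + D (to_X (x0, 1, s * (\<epsilon> / 2)))"
    by (metis D_def add.commute diff_add_cancel)
  then show ?thesis by blast
qed

end


section \<open>Gluing manifolds along open pieces\<close>

text \<open>One shape for the three families of charts of the glued manifold: restriction to the
  open part \<open>V\<close>, transport by \<open>i\<close>, and a linear identification
  \<open>L\<close> of the model spaces.\<close>

definition embed_chart :: "('a => 'c) => ('c => 'a) => 'a set => ('e => 'g) => ('a, 'e) chart => ('c, 'g) chart" where
  "embed_chart i i' V L c = (i ` (fst c \<inter> V), \<lambda>m. L (snd c (i' m)))"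

text \<open>An isomorphism of the subspace \<open>E\<close> onto the whole target space. The left
  inverse property is asked on \<open>E\<close> only, since for \<open>join\<close> this is a proper
  subspace of the space of pairs.\<close>

locale linear_iso =
  fixes E :: "'e::euclidean_space set" and L :: "'e => 'g::euclidean_space" and L' :: "'g => 'e"
  assumes L: "bounded_linear L" "bounded_linear L'" "\<And>x. x \<in> E ==> L' (L x) = x" "\<And>y. L' y \<in> E" "\<And>y. L (L' y) = y"
begin

lemma image_eq: "S \<subseteq> E ==> L ` S = L' -` S" using L(3,5) by (auto simp: image_iff) (metis subsetD)

lemma open_image: "rel_open E S ==> open (L ` S)"
proof -
  assume S: "rel_open E S"
  have "rel_open UNIV (UNIV \<inter> L' -` S)" by (rule rel_open_preimage[OF _ linear_continuous_on[OF L(2)] _ S]) (use L(4) in auto)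
  then show ?thesis using image_eq[OF rel_open_subset[OF S]] by simp
qed

end

text \<open>Between two embedded pieces the transition map is, up to the linear identifications, the
  coordinate expression of \<open>f\<close> on the overlap \<open>Ov\<close>; compatibility thus
  reduces to smoothness of \<open>f\<close>.\<close>

lemma embed_chart_compatible:
  assumes N: "premanifold N" and N': "premanifold N'" and c: "c \<in> Atlas N" and d: "d \<in> Atlas N'"
    and L: "linear_iso (Model N) L L'" and K: "linear_iso (Model N') K K'"
    and i: "\<And>p. p \<in> V ==> i' (i p) = p" and j: "\<And>q. q \<in> V' ==> j' (j q) = q"
    and Op: "{p \<in> V. i p \<in> j ` V'} = Ov" "open_in N Ov"
    and s: "\<And>p. p \<in> Ov ==> smooth_at N N' f p" and f: "\<And>p. p \<in> Ov ==> j' (i p) = f p"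
  shows "charts_compatible UNIV (embed_chart i i' V L c) (embed_chart j j' V' K d)"
proof -
  interpret L: linear_iso "Model N" L L' by (rule L)
  interpret K: linear_iso "Model N'" K K' by (rule K)
  define S where "S = snd c ` (fst c \<inter> Ov \<inter> f -` fst d)"
  have "smooth_map_on N Ov N' f" using smooth_map_on_iff[OF N N'] Op(2) s by blast
  then have S: "openin (top_of_set (Model N)) S" "smooth_on (Model N) S (snd d \<circ> f \<circ> inv_into (fst c) (snd c))"
    using c d unfolding smooth_map_on_def S_def by (auto simp: case_prod_unfold)
  have S': "rel_open (Model N) S" using S(1) mfd_subspace[OF N] by simp
  let ?c = "embed_chart i i' V L c" and ?d = "embed_chart j j' V' K d"
  have im: "snd ?c ` (fst ?c \<inter> fst ?d) = L ` S"
  proof (intro equalityI subsetI)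
    fix y assume "y \<in> snd ?c ` (fst ?c \<inter> fst ?d)"
    then obtain p q where p: "p \<in> fst c" "p \<in> V" "q \<in> fst d" "q \<in> V'" "i p = j q" "y = L (snd c (i' (i p)))"
      by (auto simp: embed_chart_def)
    have pO: "p \<in> Ov" using Op(1) p by auto
    have y: "y = L (snd c p)" using p(6) i[OF p(2)] by simp
    have "j' (i p) = q" using p(5) j[OF p(4)] by simp
    then have "f p = q" using f[OF pO] by simp
    then show "y \<in> L ` S" unfolding y S_def using p pO by blast
  next
    fix y assume "y \<in> L ` S"
    then obtain p where p: "p \<in> fst c" "p \<in> Ov" "f p \<in> fst d" "y = L (snd c p)" by (auto simp: S_def)
    then obtain q where q: "q \<in> V'" "i p = j q" "p \<in> V" using Op(1) by auto
    have "f p = q" using f[OF p(2)] q j by simp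
    then have "i p \<in> fst ?d" using q p(3) by (auto simp: embed_chart_def)
    moreover have "i p \<in> fst ?c" using p(1) q(3) by (auto simp: embed_chart_def)
    moreover have "y = snd ?c (i p)" using p(4) i[OF q(3)] by (simp add: embed_chart_def)
    ultimately show "y \<in> snd ?c ` (fst ?c \<inter> fst ?d)" by blast
  qed
  have o: "rel_open UNIV (L ` S)" using L.open_image[OF S'] by simp
  have injc: "inj_on (snd ?c) (fst ?c)"
  proof (rule inj_onI)
    fix x y assume xy: "x \<in> fst ?c" "y \<in> fst ?c" "snd ?c x = snd ?c y"
    then obtain p q where p: "p \<in> fst c" "p \<in> V" "x = i p" "q \<in> fst c" "q \<in> V" "y = i q" by (auto simp: embed_chart_def)
    then have "L (snd c p) = L (snd c q)" using xy(3) i by (simp add: embed_chart_def)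
    moreover have "snd c p \<in> Model N" "snd c q \<in> Model N" using p rel_open_subset[OF mfd_chart(2)[OF N c]] by auto
    ultimately have "snd c p = snd c q" using L.L(3) by metis
    then show "x = y" using mfd_chart(1)[OF N c] p by (auto dest: inj_onD)
  qed
  have "smooth_on UNIV (L ` S) (\<lambda>y. K ((snd d \<circ> f \<circ> inv_into (fst c) (snd c)) (L' y)))"
    by (rule smooth_on_compose_linear[OF o smooth_on_compose[OF o S' _ smooth_on_linear[OF o L.L(2)] S(2)] K.L(1)])
      (use L.image_eq[OF rel_open_subset[OF S']] in auto)
  then have "smooth_on UNIV (L ` S) (snd ?d \<circ> inv_into (fst ?c) (snd ?c))"
  proof (rule smooth_on_cong[OF o])
    fix y assume "y \<in> L ` S"
    then obtain p where p: "p \<in> fst c" "p \<in> Ov" "f p \<in> fst d" "y = L (snd c p)" by (auto simp: S_def)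
    have pV: "p \<in> V" using p(2) Op(1) by auto
    have ip: "i p \<in> fst ?c" "snd ?c (i p) = y" using p pV i by (auto simp: embed_chart_def)
    then have "inv_into (fst ?c) (snd ?c) y = i p" using inv_into_f_f[OF injc ip(1)] by simp
    moreover have "L' y = snd c p" using p L.L(3) rel_open_subset[OF mfd_chart(2)[OF N c]] by auto
    moreover have "inv_into (fst c) (snd c) (snd c p) = p" using inv_into_f_f[OF mfd_chart(1)[OF N c] p(1)] .
    ultimately show "(snd ?d \<circ> inv_into (fst ?c) (snd ?c)) y = K ((snd d \<circ> f \<circ> inv_into (fst c) (snd c)) (L' y))"
      using f[OF p(2)] by (simp add: embed_chart_def)
  qed
  then show ?thesis unfolding charts_compatible_def im using o by simp
qed

lemma embed_chart_image:
  assumes "\<And>p. p \<in> V ==> i' (i p) = p"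
  shows "snd (embed_chart i i' V L c) ` fst (embed_chart i i' V L c) = L ` img_on c V"
  using assms by (force simp: embed_chart_def)

lemma embed_chart_domains: "(\<Union>c\<in>Atlas N. fst (embed_chart i i' V L c)) = i ` (points N \<inter> V)"
  by (auto simp: embed_chart_def points_def)

text \<open>If the images of all charts of \<open>N\<close> are charts of \<open>M\<close>, then
  \<open>i\<close> is an open embedding of \<open>V\<close>. The two cut manifolds and the neck are
  instances, so that forms, vectors and actions are transported once for all three.\<close>

locale open_piece =
  fixes N :: "('a, 'e::euclidean_space) mfd" and M :: "('c, 'g::euclidean_space) mfd" and i i' V L L'
  assumes N: "premanifold N" and M: "premanifold M" and UM: "Model M = UNIV" and L: "linear_iso (Model N) L L'"
    and i: "\<And>p. p \<in> V ==> i' (i p) = p" and V: "open_in N V"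
    and ch: "\<And>c. c \<in> Atlas N ==> embed_chart i i' V L c \<in> Atlas M"
begin

lemma V_points: "V \<subseteq> points N" using V mfd_openin[OF N] by blast

lemma smooth_embed: "p \<in> V ==> smooth_at N M i p"
proof -
  assume p: "p \<in> V"
  then obtain c where c: "c \<in> Atlas N" "p \<in> fst c" using V_points by (auto simp: points_def)
  let ?T = "img_on c V"
  have T: "rel_open (Model N) ?T" by (rule rel_open_chart_image[OF N V c(1)])
  have ci: "chart_inv c x \<in> fst c \<inter> V" "snd c (chart_inv c x) = x" if "x \<in> ?T" for x using that chart_inv_left[OF N c(1)] by auto
  interpret linear_iso "Model N" L L' by (rule L)
  show ?thesis
  proof (rule smooth_atI[OF c(1) ch[OF c(1)] c(2) T])
    show "i (chart_inv c x) \<in> fst (embed_chart i i' V L c)" if "x \<in> ?T" for x using ci(1)[OF that] by (auto simp: embed_chart_def)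
    show "smooth_on (Model N) ?T (\<lambda>x. snd (embed_chart i i' V L c) (i (chart_inv c x)))"
      by (rule smooth_on_cong[OF T smooth_on_linear[OF T L(1)]]) (use ci i in \<open>auto simp: embed_chart_def\<close>)
  qed (use p c in auto)
qed

lemma smooth_embed_inverse: "p \<in> V ==> smooth_at M N i' (i p)"
proof -
  assume p: "p \<in> V"
  then obtain c where c: "c \<in> Atlas N" "p \<in> fst c" using V_points by (auto simp: points_def)
  let ?c = "embed_chart i i' V L c"
  have ip: "i p \<in> fst ?c" using p c by (auto simp: embed_chart_def)
  let ?T = "img ?c"
  have T: "rel_open (Model M) ?T" by (rule mfd_chart(2)[OF M ch[OF c(1)]])
  interpret linear_iso "Model N" L L' by (rule L)
  have ci: "i' (chart_inv ?c y) \<in> fst c" "snd c (i' (chart_inv ?c y)) = L' y" if y: "y \<in> ?T" for y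
  proof -
    obtain q where q: "q \<in> fst c" "q \<in> V" "y = snd ?c (i q)" using y by (auto simp: embed_chart_def)
    then have "chart_inv ?c y = i q" using chart_inv_left[OF M ch[OF c(1)], of "i q"] by (auto simp: embed_chart_def)
    moreover have "snd c q \<in> Model N" using q rel_open_subset[OF mfd_chart(2)[OF N c(1)]] by blast
    ultimately show "i' (chart_inv ?c y) \<in> fst c" "snd c (i' (chart_inv ?c y)) = L' y" using q i L(3) by (auto simp: embed_chart_def)
  qed
  show ?thesis
  proof (rule smooth_atI[OF ch[OF c(1)] c(1) ip T])
    show "smooth_on (Model M) ?T (\<lambda>x. snd c (i' (chart_inv ?c x)))" by (rule smooth_on_cong[OF T smooth_on_linear[OF T L(2)]]) (simp add: ci)
  qed (use ci ip in auto)
qed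

lemma openin_embed_image: "open_in M (i ` V)"
proof -
  have "i ` V = (\<Union>c\<in>Atlas N. fst (embed_chart i i' V L c))" unfolding embed_chart_domains using V_points by (simp add: Int_absorb1)
  then show ?thesis using openin_chart_domain[OF M ch] by (auto intro!: openin_Union)
qed

lemma openin_embed: "open_in N S ==> S \<subseteq> V ==> open_in M (i ` S)"
proof -
  assume S: "open_in N S" "S \<subseteq> V"
  have "open_in M (i ` V \<inter> i' -` S)" by (rule smooth_at_openin_preimage[OF M N openin_embed_image _ S(1)]) (use smooth_embed_inverse in auto)
  moreover have "i ` V \<inter> i' -` S = i ` S" using S(2) i by auto
  ultimately show ?thesis by simp
qed

lemma separate_embed:
  assumes H: "Hausdorff_space (mtopology N)" and p: "p \<in> V" "q \<in> V" "p \<noteq> q"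
  shows "\<exists>U U'. open_in M U \<and> open_in M U' \<and> i p \<in> U \<and> i q \<in> U' \<and> disjnt U U'"
proof -
  have "p \<in> topspace (mtopology N)" "q \<in> topspace (mtopology N)" using p V_points topspace_mtopology[OF N] by auto
  then obtain U U' where U: "open_in N U" "open_in N U'" "p \<in> U" "q \<in> U'" "disjnt U U'" using H p(3) unfolding Hausdorff_space_def by blast
  have "open_in M (i ` (U \<inter> V))" "open_in M (i ` (U' \<inter> V))" using U V by (auto intro!: openin_embed openin_Int)
  moreover have "disjnt (i ` (U \<inter> V)) (i ` (U' \<inter> V))" using U(5) i by (auto simp: disjnt_def) (metis IntI empty_iff)
  ultimately show ?thesis using U p by blast
qed

lemma tmap_embed:
  assumes p: "p \<in> V" and u: "u \<in> Model M" and w: "w \<in> Model N"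
  shows "tmap N M i p (tmap M N i' (i p) u) = u" "tmap M N i' (i p) (tmap N M i p w) = w"
proof -
  have s: "smooth_at N M i (i' (i p))" using smooth_embed[OF p] i[OF p] by simp
  have "tmap N M i (i' (i p)) (tmap M N i' (i p) u) = u"
    by (rule tmap_left_inverse[OF M N smooth_embed_inverse[OF p] s openin_embed_image _ _ u]) (use p i in auto)
  then show "tmap N M i p (tmap M N i' (i p) u) = u" using i[OF p] by simp
  show "tmap M N i' (i p) (tmap N M i p w) = w" by (rule tmap_left_inverse[OF N M smooth_embed[OF p] smooth_embed_inverse[OF p] V p i w])
qed

end

subsection \<open>The glued manifold\<close>

lemma Collect_pair_image: "{f V \<psi> | V \<psi>. (V, \<psi>) \<in> S} = (\<lambda>c. f (fst c) (snd c)) ` S" by force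

definition split_coord :: "'n::finite => complex ^ 'n => (complex ^ 'n) \<times> complex" where
  "split_coord l y = ((\<chi> i. if i = l then 0 else y $ i), y $ l)"

lemma linear_iso_join: "linear_iso ({z. z $ l = 0} \<times> UNIV) (join l) (split_coord l)" for l :: "'a::finite"
proof (rule linear_iso.intro)
  have "bounded_linear (\<lambda>p::(complex ^ 'a) \<times> complex. fst p + axis l (snd p))"
  proof (intro bounded_linear_add bounded_linear_fst bounded_linear_compose[OF _ bounded_linear_snd])
    show "bounded_linear (axis l :: complex => complex ^ 'a)"
      by (intro linear_conv_bounded_linear[THEN iffD1] linearI) (auto simp: axis_def vec_eq_iff)
  qed
  then show "bounded_linear (join l)" by (simp add: join_def case_prod_unfold)
  show "bounded_linear (split_coord l)" by (intro linear_conv_bounded_linear[THEN iffD1] linearI) (auto simp: split_coord_def vec_eq_iff)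
qed (auto simp: join_def split_coord_def vec_eq_iff axis_def)

lemma linear_iso_UNIV: "linear_iso UNIV (\<lambda>x. x) (\<lambda>x. x)" by (rule linear_iso.intro) (auto simp: bounded_linear_ident)

locale glue =
  A: glue_side 1 \<epsilon> id 1 l XF \<omega>F actF \<mu>F X1 \<omega>1 act1 \<mu>1 W1 \<Phi>1 +
  B: glue_side "- 1" \<epsilon> \<rho> \<sigma> l XF \<omega>F actF \<mu>F X2 \<omega>2 act2 \<mu>2 W2 \<Phi>2
  for \<epsilon> :: real and \<rho> \<sigma> and l :: "'n::finite" and XF :: "('f, complex ^ 'n) mfd" and \<omega>F actF \<mu>F
    and X1 :: "('a, complex ^ 'n) mfd" and \<omega>1 act1 \<mu>1 W1 \<Phi>1
    and X2 :: "('b, complex ^ 'n) mfd" and \<omega>2 act2 \<mu>2 W2 \<Phi>2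
begin

abbreviation Cyl where "Cyl \<equiv> cylinder \<epsilon>"
abbreviation M where "M \<equiv> gluing l \<epsilon> \<rho> XF X1 W1 \<Phi>1 X2 W2 \<Phi>2"
abbreviation P where "P \<equiv> prod_mfd XF Cyl"
abbreviation nk where "nk \<equiv> neck \<rho> W1 \<Phi>1 W2 \<Phi>2"
abbreviation C1 where "C1 \<equiv> cut_points X1 W1 \<Phi>1"
abbreviation C2 where "C2 \<equiv> cut_points X2 W2 \<Phi>2"
abbreviation ni where "ni \<equiv> inv_into (points P) nk"

lemma points_P_cases:
  assumes "q \<in> points P"
  obtains "snd (snd q) = 0" | "q \<in> A.half" "snd (snd q) > 0" | "q \<in> B.half" "snd (snd q) < 0"
  using assms that by (cases "snd (snd q)" "0::real" rule: linorder_cases)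
    (auto simp: A.half_def A.cyl_half_def B.half_def B.cyl_half_def mem_Times_iff)

lemma half_sign: "q \<in> A.half ==> snd (snd q) > 0" "q \<in> B.half ==> snd (snd q) < 0"
  by (auto simp: A.half_def A.cyl_half_def B.half_def B.cyl_half_def mem_Times_iff)

lemma nk_A: "q \<in> A.half ==> nk q = Above (A.to_X q)" using half_sign(1)[of q] by (simp add: neck_def case_prod_unfold A.to_X_def A.to_cap_def)

lemma nk_B: "q \<in> B.half ==> nk q = Below (B.to_X q)" using half_sign(2)[of q] by (simp add: neck_def case_prod_unfold B.to_X_def B.to_cap_def)

lemma nk_0: "snd (snd q) = 0 ==> nk q = Locus (fst q) (fst (snd q))" by (simp add: neck_def case_prod_unfold)

lemma nk_inj: "inj_on nk (points P)"
proof (rule inj_onI)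
  fix p q assume p: "p \<in> points P" and q: "q \<in> points P" and e: "nk p = nk q"
  show "p = q" by (rule points_P_cases[OF p]; rule points_P_cases[OF q])
      (use e nk_A[of p] nk_A[of q] nk_B[of p] nk_B[of q] nk_0[of p] nk_0[of q] A.to_X_facts(2)[of p] A.to_X_facts(2)[of q]
        B.to_X_facts(2)[of p] B.to_X_facts(2)[of q] in \<open>auto simp: prod_eq_iff\<close>)
qed

lemma ni_nk: "q \<in> points P ==> ni (nk q) = q" by (rule inv_into_f_f[OF nk_inj])

lemma Above_iff: "Above p \<in> nk ` points P \<longleftrightarrow> p \<in> A.Wcut"
proof
  assume "Above p \<in> nk ` points P"
  then obtain q where q: "q \<in> points P" "Above p = nk q" by auto
  show "p \<in> A.Wcut" by (rule points_P_cases[OF q(1)]) (use q(2) nk_A[of q] nk_B[of q] nk_0[of q] A.to_X_facts(1)[of q] in auto)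
next
  assume p: "p \<in> A.Wcut"
  then have "Above p = nk (A.of_X p)" using nk_A[OF A.of_X_half[OF p]] A.to_X_of_X[OF p] by simp
  then show "Above p \<in> nk ` points P" using A.of_X_half[OF p] A.half_points by blast
qed

lemma Below_iff: "Below p \<in> nk ` points P \<longleftrightarrow> p \<in> B.Wcut"
proof
  assume "Below p \<in> nk ` points P"
  then obtain q where q: "q \<in> points P" "Below p = nk q" by auto
  show "p \<in> B.Wcut" by (rule points_P_cases[OF q(1)]) (use q(2) nk_A[of q] nk_B[of q] nk_0[of q] B.to_X_facts(1)[of q] in auto)
next
  assume p: "p \<in> B.Wcut"
  then have "Below p = nk (B.of_X p)" using nk_B[OF B.of_X_half[OF p]] B.to_X_of_X[OF p] by simp
  then show "Below p \<in> nk ` points P" using B.of_X_half[OF p] B.half_points by blast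
qed

lemma ni_Above: "p \<in> A.Wcut ==> ni (Above p) = A.of_X p"
  using nk_A[OF A.of_X_half[of p]] A.to_X_of_X[of p] ni_nk[of "A.of_X p"] A.of_X_half[of p] A.half_points by auto

lemma ni_Below: "p \<in> B.Wcut ==> ni (Below p) = B.of_X p"
  using nk_B[OF B.of_X_half[of p]] B.to_X_of_X[of p] ni_nk[of "B.of_X p"] B.of_X_half[of p] B.half_points by auto

lemma Locus_nk: "x \<in> points XF ==> cmod z = 1 ==> Locus x z = nk (x, z, 0) \<and> (x, z, 0) \<in> points P"
  using A.eps by (simp add: nk_0 points_cylinder)

lemma nk_Above_iff: "q \<in> points P ==> nk q \<in> Above ` C1 \<longleftrightarrow> q \<in> A.half"
  by (rule points_P_cases[of q]; use half_sign[of q] nk_A[of q] nk_B[of q] nk_0[of q] A.Wcut_cut[OF A.to_X_facts(1)[of q]] in auto)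

lemma nk_Below_iff: "q \<in> points P ==> nk q \<in> Below ` C2 \<longleftrightarrow> q \<in> B.half"
  by (rule points_P_cases[of q]; use half_sign[of q] nk_A[of q] nk_B[of q] nk_0[of q] B.Wcut_cut[OF B.to_X_facts(1)[of q]] in auto)

abbreviation EA where "EA \<equiv> embed_chart Above of_Above C1 (\<lambda>x. x)"
abbreviation EB where "EB \<equiv> embed_chart Below of_Below C2 (\<lambda>x. x)"
abbreviation EN where "EN \<equiv> embed_chart nk ni (points P) (join l)"

lemma Model_M [simp]: "Model M = UNIV" by (simp add: gluing_def Let_def)

lemma Atlas_M: "Atlas M = EA ` Atlas X1 \<union> EB ` Atlas X2 \<union> EN ` Atlas P"
proof -
  have 1: "EA ` Atlas X1 = {(Above ` (U \<inter> C1), \<phi> \<circ> of_Above) | U \<phi>. (U, \<phi>) \<in> Atlas X1}"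
    unfolding Collect_pair_image[where f = "\<lambda>U \<phi>. (Above ` (U \<inter> C1), \<phi> \<circ> of_Above)"]
    by (rule image_cong[OF refl]) (simp only: embed_chart_def o_def)
  have 2: "EB ` Atlas X2 = {(Below ` (U \<inter> C2), \<phi> \<circ> of_Below) | U \<phi>. (U, \<phi>) \<in> Atlas X2}"
    unfolding Collect_pair_image[where f = "\<lambda>U \<phi>. (Below ` (U \<inter> C2), \<phi> \<circ> of_Below)"]
    by (rule image_cong[OF refl]) (simp only: embed_chart_def o_def)
  have 3: "EN ` Atlas P = {(nk ` V, join l \<circ> \<psi> \<circ> ni) | V \<psi>. (V, \<psi>) \<in> Atlas P}"
    unfolding Collect_pair_image[where f = "\<lambda>V \<psi>. (nk ` V, join l \<circ> \<psi> \<circ> ni)"]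
  proof (rule image_cong[OF refl])
    fix c assume "c \<in> Atlas P"
    then have "fst c \<inter> points P = fst c" using chart_in_points[of c P] by blast
    then show "EN c = (nk ` fst c, join l \<circ> snd c \<circ> ni)" by (simp only: embed_chart_def o_def)
  qed
  show ?thesis unfolding 1 2 3 by (simp only: gluing_def Let_def mfd.select_convs)
qed

lemma isoA: "linear_iso (Model X1) (\<lambda>x. x) (\<lambda>x. x)" by (simp add: A.X_Model linear_iso_UNIV)
lemma isoB: "linear_iso (Model X2) (\<lambda>x. x) (\<lambda>x. x)" by (simp add: B.X_Model linear_iso_UNIV)
lemma isoN: "linear_iso (Model P) (join l) (split_coord l)" by (simp add: A.F_Model linear_iso_join)

lemma C1_points: "C1 \<subseteq> points X1" and C2_points: "C2 \<subseteq> points X2" by (auto simp: cut_points_def)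

text \<open>Of the nine cases, those between a cut manifold and the neck carry the maps
  \<open>of_X\<close> or \<open>to_X\<close> of the respective side; a piece meets itself in the
  identity, and the two cut manifolds do not meet.\<close>

lemma compatible_M: "c \<in> Atlas M ==> d \<in> Atlas M ==> charts_compatible UNIV c d"
proof -
  assume "c \<in> Atlas M" "d \<in> Atlas M"
  then have c: "(\<exists>c'\<in>Atlas X1. c = EA c') \<or> (\<exists>c'\<in>Atlas X2. c = EB c') \<or> (\<exists>c'\<in>Atlas P. c = EN c')"
    and d: "(\<exists>d'\<in>Atlas X1. d = EA d') \<or> (\<exists>d'\<in>Atlas X2. d = EB d') \<or> (\<exists>d'\<in>Atlas P. d = EN d')"
    by (auto simp: Atlas_M)
  note pA = A.pm(2) and pB = B.pm(2) and pN = A.pm(3)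
  have AA: "charts_compatible UNIV (EA c') (EA d')" if "c' \<in> Atlas X1" "d' \<in> Atlas X1" for c' d'
    by (rule embed_chart_compatible[OF pA pA that isoA isoA, where Ov = C1 and f = "\<lambda>p. p"])
      (use A.openin_cut_points C1_points smooth_at_id[OF pA] in auto)
  \<comment> \<open>The two images are disjoint, so the overlap is empty and any map may be named as
    transition.\<close>
  have AB: "charts_compatible UNIV (EA c') (EB d')" if "c' \<in> Atlas X1" "d' \<in> Atlas X2" for c' d'
    by (rule embed_chart_compatible[OF pA pB that isoA isoB, where Ov = "{}" and f = "\<lambda>p. undefined"]) auto
  have BA: "charts_compatible UNIV (EB c') (EA d')" if "c' \<in> Atlas X2" "d' \<in> Atlas X1" for c' d'
    by (rule embed_chart_compatible[OF pB pA that isoB isoA, where Ov = "{}" and f = "\<lambda>p. undefined"]) auto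
  have BB: "charts_compatible UNIV (EB c') (EB d')" if "c' \<in> Atlas X2" "d' \<in> Atlas X2" for c' d'
    by (rule embed_chart_compatible[OF pB pB that isoB isoB, where Ov = C2 and f = "\<lambda>p. p"])
      (use B.openin_cut_points C2_points smooth_at_id[OF pB] in auto)
  have AN: "charts_compatible UNIV (EA c') (EN d')" if "c' \<in> Atlas X1" "d' \<in> Atlas P" for c' d'
    by (rule embed_chart_compatible[OF pA pN that isoA isoN, where Ov = A.Wcut and f = A.of_X])
      (use A.openin_Wcut A.Wcut_cut A.smooth_of_X(3) ni_Above ni_nk Above_iff in auto)
  have BN: "charts_compatible UNIV (EB c') (EN d')" if "c' \<in> Atlas X2" "d' \<in> Atlas P" for c' d'
    by (rule embed_chart_compatible[OF pB pN that isoB isoN, where Ov = B.Wcut and f = B.of_X])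
      (use B.openin_Wcut B.Wcut_cut B.smooth_of_X(3) ni_Below ni_nk Below_iff in auto)
  have hA: "{q \<in> points P. nk q \<in> Above ` C1} = A.half" and hB: "{q \<in> points P. nk q \<in> Below ` C2} = B.half"
    using nk_Above_iff nk_Below_iff A.half_points B.half_points by blast+
  have NA: "charts_compatible UNIV (EN c') (EA d')" if "c' \<in> Atlas P" "d' \<in> Atlas X1" for c' d'
    by (rule embed_chart_compatible[where i = nk and i' = ni and j = Above and j' = of_Above and f = A.to_X,
        OF pN pA that isoN isoA ni_nk _ hA A.openin_half A.smooth_to_X]) (simp_all add: nk_A)
  have NB: "charts_compatible UNIV (EN c') (EB d')" if "c' \<in> Atlas P" "d' \<in> Atlas X2" for c' d'
    by (rule embed_chart_compatible[where i = nk and i' = ni and j = Below and j' = of_Below and f = B.to_X,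
        OF pN pB that isoN isoB ni_nk _ hB B.openin_half B.smooth_to_X]) (simp_all add: nk_B)
  have NN: "charts_compatible UNIV (EN c') (EN d')" if "c' \<in> Atlas P" "d' \<in> Atlas P" for c' d'
    by (rule embed_chart_compatible[OF pN pN that isoN isoN, where Ov = "points P" and f = "\<lambda>p. p"])
      (use openin_points[OF pN] smooth_at_id[OF pN] ni_nk in auto)
  from c show ?thesis
  proof (elim disjE bexE)
    fix c' assume c': "c' \<in> Atlas X1" "c = EA c'"
    show ?thesis using d unfolding c'(2) by - (elim disjE bexE; erule ssubst; rule AA[OF c'(1)] AB[OF c'(1)] AN[OF c'(1)]; assumption)
  next
    fix c' assume c': "c' \<in> Atlas X2" "c = EB c'"
    show ?thesis using d unfolding c'(2) by - (elim disjE bexE; erule ssubst; rule BA[OF c'(1)] BB[OF c'(1)] BN[OF c'(1)]; assumption)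
  next
    fix c' assume c': "c' \<in> Atlas P" "c = EN c'"
    show ?thesis using d unfolding c'(2) by - (elim disjE bexE; erule ssubst; rule NA[OF c'(1)] NB[OF c'(1)] NN[OF c'(1)]; assumption)
  qed
qed

lemma embed_chart_ok:
  assumes N: "premanifold N" and c: "c \<in> Atlas N" and L: "linear_iso (Model N) L L'"
    and i: "\<And>p. p \<in> V ==> i' (i p) = p" and V: "open_in N V"
  shows "inj_on (snd (embed_chart i i' V L c)) (fst (embed_chart i i' V L c)) \<and>
    open (snd (embed_chart i i' V L c) ` fst (embed_chart i i' V L c))"
proof
  interpret linear_iso "Model N" L L' by (rule L)
  show "open (snd (embed_chart i i' V L c) ` fst (embed_chart i i' V L c))"
  proof -
    have "snd (embed_chart i i' V L c) ` fst (embed_chart i i' V L c) = L ` img_on c V" by (rule embed_chart_image) (rule i)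
    then show ?thesis using open_image[OF rel_open_chart_image[OF N V c]] by (simp only:)
  qed
  show "inj_on (snd (embed_chart i i' V L c)) (fst (embed_chart i i' V L c))"
  proof (rule inj_onI)
    fix x y assume xy: "x \<in> fst (embed_chart i i' V L c)" "y \<in> fst (embed_chart i i' V L c)"
      "snd (embed_chart i i' V L c) x = snd (embed_chart i i' V L c) y"
    then obtain p q where p: "p \<in> fst c" "p \<in> V" "x = i p" "q \<in> fst c" "q \<in> V" "y = i q" by (auto simp: embed_chart_def)
    then have "L (snd c p) = L (snd c q)" using xy(3) i by (simp add: embed_chart_def)
    moreover have "snd c p \<in> Model N" "snd c q \<in> Model N" using p rel_open_subset[OF mfd_chart(2)[OF N c]] by auto
    ultimately have "snd c p = snd c q" using L(3) by metis
    then show "x = y" using mfd_chart(1)[OF N c] p by (auto dest: inj_onD)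
  qed
qed

lemma mfd_M: "premanifold M" unfolding premanifold_def
proof (intro conjI ballI)
  fix c assume "c \<in> Atlas M"
  then consider c' where "c' \<in> Atlas X1" "c = EA c'" | c' where "c' \<in> Atlas X2" "c = EB c'" | c' where "c' \<in> Atlas P" "c = EN c'"
    by (auto simp: Atlas_M)
  then have "inj_on (snd c) (fst c) \<and> open (img c)"
  proof cases
    case 1
    show ?thesis unfolding 1(2) by (rule embed_chart_ok[OF A.pm(2) 1(1) isoA _ A.openin_cut_points]) simp
  next
    case 2
    show ?thesis unfolding 2(2) by (rule embed_chart_ok[OF B.pm(2) 2(1) isoB _ B.openin_cut_points]) simp
  next
    case 3
    show ?thesis unfolding 3(2) by (rule embed_chart_ok[OF A.pm(3) 3(1) isoN _ openin_points[OF A.pm(3)]]) (rule ni_nk)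
  qed
  then show "case c of (U, \<phi>) => inj_on \<phi> U \<and> openin (top_of_set (Model M)) (\<phi> ` U)" by (simp add: case_prod_unfold)
qed (use compatible_M in auto)

lemma pieceA: "open_piece X1 M Above of_Above C1 (\<lambda>x. x) (\<lambda>x. x)"
  by (rule open_piece.intro[OF A.pm(2) mfd_M Model_M isoA _ A.openin_cut_points], simp, subst Atlas_M, blast)

lemma pieceB: "open_piece X2 M Below of_Below C2 (\<lambda>x. x) (\<lambda>x. x)"
  by (rule open_piece.intro[OF B.pm(2) mfd_M Model_M isoB _ B.openin_cut_points], simp, subst Atlas_M, blast)

lemma pieceN: "open_piece P M nk ni (points P) (join l) (split_coord l)"
  by (rule open_piece.intro[OF A.pm(3) mfd_M Model_M isoN _ openin_points[OF A.pm(3)]], erule ni_nk, subst Atlas_M, blast)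

sublocale pA: open_piece X1 M Above of_Above C1 "\<lambda>x. x" "\<lambda>x. x" by (rule pieceA)
sublocale pB: open_piece X2 M Below of_Below C2 "\<lambda>x. x" "\<lambda>x. x" by (rule pieceB)
sublocale pN: open_piece P M nk ni "points P" "join l" "split_coord l" by (rule pieceN)

lemma points_M: "points M = Above ` C1 \<union> Below ` C2 \<union> nk ` points P"
proof -
  have "points M = (\<Union>c\<in>Atlas X1. fst (EA c)) \<union> (\<Union>c\<in>Atlas X2. fst (EB c)) \<union> (\<Union>c\<in>Atlas P. fst (EN c))"
    unfolding points_def[of M] Atlas_M by (simp only: image_Un image_image Union_Un_distrib)
  then show ?thesis using C1_points C2_points by (simp only: embed_chart_domains Int_absorb1 Int_absorb)
qed

lemma M_cases:
  assumes "m \<in> points M"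
  obtains p where "p \<in> C1" "m = Above p" | p where "p \<in> C2" "m = Below p" | q where "q \<in> points P" "snd (snd q) = 0" "m = nk q"
proof -
  from assms consider p where "p \<in> C1" "m = Above p" | p where "p \<in> C2" "m = Below p" | q where "q \<in> points P" "m = nk q"
    unfolding points_M by blast
  then show ?thesis
  proof cases
    case (3 q)
    show ?thesis
    proof (rule points_P_cases[OF 3(1)])
      assume "snd (snd q) = 0"
      then show ?thesis using that(3) 3 by blast
    next
      assume "q \<in> A.half"
      then show ?thesis using that(1)[of "A.to_X q"] A.Wcut_cut[OF A.to_X_facts(1)] nk_A 3(2) by simp
    next
      assume "q \<in> B.half"
      then show ?thesis using that(2)[of "B.to_X q"] B.Wcut_cut[OF B.to_X_facts(1)] nk_B 3(2) by simp
    qed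
  qed (use that in blast)+
qed

section \<open>Separation and countability of the glued manifold\<close>

definition thin :: "real => ('a, 'f, 'b) glued set" where
  "thin b = nk ` {q \<in> points P. \<bar>snd (snd q)\<bar> < b}"

lemma openin_height: "open D ==> open_in P {q \<in> points P. snd (snd q) \<in> D}"
proof -
  assume D: "open D"
  have "open_in P (points P \<inter> snd -` {p \<in> points Cyl. snd p \<in> D})"
    by (rule smooth_at_openin_preimage[OF A.pm(3) mfd_cylinder openin_points[OF A.pm(3)] _ openin_cylinder_height[OF D]])
      (rule smooth_at_fst_snd(2)[OF A.pm(1) mfd_cylinder], simp)
  moreover have "points P \<inter> snd -` {p \<in> points Cyl. snd p \<in> D} = {q \<in> points P. snd (snd q) \<in> D}" by auto
  ultimately show ?thesis by simp
qed

lemma openin_thin: "open_in M (thin b)"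
proof -
  have "open {h::real. \<bar>h\<bar> < b}" by (intro open_Collect_less continuous_intros)
  from openin_height[OF this] show ?thesis unfolding thin_def by (intro pN.openin_embed) auto
qed

definition far1 where "far1 b = C1 - {p \<in> A.Wcut. \<bar>snd (snd (A.of_X p))\<bar> \<le> b}"
definition far2 where "far2 b = C2 - {p \<in> B.Wcut. \<bar>snd (snd (B.of_X p))\<bar> \<le> b}"

lemma openin_far:
  assumes "0 \<le> b" "b < \<epsilon>"
  shows "open_in M (Above ` far1 b)" "open_in M (Below ` far2 b)"
  using A.openin_far[OF assms] B.openin_far[OF assms] unfolding far1_def far2_def by (auto intro!: pA.openin_embed pB.openin_embed)

lemma disjnt_thin:
  assumes "\<And>p. i p \<in> nk ` points P ==> p \<in> W" "\<And>p. p \<in> W ==> ni (i p) = g p"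
  shows "disjnt (i ` (C - {p \<in> W. \<bar>snd (snd (g p))\<bar> \<le> b})) (thin b)"
  unfolding disjnt_iff
proof (intro allI notI, elim conjE)
  fix m assume m: "m \<in> i ` (C - {p \<in> W. \<bar>snd (snd (g p))\<bar> \<le> b})" "m \<in> thin b"
  from m(1) obtain p where p: "p \<notin> {p \<in> W. \<bar>snd (snd (g p))\<bar> \<le> b}" "m = i p" by blast
  from m(2) obtain q where q: "q \<in> points P" "\<bar>snd (snd q)\<bar> < b" "m = nk q" unfolding thin_def by blast
  have pW: "p \<in> W" using assms(1) p(2) q(1,3) by blast
  then have "g p = q" using assms(2)[OF pW] ni_nk[OF q(1)] p(2) q(3) by simp
  then show False using p(1) pW q(2) by simp
qed

lemma disjnt_far_thin: "disjnt (Above ` far1 b) (thin b)" "disjnt (Below ` far2 b) (thin b)"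
  unfolding far1_def far2_def by (rule disjnt_thin; simp only: Above_iff Below_iff ni_Above ni_Below)+

text \<open>The critical pair is a point of a cut manifold and a point of the cut locus. If the
  former lies in the neck, the two are separated there, the neck being Hausdorff; otherwise they are
  separated by \<open>far1\<close> or \<open>far2\<close> against \<open>thin\<close>.\<close>

lemma Hausdorff_M: "Hausdorff_space (mtopology M)"
proof -
  define sep where "sep m m' \<longleftrightarrow> (\<exists>U U'. open_in M U \<and> open_in M U' \<and> m \<in> U \<and> m' \<in> U' \<and> disjnt U U')" for m m'
  have sym: "sep m m' ==> sep m' m" for m m' unfolding sep_def using disjnt_sym by blast
  have sI: "sep m m'" if "open_in M U" "open_in M U'" "m \<in> U" "m' \<in> U'" "disjnt U U'" for m m' U U' unfolding sep_def using that by blast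
  have HP: "Hausdorff_space (mtopology P)" by (rule Hausdorff_prod_mfd[OF A.pm(1) mfd_cylinder A.FT(2) Hausdorff_cylinder])
  have NN: "sep (nk p) (nk q)" if "p \<in> points P" "q \<in> points P" "nk p \<noteq> nk q" for p q
    unfolding sep_def using pN.separate_embed[OF HP that(1,2)] that(3) by blast
  have AA: "sep (Above p) (Above q)" if "p \<in> C1" "q \<in> C1" "p \<noteq> q" for p q
    unfolding sep_def by (rule pA.separate_embed[OF A.XT(2) that])
  have BB: "sep (Below p) (Below q)" if "p \<in> C2" "q \<in> C2" "p \<noteq> q" for p q
    unfolding sep_def by (rule pB.separate_embed[OF B.XT(2) that])
  have AB: "sep (Above p) (Below q)" if "p \<in> C1" "q \<in> C2" for p q
    by (rule sI[OF pA.openin_embed_image pB.openin_embed_image]) (use that in \<open>auto simp: disjnt_def\<close>)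
  \<comment> \<open>Any level strictly between \<open>0\<close> and \<open>\<epsilon>\<close> would
    serve to separate the cut locus from points outside the neck.\<close>
  have e: "0 \<le> \<epsilon> / 2" "\<epsilon> / 2 < \<epsilon>" using A.eps by auto
  have AL: "sep (Above p) (nk q)" if p: "p \<in> C1" and q: "q \<in> points P" "snd (snd q) = 0" for p q
  proof (cases "p \<in> A.Wcut")
    case True
    then have "Above p \<in> nk ` points P" using Above_iff by blast
    then obtain p' where "p' \<in> points P" "Above p = nk p'" by blast
    moreover have "Above p \<noteq> nk q" using nk_0[OF q(2)] by simp
    ultimately show ?thesis using NN[of p' q] q by simp
  next
    case False
    show ?thesis by (rule sI[OF openin_far(1)[OF e] openin_thin[of "\<epsilon> / 2"] _ _ disjnt_far_thin(1)])
        (use False p q A.eps in \<open>auto simp: far1_def thin_def\<close>)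
  qed
  have BL: "sep (Below p) (nk q)" if p: "p \<in> C2" and q: "q \<in> points P" "snd (snd q) = 0" for p q
  proof (cases "p \<in> B.Wcut")
    case True
    then have "Below p \<in> nk ` points P" using Below_iff by blast
    then obtain p' where "p' \<in> points P" "Below p = nk p'" by blast
    moreover have "Below p \<noteq> nk q" using nk_0[OF q(2)] by simp
    ultimately show ?thesis using NN[of p' q] q by simp
  next
    case False
    show ?thesis by (rule sI[OF openin_far(2)[OF e] openin_thin[of "\<epsilon> / 2"] _ _ disjnt_far_thin(2)])
        (use False p q A.eps in \<open>auto simp: far2_def thin_def\<close>)
  qed
  have "sep m m'" if m: "m \<in> points M" "m' \<in> points M" "m \<noteq> m'" for m m' by (rule M_cases[OF m(1)]; rule M_cases[OF m(2)])
      (use m(3) in \<open>simp add: AA BB NN AB sym[OF AB] AL sym[OF AL] BL sym[OF BL]\<close>)+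
  then show ?thesis unfolding Hausdorff_space_def topspace_mtopology[OF mfd_M] sep_def by blast
qed

text \<open>Compactness covers \<open>X1\<close>, \<open>X2\<close> and \<open>XF\<close> by
  finitely many charts, and two charts cover the cylinder; the induced charts of the glued manifold
  are finite in number.\<close>

lemma second_countable_M: "second_countable (mtopology M)"
proof -
  obtain K1 where K1: "finite K1" "K1 \<subseteq> Atlas X1" "points X1 \<subseteq> \<Union>(fst ` K1)"
    by (rule compact_finite_atlas[OF A.pm(2) A.X_compact])
  obtain K2 where K2: "finite K2" "K2 \<subseteq> Atlas X2" "points X2 \<subseteq> \<Union>(fst ` K2)"
    by (rule compact_finite_atlas[OF B.pm(2) B.X_compact])
  obtain KF where KF: "finite KF" "KF \<subseteq> Atlas XF" "points XF \<subseteq> \<Union>(fst ` KF)"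
    by (rule compact_finite_atlas[OF A.pm(1) A.F_compact])
  define KP where "KP = (\<lambda>(c, a). prod_chart c (cyl_chart \<epsilon> a)) ` (KF \<times> {1, - 1})"
  have KP: "finite KP" "KP \<subseteq> Atlas P" using KF by (auto simp: KP_def intro!: prod_chart_Atlas)
  have KPc: "points P \<subseteq> \<Union>(fst ` KP)"
  proof
    fix q assume q: "q \<in> points P"
    then obtain c where c: "c \<in> KF" "fst q \<in> fst c" using KF(3) by auto
    have "snd q \<in> fst (cyl_chart \<epsilon> 1) \<union> fst (cyl_chart \<epsilon> (- 1))" using q subsetD[OF cylinder_countable_atlas[of \<epsilon>], of "snd q"] by (simp add: mem_Times_iff)
    then obtain a where a: "a \<in> {1, - 1}" "snd q \<in> fst (cyl_chart \<epsilon> a)" by blast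
    then have "q \<in> fst (prod_chart c (cyl_chart \<epsilon> a))" using c by (simp add: mem_Times_iff)
    moreover have "prod_chart c (cyl_chart \<epsilon> a) \<in> KP" using a(1) c(1) by (force simp: KP_def)
    ultimately show "q \<in> \<Union>(fst ` KP)" by blast
  qed
  let ?K = "EA ` K1 \<union> EB ` K2 \<union> EN ` KP"
  show ?thesis
  proof (rule second_countable_mtopology[OF mfd_M, of ?K])
    show "countable ?K" using K1 K2 KP by (simp add: countable_finite)
    show "?K \<subseteq> Atlas M" using K1 K2 KP unfolding Atlas_M by blast
    show "points M \<subseteq> \<Union>(fst ` ?K)"
    proof
      fix m assume "m \<in> points M"
      then consider p where "p \<in> C1" "m = Above p" | p where "p \<in> C2" "m = Below p" | q where "q \<in> points P" "m = nk q"
        unfolding points_M by blast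
      then show "m \<in> \<Union>(fst ` ?K)"
      proof cases
        case 1
        then obtain c where "c \<in> K1" "p \<in> fst c" using C1_points K1 by blast
        then have "m \<in> fst (EA c)" "EA c \<in> ?K" using 1 by (auto simp: embed_chart_def)
        then show ?thesis by blast
      next
        case 2
        then obtain c where "c \<in> K2" "p \<in> fst c" using C2_points K2 by blast
        then have "m \<in> fst (EB c)" "EB c \<in> ?K" using 2 by (auto simp: embed_chart_def)
        then show ?thesis by blast
      next
        case 3
        then obtain c where c: "c \<in> KP" "q \<in> fst c" using KPc by blast
        have "m \<in> nk ` (fst c \<inter> points P)" using 3 c by blast
        then have "m \<in> fst (EN c)" "EN c \<in> ?K" using c by (auto simp: embed_chart_def)
        then show ?thesis by blast
      qed
    qed
  qed
qed

lemma smooth_manifold_M: "smooth_manifold M" using mfd_M Hausdorff_M second_countable_M by (simp add: smooth_manifold_iff)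

end


section \<open>Geometry near the cut locus\<close>

lemma tmap_chart_injective:
  assumes M: "premanifold M" and c: "c \<in> Atlas M" "p \<in> fst c" and u: "u \<in> Model M"
    and z: "tmap M (flat (Model M)) (snd c) p u = 0"
  shows "u = 0"
proof -
  have s: "smooth_at M (flat (Model M)) (snd c) p" by (rule smooth_at_chart[OF M c])
  have F: "premanifold (flat (Model M))" by (rule mfd_flat[OF mfd_subspace[OF M]])
  have x: "snd c p \<in> img c" using c by blast
  have s': "smooth_at (flat (Model M)) M (chart_inv c) (snd c p)" by (rule smooth_at_chart_inv[OF M c(1) x])
  have "tmap (flat (Model M)) M (chart_inv c) (snd c p) (tmap M (flat (Model M)) (snd c) p u) = u"
    by (rule tmap_left_inverse[OF M F s s' openin_chart_domain[OF M c(1)] c(2) chart_inv_left[OF M c(1)] u])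
  then show ?thesis using tmap_0[OF F M s'] z by simp
qed

text \<open>The chosen chart of the product at \<open>q\<close> need not be the product of the
  chosen charts of the factors, so its tangent space does not split literally. The differential of a
  product chart is used instead: it is injective, and its components factor through the two given
  maps.\<close>

lemma tmap_prod_injective:
  assumes M: "premanifold M" and N: "premanifold N" and q: "q \<in> points M \<times> points N" and u: "u \<in> Model M \<times> Model N"
    and z: "tmap (prod_mfd M N) M fst q u = 0" "tmap (prod_mfd M N) N snd q u = 0"
  shows "u = 0"
proof -
  let ?P = "prod_mfd M N"
  note P = mfd_prod[OF M N]
  note fs = smooth_at_fst_snd[OF M N q]
  have uP: "u \<in> Model ?P" using u by simp
  have "fst q \<in> points M" "snd q \<in> points N" using q by auto
  then obtain c d where c: "c \<in> Atlas M" "fst q \<in> fst c" and d: "d \<in> Atlas N" "snd q \<in> fst d" unfolding points_def by blast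
  have C: "prod_chart c d \<in> Atlas ?P" "q \<in> fst (prod_chart c d)" using prod_chart_Atlas[OF c(1) d(1)] c d by (auto simp: mem_Times_iff)
  have eq: "snd (prod_chart c d) = (\<lambda>q. (snd c (fst q), snd d (snd q)))" by (simp add: prod_chart_def map_prod_def case_prod_unfold)
  have sc: "smooth_vec M (snd c) (fst q)" "smooth_vec N (snd d) (snd q)"
    by (rule smooth_at_into_flat_UNIV[OF M mfd_subspace[OF M] smooth_at_chart[OF M c]]
      smooth_at_into_flat_UNIV[OF N mfd_subspace[OF N] smooth_at_chart[OF N d]])+
  note 1 = smooth_at_compose[OF P M mfd_vec fs(1) sc(1)]
  note 2 = smooth_at_compose[OF P N mfd_vec fs(2) sc(2)]
  have t: "dmap ?P (\<lambda>q. snd c (fst q)) q u = 0" "dmap ?P (\<lambda>q. snd d (snd q)) q u = 0"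
    using tmap_compose[OF P M mfd_vec fs(1) sc(1) uP] tmap_compose[OF P N mfd_vec fs(2) sc(2) uP]
      z tmap_0[OF M mfd_vec sc(1)] tmap_0[OF N mfd_vec sc(2)] by simp_all
  have "dmap ?P (snd (prod_chart c d)) q u = 0" unfolding eq using smooth_at_Pair_flat(2)[OF P 1 2 uP] t by (simp add: zero_prod_def)
  moreover have "snd (prod_chart c d) q \<in> Model ?P" using smooth_at_points[OF smooth_at_chart[OF P C] P] by simp
  ultimately have "tmap ?P (flat (Model ?P)) (snd (prod_chart c d)) q u = 0" using tmap_into_flat by metis
  then show ?thesis by (rule tmap_chart_injective[OF P C uP])
qed

text \<open>The witness is the sum of the images of \<open>a\<close> and \<open>b\<close> under the
  tangent maps of the two slice inclusions through \<open>q\<close>.\<close>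

lemma tmap_prod_surjective:
  assumes M: "premanifold M" and N: "premanifold N" and q: "q \<in> points M \<times> points N" and a: "a \<in> Model M" and b: "b \<in> Model N"
  obtains v where "v \<in> Model (prod_mfd M N)" "tmap (prod_mfd M N) M fst q v = a" "tmap (prod_mfd M N) N snd q v = b"
proof -
  let ?P = "prod_mfd M N"
  note P = mfd_prod[OF M N]
  note fs = smooth_at_fst_snd[OF M N q]
  have q': "fst q \<in> points M" "snd q \<in> points N" using q by auto
  have i1: "smooth_at M ?P (\<lambda>x. (x, snd q)) (fst q)" by (rule smooth_at_Pair[OF M M N smooth_at_id[OF M q'(1)] smooth_at_const[OF M q']])
  have i2: "smooth_at N ?P (\<lambda>y. (fst q, y)) (snd q)" by (rule smooth_at_Pair[OF N M N smooth_at_const[OF N q'(2,1)] smooth_at_id[OF N q'(2)]])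
  have fs': "smooth_at ?P M fst (fst q, snd q)" "smooth_at ?P N snd (fst q, snd q)" using fs by simp_all
  define va where "va = tmap M ?P (\<lambda>x. (x, snd q)) (fst q) a"
  define vb where "vb = tmap N ?P (\<lambda>y. (fst q, y)) (snd q) b"
  have mem: "va \<in> Model ?P" "vb \<in> Model ?P" unfolding va_def vb_def by (rule tmap_mem[OF M P i1 a] tmap_mem[OF N P i2 b])+
  have ta: "tmap ?P M fst q va = a" "tmap ?P N snd q va = 0"
    using tmap_compose[OF M P M i1 fs'(1) a] tmap_compose[OF M P N i1 fs'(2) a] tmap_id[OF M q'(1) a] by (simp_all add: tmap_const va_def)
  have tb: "tmap ?P M fst q vb = 0" "tmap ?P N snd q vb = b"
    using tmap_compose[OF N P M i2 fs'(1) b] tmap_compose[OF N P N i2 fs'(2) b] tmap_id[OF N q'(2) b] by (simp_all add: tmap_const vb_def)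
  have "va + vb \<in> Model ?P" using mem mfd_subspace[OF P] subspace_add by blast
  moreover have "tmap ?P M fst q (va + vb) = a" "tmap ?P N snd q (va + vb) = b"
    using tmap_linear[OF P M fs(1) mem, of 1] tmap_linear[OF P N fs(2) mem, of 1] ta tb by simp_all
  ultimately show ?thesis by (rule that)
qed

section \<open>Transport of forms, moment maps and actions along open embeddings\<close>

context open_piece
begin

lemma nondegenerate_embed:
  assumes p: "p \<in> V" and nd: "\<And>w. w \<in> Model N ==> w \<noteq> 0 ==> \<exists>v\<in>Model N. \<omega> p w v \<noteq> 0" and u: "u \<noteq> 0"
  shows "\<exists>v. pullback2 M N i' \<omega> (i p) u v \<noteq> 0"
proof -
  have uM: "u \<in> Model M" by (simp add: UM)
  let ?w = "tmap M N i' (i p) u"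
  have w: "?w \<in> Model N" by (rule tmap_mem[OF M N smooth_embed_inverse[OF p] uM])
  have "?w \<noteq> 0" using tmap_embed(1)[OF p uM w] tmap_0[OF N M smooth_embed[OF p]] u by auto
  then obtain v where v: "v \<in> Model N" "\<omega> p ?w v \<noteq> 0" using nd w by blast
  have "pullback2 M N i' \<omega> (i p) u (tmap N M i p v) = \<omega> p ?w v"
    unfolding pullback2_def using tmap_embed(2)[OF p uM v(1)] i[OF p] by simp
  then show ?thesis using v(2) by (intro exI[of _ "tmap N M i p v"]) simp
qed

lemma wedge_power_embed:
  assumes p: "p \<in> V" and v: "\<And>k. v k \<in> Model N"
  shows "wedge_power n (pullback2 M N i' \<omega> (i p)) (\<lambda>k. tmap N M i p (v k)) = wedge_power n (\<omega> p) v"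
proof -
  have e: "pullback2 M N i' \<omega> (i p) = (\<lambda>u v. \<omega> p (tmap M N i' (i p) u) (tmap M N i' (i p) v))"
    by (intro ext) (simp add: pullback2_def i[OF p])
  have "tmap M N i' (i p) (tmap N M i p (v k)) = v k" for k by (rule tmap_embed(2)[OF p, where u = 0]) (simp_all add: UM v)
  then show ?thesis unfolding e wedge_power_comp by simp
qed

lemma closed_form_embed:
  assumes "closed_smooth_form N W \<omega>" "open_in N W" "V \<subseteq> W"
  shows "closed_smooth_form M (i ` V) (pullback2 M N i' \<omega>)"
  by (rule closed_smooth_form_pullback[OF M N openin_embed_image assms(2) _ _ assms(1)])
    (use smooth_embed_inverse i assms(3) in auto)

text \<open>Meant for \<open>T\<close> the identity on the first side and \<open>flip\<close> on the
  second, with \<open>k\<close> absorbing the normalization of the given moment map. The map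
  \<open>i'\<close> intertwines the one-parameter groups of \<open>X\<close> and \<open>Y\<close>,
  so it relates their fundamental fields.\<close>

lemma moment_embed:
  fixes X Y :: "real ^ 'n::finite"
  assumes p: "p \<in> V" and S: "open_in M S" "i p \<in> S"
    and T: "bounded_linear T" "\<And>x. T x \<bullet> X = x \<bullet> Y" and mom: "\<And>q. q \<in> S ==> mom q = T (\<mu> (i' q)) + k"
    and \<mu>: "smooth_vec N \<mu> p"
      "\<And>w. w \<in> Model N ==> dmap N (\<lambda>q. \<mu> q \<bullet> Y) p w = - \<omega> p (fundamental_field N actN Y p) w"
    and act: "\<And>t. i' (act (torus_exp (t *\<^sub>R X)) (i p)) = actN (torus_exp (t *\<^sub>R Y)) p"
    and one: "act 1 (i p) = i p" "actN 1 p = p"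
    and orb: "smooth_at (flat UNIV) M (orbit act X (i p)) 0"
  shows "smooth_vec M mom (i p)"
    "dmap M (\<lambda>q. mom q \<bullet> X) (i p) u = - pullback2 M N i' \<omega> (i p) (fundamental_field M act X (i p)) u"
proof -
  note s = smooth_embed_inverse[OF p]
  have uM: "u \<in> Model M" by (simp add: UM)
  have \<mu>': "smooth_vec N \<mu> (i' (i p))" using \<mu>(1) i[OF p] by simp
  note c = smooth_at_compose[OF M N mfd_vec s \<mu>']
  have ip: "i p \<in> points M" using smooth_at_points[OF s M] by blast
  have k: "smooth_vec M (\<lambda>q. k) (i p)" by (rule smooth_at_const[OF M ip]) simp
  have 1: "smooth_vec M (\<lambda>q. T (\<mu> (i' q)) + k) (i p)" by (rule smooth_at_add_flat(1)[OF M smooth_at_linear_flat(1)[OF M c T(1)] k])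
  show "smooth_vec M mom (i p)" by (rule smooth_at_cong[OF M 1 S mom])
  have \<mu>Y: "smooth_vec N (\<lambda>q. \<mu> q \<bullet> Y) (i' (i p))" by (rule smooth_at_linear_flat(1)[OF N \<mu>' bounded_linear_inner_left])
  note cY = smooth_at_compose[OF M N mfd_vec s \<mu>Y]
  have kX: "smooth_vec M (\<lambda>q. k \<bullet> X) (i p)" by (rule smooth_at_const[OF M ip]) simp
  have "dmap M (\<lambda>q. mom q \<bullet> X) (i p) u = dmap M (\<lambda>q. \<mu> (i' q) \<bullet> Y + k \<bullet> X) (i p) u"
    by (rule tmap_cong[OF M S _ uM]) (simp add: mom T(2) inner_add_left)
  also have "\<dots> = dmap M (\<lambda>q. \<mu> (i' q) \<bullet> Y) (i p) u" using smooth_at_add_flat(2)[OF M cY kX uM] by (simp add: tmap_const)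
  also have "\<dots> = dmap N (\<lambda>q. \<mu> q \<bullet> Y) (i' (i p)) (tmap M N i' (i p) u)" by (rule tmap_compose[OF M N mfd_vec s \<mu>Y uM])
  also have "\<dots> = - \<omega> p (fundamental_field N actN Y p) (tmap M N i' (i p) u)" using \<mu>(2)[OF tmap_mem[OF M N s uM]] i[OF p] by simp
  also have "fundamental_field N actN Y p = tmap M N i' (i p) (fundamental_field M act X (i p))"
    using tmap_fundamental_field[where act = act and act' = actN, OF M N s orb one(1), of Y] act one(2) i[OF p] by simp
  finally show "dmap M (\<lambda>q. mom q \<bullet> X) (i p) u = - pullback2 M N i' \<omega> (i p) (fundamental_field M act X (i p)) u"
    by (simp add: pullback2_def i[OF p])
qed

lemma smooth_action_embed:
  fixes X :: "real ^ 'n::finite"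
  assumes p: "p \<in> V" and b: "smooth_at (prod_mfd (flat UNIV) N) N (\<lambda>(X, p). b X p) (X, p)"
    and bV: "\<And>X p. p \<in> V ==> b X p \<in> V" and act: "\<And>X p. p \<in> V ==> act (torus_exp X) (i p) = i (b X p)"
  shows "smooth_at (prod_mfd (flat UNIV) M) M (\<lambda>(X, m). act (torus_exp X) m) (X, i p)"
proof -
  let ?Q = "prod_mfd (flat (UNIV :: (real ^ 'n) set)) M"
  note Q = mfd_prod[OF mfd_vec M]
  note QN = mfd_prod[OF mfd_vec N]
  have ip: "i p \<in> points M" using smooth_at_points[OF smooth_embed_inverse[OF p] M] by blast
  have x: "(X, i p) \<in> points (flat UNIV) \<times> points M" using ip by simp
  note fs = smooth_at_fst_snd[OF mfd_vec M x]
  have 1: "smooth_at ?Q N (\<lambda>q. i' (snd q)) (X, i p)" by (rule smooth_at_compose[OF Q M N fs(2)]) (simp add: smooth_embed_inverse[OF p])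
  have 2: "smooth_at ?Q (prod_mfd (flat UNIV) N) (\<lambda>q. (fst q, i' (snd q))) (X, i p)" by (rule smooth_at_Pair[OF Q mfd_vec N fs(1) 1])
  have 3: "smooth_at ?Q N (\<lambda>q. b (fst q) (i' (snd q))) (X, i p)"
    using smooth_at_compose[OF Q QN N 2, of "\<lambda>(X, p). b X p"] b i[OF p] by simp
  have 4: "smooth_at ?Q M (\<lambda>q. i (b (fst q) (i' (snd q)))) (X, i p)"
    using smooth_at_compose[OF Q N M 3, of i] smooth_embed[OF bV[OF p]] i[OF p] by simp
  have O: "open_in ?Q (points ?Q \<inter> snd -` (i ` V))" by (rule smooth_at_openin_preimage[OF Q M openin_points[OF Q] _ openin_embed_image])
      (rule smooth_at_fst_snd(2)[OF mfd_vec M], simp)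
  show ?thesis by (rule smooth_at_cong[OF Q 4 O]) (use ip p act i in auto)
qed

end

declare prod_mfd_simps(2) [simp del]

context glue
begin

abbreviation Neck where "Neck \<equiv> nk ` points P"
abbreviation \<pi>F where "\<pi>F \<equiv> \<lambda>m. fst (ni m)"
abbreviation \<pi>C where "\<pi>C \<equiv> \<lambda>m. snd (ni m)"
abbreviation ht where "ht \<equiv> \<lambda>m. snd (snd (ni m))"
abbreviation dF where "dF \<equiv> tmap M XF \<pi>F"
abbreviation dC where "dC \<equiv> tmap M Cyl \<pi>C"

lemma openin_Neck: "open_in M Neck" by (rule pN.openin_embed_image)

lemma neck_smooth:
  assumes m: "m \<in> Neck"
  shows "ni m \<in> points XF \<times> points Cyl" "\<pi>F m \<in> points XF" "\<pi>C m \<in> points Cyl"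
    "smooth_at M P ni m" "smooth_at M XF \<pi>F m" "smooth_at M Cyl \<pi>C m" "smooth_vec M ht m"
    "dmap M ht m u = Im (dC m u)"
proof -
  obtain q where q: "q \<in> points P" "m = nk q" using m by blast
  then have niq: "ni m = q" by (simp add: ni_nk)
  show 1: "ni m \<in> points XF \<times> points Cyl" using niq q(1) by (simp add: prod_mfd_simps(2))
  then show "\<pi>F m \<in> points XF" "\<pi>C m \<in> points Cyl" by (auto simp: mem_Times_iff)
  show n: "smooth_at M P ni m" using pN.smooth_embed_inverse[OF q(1)] q(2) by simp
  note fs = smooth_at_fst_snd[OF A.pm(1) mfd_cylinder 1]
  show "smooth_at M XF \<pi>F m" by (rule smooth_at_compose[OF mfd_M A.pm(3,1) n fs(1)])
  show c: "smooth_at M Cyl \<pi>C m" by (rule smooth_at_compose[OF mfd_M A.pm(3) mfd_cylinder n fs(2)])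
  show "smooth_vec M ht m" "dmap M ht m u = Im (dC m u)" by (rule tmap_cylinder[OF mfd_M c, of u]; simp)+
qed

lemma neck_tangent:
  assumes m: "m \<in> Neck"
  shows "dF m u = tmap P XF fst (ni m) (tmap M P ni m u)"
    "dC m u = tmap P Cyl snd (ni m) (tmap M P ni m u)"
proof -
  note fs = smooth_at_fst_snd[OF A.pm(1) mfd_cylinder neck_smooth(1)[OF m]]
  have u: "u \<in> Model M" by simp
  show "dF m u = tmap P XF fst (ni m) (tmap M P ni m u)" by (rule tmap_compose[OF mfd_M A.pm(3,1) neck_smooth(4)[OF m] fs(1) u])
  show "dC m u = tmap P Cyl snd (ni m) (tmap M P ni m u)" by (rule tmap_compose[OF mfd_M A.pm(3) mfd_cylinder neck_smooth(4)[OF m] fs(2) u])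
qed

lemma neck_tangent_injective:
  assumes m: "m \<in> Neck" and z: "dF m u = 0" "dC m u = 0"
  shows "u = 0"
proof -
  obtain q where q: "q \<in> points P" "m = nk q" using m by blast
  have u: "u \<in> Model M" by simp
  have mem: "tmap M P ni m u \<in> Model P" by (rule tmap_mem[OF mfd_M A.pm(3) neck_smooth(4)[OF m] u])
  have "tmap M P ni m u = 0" by (rule tmap_prod_injective[OF A.pm(1) mfd_cylinder neck_smooth(1)[OF m]])
      (use mem z neck_tangent[OF m, of u] in simp_all)
  then show ?thesis using pN.tmap_embed(1)[OF q(1) u mem] q(2) tmap_0[OF A.pm(3) mfd_M pN.smooth_embed[OF q(1)]] by simp
qed

lemma neck_tangent_surjective:
  assumes m: "m \<in> Neck" and a: "a \<in> Model XF"
  obtains v where "dF m v = a" "dC m v = b"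
proof -
  obtain q where q: "q \<in> points P" "m = nk q" using m by blast
  obtain w where w: "w \<in> Model P" "tmap P XF fst (ni m) w = a" "tmap P Cyl snd (ni m) w = b"
    by (rule tmap_prod_surjective[OF A.pm(1) mfd_cylinder neck_smooth(1)[OF m] a, of b]) simp_all
  have "tmap M P ni m (tmap P M nk q w) = w" unfolding q(2) by (rule pN.tmap_embed(2)[OF q(1) _ w(1), where u = 0]) simp
  then show ?thesis using that[of "tmap P M nk q w"] w(2,3) neck_tangent[OF m] by simp
qed

text \<open>Every form considered near the cut locus is \<open>base\<close> plus a function of the
  height times \<open>area\<close>; the two summands are the pullbacks of \<open>\<omega>F\<close>
  and of \<open>dh \<and> d\<theta>\<close>.\<close>

definition base where "base = pullback2 M XF \<pi>F \<omega>F"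
definition area where "area = pullback2 M Cyl \<pi>C (cyl_form (\<lambda>_. 1))"

lemma base_eq: "base m u v = \<omega>F (\<pi>F m) (dF m u) (dF m v)" by (simp add: base_def pullback2_def)

lemma area_eq: "area m u v = Im (dC m u) * Re (dC m v)
    - Im (dC m v) * Re (dC m u)"
  by (simp add: area_def pullback2_def cyl_form_def)

lemma area_scaled: "pullback2 M Cyl \<pi>C (cyl_form \<gamma>) m u v = \<gamma> (ht m) * area m u v"
  by (simp add: area_def pullback2_def cyl_form_def)

lemma F_zero:
  assumes "x \<in> points XF" "a \<in> Model XF"
  shows "\<omega>F x 0 a = 0" "\<omega>F x a 0 = 0"
  using alternating_bilinear_left(3)[OF A.FT(5)[OF assms(1)] mfd_subspace[OF A.pm(1)], of a a a]
    alternating_bilinear_right(3)[OF A.FT(5)[OF assms(1)] mfd_subspace[OF A.pm(1)], of a a a] assms(2) by auto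

lemma neck_base_alternating:
  assumes m: "m \<in> Neck"
  shows "alternating_bilinear UNIV (base m)"
  using alternating_bilinear_pullback2[where f = \<pi>F and p = m and \<omega> = \<omega>F, OF mfd_M A.pm(1) neck_smooth(5)[OF m] A.FT(5)[OF neck_smooth(2)[OF m]]]
  by (simp add: base_def)

text \<open>A vector without component along \<open>XF\<close> is paired with its quarter turn in
  the cylinder, where \<open>area\<close> gives minus the squared length. Any other vector is paired
  with one along \<open>XF\<close>, on which the area term vanishes.\<close>

lemma neck_nondegenerate:
  assumes m: "m \<in> Neck" and t: "t \<noteq> 0" and u: "u \<noteq> 0"
  shows "\<exists>v. base m u v + t * area m u v \<noteq> 0"
proof (cases "dF m u = 0")
  case True
  let ?c = "dC m u"
  have c: "?c \<noteq> 0" using neck_tangent_injective[OF m True] u by blast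
  obtain v where v: "dF m v = 0" "dC m v = \<i> * ?c" by (rule neck_tangent_surjective[OF m subspace_0[OF mfd_subspace[OF A.pm(1)]], of "\<i> * ?c"])
  have "base m u v = 0" using True v(1) F_zero[OF neck_smooth(2)[OF m] subspace_0[OF mfd_subspace[OF A.pm(1)]]] by (simp add: base_eq)
  moreover have "area m u v = - ((Re ?c)\<^sup>2 + (Im ?c)\<^sup>2)" using v(2) by (simp add: area_eq power2_eq_square)
  moreover have "(Re ?c)\<^sup>2 + (Im ?c)\<^sup>2 > 0" using c by (simp add: complex_neq_0)
  ultimately have "base m u v = 0" "area m u v \<noteq> 0" by linarith+
  then have "base m u v + t * area m u v \<noteq> 0" using t by simp
  then show ?thesis by blast
next
  case False
  have a: "dF m u \<in> Model XF" by (rule tmap_mem[OF mfd_M A.pm(1) neck_smooth(5)[OF m]]) simp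
  obtain b where b: "b \<in> Model XF" "\<omega>F (\<pi>F m) (dF m u) b \<noteq> 0" using A.FT(6)[OF neck_smooth(2)[OF m] a False] by blast
  obtain v where v: "dF m v = b" "dC m v = 0" by (rule neck_tangent_surjective[OF m b(1), of 0])
  then have "base m u v + t * area m u v \<noteq> 0" using b(2) by (simp add: base_eq area_eq)
  then show ?thesis by blast
qed

lemma openin_neck_height: "open D ==> open_in M {m \<in> Neck. ht m \<in> D}"
proof -
  assume D: "open D"
  have "{m \<in> Neck. ht m \<in> D} = nk ` {q \<in> points P. snd (snd q) \<in> D}" by (auto simp: ni_nk)
  then show ?thesis using pN.openin_embed[OF openin_height[OF D]] by auto
qed

lemma closed_base: "closed_smooth_form M Neck base" unfolding base_def
  by (rule closed_smooth_form_pullback[OF mfd_M A.pm(1) openin_Neck openin_points[OF A.pm(1)] neck_smooth(5) _ A.FT(4)])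
    (use neck_smooth(2) in auto)

lemma closed_smooth_form_subset: "closed_smooth_form M W \<omega> ==> premanifold M ==> open_in M V ==> V \<subseteq> W ==> closed_smooth_form M V \<omega>"
  for M :: "('x, 'y::euclidean_space) mfd" and \<omega>
  unfolding smooth_form2_on_def closed_form2_on_def
  by (intro conjI ballI) (use smooth_on_subset rel_open_chart_image[of M V] in \<open>blast intro: smooth_on_subset\<close>)+

lemma closed_neck_form:
  assumes D: "open D" and \<gamma>: "smooth_on UNIV D \<gamma>"
  shows "closed_smooth_form M {m \<in> Neck. ht m \<in> D} (\<lambda>m u v. base m u v + \<gamma> (ht m) * area m u v)"
proof -
  let ?W = "{m \<in> Neck. ht m \<in> D}"
  have W: "open_in M ?W" by (rule openin_neck_height[OF D])
  have 1: "closed_smooth_form M ?W base" unfolding base_def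
    by (rule closed_smooth_form_pullback[OF mfd_M A.pm(1) W openin_points[OF A.pm(1)] neck_smooth(5) _ A.FT(4)])
      (use neck_smooth(2) in auto)
  have 2: "closed_smooth_form M ?W (pullback2 M Cyl \<pi>C (cyl_form \<gamma>))"
    by (rule closed_smooth_form_pullback[OF mfd_M mfd_cylinder W openin_cylinder_height[OF D] neck_smooth(6) _
        closed_smooth_cyl_form[OF D \<gamma>]]) (use neck_smooth(3) in auto)
  from closed_smooth_form_add[OF mfd_M W 1 2] show ?thesis by (simp add: area_scaled)
qed

text \<open>Instance of \<open>wedge_power_scale_plane\<close> with \<open>\<alpha> = dh\<close>,
  \<open>\<beta> = d\<theta>\<close> and \<open>e\<close> the direction of rotation, which
  \<open>base\<close> annihilates. With \<open>t = - 1\<close> it shows that the two signs of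
  \<open>area\<close> induce opposite orientations.\<close>

lemma neck_wedge_scale:
  assumes m: "m \<in> Neck"
  shows "wedge_power CARD('n) (\<lambda>u v. base m u v + t * area m u v) v
    = t * wedge_power CARD('n) (\<lambda>u v. base m u v + area m u v) v"
proof -
  let ?c = "dC m"
  have lin: "?c (a *\<^sub>R u + v) = a *\<^sub>R ?c u + ?c v" for a u v by (rule tmap_linear[OF mfd_M mfd_cylinder neck_smooth(6)[OF m]]) simp_all
  obtain e where e: "dF m e = 0" "?c e = 1" by (rule neck_tangent_surjective[OF m subspace_0[OF mfd_subspace[OF A.pm(1)]], of 1])
  have "wedge_power CARD('n) (\<lambda>u v. base m u v + t * (Im (?c u) * Re (?c v) - Im (?c v) * Re (?c u))) v
    = t * wedge_power CARD('n) (\<lambda>u v. base m u v + (Im (?c u) * Re (?c v) - Im (?c v) * Re (?c u))) v"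
  proof (rule wedge_power_scale_plane[where E = UNIV and e = e and \<alpha> = "\<lambda>u. Im (?c u)" and \<beta> = "\<lambda>u. Re (?c u)"])
    show "dim (UNIV :: (complex ^ 'n) set) = 2 * CARD('n)" by simp
    show "base m e u = 0" for u
      using F_zero(1)[OF neck_smooth(2)[OF m] tmap_mem[OF mfd_M A.pm(1) neck_smooth(5)[OF m], of u]] e by (simp add: base_eq)
  qed (use neck_base_alternating[OF m] e lin in simp_all)
  then show ?thesis by (simp add: area_eq)
qed

lemma Above_Neck: "p \<in> A.Wcut ==> Above p \<in> Neck" and Below_Neck: "p' \<in> B.Wcut ==> Below p' \<in> Neck"
  using Above_iff Below_iff by blast+

text \<open>On the end, \<open>ni\<close> after \<open>Above\<close> is \<open>A.of_X\<close>, so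
  both sides are pullbacks under the same maps and \<open>A.form_Wcut\<close> applies. The
  counterpart for the second side carries the factor \<open>\<sigma>\<close>.\<close>

lemma above_form:
  assumes p: "p \<in> A.Wcut"
  shows "pullback2 M X1 of_Above \<omega>1 (Above p) u v = base (Above p) u v + area (Above p) u v"
proof -
  have uv: "u \<in> Model M" "v \<in> Model M" by simp_all
  note s = pA.smooth_embed_inverse[OF A.Wcut_cut[OF p]]
  have O: "open_in M (Above ` A.Wcut)" by (rule pA.openin_embed[OF A.openin_Wcut]) (use A.Wcut_cut in blast)
  have sF: "smooth_at X1 XF A.\<pi>F (of_Above (Above p))" "smooth_at X1 Cyl A.\<pi>C (of_Above (Above p))" using A.smooth_of_X[OF p] by simp_all
  have "base (Above p) u v = pullback2 M XF (\<lambda>m. A.\<pi>F (of_Above m)) \<omega>F (Above p) u v"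
    unfolding base_def by (rule pullback2_cong[OF mfd_M O _ _ uv]) (use p ni_Above in auto)
  also have "\<dots> = pullback2 M X1 of_Above (pullback2 X1 XF A.\<pi>F \<omega>F) (Above p) u v"
    by (rule pullback2_compose[OF mfd_M A.pm(2,1) s sF(1) uv])
  finally have 1: "base (Above p) u v = \<dots>" .
  have "area (Above p) u v = pullback2 M Cyl (\<lambda>m. A.\<pi>C (of_Above m)) (cyl_form (\<lambda>_. 1)) (Above p) u v"
    unfolding area_def by (rule pullback2_cong[OF mfd_M O _ _ uv]) (use p ni_Above in auto)
  also have "\<dots> = pullback2 M X1 of_Above (pullback2 X1 Cyl A.\<pi>C (cyl_form (\<lambda>_. 1))) (Above p) u v"
    by (rule pullback2_compose[OF mfd_M A.pm(2) mfd_cylinder s sF(2) uv])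
  finally have 2: "area (Above p) u v = \<dots>" .
  show ?thesis unfolding 1 2 unfolding pullback2_def[of M X1 of_Above] using A.form_Wcut[OF p] by simp
qed

lemma below_form:
  assumes p: "p \<in> B.Wcut"
  shows "pullback2 M X2 of_Below \<omega>2 (Below p) u v = base (Below p) u v + \<sigma> * area (Below p) u v"
proof -
  have uv: "u \<in> Model M" "v \<in> Model M" by simp_all
  note s = pB.smooth_embed_inverse[OF B.Wcut_cut[OF p]]
  have O: "open_in M (Below ` B.Wcut)" by (rule pB.openin_embed[OF B.openin_Wcut]) (use B.Wcut_cut in blast)
  have sF: "smooth_at X2 XF B.\<pi>F (of_Below (Below p))" "smooth_at X2 Cyl B.\<pi>C (of_Below (Below p))" using B.smooth_of_X[OF p] by simp_all
  have "base (Below p) u v = pullback2 M XF (\<lambda>m. B.\<pi>F (of_Below m)) \<omega>F (Below p) u v"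
    unfolding base_def by (rule pullback2_cong[OF mfd_M O _ _ uv]) (use p ni_Below in auto)
  also have "\<dots> = pullback2 M X2 of_Below (pullback2 X2 XF B.\<pi>F \<omega>F) (Below p) u v"
    by (rule pullback2_compose[OF mfd_M B.pm(2,1) s sF(1) uv])
  finally have 1: "base (Below p) u v = \<dots>" .
  have "area (Below p) u v = pullback2 M Cyl (\<lambda>m. B.\<pi>C (of_Below m)) (cyl_form (\<lambda>_. 1)) (Below p) u v"
    unfolding area_def by (rule pullback2_cong[OF mfd_M O _ _ uv]) (use p ni_Below in auto)
  also have "\<dots> = pullback2 M X2 of_Below (pullback2 X2 Cyl B.\<pi>C (cyl_form (\<lambda>_. 1))) (Below p) u v"
    by (rule pullback2_compose[OF mfd_M B.pm(2) mfd_cylinder s sF(2) uv])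
  finally have 2: "area (Below p) u v = \<dots>" .
  show ?thesis unfolding 1 2 unfolding pullback2_def[of M X2 of_Below] using B.form_Wcut[OF p] by simp
qed

subsection \<open>The torus action\<close>

text \<open>On the second side the neck identification turns rotation by \<open>z $ l\<close> into
  rotation by \<open>\<rho> (z $ l)\<close>. Precomposing the second action with this automorphism
  makes it plain rotation on the neck; \<open>flip\<close> is the differential of the
  automorphism.\<close>

definition twist :: "complex ^ 'n => complex ^ 'n" where "twist z = (\<chi> i. if i = l then \<rho> (z $ i) else z $ i)"
definition flip :: "real ^ 'n => real ^ 'n" where "flip X = (\<chi> i. if i = l then \<sigma> * X $ i else X $ i)"

definition act :: "complex ^ 'n => ('a, 'f, 'b) glued => ('a, 'f, 'b) glued" where
  "act z m = (case m of Above p => Above (act1 z p) | Locus x w => Locus (actF (drop_circle l z) x) (z $ l * w)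
    | Below p => Below (act2 (twist z) p))"

lemma act_simps [simp]: "act z (Above p) = Above (act1 z p)" "act z (Below p') = Below (act2 (twist z) p')"
  "act z (Locus x w) = Locus (actF (drop_circle l z) x) (z $ l * w)"
  by (simp_all add: act_def)

lemma twist_torus: "z \<in> torus UNIV ==> twist z \<in> torus UNIV" by (auto simp: torus_def twist_def B.\<rho>)

lemma twist_simps: "twist (z * w) = twist z * twist w" "twist 1 = 1" "drop_circle l (twist z) = drop_circle l z"
    "twist z $ l = \<rho> (z $ l)" "twist (torus_exp X) = torus_exp (flip X)"
  by (auto simp: twist_def flip_def vec_eq_iff B.\<rho> drop_circle_def torus_exp_def B.\<rho>_cis)

lemma drop_circle_simps: "drop_circle l (z * w) = drop_circle l z * drop_circle l w" "drop_circle l 1 = 1" by (auto simp: drop_circle_def vec_eq_iff)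

lemma flip_simps: "bounded_linear flip" "flip (t *\<^sub>R X) = t *\<^sub>R flip X" "flip X \<bullet> Y = X \<bullet> flip Y"
    "flip (X - Y) = flip X - flip Y"
proof -
  show "bounded_linear flip" by (intro linear_conv_bounded_linear[THEN iffD1] linearI) (auto simp: flip_def vec_eq_iff algebra_simps)
  show "flip X \<bullet> Y = X \<bullet> flip Y" unfolding inner_vec_def by (rule sum.cong) (auto simp: flip_def)
qed (auto simp: flip_def vec_eq_iff algebra_simps)

definition rot where "rot z q = (actF (drop_circle l z) (fst q), z $ l * fst (snd q), snd (snd q))"

lemma rot_points: "z \<in> torus UNIV ==> q \<in> points P ==> rot z q \<in> points P"
  using A.FT(8)[OF drop_circle_torus] by (auto simp: rot_def points_cylinder norm_mult torus_def prod_mfd_simps(2))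

text \<open>In neck coordinates the action is the product action \<open>rot\<close> on both halves
  and on the cut locus alike, which carries smoothness across the locus. On the lower half
  \<open>\<rho>\<close> occurs once in \<open>twist\<close> and once in \<open>B.act_Wcut\<close>,
  and the two cancel.\<close>

lemma act_nk:
  assumes z: "z \<in> torus UNIV" and q: "q \<in> points P"
  shows "act z (nk q) = nk (rot z q)"
proof (rule points_P_cases[OF q])
  assume "snd (snd q) = 0"
  then show ?thesis by (simp add: nk_0 rot_def)
next
  assume h: "q \<in> A.half"
  note t = A.to_X_facts[OF h]
  have e: "A.of_X (act1 z (A.to_X q)) = rot z q" using A.act_Wcut(2)[OF z t(1)] t(2) by (simp add: rot_def)
  have "rot z q \<in> A.half" using A.of_X_half[OF A.act_Wcut(1)[OF z t(1)]] e by simp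
  then show ?thesis using nk_A[OF h] nk_A[of "rot z q"] A.to_X_of_X[OF A.act_Wcut(1)[OF z t(1)]] e by simp
next
  assume h: "q \<in> B.half"
  note t = B.to_X_facts[OF h] and z' = twist_torus[OF z]
  have e: "B.of_X (act2 (twist z) (B.to_X q)) = rot z q" using B.act_Wcut(2)[OF z' t(1)] t(2) by (simp add: rot_def twist_simps B.\<rho>)
  have "rot z q \<in> B.half" using B.of_X_half[OF B.act_Wcut(1)[OF z' t(1)]] e by simp
  then show ?thesis using nk_B[OF h] nk_B[of "rot z q"] B.to_X_of_X[OF B.act_Wcut(1)[OF z' t(1)]] e by simp
qed

lemma act_Neck:
  assumes z: "z \<in> torus UNIV" and m: "m \<in> Neck"
  shows "act z m \<in> Neck" "ni (act z m) = rot z (ni m)"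
proof -
  obtain q where q: "q \<in> points P" "m = nk q" using m by blast
  then have e: "act z m = nk (rot z q)" using act_nk[OF z q(1)] by simp
  then show "act z m \<in> Neck" using rot_points[OF z q(1)] by blast
  show "ni (act z m) = rot z (ni m)" using e rot_points[OF z q(1)] q by (simp add: ni_nk)
qed

lemma torus_action_M: "torus_action UNIV M act" unfolding torus_action_def torus_lie_UNIV
proof (intro conjI ballI)
  fix z :: "complex ^ 'n" and m assume z: "z \<in> torus UNIV" and m: "m \<in> points M"
  show "act z m \<in> points M" by (rule M_cases[OF m])
      (use A.act_cut[OF z] B.act_cut[OF twist_torus[OF z]] act_Neck(1)[OF z] points_M in auto)
  fix w :: "complex ^ 'n" assume w: "w \<in> torus UNIV"
  show "act (z * w) m = act z (act w m)"
  proof (rule M_cases[OF m])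
    fix p assume "p \<in> C1" "m = Above p"
    then show ?thesis using A.XT(9)[OF z w] C1_points by auto
  next
    fix p assume "p \<in> C2" "m = Below p"
    then show ?thesis using B.XT(9)[OF twist_torus[OF z] twist_torus[OF w]] C2_points by (auto simp: twist_simps)
  next
    fix q assume "q \<in> points P" "snd (snd q) = 0" "m = nk q"
    then show ?thesis using A.FT(9)[OF drop_circle_torus[OF z] drop_circle_torus[OF w]]
      by (auto simp: nk_0 drop_circle_simps mult.assoc prod_mfd_simps(2))
  qed
next
  fix m assume m: "m \<in> points M"
  show "act 1 m = m"
    by (rule M_cases[OF m]) (use A.XT(7) B.XT(7) A.FT(7) C1_points C2_points in \<open>auto simp: nk_0 drop_circle_simps twist_simps prod_mfd_simps(2)\<close>)
next
  let ?Q = "prod_mfd (flat (UNIV :: (real ^ 'n) set)) M"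
  have Q: "premanifold ?Q" by (rule mfd_prod[OF mfd_vec mfd_M])
  have above: "smooth_at ?Q M (\<lambda>(X, m). act (torus_exp X) m) (X, Above p)" if p: "p \<in> C1" for X p
  proof (rule pA.smooth_action_embed[OF p, of "\<lambda>X. act1 (torus_exp X)"])
    show "smooth_at (prod_mfd (flat UNIV) X1) X1 (\<lambda>(X, p). act1 (torus_exp X) p) (X, p)"
      using smooth_at_action[OF A.pm(2) A.XT(3), of p X] p C1_points by auto
  qed (use A.act_cut[OF torus_exp_UNIV] in simp_all)
  have below: "smooth_at ?Q M (\<lambda>(X, m). act (torus_exp X) m) (X, Below p)" if p: "p \<in> C2" for X p
  proof (rule pB.smooth_action_embed[OF p, of "\<lambda>X. act2 (torus_exp (flip X))"])
    have pX: "p \<in> points X2" using p C2_points by blast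
    have x: "(X, p) \<in> points (flat UNIV) \<times> points X2" using pX by simp
    note Q2 = mfd_prod[OF mfd_vec B.pm(2)]
    note fs = smooth_at_fst_snd[OF mfd_vec B.pm(2) x]
    have "smooth_at (prod_mfd (flat UNIV) X2) (prod_mfd (flat UNIV) X2) (\<lambda>q. (flip (fst q), snd q)) (X, p)"
      by (rule smooth_at_Pair[OF Q2 mfd_vec B.pm(2) smooth_at_linear_flat(1)[OF Q2 fs(1) flip_simps(1)] fs(2)])
    from smooth_at_compose[OF Q2 Q2 B.pm(2) this, of "\<lambda>(X, p). act2 (torus_exp X) p"]
    show "smooth_at (prod_mfd (flat UNIV) X2) X2 (\<lambda>(X, p). act2 (torus_exp (flip X)) p) (X, p)"
      using smooth_at_action[OF B.pm(2) B.XT(3) pX, of "flip X"] by (simp add: case_prod_unfold)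
  qed (use B.act_cut[OF torus_exp_UNIV] in \<open>simp_all add: twist_simps\<close>)
  have neck: "smooth_at ?Q M (\<lambda>(X, m). act (torus_exp X) m) (X, nk q)" if q: "q \<in> points P" for X q
  proof (rule pN.smooth_action_embed[OF q, of "\<lambda>X. rot (torus_exp X)"])
    let ?R = "prod_mfd (flat (UNIV :: (real ^ 'n) set)) P"
    let ?E = "torus_lie (- {l})"
    note R = mfd_prod[OF mfd_vec A.pm(3)]
    have x: "(Y, q') \<in> points (flat UNIV) \<times> points P" if "q' \<in> points P" for Y :: "real ^ 'n" and q' using that by simp
    note fs = smooth_at_fst_snd[OF mfd_vec A.pm(3) x[OF q]]
    have xq: "q \<in> points XF \<times> points Cyl" using q by (simp add: prod_mfd_simps(2))
    note fq = smooth_at_fst_snd[OF A.pm(1) mfd_cylinder xq]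
    have s1: "smooth_at ?R XF (\<lambda>r. fst (snd r)) (X, q)" by (rule smooth_at_compose[OF R A.pm(3,1) fs(2)]) (simp add: fq)
    have s2: "smooth_at ?R Cyl (\<lambda>r. snd (snd r)) (X, q)" by (rule smooth_at_compose[OF R A.pm(3) mfd_cylinder fs(2)]) (simp add: fq)
    have E: "premanifold (flat ?E)" by (rule mfd_flat[OF subspace_torus_lie])
    have bl: "bounded_linear (drop_coord l)" by (intro linear_conv_bounded_linear[THEN iffD1] linearI) (auto simp: drop_coord_def vec_eq_iff)
    have dE: "smooth_at (flat UNIV) (flat ?E) (drop_coord l) X"
      by (rule smooth_at_flat[of UNIV UNIV]) (use drop_coord_lie smooth_on_linear[of UNIV UNIV, OF _ bl] in auto)
    have s3: "smooth_at ?R (flat ?E) (\<lambda>r. drop_coord l (fst r)) (X, q)" by (rule smooth_at_compose[OF R mfd_vec E fs(1)]) (simp add: dE)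
    have "fst q \<in> points XF" using xq by auto
    note s4 = smooth_at_action[OF A.pm(1) A.FT(3) this drop_coord_lie[of l X]]
    have s5: "smooth_at ?R XF (\<lambda>r. actF (torus_exp (drop_coord l (fst r))) (fst (snd r))) (X, q)"
      using smooth_at_compose[OF R mfd_prod[OF E A.pm(1)] A.pm(1) smooth_at_Pair[OF R E A.pm(1) s3 s1],
          of "\<lambda>(X, p). actF (torus_exp X) p"] s4 by simp
    have u0: "(0, 0) \<in> Model ?R" using subspace_0[OF mfd_subspace[OF A.pm(1)]] by (simp add: zero_prod_def mem_Times_iff)
    note cy = tmap_cylinder(3,4)[OF R s2 u0]
    have "bounded_linear (\<lambda>X::real ^ 'n. X $ l)" by (rule bounded_linear_vec_nth)
    note s6 = smooth_at_linear_flat(1)[OF R fs(1) this]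
    have s7: "smooth_vec ?R (\<lambda>r. cis (fst r $ l)) (X, q)" by (rule smooth_at_compose_flat[OF R s6 open_UNIV UNIV_I smooth_on_cis])
    have s8: "smooth_vec ?R (\<lambda>r. cis (fst r $ l) * fst (snd (snd r))) (X, q)"
      by (rule smooth_at_bilinear[OF R bounded_bilinear_mult s7 cy(1)])
    have s9: "smooth_at ?R Cyl (\<lambda>r. (cis (fst r $ l) * fst (snd (snd r)), snd (snd (snd r)))) (X, q)"
      by (rule smooth_at_into_cylinder[OF R openin_points[OF R]])
        (use q s8 cy(2) in \<open>auto simp: points_cylinder norm_mult prod_mfd_simps(2)\<close>)
    have r: "rot (torus_exp Y) q' = (actF (torus_exp (drop_coord l Y)) (fst q'), cis (Y $ l) * fst (snd q'), snd (snd q'))" for Y q'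
      using drop_circle_exp[of l 1 Y] by (simp add: rot_def) (simp add: torus_exp_def)
    show "smooth_at ?R P (\<lambda>(X, q). rot (torus_exp X) q) (X, q)"
      unfolding case_prod_unfold r by (rule smooth_at_Pair[OF R A.pm(1) mfd_cylinder s5 s9])
  qed (use rot_points[OF torus_exp_UNIV] act_nk[OF torus_exp_UNIV] in blast)+
  have "smooth_at ?Q M (\<lambda>(X, m). act (torus_exp X) m) r" if r: "r \<in> points ?Q" for r
  proof -
    have "snd r \<in> points M" using r by (auto simp: mem_Times_iff prod_mfd_simps(2))
    then show ?thesis by (cases r) (use above below neck in \<open>auto simp: points_M\<close>)
  qed
  then show "smooth_map ?Q M (\<lambda>(X, m). act (torus_exp X) m)" using smooth_map_on_iff[OF Q mfd_M] openin_points[OF Q] by blast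
qed

text \<open>The cut locus alone detects every torus element: coordinate \<open>l\<close> moves its
  circle freely, and the other coordinates act effectively on \<open>XF\<close>.\<close>

lemma effective_M: "effective_action UNIV M act" unfolding effective_action_def
proof (intro ballI impI)
  fix z :: "complex ^ 'n" assume z: "z \<in> torus UNIV" and fix_all: "\<forall>p\<in>points M. act z p = p"
  have L: "actF (drop_circle l z) x = x" "z $ l = 1" if x: "x \<in> points XF" for x
  proof -
    have "Locus x 1 \<in> points M" using Locus_nk[OF x, of 1] points_M by auto
    then have "act z (Locus x 1) = Locus x 1" using fix_all by blast
    then show "actF (drop_circle l z) x = x" "z $ l = 1" by simp_all
  qed
  have "drop_circle l z = 1" using A.FT(13) L(1) drop_circle_torus[OF z] unfolding effective_action_def by blast
  moreover have "z $ l = 1" using L(2) A.F_nonempty by blast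
  ultimately show "z = 1" by (auto simp: drop_circle_def vec_eq_iff) metis
qed

lemma smooth_orbit_M: "m \<in> points M ==> smooth_at (flat UNIV) M (orbit act X m) s" by (rule smooth_at_orbit[OF mfd_M torus_action_M]) simp_all

lemma act_one: "m \<in> points M ==> act 1 m = m" using torus_action_M by (simp add: torus_action_def)

lemma Neck_points: "m \<in> Neck ==> m \<in> points M" by (simp add: points_M)

lemma fundamental_neck:
  assumes m: "m \<in> Neck"
  shows "dF m (fundamental_field M act Y m) = fundamental_field XF actF (drop_coord l Y) (\<pi>F m)"
    "dC m (fundamental_field M act Y m) = complex_of_real (Y $ l)"
proof -
  have mM: "m \<in> points M" by (rule Neck_points[OF m])
  note orb = smooth_orbit_M[OF mM, of Y 0]
  have e: "ni (act (torus_exp (t *\<^sub>R Y)) m) = (actF (torus_exp (t *\<^sub>R drop_coord l Y)) (\<pi>F m), cis (t * Y $ l) * fst (\<pi>C m), snd (\<pi>C m))" for t :: real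
    using act_Neck(2)[OF torus_exp_UNIV m, of "t *\<^sub>R Y"] by (simp add: rot_def drop_circle_exp) (simp add: torus_exp_def)
  show "dF m (fundamental_field M act Y m) = fundamental_field XF actF (drop_coord l Y) (\<pi>F m)"
    by (rule tmap_fundamental_field[where act = act and act' = actF, OF mfd_M A.pm(1) neck_smooth(5)[OF m] orb act_one[OF mM] A.FT(7)[OF neck_smooth(2)[OF m]]])
      (simp add: e)
  show "dC m (fundamental_field M act Y m) = complex_of_real (Y $ l)"
    by (rule tmap_fundamental_field_cylinder[where act = act, OF mfd_M neck_smooth(6)[OF m] orb act_one[OF mM]]) (simp_all add: e)
qed

end


section \<open>The glued toric structure\<close>

text \<open>
  The function \<open>G\<close> of the height is the last component of the moment map near the cut locus, and \<open>\<gamma>\<close> is its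
  derivative. Away from the cut locus it is prescribed by the two given structures.
\<close>

locale glue_profile = glue \<epsilon> \<rho> \<sigma> l XF \<omega>F actF \<mu>F X1 \<omega>1 act1 \<mu>1 W1 \<Phi>1 X2 \<omega>2 act2 \<mu>2 W2 \<Phi>2
  for \<epsilon> :: real and \<rho> \<sigma> and l :: "'n::finite" and XF :: "('f, complex ^ 'n) mfd" and \<omega>F actF \<mu>F
    and X1 :: "('a, complex ^ 'n) mfd" and \<omega>1 act1 \<mu>1 W1 \<Phi>1
    and X2 :: "('b, complex ^ 'n) mfd" and \<omega>2 act2 \<mu>2 W2 \<Phi>2 +
  fixes D :: "real set" and G \<gamma> :: "real => real" and a :: real
  assumes D: "open D" "\<And>h. h \<noteq> 0 ==> h \<in> D"
    and a: "0 < a" "a < \<epsilon>"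
    and G: "\<And>h. h \<in> D ==> (G has_real_derivative \<gamma> h) (at h)" "smooth_on UNIV D G" "smooth_on UNIV D \<gamma>"
      "\<And>h. a \<le> h ==> G h = h" "\<And>h. h \<le> - a ==> G h = \<sigma> * h"
    and \<gamma>: "\<And>h. h \<in> D ==> \<bar>h\<bar> < \<epsilon> ==> \<gamma> h \<noteq> 0"
begin

lemma \<gamma>_far: "a < h ==> \<gamma> h = 1" "h < - a ==> \<gamma> h = \<sigma>"
proof -
  assume h: "a < h"
  then have hD: "h \<in> D" using a D(2) by simp
  have "((\<lambda>h. h) has_real_derivative \<gamma> h) (at h)"
    by (rule has_field_derivative_transform_within_open[OF G(1)[OF hD] open_greaterThan[of a]]) (use h G(4) in auto)
  then show "\<gamma> h = 1" using DERIV_unique[OF _ DERIV_ident] by blast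
next
  assume h: "h < - a"
  then have hD: "h \<in> D" using a D(2) by simp
  have "((\<lambda>h. \<sigma> * h) has_real_derivative \<gamma> h) (at h)"
    by (rule has_field_derivative_transform_within_open[OF G(1)[OF hD] open_lessThan[of "- a"]]) (use h G(5) in auto)
  then show "\<gamma> h = \<sigma>" using DERIV_unique[OF _ DERIV_cmult_Id] by blast
qed

text \<open>The constants by which the given moment maps differ from the expected ones on the ends,
  chosen from the existence statement \<open>moment_Wcut\<close> of each side.\<close>

definition k1 where "k1 = (SOME k. \<forall>p\<in>A.Wcut. \<mu>1 p = \<mu>F (A.\<pi>F p) + axis l (snd (A.\<pi>C p)) + k)"
definition k2 where "k2 = (SOME k. \<forall>p\<in>B.Wcut. \<mu>2 p = \<mu>F (B.\<pi>F p) + axis l (snd (B.\<pi>C p)) + k)"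

lemma k1: "p \<in> A.Wcut ==> \<mu>1 p = \<mu>F (A.\<pi>F p) + axis l (snd (A.\<pi>C p)) + k1"
  using someI_ex[OF A.moment_Wcut] unfolding k1_def by blast

lemma k2: "p \<in> B.Wcut ==> \<mu>2 p = \<mu>F (B.\<pi>F p) + axis l (snd (B.\<pi>C p)) + k2"
  using someI_ex[OF B.moment_Wcut] unfolding k2_def by blast

text \<open>The neck has precedence in the case distinction. The given forms are altered only up to
  height \<open>a\<close>, since beyond it \<open>\<gamma>\<close> takes the values \<open>1\<close>
  and \<open>\<sigma>\<close> that reproduce them.\<close>

definition form :: "(('a, 'f, 'b) glued, complex ^ 'n) form2" where
  "form m u v = (if m \<in> Neck then base m u v + \<gamma> (ht m) * area m u v
     else if m \<in> Above ` C1 then pullback2 M X1 of_Above \<omega>1 m u v else pullback2 M X2 of_Below \<omega>2 m u v)"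

text \<open>The constants are subtracted so that the branches agree at heights beyond
  \<open>a\<close>; on the second side \<open>flip\<close> accounts for the precomposition of the
  action with \<open>twist\<close>.\<close>

definition mom :: "('a, 'f, 'b) glued => real ^ 'n" where
  "mom m = (if m \<in> Neck then \<mu>F (\<pi>F m) + axis l (G (ht m))
     else if m \<in> Above ` C1 then \<mu>1 (of_Above m) - k1 else flip (\<mu>2 (of_Below m) - k2))"

text \<open>Empty for \<open>D = UNIV\<close> and equal to the cut locus for
  \<open>D = - {0}\<close>, so that one development covers both gluings.\<close>

definition Sing where "Sing = {m \<in> Neck. ht m \<notin> D}"

lemma far1_height: "p \<in> far1 a ==> p \<in> A.Wcut ==> a < snd (snd (A.of_X p))" using half_sign(1)[OF A.of_X_half[of p]] by (auto simp: far1_def)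

lemma far2_height: "p \<in> far2 a ==> p \<in> B.Wcut ==> snd (snd (B.of_X p)) < - a"
  using half_sign(2)[OF B.of_X_half[of p]] by (auto simp: far2_def)

lemma far_C: "p \<in> far1 a ==> p \<in> C1" "p' \<in> far2 a ==> p' \<in> C2" by (simp_all add: far1_def far2_def)

lemma form_far1: "p \<in> far1 a ==> form (Above p) u v = pullback2 M X1 of_Above \<omega>1 (Above p) u v"
  using Above_iff[of p] far_C(1)[of p] far1_height[of p] \<gamma>_far(1)[of "snd (snd (A.of_X p))"] above_form[of p u v] ni_Above[of p]
  by (cases "p \<in> A.Wcut") (auto simp: form_def)

lemma form_far2: "p \<in> far2 a ==> form (Below p) u v = pullback2 M X2 of_Below \<omega>2 (Below p) u v"
  using Below_iff[of p] far_C(2)[of p] far2_height[of p] \<gamma>_far(2)[of "snd (snd (B.of_X p))"] below_form[of p u v] ni_Below[of p]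
  by (cases "p \<in> B.Wcut") (auto simp: form_def)

lemma mom_far1: "p \<in> far1 a ==> mom (Above p) = \<mu>1 p - k1"
  using Above_iff[of p] far_C(1)[of p] far1_height[of p] G(4)[of "snd (snd (A.of_X p))"] k1[of p] ni_Above[of p]
  by (cases "p \<in> A.Wcut") (auto simp: mom_def)

lemma flip_neck: "x \<in> points XF ==> flip (\<mu>F x + axis l h) = \<mu>F x + axis l (\<sigma> * h)"
  using smooth_at_points[OF A.FT(10)[of x] A.pm(1)] by (auto simp: flip_def vec_eq_iff axis_def torus_lie_def)

lemma mom_far2: 
  assumes p: "p \<in> far2 a"
  shows "mom (Below p) = flip (\<mu>2 p - k2)"
proof (cases "p \<in> B.Wcut")
  case True
  have "\<mu>2 p - k2 = \<mu>F (B.\<pi>F p) + axis l (snd (B.\<pi>C p))" using k2[OF True] by simp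
  moreover have "B.\<pi>F p \<in> points XF" using neck_smooth(2)[OF Below_Neck[OF True]] ni_Below[OF True] by simp
  moreover have "G (snd (B.\<pi>C p)) = \<sigma> * snd (B.\<pi>C p)" using G(5) far2_height[OF p True] by simp
  ultimately show ?thesis using Below_Neck[OF True] ni_Below[OF True] by (simp add: mom_def flip_neck)
next
  case False
  then show ?thesis using Below_iff[of p] by (auto simp: mom_def)
qed

text \<open>On each of these three open sets \<open>form\<close> and \<open>mom\<close> have a
  single formula, so local statements are checked on them one by one.\<close>

lemma Reg_eq: "points M - Sing = {m \<in> Neck. ht m \<in> D} \<union> Above ` far1 a \<union> Below ` far2 a"
proof (intro equalityI subsetI)
  fix m assume m: "m \<in> points M - Sing"
  show "m \<in> {m \<in> Neck. ht m \<in> D} \<union> Above ` far1 a \<union> Below ` far2 a"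
  proof (cases "m \<in> Neck")
    case True
    then have "ht m \<in> D" using m unfolding Sing_def by blast
    then show ?thesis using True by blast
  next
    case False
    then consider p where "p \<in> C1" "m = Above p" | p where "p \<in> C2" "m = Below p" using m unfolding points_M by blast
    then show ?thesis
    proof cases
      case 1
      then have "p \<notin> A.Wcut" using False Above_Neck by blast
      then show ?thesis using 1 by (simp add: far1_def)
    next
      case 2
      then have "p \<notin> B.Wcut" using False Below_Neck by blast
      then show ?thesis using 2 by (simp add: far2_def)
    qed
  qed
next
  fix m assume m: "m \<in> {m \<in> Neck. ht m \<in> D} \<union> Above ` far1 a \<union> Below ` far2 a"
  have nz: "m \<notin> Sing" if "m \<in> Neck ==> ht m \<noteq> 0" using that D(2) unfolding Sing_def by blast
  from m consider "m \<in> Neck" "ht m \<in> D" | p where "p \<in> far1 a" "m = Above p" | p where "p \<in> far2 a" "m = Below p" by blast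
  then show "m \<in> points M - Sing"
  proof cases
    case 1
    then show ?thesis using Neck_points by (simp add: Sing_def)
  next
    case 2
    have "m \<notin> Sing" using nz Above_iff[of p] far1_height[OF 2(1)] ni_Above[of p] a unfolding 2(2) by fastforce
    then show ?thesis using 2 far_C(1) by (simp add: points_M)
  next
    case 3
    have "m \<notin> Sing" using nz Below_iff[of p] far2_height[OF 3(1)] ni_Below[of p] a unfolding 3(2) by fastforce
    then show ?thesis using 3 far_C(2) by (simp add: points_M)
  qed
qed

lemma Reg_cases:
  assumes "m \<in> points M - Sing"
  obtains "m \<in> Neck" "ht m \<in> D" | p where "p \<in> far1 a" "m = Above p" | p where "p \<in> far2 a" "m = Below p"
  using assms unfolding Reg_eq by blast

lemma openin_far_a: "open_in M (Above ` far1 a)" "open_in M (Below ` far2 a)" using openin_far a by auto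

lemma openin_Reg: "open_in M (points M - Sing)" unfolding Reg_eq by (intro openin_Un openin_neck_height D openin_far_a)

lemma form_closed: "closed_smooth_form M (points M - Sing) form"
proof (rule closed_smooth_form_local[OF mfd_M openin_Reg])
  have X1: "closed_smooth_form M (Above ` far1 a) (pullback2 M X1 of_Above \<omega>1)"
    by (rule closed_smooth_form_subset[OF pA.closed_form_embed[OF A.XT(4) openin_points[OF A.pm(2)] C1_points] mfd_M openin_far_a(1)])
      (use far_C in blast)
  have X2: "closed_smooth_form M (Below ` far2 a) (pullback2 M X2 of_Below \<omega>2)"
    by (rule closed_smooth_form_subset[OF pB.closed_form_embed[OF B.XT(4) openin_points[OF B.pm(2)] C2_points] mfd_M openin_far_a(2)])
      (use far_C in blast)
  have loc: "\<exists>V \<omega>'. open_in M V \<and> m \<in> V \<and> closed_smooth_form M V \<omega>' \<and>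
      (\<forall>q\<in>V. \<forall>u v. alternating_bilinear (Model M) (form q) \<and> (u \<in> Model M \<longrightarrow> v \<in> Model M \<longrightarrow> form q u v = \<omega>' q u v))"
    if V: "open_in M V" "m \<in> V" "closed_smooth_form M V \<omega>'" "\<And>q u v. q \<in> V ==> form q u v = \<omega>' q u v" for m V \<omega>'
  proof -
    have "alternating_bilinear (Model M) (form q)" if "q \<in> V" for q
    proof -
      have "form q = \<omega>' q" using V(4)[OF that] by (intro ext)
      then show ?thesis using V(3) that unfolding smooth_form2_on_def by simp
    qed
    then show ?thesis using V by blast
  qed
  fix m assume m: "m \<in> points M - Sing"
  show "\<exists>V \<omega>'. open_in M V \<and> m \<in> V \<and> closed_smooth_form M V \<omega>' \<and>
      (\<forall>q\<in>V. \<forall>u v. alternating_bilinear (Model M) (form q) \<and> (u \<in> Model M \<longrightarrow> v \<in> Model M \<longrightarrow> form q u v = \<omega>' q u v))"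
  proof (rule Reg_cases[OF m])
    assume h: "m \<in> Neck" "ht m \<in> D"
    show ?thesis by (rule loc[OF openin_neck_height[OF D(1)] _ closed_neck_form[OF D(1) G(3)]]) (use h in \<open>simp_all add: form_def\<close>)
  next
    fix p assume p: "p \<in> far1 a" "m = Above p"
    show ?thesis by (rule loc[OF openin_far_a(1) _ X1]) (use p form_far1 in auto)
  next
    fix p assume p: "p \<in> far2 a" "m = Below p"
    show ?thesis by (rule loc[OF openin_far_a(2) _ X2]) (use p form_far2 in auto)
  qed
qed

lemma form_nondegenerate:
  assumes m: "m \<in> points M - Sing" and u: "u \<noteq> 0"
  shows "\<exists>v. form m u v \<noteq> 0"
proof (rule Reg_cases[OF m])
  assume h: "m \<in> Neck" "ht m \<in> D"
  have "\<bar>ht m\<bar> < \<epsilon>" using neck_smooth(3)[OF h(1)] by (auto simp: points_cylinder)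
  then show ?thesis using neck_nondegenerate[OF h(1) \<gamma>[OF h(2)] u] h(1) by (simp add: form_def)
next
  fix p assume p: "p \<in> far1 a" "m = Above p"
  have "\<exists>v. pullback2 M X1 of_Above \<omega>1 (Above p) u v \<noteq> 0"
    by (rule pA.nondegenerate_embed[OF far_C(1)[OF p(1)] _ u]) (use A.XT(6) C1_points far_C(1)[OF p(1)] in blast)
  then show ?thesis unfolding p(2) form_far1[OF p(1)] .
next
  fix p assume p: "p \<in> far2 a" "m = Below p"
  have "\<exists>v. pullback2 M X2 of_Below \<omega>2 (Below p) u v \<noteq> 0"
    by (rule pB.nondegenerate_embed[OF far_C(2)[OF p(1)] _ u]) (use B.XT(6) C2_points far_C(2)[OF p(1)] in blast)
  then show ?thesis unfolding p(2) form_far2[OF p(1)] .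
qed

lemma bounded_linear_axis: "bounded_linear (axis l :: real => real ^ 'n)"
  by (intro linear_conv_bounded_linear[THEN iffD1] linearI) (auto simp: axis_def vec_eq_iff)

text \<open>On the neck the derivative splits into that of the moment map of \<open>XF\<close> and
  \<open>\<gamma>(h) dh\<close>; the latter is minus the contraction of
  \<open>\<gamma>(h) dh \<and> d\<theta>\<close> with the unit rotation field. On the far sets the
  given identities are transported by \<open>moment_embed\<close>.\<close>

lemma mom_tmap:
  assumes m: "m \<in> points M - Sing"
  shows "smooth_vec M mom m"
    "dmap M (\<lambda>q. mom q \<bullet> X) m u = - form m (fundamental_field M act X m) u"
proof -
  have mM: "m \<in> points M" using m by blast
  note orb = smooth_orbit_M[OF mM, of X 0]
  have uM: "u \<in> Model M" by simp
  have "smooth_vec M mom m \<and>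
      dmap M (\<lambda>q. mom q \<bullet> X) m u = - form m (fundamental_field M act X m) u"
  proof (rule Reg_cases[OF m])
    assume h: "m \<in> Neck" "ht m \<in> D"
    have mom_neck: "mom q = \<mu>F (\<pi>F q) + axis l (G (ht q))" if "q \<in> Neck" for q using that by (simp add: mom_def)
    note sF = neck_smooth(5)[OF h(1)] and xF = neck_smooth(2)[OF h(1)]
    have s1: "smooth_vec M (\<lambda>q. \<mu>F (\<pi>F q)) m" by (rule smooth_at_compose[OF mfd_M A.pm(1) mfd_vec sF A.moment_F(1)[OF xF]])
    have s2: "smooth_vec M (\<lambda>q. G (ht q)) m" by (rule smooth_at_compose_flat[OF mfd_M neck_smooth(7)[OF h(1)] D(1) h(2) G(2)])
    have s3: "smooth_vec M (\<lambda>q. axis l (G (ht q))) m" by (rule smooth_at_linear_flat(1)[OF mfd_M s2 bounded_linear_axis])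
    have s: "smooth_vec M mom m" by (rule smooth_at_cong[OF mfd_M smooth_at_add_flat(1)[OF mfd_M s1 s3] openin_Neck h(1) mom_neck])
    have s4: "smooth_vec M (\<lambda>q. \<mu>F (\<pi>F q) \<bullet> X) m"
      by (rule smooth_at_compose[OF mfd_M A.pm(1) mfd_vec sF A.moment_F(2)[OF xF]])
    note s5 = smooth_at_linear_flat[OF mfd_M s2 bounded_linear_mult_right[of "X $ l"]]
    have t1: "dmap M (\<lambda>q. \<mu>F (\<pi>F q) \<bullet> X) m u = - \<omega>F (\<pi>F m) (fundamental_field XF actF (drop_coord l X) (\<pi>F m)) (dF m u)"
      using tmap_compose[OF mfd_M A.pm(1) mfd_vec sF A.moment_F(2)[OF xF] uM]
        A.moment_F(3)[OF xF tmap_mem[OF mfd_M A.pm(1) sF uM]] by simp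
    have "dmap M (\<lambda>q. G (ht q)) m u = \<gamma> (ht m) * dmap M ht m u"
      by (rule tmap_compose_flat[OF mfd_M neck_smooth(7)[OF h(1)] D(1) h(2) G(2) _ uM])
        (use G(1)[OF h(2)] in \<open>simp add: has_field_derivative_def\<close>)
    then have t2: "dmap M (\<lambda>q. X $ l * G (ht q)) m u = X $ l * (\<gamma> (ht m) * Im (dC m u))"
      using s5(2)[OF uM] neck_smooth(8)[OF h(1), of u] by simp
    have "dmap M (\<lambda>q. mom q \<bullet> X) m u = dmap M (\<lambda>q. \<mu>F (\<pi>F q) \<bullet> X + X $ l * G (ht q)) m u"
      by (rule tmap_cong[OF mfd_M openin_Neck h(1) _ uM]) (simp add: mom_neck inner_add_left inner_axis' mult.commute)
    also have "\<dots> = - form m (fundamental_field M act X m) u"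
      using smooth_at_add_flat(2)[OF mfd_M s4 s5(1) uM] t1 t2 h(1) fundamental_neck[OF h(1), of X] by (simp add: form_def base_eq area_eq)
    finally show ?thesis using s by blast
  next
    fix p assume p: "p \<in> far1 a" "m = Above p"
    have pC: "p \<in> C1" "p \<in> points X1" using far_C(1)[OF p(1)] C1_points by auto
    have pm: "Above p \<in> Above ` far1 a" using p by blast
    have eq: "mom q = \<mu>1 (of_Above q) + - k1" if "q \<in> Above ` far1 a" for q using that mom_far1 by auto
    note r = pA.moment_embed[where mom = mom and T = "\<lambda>x. x" and \<mu> = \<mu>1 and Y = X and X = X and act = act and actN = act1 and \<omega> = \<omega>1 and k = "- k1",
        OF pC(1) openin_far_a(1) pm bounded_linear_ident refl eq A.smooth_moment[OF pC(2)] A.XT(12)[OF _ pC(2)] _ act_one A.XT(7)[OF pC(2)] orb[unfolded p(2)]]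
    show ?thesis unfolding p(2) form_far1[OF p(1)] using r mM p(2) by simp
  next
    fix p assume p: "p \<in> far2 a" "m = Below p"
    have pC: "p \<in> C2" "p \<in> points X2" using far_C(2)[OF p(1)] C2_points by auto
    have pm: "Below p \<in> Below ` far2 a" using p by blast
    have eq: "mom q = flip (\<mu>2 (of_Below q)) + - flip k2" if "q \<in> Below ` far2 a" for q using that mom_far2 by (auto simp: flip_simps)
    have act: "of_Below (act (torus_exp (t *\<^sub>R X)) (Below p)) = act2 (torus_exp (t *\<^sub>R flip X)) p" for t
      by (simp add: twist_simps flip_simps)
    note r = pB.moment_embed[where mom = mom and T = flip and \<mu> = \<mu>2 and Y = "flip X" and X = X and act = act and actN = act2 and \<omega> = \<omega>2 and k = "- flip k2",
        OF pC(1) openin_far_a(2) pm flip_simps(1,3) eq B.smooth_moment[OF pC(2)] B.XT(12)[OF _ pC(2)] act act_one B.XT(7)[OF pC(2)] orb[unfolded p(2)]]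
    show ?thesis unfolding p(2) form_far2[OF p(1)] using r mM p(2) by simp
  qed
  then show "smooth_vec M mom m" "dmap M (\<lambda>q. mom q \<bullet> X) m u = - form m (fundamental_field M act X m) u" by blast+
qed

lemma act_mult: "z \<in> torus UNIV ==> w \<in> torus UNIV ==> m \<in> points M ==> act (z * w) m = act z (act w m)"
  using torus_action_M by (simp add: torus_action_def)

lemma act_Neck_iff: "z \<in> torus UNIV ==> m \<in> points M ==> act z m \<in> Neck \<longleftrightarrow> m \<in> Neck"
proof
  assume z: "z \<in> torus UNIV" and m: "m \<in> points M"
  define z' where "z' = (\<chi> i. cnj (z $ i))"
  have z': "z' \<in> torus UNIV" "z' * z = 1" using A.torus_inverse[OF z] by (auto simp: z'_def)
  have e: "act z' (act z m) = m" using act_mult[OF z'(1) z m] z'(2) act_one[OF m] by simp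
  assume "act z m \<in> Neck"
  then have "act z' (act z m) \<in> Neck" by (rule act_Neck(1)[OF z'(1)])
  then show "m \<in> Neck" unfolding e .
next
  assume "z \<in> torus UNIV" "m \<in> Neck"
  then show "act z m \<in> Neck" by (rule act_Neck(1))
qed

lemma mom_invariant:
  assumes z: "z \<in> torus UNIV" and m: "m \<in> points M"
  shows "mom (act z m) = mom m"
proof (cases "m \<in> Neck")
  case True
  then show ?thesis using act_Neck[OF z True] A.FT(11)[OF drop_circle_torus[OF z] neck_smooth(2)[OF True]] by (simp add: mom_def rot_def)
next
  case False
  then have n: "act z m \<notin> Neck" using act_Neck_iff[OF z m] by blast
  from m False consider p where "p \<in> C1" "m = Above p" | p where "p \<in> C2" "m = Below p" unfolding points_M by blast
  then show ?thesis
  proof cases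
    case 1
    then have "\<mu>1 (act1 z p) = \<mu>1 p" "act1 z p \<in> C1" using A.XT(11)[OF z] A.act_cut[OF z] C1_points by blast+
    then show ?thesis using 1 n False by (simp add: mom_def)
  next
    case 2
    then have "\<mu>2 (act2 (twist z) p) = \<mu>2 p" using B.XT(11)[OF twist_torus[OF z]] C2_points by blast
    then show ?thesis using 2 n False by (auto simp: mom_def)
  qed
qed

text \<open>Up to sign this value is the derivative of a component of \<open>mom\<close> along an
  orbit, and \<open>mom\<close> is constant on orbits.\<close>

lemma form_isotropic:
  assumes m: "m \<in> points M - Sing"
  shows "form m (fundamental_field M act X m) (fundamental_field M act Y m) = 0"
proof -
  have mM: "m \<in> points M" using m by blast
  have s: "smooth_vec M (\<lambda>q. mom q \<bullet> X) m" by (rule smooth_at_linear_flat(1)[OF mfd_M mom_tmap(1)[OF m] bounded_linear_inner_left])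
  have "dmap M (\<lambda>q. mom q \<bullet> X) m (fundamental_field M act Y m) = 0"
    by (rule tmap_fundamental_field_invariant[where act = act, OF mfd_M mfd_vec s smooth_orbit_M[OF mM] act_one[OF mM]])
      (simp add: mom_invariant[OF torus_exp_UNIV mM])
  then show ?thesis using mom_tmap(2)[OF m] by simp
qed

lemma toric_M:
  assumes "D = UNIV"
  shows "toric_structure UNIV M form act mom"
proof -
  have S: "points M - Sing = points M" unfolding Sing_def unfolding assms by simp
  have "symplectic_form M form" using form_closed form_nondegenerate unfolding symplectic_form_def S by auto
  moreover have "moment_map UNIV M form act mom" unfolding moment_map_def torus_lie_UNIV smooth_map_on_iff[OF mfd_M mfd_vec]
    using mom_tmap mom_invariant openin_points[OF mfd_M] unfolding S by blast
  ultimately show ?thesis using smooth_manifold_M torus_action_M effective_M by (simp add: toric_structure_def)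
qed

end


section \<open>The glued \<open>b\<close>-toric structure\<close>

lemma smooth_wedge_power:
  assumes M: "premanifold M" and W: "open_in M W" and \<omega>: "smooth_form2_on M W \<omega>" and c: "c \<in> Atlas M"
    and v: "\<And>i. v i \<in> Model M"
  shows "smooth_on (Model M) (img_on c W) (\<lambda>x. wedge_power n (\<omega> (chart_inv c x)) (\<lambda>i. chart_vector M c x (v i)))"
proof -
  let ?T = "img_on c W"
  have T: "rel_open (Model M) ?T" by (rule rel_open_chart_image[OF M W c])
  have e: "wedge_power n (\<omega> (chart_inv c x)) (\<lambda>i. chart_vector M c x (v i)) = wedge_power n (local_form M c \<omega> x) v" for x
  proof -
    have "local_form M c \<omega> x = (\<lambda>u v. \<omega> (chart_inv c x) (chart_vector M c x u) (chart_vector M c x v))"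
      by (intro ext) (simp add: local_form_def)
    then show ?thesis by (simp only: wedge_power_comp)
  qed
  have "smooth_on (Model M) ?T (\<lambda>x. local_form M c \<omega> x (v i) (v j))" for i j using \<omega> c v unfolding smooth_form2_on_def by blast
  then show ?thesis unfolding e unfolding wedge_power_def divide_inverse
    by (intro smooth_on_mult[OF T] smooth_on_sum[OF T] smooth_on_prod[OF T] smooth_on_const mfd_subspace[OF M])
qed

lemma alternating_multilinear_scale:
  fixes E :: "'e::real_vector set"
  assumes A: "alternating_multilinear E d A"
  shows "alternating_multilinear E d (\<lambda>v. s * A v)"
  unfolding alternating_multilinear_def
proof (intro allI impI conjI ballI)
  fix v :: "nat => 'e" and i a u w assume "\<forall>i. v i \<in> E" "i < d" "u \<in> E" "w \<in> E"
  then show "s * A (v(i := a *\<^sub>R u + w)) = a * (s * A (v(i := u))) + s * A (v(i := w))"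
    using alternating_multilinearD(1)[OF A, of v i u w a] by (simp add: algebra_simps)
next
  fix v :: "nat => 'e" and i j assume "\<forall>i. v i \<in> E" "i < d" "j < d" "i \<noteq> j \<and> v i = v j"
  then show "s * A v = 0" using alternating_multilinearD(2)[OF A, of v i j] by simp
next
  fix v w :: "nat => 'e" assume "\<forall>i. v i \<in> E" "(\<forall>i. w i \<in> E) \<and> (\<forall>i<d. w i = v i)"
  then show "s * A w = s * A v" using alternating_multilinearD(3)[OF A, of v w] by simp
qed

lemma split_coord_fst_mem: "fst (split_coord l x) \<in> {z. z $ l = 0}" by (simp add: split_coord_def)

locale glue_log = glue_profile \<epsilon> \<rho> \<sigma> l XF \<omega>F actF \<mu>F X1 \<omega>1 act1 \<mu>1 W1 \<Phi>1 X2 \<omega>2 act2 \<mu>2 W2 \<Phi>2 D G \<gamma> a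
  for \<epsilon> :: real and \<rho> \<sigma> and l :: "'n::finite" and XF :: "('f, complex ^ 'n) mfd" and \<omega>F actF \<mu>F
    and X1 :: "('a, complex ^ 'n) mfd" and \<omega>1 act1 \<mu>1 W1 \<Phi>1
    and X2 :: "('b, complex ^ 'n) mfd" and \<omega>2 act2 \<mu>2 W2 \<Phi>2
    and D G \<gamma> a +
  fixes w :: "real => real" and \<delta> :: real
  assumes rev: "\<sigma> = - 1" and D0: "D = - {0}"
    and w: "smooth_on UNIV UNIV w" "\<And>h. h \<noteq> 0 ==> w h = h * \<gamma> h" "\<And>h. \<bar>h\<bar> < \<epsilon> ==> w h \<noteq> 0"
    and \<delta>: "0 < \<delta>" "\<And>h. h \<noteq> 0 ==> \<bar>h\<bar> < \<delta> ==> G h = ln \<bar>h\<bar>"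
begin

abbreviation Z where "Z \<equiv> (cut_locus XF :: ('a, 'f, 'b) glued set)"

lemma Z_eq: "Z = {m \<in> Neck. ht m = 0}"
proof (intro equalityI subsetI)
  fix m assume "m \<in> Z"
  then obtain x z where x: "x \<in> points XF" "cmod z = 1" "m = Locus x z" unfolding cut_locus_def by blast
  have "m = nk (x, z, 0)" "(x, z, 0) \<in> points P" using Locus_nk[OF x(1,2)] x(3) by simp_all
  then show "m \<in> {m \<in> Neck. ht m = 0}" using ni_nk[of "(x, z, 0)"] by simp
next
  fix m assume "m \<in> {m \<in> Neck. ht m = 0}"
  then obtain q where q: "q \<in> points P" "m = nk q" "snd (snd q) = 0" using ni_nk by auto
  then show "m \<in> Z" using nk_0[OF q(3)] by (auto simp: cut_locus_def points_cylinder prod_mfd_simps(2))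
qed

lemma Sing_Z: "Sing = Z" unfolding Sing_def Z_eq unfolding D0 by simp

lemma Z_points: "Z \<subseteq> points M" using Z_eq Neck_points by blast

lemma defining_height:
  assumes "open_in M W" "W \<subseteq> Neck"
  shows "defining_function M Z W ht"
  unfolding defining_function_def
proof (intro conjI ballI)
  show "smooth_map_on M W (flat UNIV) ht" using assms neck_smooth(7) smooth_map_on_iff[OF mfd_M mfd_vec] by blast
  show "Z \<inter> W = {q \<in> W. ht q = 0}" using assms(2) unfolding Z_eq by blast
  fix q assume "q \<in> Z \<inter> W"
  then have q: "q \<in> Neck" using assms by blast
  obtain v where "dC q v = \<i>" by (rule neck_tangent_surjective[OF q subspace_0[OF mfd_subspace[OF A.pm(1)]], of \<i>])
  then show "\<exists>u\<in>Model M. dmap M ht q u \<noteq> 0" using neck_smooth(8)[OF q, of v] by (intro bexI[of _ v]) simp_all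
qed

lemma hypersurface_Z: "closed_hypersurface M Z" unfolding closed_hypersurface_def
proof (intro conjI ballI)
  show "closedin (mtopology M) Z" using openin_Reg Z_points by (simp add: closedin_def topspace_mtopology[OF mfd_M] Sing_Z)
  fix p assume "p \<in> Z"
  then show "\<exists>W y. p \<in> W \<and> defining_function M Z W y" using defining_height[OF openin_Neck] Z_eq by blast
qed

subsection \<open>The orientation\<close>

definition top :: "('a, 'f, 'b) glued => (nat => complex ^ 'n) => real" where
  "top m = (if m \<in> Neck then wedge_power CARD('n) (\<lambda>u v. base m u v + area m u v)
     else if m \<in> Above ` C1 then wedge_power CARD('n) (pullback2 M X1 of_Above \<omega>1 m)
     else (\<lambda>v. - wedge_power CARD('n) (pullback2 M X2 of_Below \<omega>2 m) v))"

lemma top_Above: "p \<in> C1 ==> top (Above p) = wedge_power CARD('n) (pullback2 M X1 of_Above \<omega>1 (Above p))"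
proof (cases "p \<in> A.Wcut")
  case True
  have "pullback2 M X1 of_Above \<omega>1 (Above p) = (\<lambda>u v. base (Above p) u v + area (Above p) u v)"
    by (intro ext) (rule above_form[OF True])
  then show ?thesis using Above_Neck[OF True] by (simp add: top_def)
qed (use Above_iff in \<open>auto simp: top_def\<close>)

text \<open>On the second end the given form is \<open>base - area\<close>; by
  \<open>neck_wedge_scale\<close> with \<open>t = - 1\<close> its top power is the negative of that
  of \<open>base + area\<close>, so the two branches of \<open>top\<close> agree.\<close>

lemma top_Below: "p \<in> C2 ==> top (Below p) = (\<lambda>v. - wedge_power CARD('n) (pullback2 M X2 of_Below \<omega>2 (Below p)) v)"
proof (cases "p \<in> B.Wcut")
  case True
  have "pullback2 M X2 of_Below \<omega>2 (Below p) = (\<lambda>u v. base (Below p) u v + (- 1) * area (Below p) u v)"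
    by (intro ext) (simp only: below_form[OF True] rev)
  then have "wedge_power CARD('n) (pullback2 M X2 of_Below \<omega>2 (Below p)) v
      = - 1 * wedge_power CARD('n) (\<lambda>u v. base (Below p) u v + area (Below p) u v) v" for v
    using neck_wedge_scale[OF Below_Neck[OF True], of "- 1" v] by (simp only:)
  then show ?thesis using Below_Neck[OF True] by (simp add: top_def)
qed (use Below_iff in \<open>auto simp: top_def\<close>)

text \<open>Smoothness and non-vanishing of \<open>top\<close> need only a local top power of a
  smooth non-degenerate form up to a nonzero factor; the factor is \<open>- 1\<close> on the second
  side and \<open>1\<close> elsewhere.\<close>

lemma top_local:
  assumes m: "m \<in> points M"
  obtains W \<omega> s where "open_in M W" "m \<in> W" "closed_smooth_form M W \<omega>" "s \<noteq> (0::real)"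
    "\<And>q v. q \<in> W ==> top q v = s * wedge_power CARD('n) (\<omega> q) v" "\<And>u. u \<noteq> 0 ==> \<exists>v. \<omega> m u v \<noteq> 0"
proof -
  from m consider "m \<in> Neck" | p where "p \<in> C1" "m = Above p" | p where "p \<in> C2" "m = Below p" unfolding points_M by blast
  then show ?thesis
  proof cases
    case 1
    have "smooth_on UNIV UNIV (\<lambda>h::real. 1::real)" by (rule smooth_on_const) simp
    from closed_neck_form[OF open_UNIV this] have c: "closed_smooth_form M Neck (\<lambda>m u v. base m u v + area m u v)" by simp
    show ?thesis by (rule that[OF openin_Neck 1 c, of 1]) (use neck_nondegenerate[OF 1, of 1] in \<open>simp_all add: top_def\<close>)
  next
    case 2
    show ?thesis by (rule that[OF pA.openin_embed_image _ pA.closed_form_embed[OF A.XT(4) openin_points[OF A.pm(2)] C1_points], of 1])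
        (use 2 top_Above pA.nondegenerate_embed[OF 2(1), of \<omega>1] A.XT(6) C1_points in auto)
  next
    case 3
    show ?thesis by (rule that[OF pB.openin_embed_image _ pB.closed_form_embed[OF B.XT(4) openin_points[OF B.pm(2)] C2_points], of "- 1"])
        (use 3 top_Below pB.nondegenerate_embed[OF 3(1), of \<omega>2] B.XT(6) C2_points in auto)
  qed
qed

lemma dim_M: "dim (Model M) = 2 * CARD('n)" by simp

lemma wedge_power_nonzero:
  assumes "alternating_bilinear UNIV B" "\<And>u. u \<noteq> 0 ==> \<exists>v. B u v \<noteq> 0"
  shows "\<exists>v. (\<forall>i. v i \<in> Model M) \<and> wedge_power CARD('n) B v \<noteq> 0"
  using wedge_power_nondegenerate[OF mfd_subspace[OF mfd_M] dim_M, of B] assms by simp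

lemma orientation_top: "orientation_form M top" unfolding orientation_form_def
proof (intro conjI ballI allI impI)
  fix p assume p: "p \<in> points M"
  obtain W \<omega> s where W: "open_in M W" "p \<in> W" "closed_smooth_form M W \<omega>" "s \<noteq> (0::real)"
    "\<And>q v. q \<in> W ==> top q v = s * wedge_power CARD('n) (\<omega> q) v" "\<And>u. u \<noteq> 0 ==> \<exists>v. \<omega> p u v \<noteq> 0"
    by (rule top_local[OF p]) (rule that)
  have ab: "alternating_bilinear (Model M) (\<omega> p)" using W(2,3) unfolding smooth_form2_on_def by blast
  have am: "alternating_multilinear (Model M) (dim (Model M)) (wedge_power CARD('n) (\<omega> p))"
    unfolding dim_M by (rule alternating_multilinear_wedge_power[OF ab mfd_subspace[OF mfd_M]])
  have t: "top p = (\<lambda>v. s * wedge_power CARD('n) (\<omega> p) v)" using W(5)[OF W(2)] by (intro ext)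
  show "alternating_multilinear (Model M) (dim (Model M)) (top p)" unfolding t by (rule alternating_multilinear_scale[OF am])
  obtain v where "\<forall>i. v i \<in> Model M" "wedge_power CARD('n) (\<omega> p) v \<noteq> 0"
    using wedge_power_nonzero[of "\<omega> p"] ab W(6) by auto
  then show "\<exists>v. (\<forall>i. v i \<in> Model M) \<and> top p v \<noteq> 0" using W(4) unfolding t by (intro exI[of _ v]) simp
next
  fix c and v :: "nat => complex ^ 'n" assume c: "c \<in> Atlas M" and v: "\<forall>i. v i \<in> Model M"
  note C = mfd_chart(2)[OF mfd_M c]
  show "smooth_on (Model M) (img c) (\<lambda>x. top (chart_inv c x) (\<lambda>i. chart_vector M c x (v i)))"
  proof (rule smooth_on_local[OF C])
    fix x assume "x \<in> img c"
    then obtain p where p: "p \<in> fst c" "x = snd c p" by blast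
    obtain W \<omega> s where W: "open_in M W" "p \<in> W" "closed_smooth_form M W \<omega>" "s \<noteq> (0::real)"
      "\<And>q v. q \<in> W ==> top q v = s * wedge_power CARD('n) (\<omega> q) v" "\<And>u. u \<noteq> 0 ==> \<exists>v. \<omega> p u v \<noteq> 0"
      by (rule top_local[OF chart_in_points[OF c p(1)]]) (rule that)
    let ?T = "img_on c W"
    have T: "rel_open (Model M) ?T" by (rule rel_open_chart_image[OF mfd_M W(1) c])
    have "smooth_on (Model M) ?T (\<lambda>x. wedge_power CARD('n) (\<omega> (chart_inv c x)) (\<lambda>i. chart_vector M c x (v i)))"
      by (rule smooth_wedge_power[OF mfd_M W(1) _ c]) (use W(3) v in auto)
    from smooth_on_mult[OF T smooth_on_const[OF mfd_subspace[OF mfd_M], of ?T s] this]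
    have "smooth_on (Model M) ?T (\<lambda>x. top (chart_inv c x) (\<lambda>i. chart_vector M c x (v i)))"
    proof (rule smooth_on_cong[OF T])
      fix y assume "y \<in> ?T"
      then have "chart_inv c y \<in> W" using chart_inv_left[OF mfd_M c] by auto
      then show "top (chart_inv c y) (\<lambda>i. chart_vector M c y (v i))
          = s * wedge_power CARD('n) (\<omega> (chart_inv c y)) (\<lambda>i. chart_vector M c y (v i))" by (rule W(5))
    qed
    then show "\<exists>T. rel_open (Model M) T \<and> x \<in> T \<and>
        smooth_on (Model M) T (\<lambda>x. top (chart_inv c x) (\<lambda>i. chart_vector M c x (v i)))"
      using T p W(2) by blast
  qed
qed

lemma half_dim_X: "half_dim X1 = CARD('n)" "half_dim X2 = CARD('n)" "half_dim M = CARD('n)" by (simp_all add: half_dim_def A.X_Model B.X_Model)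

lemma matches_Above: "matches_orientation 1 X1 \<omega>1 C1 M top Above" unfolding matches_orientation_def half_dim_X
proof (intro ballI exI[of _ "1::real"] conjI allI impI)
  fix p and v :: "nat => complex ^ 'n" assume p: "p \<in> C1" and v: "\<forall>i. v i \<in> Model X1"
  show "top (Above p) (\<lambda>i. tmap X1 M Above p (v i)) = 1 * 1 * wedge_power CARD('n) (\<omega>1 p) v"
    unfolding top_Above[OF p] using pA.wedge_power_embed[OF p, of v "CARD('n)" \<omega>1] v by simp
qed simp

lemma matches_Below: "matches_orientation (- 1) X2 \<omega>2 C2 M top Below" unfolding matches_orientation_def half_dim_X
proof (intro ballI exI[of _ "1::real"] conjI allI impI)
  fix p and v :: "nat => complex ^ 'n" assume p: "p \<in> C2" and v: "\<forall>i. v i \<in> Model X2"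
  show "top (Below p) (\<lambda>i. tmap X2 M Below p (v i)) = - 1 * 1 * wedge_power CARD('n) (\<omega>2 p) v"
    unfolding top_Below[OF p] using pB.wedge_power_embed[OF p, of v "CARD('n)" \<omega>2] v by simp
qed simp

subsection \<open>Adapted charts\<close>

context
  fixes d d' c
  assumes d: "d \<in> Atlas XF" and d': "d' \<in> Atlas Cyl" and c: "c = EN (prod_chart d d')"
begin

lemma neck_chart_Atlas: "c \<in> Atlas M" unfolding c Atlas_M using prod_chart_Atlas[OF d d'] by blast

abbreviation proj where "proj x \<equiv> fst (split_coord l x)"

lemma neck_chart_inv:
  assumes x: "x \<in> img c"
  shows "proj x \<in> img d" "x $ l \<in> img d'" "chart_inv c x \<in> Neck"
    "\<pi>F (chart_inv c x) = chart_inv d (proj x)" "\<pi>C (chart_inv c x) = chart_inv d' (x $ l)"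
proof -
  obtain m where m: "m \<in> fst c" "x = snd c m" using x by blast
  then obtain q where q: "q \<in> fst (prod_chart d d')" "q \<in> points P" "m = nk q" unfolding c embed_chart_def fst_conv by blast
  have q12: "fst q \<in> fst d" "snd q \<in> fst d'" using q(1) by (auto simp: mem_Times_iff)
  have xq: "x = join l (snd d (fst q), snd d' (snd q))"
    using m(2) q(3) ni_nk[OF q(2)] by (simp add: c embed_chart_def prod_chart_def map_prod_def case_prod_unfold)
  have "snd d (fst q) \<in> Model XF" using rel_open_subset[OF mfd_chart(2)[OF A.pm(1) d]] q12(1) by blast
  then have sp: "split_coord l x = (snd d (fst q), snd d' (snd q))" unfolding xq by (intro linear_iso.L(3)[OF isoN]) simp
  then have xs: "proj x = snd d (fst q)" "x $ l = snd d' (snd q)" by (simp_all add: split_coord_def)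
  then show "proj x \<in> img d" "x $ l \<in> img d'" using q12 by blast+
  have ci: "chart_inv c x = nk q" using chart_inv_left[OF mfd_M neck_chart_Atlas m(1)] m(2) q(3) by simp
  then show "chart_inv c x \<in> Neck" using q(2) by blast
  show "\<pi>F (chart_inv c x) = chart_inv d (proj x)" "\<pi>C (chart_inv c x) = chart_inv d' (x $ l)"
    using ci ni_nk[OF q(2)] xs chart_inv_left[OF A.pm(1) d q12(1)] chart_inv_left[OF mfd_cylinder d' q12(2)] by simp_all
qed

text \<open>Since \<open>join\<close> puts \<open>\<theta> + \<i> h\<close> into component
  \<open>l\<close>, the imaginary part of that component is the coordinate that defines the cut
  locus.\<close>

lemma neck_chart_height: "x \<in> img c ==> ht (chart_inv c x) = Im (x $ l)"
  using chart_vector_cylinder(2)[OF d' neck_chart_inv(2)] neck_chart_inv(5) by simp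

text \<open>In chart coordinates the two projections of the neck are linear maps followed by inverse
  charts of the factors, so the chain rule applies; on the cylinder the components of a vector do
  not depend on the chart.\<close>

lemma neck_chart_vector:
  assumes x: "x \<in> img c"
  shows "dC (chart_inv c x) (chart_vector M c x u) = u $ l"
    "dF (chart_inv c x) (chart_vector M c x u) = chart_vector XF d (proj x) (proj u)"
proof -
  note N = neck_chart_inv[OF x]
  let ?T = "img c"
  have T: "open_in (flat UNIV) ?T" using mfd_chart(2)[OF mfd_M neck_chart_Atlas] by simp
  have u: "u \<in> Model (flat UNIV)" by simp
  have sm: "smooth_at (flat UNIV) M (chart_inv c) x" using smooth_at_chart_inv[OF mfd_M neck_chart_Atlas x] by simp
  have cv: "chart_vector M c x u = tmap (flat UNIV) M (chart_inv c) x u" using chart_vector_eq_tmap[OF mfd_M neck_chart_Atlas x, of u] by simp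
  have lin: "smooth_vec (flat UNIV) L x" "dmap (flat UNIV) L x u = L u"
    if "bounded_linear L" for L :: "complex ^ 'n => 'z::euclidean_space"
    using smooth_at_linear_flat[OF mfd_vec smooth_at_id[OF mfd_vec, of x] that] tmap_id[OF mfd_vec, of x u] by simp_all
  note nth = lin[OF bounded_linear_vec_nth[of l]]
  have sd: "smooth_at (flat UNIV) Cyl (chart_inv d') (x $ l)" using smooth_at_chart_inv[OF mfd_cylinder d' N(2)] by simp
  have "dC (chart_inv c x) (chart_vector M c x u) = tmap (flat UNIV) Cyl (\<lambda>y. \<pi>C (chart_inv c y)) x u"
    unfolding cv by (rule tmap_compose[OF mfd_vec mfd_M mfd_cylinder sm neck_smooth(6)[OF N(3)] u, symmetric])
  also have "\<dots> = tmap (flat UNIV) Cyl (\<lambda>y. chart_inv d' (y $ l)) x u" by (rule tmap_cong[OF mfd_vec T x neck_chart_inv(5) u])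
  also have "\<dots> = tmap (flat UNIV) Cyl (chart_inv d') (x $ l) (u $ l)"
    using tmap_compose[OF mfd_vec mfd_vec mfd_cylinder nth(1) sd u] nth(2) by simp
  also have "\<dots> = u $ l" using chart_vector_cylinder(1)[OF d' N(2), of "u $ l"] chart_vector_eq_tmap[OF mfd_cylinder d' N(2), of "u $ l"] by simp
  finally show "dC (chart_inv c x) (chart_vector M c x u) = u $ l" .
  have bl: "bounded_linear (\<lambda>y. proj y)" using bounded_linear_compose[OF bounded_linear_fst linear_iso.L(2)[OF isoN]] by (simp add: o_def)
  have E: "premanifold (flat (Model XF))" by (rule mfd_flat[OF mfd_subspace[OF A.pm(1)]])
  have pm: "proj y \<in> Model XF" for y using split_coord_fst_mem by (simp add: A.F_Model)
  have sK: "smooth_at (flat UNIV) (flat (Model XF)) (\<lambda>y. proj y) x"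
    by (rule smooth_at_flat[of UNIV UNIV]) (use pm smooth_on_linear[of UNIV UNIV, OF _ bl] in auto)
  have tK: "tmap (flat UNIV) (flat (Model XF)) (\<lambda>y. proj y) x u = proj u"
    using tmap_into_flat[of "\<lambda>y. proj y" x "Model XF" "flat UNIV" u] pm lin(2)[OF bl] by simp
  have sd: "smooth_at (flat (Model XF)) XF (chart_inv d) (proj x)" by (rule smooth_at_chart_inv[OF A.pm(1) d N(1)])
  have "dF (chart_inv c x) (chart_vector M c x u) = tmap (flat UNIV) XF (\<lambda>y. \<pi>F (chart_inv c y)) x u"
    unfolding cv by (rule tmap_compose[OF mfd_vec mfd_M A.pm(1) sm neck_smooth(5)[OF N(3)] u, symmetric])
  also have "\<dots> = tmap (flat UNIV) XF (\<lambda>y. chart_inv d (proj y)) x u" by (rule tmap_cong[OF mfd_vec T x neck_chart_inv(4) u])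
  also have "\<dots> = tmap (flat (Model XF)) XF (chart_inv d) (proj x) (proj u)" using tmap_compose[OF mfd_vec E A.pm(1) sK sd u] tK by simp
  also have "\<dots> = chart_vector XF d (proj x) (proj u)" using chart_vector_eq_tmap[OF A.pm(1) d N(1) pm] by simp
  finally show "dF (chart_inv c x) (chart_vector M c x u) = chart_vector XF d (proj x) (proj u)" .
qed

text \<open>The \<open>b\<close>-frame turns \<open>\<gamma> (h)\<close> into \<open>w (h) = h \<gamma> (h)\<close>, which extends smoothly over the cut locus.\<close>

definition coeff where
  "coeff x u v = local_form M c base x u v + w (Im (x $ l)) * (Im (u $ l) * Re (v $ l) - Im (v $ l) * Re (u $ l))"

lemma coeff_eq:
  assumes x: "x \<in> img c"
  shows "coeff x u v = base (chart_inv c x) (chart_vector M c x u) (chart_vector M c x v)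
    + w (ht (chart_inv c x)) * area (chart_inv c x) (chart_vector M c x u) (chart_vector M c x v)"
  using neck_chart_height[OF x] neck_chart_vector(1)[OF x] by (simp add: coeff_def local_form_def area_eq)

lemma coeff_alternating:
  assumes x: "x \<in> img c"
  shows "alternating_bilinear UNIV (coeff x)"
proof -
  have "alternating_bilinear (Model M) (local_form M c base x)" by (rule alternating_local_form[OF mfd_M neck_chart_Atlas x])
      (use neck_base_alternating[OF neck_chart_inv(3)[OF x]] in simp)
  moreover have "alternating_bilinear UNIV (\<lambda>u v. w (Im (x $ l)) * (Im (u $ l) * Re (v $ l) - Im (v $ l) * Re (u $ l)))"
    by (simp add: alternating_bilinear_def algebra_simps)
  ultimately have "alternating_bilinear UNIV (\<lambda>u v. local_form M c base x u v + w (Im (x $ l)) * (Im (u $ l) * Re (v $ l) - Im (v $ l) * Re (u $ l)))"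
    by (intro alternating_bilinear_plus) simp_all
  moreover have "coeff x = (\<lambda>u v. local_form M c base x u v + w (Im (x $ l)) * (Im (u $ l) * Re (v $ l) - Im (v $ l) * Re (u $ l)))"
    by (intro ext) (rule coeff_def)
  ultimately show ?thesis by simp
qed

lemma coeff_smooth: "smooth_on UNIV (img c) (\<lambda>x. coeff x u v)"
proof -
  have T: "rel_open UNIV (img c)" using mfd_chart(2)[OF mfd_M neck_chart_Atlas] by simp
  have sub: "fst c \<subseteq> Neck" using neck_chart_inv(3) chart_inv_left[OF mfd_M neck_chart_Atlas] by force
  have 1: "smooth_on UNIV (img c) (\<lambda>x. local_form M c base x u v)"
    using closed_base neck_chart_Atlas sub unfolding smooth_form2_on_def by (auto simp: Int_absorb2)
  have 2: "smooth_on UNIV (img c) (\<lambda>x. w (Im (x $ l)))" by (rule smooth_on_compose[OF T _ _ smooth_on_linear[OF T] w(1)])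
      (auto intro: bounded_linear_compose[OF bounded_linear_Im bounded_linear_vec_nth])
  show ?thesis unfolding coeff_def by (rule smooth_on_add[OF T 1 smooth_on_mult[OF T 2 smooth_on_const]]) simp
qed

text \<open>The factor \<open>w\<close> is nonzero also at height \<open>0\<close>, so
  \<open>neck_nondegenerate\<close> covers the cut locus; the tangent map of the chart carries the
  partner vector back to coordinates.\<close>

lemma coeff_nondegenerate:
  assumes x: "x \<in> img c" and u: "u \<noteq> 0"
  shows "\<exists>v. coeff x u v \<noteq> 0"
proof -
  let ?m = "chart_inv c x"
  note cM = neck_chart_Atlas
  have m: "?m \<in> Neck" by (rule neck_chart_inv(3)[OF x])
  have mc: "?m \<in> fst c" "snd c ?m = x" using chart_inv_right[OF x] by simp_all
  have F: "premanifold (flat (Model M))" by simp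
  have s: "smooth_at M (flat (Model M)) (snd c) ?m" by (rule smooth_at_chart[OF mfd_M cM mc(1)])
  have s': "smooth_at (flat (Model M)) M (chart_inv c) x" by (rule smooth_at_chart_inv[OF mfd_M cM x])
  have T: "openin (mtopology (flat (Model M))) (img c)" using mfd_chart(2)[OF mfd_M cM] by simp
  have inv1: "tmap M (flat (Model M)) (snd c) ?m (chart_vector M c x a) = a" for a unfolding chart_vector_eq_tmap[OF mfd_M cM x, of a, simplified]
    using tmap_left_inverse[OF F mfd_M s' s T x chart_inv_right(1), of a] by simp
  have inv2: "chart_vector M c x (tmap M (flat (Model M)) (snd c) ?m b) = b" for b
  proof -
    have s'': "smooth_at (flat (Model M)) M (chart_inv c) (snd c ?m)" using s' mc(2) by simp
    have "tmap (flat (Model M)) M (chart_inv c) (snd c ?m) (tmap M (flat (Model M)) (snd c) ?m b) = b"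
      by (rule tmap_left_inverse[OF mfd_M F s s'' openin_chart_domain[OF mfd_M cM] mc(1) chart_inv_left[OF mfd_M cM]]) simp_all
    then show ?thesis using chart_vector_eq_tmap[OF mfd_M cM x] mc(2) by simp
  qed
  have nz: "chart_vector M c x u \<noteq> 0" using inv1[of u] u tmap_0[OF mfd_M F s] by auto
  have "\<bar>ht ?m\<bar> < \<epsilon>" using neck_smooth(3)[OF m] by (auto simp: points_cylinder)
  from neck_nondegenerate[OF m w(3)[OF this] nz]
  obtain b where b: "base ?m (chart_vector M c x u) b + w (ht ?m) * area ?m (chart_vector M c x u) b \<noteq> 0" by blast
  have "coeff x u (tmap M (flat (Model M)) (snd c) ?m b) \<noteq> 0" using b unfolding coeff_eq[OF x] inv2 .
  then show ?thesis by blast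
qed

text \<open>The unit vector is \<open>axis l \<i>\<close> because the height is the imaginary part
  of component \<open>l\<close>. Passing to the \<open>b\<close>-frame multiplies just that part of
  a vector by the height, so \<open>area\<close> gains a factor \<open>h\<close> that turns
  \<open>\<gamma>\<close> into \<open>w\<close>, while \<open>base\<close> is unaffected.\<close>

lemma coeff_b_coefficients: "b_coefficients M Z form c (axis l \<i>) coeff"
proof -
  note cM = neck_chart_Atlas
  have ie: "x \<bullet> axis l \<i> = Im (x $ l)" for x :: "complex ^ 'n" by (simp add: inner_axis inner_complex_def)
  have Zc: "m \<in> Z \<longleftrightarrow> Im (snd c m $ l) = 0" if m: "m \<in> fst c" for m
  proof -
    have x: "snd c m \<in> img c" using m by blast
    have e: "chart_inv c (snd c m) = m" by (rule chart_inv_left[OF mfd_M cM m])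
    show ?thesis using neck_chart_height[OF x] neck_chart_inv(3)[OF x] unfolding e Z_eq by simp
  qed
  have "adapted_chart M Z c (axis l \<i>)" unfolding adapted_chart_def
  proof (intro conjI)
    show "is_chart M c" using mfd_chart[OF mfd_M cM] mfd_M cM chart_in_points[OF cM] unfolding is_chart_def premanifold_def by auto
    show "norm (axis l \<i> :: complex ^ 'n) = 1" by (simp add: norm_eq_sqrt_inner inner_axis inner_complex_def)
    show "img_on c Z = {x \<in> img c. x \<bullet> axis l \<i> = 0}" using Zc unfolding ie by blast
  qed simp
  moreover have "coeff x u v = local_form M c form x (b_frame (axis l \<i>) x u) (b_frame (axis l \<i>) x v)"
    if x': "x \<in> snd c ` (fst c - Z)" for x u v
  proof -
    have x: "x \<in> img c" using x' by blast
    obtain m where m: "m \<in> fst c" "m \<notin> Z" "x = snd c m" using x' by blast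
    have h: "Im (x $ l) \<noteq> 0" using Zc[OF m(1)] m(2,3) by simp
    have bp: "proj (b_frame (axis l \<i>) x a) = proj a" for a by (simp add: split_coord_def b_frame_def vec_eq_iff axis_def)
    have ax: "(axis l \<i> :: complex ^ 'n) $ l = \<i>" by (simp add: axis_def)
    have bl: "Re (b_frame (axis l \<i>) x a $ l) = Re (a $ l)" "Im (b_frame (axis l \<i>) x a $ l) = Im (x $ l) * Im (a $ l)" for a
      by (simp_all add: b_frame_def ie ax)
    have "local_form M c form x (b_frame (axis l \<i>) x u) (b_frame (axis l \<i>) x v)
        = base (chart_inv c x) (chart_vector M c x (b_frame (axis l \<i>) x u)) (chart_vector M c x (b_frame (axis l \<i>) x v))
          + \<gamma> (Im (x $ l)) * area (chart_inv c x) (chart_vector M c x (b_frame (axis l \<i>) x u)) (chart_vector M c x (b_frame (axis l \<i>) x v))"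
      using neck_chart_inv(3)[OF x] neck_chart_height[OF x] by (simp add: local_form_def form_def)
    also have "\<dots> = coeff x u v" unfolding coeff_eq[OF x] base_eq area_eq neck_chart_vector[OF x] bp bl neck_chart_height[OF x] w(2)[OF h]
      by (simp add: algebra_simps)
    finally show ?thesis by simp
  qed
  ultimately show ?thesis unfolding b_coefficients_def using coeff_alternating coeff_smooth by simp
qed

end

lemma Z_coefficients:
  assumes p: "p \<in> Z"
  shows "\<exists>c e B. p \<in> fst c \<and> b_coefficients M Z form c e B \<and>
    (\<exists>v. (\<forall>i. v i \<in> Model M) \<and> wedge_power (half_dim M) (B (snd c p)) v \<noteq> 0)"
proof -
  have "p \<in> Neck" using p Z_eq by blast
  then obtain q where q: "q \<in> points P" "p = nk q" by blast
  then have "fst q \<in> points XF" "snd q \<in> points Cyl" by (auto simp: prod_mfd_simps(2))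
  then obtain d d' where d: "d \<in> Atlas XF" "fst q \<in> fst d" and d': "d' \<in> Atlas Cyl" "snd q \<in> fst d'" unfolding points_def by blast
  let ?c = "EN (prod_chart d d')"
  have "q \<in> fst (prod_chart d d') \<inter> points P" using d d' q by (simp add: mem_Times_iff)
  then have pc: "p \<in> fst ?c" using q(2) unfolding embed_chart_def fst_conv by blast
  then have x: "snd ?c p \<in> img ?c" by blast
  note b = coeff_b_coefficients[OF d(1) d'(1) refl]
  obtain v where v: "(\<forall>i. v i \<in> Model M) \<and> wedge_power CARD('n) (coeff ?c (snd ?c p)) v \<noteq> 0"
    using wedge_power_nonzero[OF coeff_alternating[OF d(1) d'(1) refl x] coeff_nondegenerate[OF d(1) d'(1) refl x]] by blast
  show ?thesis unfolding half_dim_X using pc b v by blast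
qed

section \<open>The form and the action in the sense of b-geometry\<close>

lemma b_symplectic_M: "b_symplectic_form M Z form" unfolding b_symplectic_form_def b_form2_def
proof (intro conjI ballI)
  show "smooth_form2_on M (points M - Z) form" "closed_form2_on M (points M - Z) form" using form_closed unfolding Sing_Z by blast+
  fix p assume p: "p \<in> points M - Z"
  have "alternating_bilinear UNIV (form p)" using form_closed p unfolding Sing_Z smooth_form2_on_def by simp
  then show "\<exists>v. (\<forall>i. v i \<in> Model M) \<and> wedge_power (half_dim M) (form p) v \<noteq> 0"
    unfolding half_dim_X by (rule wedge_power_nonzero) (use form_nondegenerate p Sing_Z in blast)
qed (use Z_coefficients in \<open>simp, blast+\<close>)

text \<open>The minus sign comes from the moment map convention. Near the cut locus component
  \<open>l\<close> of \<open>mom\<close> is the logarithm of the height, which gives the coefficient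
  \<open>- (X $ l)\<close>; the other summand comes from \<open>\<mu>F\<close> and is smooth across
  the locus.\<close>

lemma b_function_mom: "b_function M Z (\<lambda>m. - (mom m \<bullet> X))" unfolding b_function_def
proof (intro conjI ballI)
  have m: "bounded_linear (\<lambda>x::real. - x)" by (intro bounded_linear_minus bounded_linear_ident)
  have "smooth_vec M (\<lambda>m. - (mom m \<bullet> X)) p" if "p \<in> points M - Z" for p
    by (rule smooth_at_linear_flat(1)[OF mfd_M smooth_at_linear_flat(1)[OF mfd_M mom_tmap(1) bounded_linear_inner_left] m])
      (use that Sing_Z in blast)
  then show "smooth_map_on M (points M - Z) (flat UNIV) (\<lambda>m. - (mom m \<bullet> X))"
    unfolding smooth_map_on_iff[OF mfd_M mfd_vec] using openin_Reg unfolding Sing_Z by blast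
  fix p assume p: "p \<in> Z"
  let ?W = "{m \<in> Neck. ht m \<in> {- \<delta><..<\<delta>}}"
  have W: "open_in M ?W" by (rule openin_neck_height) simp
  have pW: "p \<in> ?W" using p \<delta>(1) unfolding Z_eq by simp
  have d: "defining_function M Z ?W ht" by (rule defining_height[OF W]) blast
  have "smooth_vec M (\<lambda>q. - (\<mu>F (\<pi>F q) \<bullet> X)) q" if "q \<in> ?W" for q
    by (rule smooth_at_linear_flat(1)[OF mfd_M smooth_at_compose[OF mfd_M A.pm(1) mfd_vec neck_smooth(5) A.moment_F(2)[OF neck_smooth(2)]] m])
      (use that in blast)+
  then have s: "smooth_map_on M ?W (flat UNIV) (\<lambda>q. - (\<mu>F (\<pi>F q) \<bullet> X))"
    unfolding smooth_map_on_iff[OF mfd_M mfd_vec] using W by blast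
  have eq: "- (mom q \<bullet> X) = - (X $ l) * ln \<bar>ht q\<bar> + - (\<mu>F (\<pi>F q) \<bullet> X)" if q: "q \<in> ?W - Z" for q
  proof -
    have "q \<in> Neck" "ht q \<noteq> 0" "\<bar>ht q\<bar> < \<delta>" using q unfolding Z_eq by auto
    then show ?thesis using \<delta>(2) by (simp add: mom_def inner_add_left inner_axis')
  qed
  show "\<exists>W c y g. p \<in> W \<and> defining_function M Z W y \<and> smooth_map_on M W (flat UNIV) g \<and>
      (\<forall>q\<in>W - Z. - (mom q \<bullet> X) = c * ln \<bar>y q\<bar> + g q)"
    by (intro exI[of _ ?W] exI[of _ "- (X $ l)"] exI[of _ ht] exI[of _ "\<lambda>q. - (\<mu>F (\<pi>F q) \<bullet> X)"] conjI ballI pW d s eq)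
qed

lemma b_hamiltonian_M: "b_hamiltonian M Z form act" unfolding b_hamiltonian_def
proof (intro conjI ballI allI)
  fix z :: "complex ^ 'n" and p assume z: "z \<in> torus UNIV" and p: "p \<in> Z"
  then have "p \<in> Neck" "ht p = 0" unfolding Z_eq by auto
  then show "act z p \<in> Z" using act_Neck[OF z] unfolding Z_eq by (simp add: rot_def)
next
  fix X :: "real ^ 'n"
  have "form p (fundamental_field M act X p) u = dmap M (\<lambda>m. - (mom m \<bullet> X)) p u"
    if p: "p \<in> points M - Z" for p u
  proof -
    have m: "bounded_linear (\<lambda>x::real. - x)" by (intro bounded_linear_minus bounded_linear_ident)
    have pS: "p \<in> points M - Sing" using p Sing_Z by blast
    show ?thesis
      using smooth_at_linear_flat(2)[OF mfd_M smooth_at_linear_flat(1)[OF mfd_M mom_tmap(1)[OF pS] bounded_linear_inner_left[of X]] m, of u] mom_tmap(2)[OF pS, of X u]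
      by simp
  qed
  then show "\<exists>f. b_function M Z f \<and> (\<forall>p\<in>points M - Z. \<forall>u\<in>Model M.
      form p (fundamental_field M act X p) u = dmap M f p u)"
    using b_function_mom by blast
next
  fix X Y :: "real ^ 'n" and p assume "p \<in> points M - Z"
  then show "form p (fundamental_field M act X p) (fundamental_field M act Y p) = 0" using form_isotropic Sing_Z by blast
qed

lemma b_toric_M: "b_toric_structure M top Z form act"
  using smooth_manifold_M orientation_top hypersurface_Z b_symplectic_M torus_action_M effective_M b_hamiltonian_M
  by (simp add: b_toric_structure_def b_manifold_def)

end


theorem theorem36:
  fixes l :: "'n::finite" and c \<epsilon> :: real
    and \<Delta>1 \<Delta>2 F :: "(real ^ 'n) set"
    and X1 :: "('a, complex ^ 'n) mfd" and \<omega>1 :: "('a, complex ^ 'n) form2"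
    and act1 :: "complex ^ 'n \<Rightarrow> 'a \<Rightarrow> 'a" and \<mu>1 :: "'a \<Rightarrow> real ^ 'n"
    and X2 :: "('b, complex ^ 'n) mfd" and \<omega>2 :: "('b, complex ^ 'n) form2"
    and act2 :: "complex ^ 'n \<Rightarrow> 'b \<Rightarrow> 'b" and \<mu>2 :: "'b \<Rightarrow> real ^ 'n"
    and XF :: "('f, complex ^ 'n) mfd" and \<omega>F :: "('f, complex ^ 'n) form2"
    and actF :: "complex ^ 'n \<Rightarrow> 'f \<Rightarrow> 'f" and \<mu>F :: "'f \<Rightarrow> real ^ 'n"
    and W1 :: "'a set" and \<Phi>1 :: "'a \<Rightarrow> 'f \<times> complex \<times> real"
    and W2 :: "'b set" and \<Phi>2 :: "'b \<Rightarrow> 'f \<times> complex \<times> real"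
  assumes "delzant \<Delta>1" and "delzant \<Delta>2"
    and "F = {t. t $ l = c}"
    and "strict_parallel_hyperplane F \<Delta>1" and "strict_parallel_hyperplane F \<Delta>2"
    and "\<forall>t\<in>\<Delta>1. c \<le> t $ l" and "\<forall>t\<in>\<Delta>2. t $ l \<le> c"
    and "\<Delta>1 \<inter> F = \<Delta>2 \<inter> F"
    and "toric_manifold_of UNIV \<Delta>1 X1 \<omega>1 act1 \<mu>1" and "Model X1 = UNIV"
    and "toric_manifold_of UNIV \<Delta>2 X2 \<omega>2 act2 \<mu>2" and "Model X2 = UNIV"
    and "toric_manifold_of (- {l}) (drop_coord l ` (\<Delta>1 \<inter> F)) XF \<omega>F actF \<mu>F"
    and "Model XF = {z. z $ l = 0}"
    and "0 < \<epsilon>" and "\<epsilon> \<le> 1"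
    and "local_model l 1 \<epsilon> XF \<omega>F actF X1 \<omega>1 act1 W1 \<Phi>1"
    and "{p \<in> points X1. \<mu>1 p \<in> \<Delta>1 \<inter> F} \<subseteq> W1"
    and "local_model l (- 1) \<epsilon> XF \<omega>F actF X2 \<omega>2 act2 W2 \<Phi>2"
    and "{p \<in> points X2. \<mu>2 p \<in> \<Delta>2 \<inter> F} \<subseteq> W2"
  shows "(let M = gluing l \<epsilon> id XF X1 W1 \<Phi>1 X2 W2 \<Phi>2 in
            \<exists>\<omega> act \<mu>. toric_structure (UNIV :: 'n set) M \<omega> act \<mu>)
       \<and> (let M = gluing l \<epsilon> cnj XF X1 W1 \<Phi>1 X2 W2 \<Phi>2 in
            \<exists>\<Omega> \<omega> (act :: complex ^ 'n \<Rightarrow> ('a, 'f, 'b) glued \<Rightarrow> ('a, 'f, 'b) glued).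
              matches_orientation 1 X1 \<omega>1 (cut_points X1 W1 \<Phi>1) M \<Omega> Above \<and>
              matches_orientation (- 1) X2 \<omega>2 (cut_points X2 W2 \<Phi>2) M \<Omega> Below \<and>
              b_toric_structure M \<Omega> (cut_locus XF) \<omega> act)"
proof -
  let ?M = "\<lambda>\<rho>. gluing l \<epsilon> \<rho> XF X1 W1 \<Phi>1 X2 W2 \<Phi>2"
  \<comment> \<open>The image is the projection of \<open>\<Delta>1 \<inter> F\<close>, which is
    nonempty as \<open>F\<close> meets \<open>\<Delta>1\<close>. A point of \<open>XF\<close> serves
    as base point when the moment maps are compared.\<close>
  have "\<mu>F ` points XF \<noteq> {}"
    using assms(4,13) by (auto simp: toric_manifold_of_def strict_parallel_hyperplane_def parallel_hyperplane_def Int_commute)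
  then have ne: "points XF \<noteq> {}" by blast
  have side1: "glue_side 1 \<epsilon> id 1 l XF \<omega>F actF \<mu>F X1 \<omega>1 act1 \<mu>1 W1 \<Phi>1" using assms(9,10,13-17) ne
    by (intro glue_side.intro half_cylinder.intro polar_cap.intro half_cylinder_axioms.intro glue_side_axioms.intro)
      (simp_all add: toric_manifold_of_def)
  have side2: "glue_side (- 1) \<epsilon> \<rho> \<sigma> l XF \<omega>F actF \<mu>F X2 \<omega>2 act2 \<mu>2 W2 \<Phi>2"
    if "\<rho> = id \<and> \<sigma> = 1 \<or> \<rho> = cnj \<and> \<sigma> = - 1" for \<rho> \<sigma>
    using assms(11-16,19) ne that by (intro glue_side.intro half_cylinder.intro polar_cap.intro half_cylinder_axioms.intro glue_side_axioms.intro)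
      (simp_all add: toric_manifold_of_def)
  \<comment> \<open>The given structures are kept at heights beyond \<open>\<epsilon> / 2\<close>,
    strictly inside the ends; the bound by \<open>1\<close> is what \<open>log_profile\<close> asks
    for.\<close>
  have a: "0 < \<epsilon> / 2" "\<epsilon> / 2 < \<epsilon>" "\<epsilon> / 2 < 1" using assms(15,16) by simp_all
  \<comment> \<open>Without reflection the profile \<open>G h = h\<close> continues both given
    moment maps through height \<open>0\<close>, so \<open>D\<close> is the whole line.\<close>
  have "glue_profile \<epsilon> id 1 l XF \<omega>F actF \<mu>F X1 \<omega>1 act1 \<mu>1 W1 \<Phi>1 X2 \<omega>2 act2 \<mu>2 W2 \<Phi>2 UNIV (\<lambda>h. h) (\<lambda>_. 1) (\<epsilon> / 2)"
    by (intro glue_profile.intro glue.intro side1 side2 glue_profile_axioms.intro)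
      (use a in \<open>auto intro: smooth_on_const smooth_on_linear bounded_linear_ident\<close>)
  from glue_profile.toric_M[OF this refl]
  have 1: "\<exists>\<omega> act \<mu>. toric_structure (UNIV :: 'n set) (?M id) \<omega> act \<mu>" by blast
  obtain G \<gamma> w and \<delta> :: real where p: "\<And>h. h \<noteq> 0 ==> (G has_real_derivative \<gamma> h) (at h)" "smooth_on UNIV (- {0}) G"
    "smooth_on UNIV (- {0}) \<gamma>" "smooth_on UNIV UNIV w" "\<And>h. h \<noteq> 0 ==> w h = h * \<gamma> h" "\<And>h. \<bar>h\<bar> < 1 ==> w h > 0"
    "\<And>h. \<bar>h\<bar> \<ge> \<epsilon> / 2 ==> G h = \<bar>h\<bar>" "\<delta> > 0" "\<And>h. h \<noteq> 0 ==> \<bar>h\<bar> < \<delta> ==> G h = ln \<bar>h\<bar>"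
    by (rule log_profile[OF a(1,3)]) blast
  \<comment> \<open>Here \<open>\<epsilon> \<le> 1\<close> places the whole neck in the range where
    \<open>log_profile\<close> gives positivity.\<close>
  have w: "w h \<noteq> 0" if "\<bar>h\<bar> < \<epsilon>" for h using p(6)[of h] that assms(16) by fastforce
  have \<gamma>: "\<gamma> h \<noteq> 0" if "h \<noteq> 0" "\<bar>h\<bar> < \<epsilon>" for h using w[OF that(2)] p(5)[OF that(1)] by auto
  \<comment> \<open>With \<open>\<sigma> = - 1\<close> the profile has to be \<open>h\<close> above
    and \<open>- h\<close> below, which is \<open>\<bar>h\<bar>\<close> on both sides; height
    \<open>0\<close> is removed from the domain because of the logarithm.\<close>
  have "glue_profile \<epsilon> cnj (- 1) l XF \<omega>F actF \<mu>F X1 \<omega>1 act1 \<mu>1 W1 \<Phi>1 X2 \<omega>2 act2 \<mu>2 W2 \<Phi>2 (- {0}) G \<gamma> (\<epsilon> / 2)"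
    by (intro glue_profile.intro glue.intro side1 side2 glue_profile_axioms.intro) (use a p(1-3) p(7) \<gamma> in auto)
  then have b: "glue_log \<epsilon> cnj (- 1) l XF \<omega>F actF \<mu>F X1 \<omega>1 act1 \<mu>1 W1 \<Phi>1 X2 \<omega>2 act2 \<mu>2 W2 \<Phi>2 (- {0}) G \<gamma> (\<epsilon> / 2) w \<delta>"
    by (intro glue_log.intro glue_log_axioms.intro) (use p w in auto)
  show ?thesis unfolding Let_def using 1 glue_log.matches_Above[OF b] glue_log.matches_Below[OF b] glue_log.b_toric_M[OF b] by blast
qed

end
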